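(* Let $\mathbf V$ be a model of GCH and let $\mathbf V[G]$ be the extension obtained by the finite support iteration of length $\omega_2$ of the forcing adding one Cohen real (so $2^{\aleph_0}=\aleph_2$ in $\mathbf V[G]$). Then in $\mathbf V[G]$ there is a family $\mathcal F$ of $\aleph_2$ many UG Banach spaces of density $\aleph_1$ such that there is no family of fewer than $\aleph_2$ Banach spaces of density $\aleph_1$ into whose members every element of $\mathcal F$ isomorphically embeds.
   Context: A Banach space is UG if it admits a uniformly Gâteaux differentiable renorming. An isomorphic embedding is a linear map $T$ with $\frac1c\|x\|\le\|Tx\|\le c\|x\|$ for some $c>0$. The Cohen forcing is the poset of finite partial functions from $\omega$ to $2$ ordered by extension. *)

theory Defs
  imports Complex_Main "HOL-Algebra.Module"
begin

section \<open>Structures for the language of set theory\<close>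

datatype fm = Mem nat nat | Eql nat nat | Neg fm | Conj fm fm | All nat fm

text \<open>
  A structure is a type together with a binary relation; its universe is the whole type.
  Quantifiers over the type are therefore quantifiers over the structure: every definition
  below is the relativization of the usual set-theoretic one, except that statements which
  only speak about the elements of a given set (algebraic laws, inequalities between reals)
  are written with ordinary HOL notions on the extension of that set.
\<close>

locale set_struct =
  fixes mem :: "'v \<Rightarrow> 'v \<Rightarrow> bool" (infix \<open>\<epsilon>\<close> 50)
begin

definition ext :: "'v \<Rightarrow> 'v set" where
  "ext a = {x. x \<epsilon> a}"

text \<open>The element with a given extension. It is only meaningful when there is a unique one,
  as the axioms of ZFC guarantee in all uses below.\<close>

definition coll :: "'v set \<Rightarrow> 'v" where
  "coll S = (THE a. ext a = S)"

definition pair :: "'v \<Rightarrow> 'v \<Rightarrow> 'v" where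
  "pair a b = coll {coll {a}, coll {a, b}}"

definition pfst :: "'v \<Rightarrow> 'v" where
  "pfst z = (THE x. \<exists>y. z = pair x y)"

definition psnd :: "'v \<Rightarrow> 'v" where
  "psnd z = (THE y. \<exists>x. z = pair x y)"

definition empty :: 'v where
  "empty = coll {}"

definition succ :: "'v \<Rightarrow> 'v" where
  "succ a = coll (insert a (ext a))"

definition powset :: "'v \<Rightarrow> 'v" where
  "powset a = coll {b. ext b \<subseteq> ext a}"

definition cprod :: "'v \<Rightarrow> 'v \<Rightarrow> 'v" where
  "cprod a b = coll {pair x y | x y. x \<epsilon> a \<and> y \<epsilon> b}"

definition func_on :: "'v \<Rightarrow> 'v \<Rightarrow> bool" where
  "func_on f a \<longleftrightarrow>
     (\<forall>z. z \<epsilon> f \<longrightarrow> (\<exists>x y. z = pair x y \<and> x \<epsilon> a)) \<and>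
     (\<forall>x. x \<epsilon> a \<longrightarrow> (\<exists>!y. pair x y \<epsilon> f))"

definition app :: "'v \<Rightarrow> 'v \<Rightarrow> 'v" where
  "app f x = (THE y. pair x y \<epsilon> f)"

definition fn :: "'v \<Rightarrow> 'v \<Rightarrow> 'v \<Rightarrow> bool" where
  "fn f a b \<longleftrightarrow> func_on f a \<and> (\<forall>x. x \<epsilon> a \<longrightarrow> app f x \<epsilon> b)"

definition restr :: "'v \<Rightarrow> 'v \<Rightarrow> 'v" where
  "restr f a = coll {z. z \<epsilon> f \<and> (\<exists>x y. z = pair x y \<and> x \<epsilon> a)}"

subsection \<open>ZFC\<close>

fun sat :: "(nat \<Rightarrow> 'v) \<Rightarrow> fm \<Rightarrow> bool" where
  "sat e (Mem i j) \<longleftrightarrow> e i \<epsilon> e j"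
| "sat e (Eql i j) \<longleftrightarrow> e i = e j"
| "sat e (Neg \<phi>) \<longleftrightarrow> \<not> sat e \<phi>"
| "sat e (Conj \<phi> \<psi>) \<longleftrightarrow> sat e \<phi> \<and> sat e \<psi>"
| "sat e (All i \<phi>) \<longleftrightarrow> (\<forall>x. sat (e(i := x)) \<phi>)"

definition extensional :: bool where
  "extensional \<longleftrightarrow> (\<forall>a b. ext a = ext b \<longrightarrow> a = b)"

text \<open>In the two schemes the environment supplies the parameters.\<close>

definition ZFC :: bool where
  "ZFC \<longleftrightarrow>
     extensional \<and>
     (\<forall>a. ext a \<noteq> {} \<longrightarrow> (\<exists>x. x \<epsilon> a \<and> ext x \<inter> ext a = {})) \<and>
     (\<forall>a b. \<exists>c. ext c = {a, b}) \<and>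
     (\<forall>a. \<exists>u. ext u = {x. \<exists>y. x \<epsilon> y \<and> y \<epsilon> a}) \<and>
     (\<forall>a. \<exists>b. ext b = {x. ext x \<subseteq> ext a}) \<and>
     (\<exists>w. empty \<epsilon> w \<and> (\<forall>x. x \<epsilon> w \<longrightarrow> succ x \<epsilon> w)) \<and>
     (\<forall>\<phi> e a. \<exists>b. ext b = {x. x \<epsilon> a \<and> sat (e(0 := x)) \<phi>}) \<and>
     (\<forall>\<phi> e a. (\<forall>x. x \<epsilon> a \<longrightarrow> (\<exists>!y. sat (e(0 := x, 1 := y)) \<phi>)) \<longrightarrow>
        (\<exists>b. ext b = {y. \<exists>x. x \<epsilon> a \<and> sat (e(0 := x, 1 := y)) \<phi>})) \<and>
     (\<forall>a. (\<forall>x. x \<epsilon> a \<longrightarrow> ext x \<noteq> {}) \<and>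
          (\<forall>x y. x \<epsilon> a \<and> y \<epsilon> a \<and> x \<noteq> y \<longrightarrow> ext x \<inter> ext y = {}) \<longrightarrow>
        (\<exists>c. \<forall>x. x \<epsilon> a \<longrightarrow> (\<exists>!z. z \<epsilon> x \<and> z \<epsilon> c)))"

subsection \<open>Ordinals, cardinals, GCH\<close>

definition ordinal :: "'v \<Rightarrow> bool" where
  "ordinal a \<longleftrightarrow> (\<forall>x. x \<epsilon> a \<longrightarrow> ext x \<subseteq> ext a) \<and>
     (\<forall>x y. x \<epsilon> a \<and> y \<epsilon> x \<longrightarrow> ext y \<subseteq> ext x)"

primrec num :: "nat \<Rightarrow> 'v" where
  "num 0 = empty"
| "num (Suc n) = succ (num n)"

text \<open>All structures considered are well-founded, so that their set of natural numbers consists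
  of the standard numerals, and a set is finite in the structure iff its extension is finite.\<close>

definition omega :: 'v where
  "omega = coll (range num)"

definition equinum :: "'v \<Rightarrow> 'v \<Rightarrow> bool" where
  "equinum a b \<longleftrightarrow> (\<exists>f. fn f a b \<and> bij_betw (app f) (ext a) (ext b))"

definition cardinal :: "'v \<Rightarrow> bool" where
  "cardinal k \<longleftrightarrow> ordinal k \<and> (\<forall>a. a \<epsilon> k \<longrightarrow> \<not> equinum a k)"

definition csucc :: "'v \<Rightarrow> 'v" where
  "csucc k = (THE l. cardinal l \<and> k \<epsilon> l \<and>
     (\<forall>m. cardinal m \<and> k \<epsilon> m \<longrightarrow> ext l \<subseteq> ext m))"

definition aleph1 :: 'v where
  "aleph1 = csucc omega"

definition aleph2 :: 'v where
  "aleph2 = csucc aleph1"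

definition GCH :: bool where
  "GCH \<longleftrightarrow> (\<forall>k. cardinal k \<and> ext omega \<subseteq> ext k \<longrightarrow> equinum (powset k) (csucc k))"

subsection \<open>Forcing\<close>

text \<open>
  A poset is given by its extension and its order. The next two definitions are the usual
  forcing relation for atomic formulas, by recursion on names; as the membership relation is
  well-founded, the inductive definition is that recursion. Elements of a set other than pairs
  with second component in the poset are ignored, so every set may serve as a name.
\<close>

inductive forces_eq :: "'v set \<Rightarrow> ('v \<Rightarrow> 'v \<Rightarrow> bool) \<Rightarrow> 'v \<Rightarrow> 'v \<Rightarrow> 'v \<Rightarrow> bool"
  for P :: "'v set" and leP :: "'v \<Rightarrow> 'v \<Rightarrow> bool" where
  "\<lbrakk> p \<in> P;
     \<forall>\<pi> s. \<forall>q\<in>P. pair \<pi> s \<epsilon> \<tau> \<and> s \<in> P \<and> leP q p \<and> leP q s \<longrightarrow>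
       (\<exists>r\<in>P. leP r q \<and> (\<exists>\<rho> t. pair \<rho> t \<epsilon> \<sigma> \<and> t \<in> P \<and> leP r t \<and> forces_eq P leP r \<pi> \<rho>));
     \<forall>\<rho> t. \<forall>q\<in>P. pair \<rho> t \<epsilon> \<sigma> \<and> t \<in> P \<and> leP q p \<and> leP q t \<longrightarrow>
       (\<exists>r\<in>P. leP r q \<and> (\<exists>\<pi> s. pair \<pi> s \<epsilon> \<tau> \<and> s \<in> P \<and> leP r s \<and> forces_eq P leP r \<pi> \<rho>)) \<rbrakk>
   \<Longrightarrow> forces_eq P leP p \<tau> \<sigma>"

definition forces_mem :: "'v set \<Rightarrow> ('v \<Rightarrow> 'v \<Rightarrow> bool) \<Rightarrow> 'v \<Rightarrow> 'v \<Rightarrow> 'v \<Rightarrow> bool" where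
  "forces_mem P leP p \<tau> \<sigma> \<longleftrightarrow> (\<forall>q\<in>P. leP q p \<longrightarrow>
     (\<exists>r\<in>P. leP r q \<and> (\<exists>\<rho> t. pair \<rho> t \<epsilon> \<sigma> \<and> t \<in> P \<and> leP r t \<and> forces_eq P leP r \<tau> \<rho>)))"

definition forces_subset :: "'v set \<Rightarrow> ('v \<Rightarrow> 'v \<Rightarrow> bool) \<Rightarrow> 'v \<Rightarrow> 'v \<Rightarrow> 'v \<Rightarrow> bool" where
  "forces_subset P leP p \<tau> \<sigma> \<longleftrightarrow> (\<forall>\<pi> s. \<forall>q\<in>P. pair \<pi> s \<epsilon> \<tau> \<and> s \<in> P \<and> leP q p \<and> leP q s \<longrightarrow>
     forces_mem P leP q \<pi> \<sigma>)"

text \<open>The canonical name of a set, for a poset with largest element \<open>top1\<close>.\<close>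

definition check :: "'v \<Rightarrow> 'v \<Rightarrow> 'v" where
  "check top1 = wfrec {(y, x). y \<epsilon> x} (\<lambda>f x. coll ((\<lambda>y. pair (f y) top1) ` ext x))"

text \<open>Finite partial functions from \<open>omega\<close> to \<open>2\<close>; the order is reverse inclusion and the largest
  element is the empty function.\<close>

definition cohen :: 'v where
  "cohen = coll {p. \<exists>d. finite (ext d) \<and> ext d \<subseteq> ext omega \<and> fn p d (num 2)}"

text \<open>
  \<open>fs_iteration \<delta> Q P leP\<close>: \<open>P \<alpha>\<close> with the order \<open>leP \<alpha>\<close>, for \<open>\<alpha> \<le> \<delta>\<close>, are the stages of the finite
  support iteration of the posets named by \<open>Q \<xi>\<close>, for \<open>\<xi> < \<delta>\<close>. The iterands are sets ordered
  by reverse inclusion, with the empty set (named by itself) as largest element.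
  Conditions in \<open>P \<alpha>\<close> are functions on \<open>\<alpha>\<close> whose \<open>\<xi>\<close>-th value is a name from the domain of
  \<open>Q \<xi>\<close>. The clauses for zero, successor and limit stages are merged into one.
\<close>

definition fs_iteration ::
  "'v \<Rightarrow> ('v \<Rightarrow> 'v) \<Rightarrow> ('v \<Rightarrow> 'v set) \<Rightarrow> ('v \<Rightarrow> 'v \<Rightarrow> 'v \<Rightarrow> bool) \<Rightarrow> bool" where
  "fs_iteration \<delta> Q P leP \<longleftrightarrow> (\<forall>\<alpha>. \<alpha> = \<delta> \<or> \<alpha> \<epsilon> \<delta> \<longrightarrow>
     P \<alpha> = {p. func_on p \<alpha> \<and> finite {\<xi>. \<xi> \<epsilon> \<alpha> \<and> app p \<xi> \<noteq> empty} \<and>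
       (\<forall>\<xi>. \<xi> \<epsilon> \<alpha> \<longrightarrow> restr p \<xi> \<in> P \<xi> \<and> (\<exists>s. pair (app p \<xi>) s \<epsilon> Q \<xi>) \<and>
          forces_mem (P \<xi>) (leP \<xi>) (restr p \<xi>) (app p \<xi>) (Q \<xi>))} \<and>
     (\<forall>p q. leP \<alpha> p q \<longleftrightarrow> p \<in> P \<alpha> \<and> q \<in> P \<alpha> \<and>
       (\<forall>\<xi>. \<xi> \<epsilon> \<alpha> \<longrightarrow> forces_subset (P \<xi>) (leP \<xi>) (restr p \<xi>) (app q \<xi>) (app p \<xi>))))"

text \<open>The largest element of \<open>P \<xi>\<close>.\<close>

definition iter_one :: "'v \<Rightarrow> 'v" where
  "iter_one \<xi> = cprod \<xi> (coll {empty})"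

text \<open>The Cohen poset is absolute: as defined in any generic extension it is the one of the
  ground model, so its canonical name is a name for the forcing adding one Cohen real.\<close>

definition fs_cohen_iteration ::
  "'v \<Rightarrow> ('v \<Rightarrow> 'v set) \<Rightarrow> ('v \<Rightarrow> 'v \<Rightarrow> 'v \<Rightarrow> bool) \<Rightarrow> bool" where
  "fs_cohen_iteration \<delta> P leP \<longleftrightarrow> fs_iteration \<delta> (\<lambda>\<xi>. check (iter_one \<xi>) cohen) P leP"

definition generic_filter :: "'v set \<Rightarrow> ('v \<Rightarrow> 'v \<Rightarrow> bool) \<Rightarrow> 'v set \<Rightarrow> bool" where
  "generic_filter P leP G \<longleftrightarrow> G \<subseteq> P \<and> G \<noteq> {} \<and>
     (\<forall>p\<in>G. \<forall>q\<in>P. leP p q \<longrightarrow> q \<in> G) \<and>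
     (\<forall>p\<in>G. \<forall>q\<in>G. \<exists>r\<in>G. leP r p \<and> leP r q) \<and>
     (\<forall>d. ext d \<subseteq> P \<and> (\<forall>p\<in>P. \<exists>q\<in>ext d. leP q p) \<longrightarrow> G \<inter> ext d \<noteq> {})"

subsection \<open>Real numbers\<close>

definition rat_code :: "rat \<Rightarrow> 'v" where
  "rat_code q = (case quotient_of q of (a, b) \<Rightarrow>
     pair (pair (num (nat a)) (num (nat (- a)))) (num (nat b)))"

text \<open>The real numbers of the structure are the left Dedekind cuts of rationals that belong to it.
  Through \<open>is_real\<close> they are identified with real numbers of HOL; \<open>Reals_in\<close> is the subfield of
  the real numbers which occur in the structure.\<close>

definition is_real :: "'v \<Rightarrow> real \<Rightarrow> bool" where
  "is_real c r \<longleftrightarrow> ext c = rat_code ` {q. of_rat q < r}"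

definition Reals_in :: "real set" where
  "Reals_in = {r. \<exists>c. is_real c r}"

definition real_code :: "real \<Rightarrow> 'v" where
  "real_code r = (THE c. is_real c r)"

definition real_val :: "'v \<Rightarrow> real" where
  "real_val c = (THE r. is_real c r)"

definition reals :: 'v where
  "reals = coll {c. \<exists>r. is_real c r}"

definition scalars :: "real ring" where
  "scalars = \<lparr>carrier = Reals_in, monoid.mult = (*), one = 1, zero = 0, add = (+)\<rparr>"

subsection \<open>Banach spaces\<close>

text \<open>A normed space is coded by the quadruple of its underlying set, addition, scalar
  multiplication and norm.\<close>

definition points :: "'v \<Rightarrow> 'v" where
  "points X = pfst (pfst X)"

definition plus_of :: "'v \<Rightarrow> 'v" where
  "plus_of X = psnd (pfst X)"

definition scale_of :: "'v \<Rightarrow> 'v" where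
  "scale_of X = pfst (psnd X)"

definition norm_of :: "'v \<Rightarrow> 'v" where
  "norm_of X = psnd (psnd X)"

text \<open>The fields \<open>mult\<close> and \<open>one\<close> play no role in a module.\<close>

definition vec :: "'v \<Rightarrow> (real, 'v) module" where
  "vec X = \<lparr>carrier = ext (points X), monoid.mult = undefined, one = undefined,
     zero = (THE z. z \<epsilon> points X \<and> (\<forall>x. x \<epsilon> points X \<longrightarrow> app (plus_of X) (pair z x) = x)),
     add = (\<lambda>x y. app (plus_of X) (pair x y)),
     smult = (\<lambda>r x. app (scale_of X) (pair (real_code r) x))\<rparr>"

definition nrm :: "'v \<Rightarrow> 'v \<Rightarrow> real" where
  "nrm m x = real_val (app m x)"

definition vector_space :: "'v \<Rightarrow> bool" where
  "vector_space X \<longleftrightarrow>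
     fn (plus_of X) (cprod (points X) (points X)) (points X) \<and>
     fn (scale_of X) (cprod reals (points X)) (points X) \<and>
     module scalars (vec X)"

definition is_norm :: "'v \<Rightarrow> 'v \<Rightarrow> bool" where
  "is_norm X m \<longleftrightarrow> fn m (points X) reals \<and>
     (\<forall>x\<in>carrier (vec X). 0 \<le> nrm m x \<and> (nrm m x = 0 \<longrightarrow> x = \<zero>\<^bsub>vec X\<^esub>)) \<and>
     (\<forall>x\<in>carrier (vec X). \<forall>r\<in>Reals_in. nrm m (r \<odot>\<^bsub>vec X\<^esub> x) = \<bar>r\<bar> * nrm m x) \<and>
     (\<forall>x\<in>carrier (vec X). \<forall>y\<in>carrier (vec X). nrm m (x \<oplus>\<^bsub>vec X\<^esub> y) \<le> nrm m x + nrm m y)"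

definition is_complete :: "'v \<Rightarrow> 'v \<Rightarrow> bool" where
  "is_complete X m \<longleftrightarrow> (\<forall>s. fn s omega (points X) \<and>
     (\<forall>e>0. \<exists>N. \<forall>i\<ge>N. \<forall>j\<ge>N. nrm m (app s (num i) \<ominus>\<^bsub>vec X\<^esub> app s (num j)) < e) \<longrightarrow>
     (\<exists>x\<in>carrier (vec X). \<forall>e>0. \<exists>N. \<forall>i\<ge>N. nrm m (app s (num i) \<ominus>\<^bsub>vec X\<^esub> x) < e))"

definition banach :: "'v \<Rightarrow> bool" where
  "banach X \<longleftrightarrow>
     X = pair (pair (points X) (plus_of X)) (pair (scale_of X) (norm_of X)) \<and>
     vector_space X \<and> is_norm X (norm_of X) \<and> is_complete X (norm_of X)"

definition dense_in :: "'v \<Rightarrow> 'v \<Rightarrow> bool" where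
  "dense_in X d \<longleftrightarrow> ext d \<subseteq> carrier (vec X) \<and>
     (\<forall>x\<in>carrier (vec X). \<forall>e>0. \<exists>y\<in>ext d. nrm (norm_of X) (x \<ominus>\<^bsub>vec X\<^esub> y) < e)"

definition has_density :: "'v \<Rightarrow> 'v \<Rightarrow> bool" where
  "has_density X k \<longleftrightarrow> (\<exists>d. dense_in X d \<and> equinum d k) \<and>
     (\<forall>d l. dense_in X d \<and> l \<epsilon> k \<longrightarrow> \<not> equinum d l)"

text \<open>For every direction the difference quotients converge uniformly on the unit sphere.\<close>

definition uniformly_Gateaux :: "'v \<Rightarrow> 'v \<Rightarrow> bool" where
  "uniformly_Gateaux X m \<longleftrightarrow> (\<forall>h\<in>carrier (vec X). \<exists>D :: 'v \<Rightarrow> real.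
     \<forall>e>0. \<exists>d>0. \<forall>x\<in>carrier (vec X). \<forall>t\<in>Reals_in.
       nrm m x = 1 \<and> 0 < \<bar>t\<bar> \<and> \<bar>t\<bar> < d \<longrightarrow>
       \<bar>(nrm m (x \<oplus>\<^bsub>vec X\<^esub> t \<odot>\<^bsub>vec X\<^esub> h) - nrm m x) / t - D x\<bar> < e)"

definition equivalent_norms :: "'v \<Rightarrow> 'v \<Rightarrow> 'v \<Rightarrow> bool" where
  "equivalent_norms X m n \<longleftrightarrow> (\<exists>c>0. \<forall>x\<in>carrier (vec X).
     1 / c * nrm m x \<le> nrm n x \<and> nrm n x \<le> c * nrm m x)"

definition UG :: "'v \<Rightarrow> bool" where
  "UG X \<longleftrightarrow> (\<exists>m. is_norm X m \<and> equivalent_norms X (norm_of X) m \<and> uniformly_Gateaux X m)"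

definition embeds :: "'v \<Rightarrow> 'v \<Rightarrow> bool" where
  "embeds X Y \<longleftrightarrow> (\<exists>T. fn T (points X) (points Y) \<and>
     (\<forall>x\<in>carrier (vec X). \<forall>y\<in>carrier (vec X).
        app T (x \<oplus>\<^bsub>vec X\<^esub> y) = app T x \<oplus>\<^bsub>vec Y\<^esub> app T y) \<and>
     (\<forall>r\<in>Reals_in. \<forall>x\<in>carrier (vec X). app T (r \<odot>\<^bsub>vec X\<^esub> x) = r \<odot>\<^bsub>vec Y\<^esub> app T x) \<and>
     (\<exists>c>0. \<forall>x\<in>carrier (vec X).
        1 / c * nrm (norm_of X) x \<le> nrm (norm_of Y) (app T x) \<and>
        nrm (norm_of Y) (app T x) \<le> c * nrm (norm_of X) x))"

end

text \<open>
  \<open>generic_extension memV G memW val\<close>: the structure \<open>memW\<close> is V[G], the set of the values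
  \<open>val \<tau> = {val \<sigma> | \<exists>p\<in>G. (\<sigma>, p) \<in> \<tau>}\<close> of all names \<open>\<tau>\<close> in V. Since \<open>memV\<close> is well-founded, the
  recursion determines \<open>memW\<close> up to isomorphism.
\<close>

definition generic_extension ::
  "('v \<Rightarrow> 'v \<Rightarrow> bool) \<Rightarrow> 'v set \<Rightarrow> ('w \<Rightarrow> 'w \<Rightarrow> bool) \<Rightarrow> ('v \<Rightarrow> 'w) \<Rightarrow> bool" where
  "generic_extension memV G memW val \<longleftrightarrow>
     set_struct.extensional memW \<and> surj val \<and>
     (\<forall>\<tau>. set_struct.ext memW (val \<tau>) =
        {val \<sigma> | \<sigma>. \<exists>p\<in>G. memV (set_struct.pair memV \<sigma> p) \<tau>})"

end

theory Submission
  imports Defs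
begin

text \<open>
  To a graph on an index set \<open>I\<close> we attach the norm \<open>N\<close> whose fourth power is the supremum over finite \<open>F \<subseteq> I\<close> of the
  infimum of \<open>\<Sum>i\<in>F. x i ^ 4 / w i\<close>, taken over the positive weights \<open>w\<close> with mass at most one on every clique. It is
  uniformly smooth, hence uniformly Gateaux differentiable, and the sum of \<open>K\<close> unit vectors has norm at least \<open>K\<close> to the
  power 1/2 on a clique and at most \<open>K\<close> to the power 1/4 on an anticlique. The \<open>\<alpha>\<close>-th space has as index set the power
  set of \<open>\<omega>\<close> in the ground model, and two indices are joined iff the \<open>\<alpha>\<close>-th Cohen real is 1 at the least place where they
  differ.

  If fewer than \<open>\<aleph>\<^sub>2\<close> spaces of density \<open>\<aleph>\<^sub>1\<close> sufficed, unboundedly many of the spaces would embed, with the same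
  constant, into a single \<open>Y\<close>. The norms of finite sums from a dense subset of \<open>Y\<close> are decided by conditions which
  use only boundedly many coordinates, so some \<open>\<alpha>\<close> is not among these. Given \<open>K\<close> jointly compatible conditions that decide
  the (approximate) images of \<open>K\<close> indices, the \<open>\<alpha>\<close>-th real can still be chosen to be 1, or 0, at all places where
  these indices split: the tuple becomes a clique or an anticlique, while the norm of the sum of the images stays the same.

  Instead of the countable chain condition we use that among infinitely many conditions of bounded size there are
  arbitrarily many jointly compatible ones. In the extension only the axioms of Zermelo set theory are needed.
\<close>

text \<open>The graph for \<alpha> has to be altered after the images have been decided, although
  the deciding conditions may mention the \<alpha>-th real. Hence the indices are thinned until they
  agree below all places mentioned there: every place where two of them split is still free. Whether
  the tuple of approximate images has a large sum is decided by a condition silent about \<alpha>,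
  hence compatible with both ways of filling these places, so a clique and an anticlique get the
  same verdict. Only a gap that grows with \<open>K\<close> defeats an unknown distortion: if it is
  at most \<open>C\<close>, then \<open>K = 16 C^8\<close> makes the sums at least
  \<open>4 C^3\<close> and at most \<open>2 C^3\<close>.

  Separation holds only for first-order formulas with parameters, so each set formed in a structure
  comes with a proof that its predicate is definable. The extension is given neither replacement nor
  choice: where a choice is required there, least ordinals are taken, and its cardinals are computed
  in the ground model. Flipping finitely many bits yields a generic filter through any given
  condition with the same extension, so forcing can be handled as truth for all such
  filters.\<close>

abbreviation (input) iff_ascii (infixr \<open><->\<close> 25) where "A<->B \<equiv> (A :: bool) = B"

section \<open>Definability\<close>

primrec vars :: "fm => nat set" where
 "vars (Mem i j) = {i,j}"
| "vars (Eql i j) = {i,j}"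
| "vars (Neg ph) = vars ph"
| "vars (Conj ph ps) = vars ph \<union> vars ps"
| "vars (All i ph) = insert i (vars ph)"

lemma finite_vars:"finite (vars ph)"
 by (induction ph) auto

text \<open>The bound variable becomes a number above the images of all variables of the body, so no
  variable is captured.\<close>

primrec ren :: "fm => (nat => nat) => fm" where
 "ren (Mem i j) f = Mem (f i) (f j)"
| "ren (Eql i j) f = Eql (f i) (f j)"
| "ren (Neg ph) f = Neg (ren ph f)"
| "ren (Conj ph ps) f = Conj (ren ph f) (ren ps f)"
| "ren (All i ph) f = All (Suc (Max (insert 0 (f ` vars ph)))) (ren ph (f(i := Suc (Max (insert 0 (f ` vars ph))))))"

definition mix :: "(nat => 'v) => (nat => 'v) => nat => 'v" where
 "mix e p = (%n. if even n then e (n div 2) else p (n div 2))"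

lemma mix_simps [simp]:"mix e p (2 * n) = e n" "mix e p (Suc (2 * n)) = p n" "mix e p 0 = e 0" "mix e p (Suc 0) = p 0"
 "mix e p (Suc (Suc (2 * n))) = e (Suc n)"
 by (auto simp: mix_def)

lemma Suc_double_div2:"Suc (2 * m) div 2 = m"
 by simp

lemma nat_even_odd_cases:
 fixes n :: nat
 obtains (1) m where "n = 2 * m" | (2) m where "n = Suc (2 * m)"
 by (metis oddE evenE Suc_eq_plus1)

text \<open>Closure rules by which definability of a predicate or a term is read off from its
  syntax. Separation, replacement and choice apply only to definable predicates, so most sets formed
  later rest on these rules.\<close>

named_theorems dpi

context set_struct
begin

lemma sat_cong:"(!!i. i : vars ph==>e i = e' i)==>sat e ph = sat e' ph"
proof (induction ph arbitrary: e e')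
 case (All i ph)
 have "sat (e(i := x)) ph = sat (e'(i := x)) ph" for x
 by (rule All.IH) (use All.prems in auto)
 thus ?case by simp
next
 case (Conj ph ps)
 thus ?case by (metis UnCI sat.simps(4) vars.simps(4))
next
 case (Neg ph)
 thus ?case by (metis sat.simps(3) vars.simps(3))
qed auto

lemma sat_ren:"sat e (ren ph f) = sat (%i. e (f i)) ph"
proof (induction ph arbitrary: e f)
 case (All i ph)
 define k where "k = Suc (Max (insert 0 (f ` vars ph)))"
 have k:"f j ~= k" if "j : vars ph" for j
 proof -
 have "f j <= Max (insert 0 (f ` vars ph))" using that finite_vars by (intro Max_ge) auto
 thus ?thesis by (simp add: k_def)
 qed
 have "sat (e(k := x)) (ren ph (f(i := k))) = sat ((%i. e (f i))(i := x)) ph" for x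
 unfolding All.IH by (rule sat_cong) (auto simp: k)
 thus ?case by (simp add: k_def[symmetric])
qed auto

text \<open>\<open>dp C R\<close>: the predicate \<open>R\<close> on environments is definable with parameters from \<open>C\<close>.
 Even variables of the defining formula hold the environment, odd ones the parameters.
 \<open>dt C t\<close>: the graph of \<open>t\<close> is definable. Environments are extended de Bruijn style.\<close>

definition dp :: "'v set => ((nat => 'v) => bool) => bool" where
 "dp C R<->(EX ph p. range p <= insert empty C&(ALL e. R e = sat (mix e p) ph))"

lemma dpI:"range p <= insert empty C==>(!!e. R e = sat (mix e p) ph)==>dp C R"
 unfolding dp_def by auto

lemma dpE:
 assumes "dp C R"
 obtains ph p where "range p <= insert empty C" "!!e. R e = sat (mix e p) ph"
 using assms unfolding dp_def by auto

definition dt :: "'v set => ((nat => 'v) => 'v) => bool" where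
 "dt C t<->dp C (%e. e 0 = t (%n. e (Suc n)))"

text \<open>Renaming acts on the even variables only; the odd ones, which hold the parameters,
  stay.\<close>

lemma dp_reindex: assumes "dp C R" shows "dp C (%e. R (%n. e (f n)))"
proof -
 obtain ph p where 1:"range p <= insert empty C" "!!e. R e = sat (mix e p) ph"
 using assms by (rule dpE) blast
 define g where "g n = (if even n then 2 * f (n div 2) else n)" for n
 have "(%i. mix e p (g i)) = mix (%n. e (f n)) p" for e
 by (auto simp: fun_eq_iff g_def mix_def)
 hence "R (%n. e (f n)) = sat (mix e p) (ren ph g)" for e
 by (simp add: 1 sat_ren)
 thus ?thesis by (rule dpI[OF 1(1)])
qed

lemma dp_var_mem:"dp C (%e. e i \<epsilon> e j)"
proof -
 have "ALL e. (e i \<epsilon> e j) = sat (mix e (%_. empty)) (Mem (2*i) (2*j))" by simp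
 thus ?thesis unfolding dp_def by (intro exI[of _ "Mem (2*i) (2*j)"] exI[of _ "%_. empty"]) auto
qed

lemma dp_var_eq:"dp C (%e. e i = e j)"
 unfolding dp_def by (intro exI[of _ "Eql (2*i) (2*j)"] exI[of _ "%_. empty"]) auto

lemma dp_const_eq:"c : C==>dp C (%e. e i = c)"
 unfolding dp_def by (intro exI[of _ "Eql (2*i) (Suc (2*0))"] exI[of _ "%_. c"]) auto

lemma dp_not [dpi]:"dp C R==>dp C (%e. ~ R e)"
 unfolding dp_def by (elim exE conjE,rule_tac x = "Neg ph" in exI) auto

lemma dp_conj [dpi]: assumes "dp C R" "dp C S" shows "dp C (%e. R e&S e)"
proof -
 obtain ph p where 1:"range p <= insert empty C" "!!e. R e = sat (mix e p) ph"
 using assms(1) by (rule dpE) blast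
 obtain ps q where 2:"range q <= insert empty C" "!!e. S e = sat (mix e q) ps"
 using assms(2) by (rule dpE) blast
 \<comment> \<open>The two parameter lists are interleaved into one; \<open>f\<close> and
   \<open>g\<close> redirect the parameters of each formula to its half of the merged list.\<close>
 define f where "f n = (if even n then n else Suc (2 * (2 * (n div 2))))" for n :: nat
 define g where "g n = (if even n then n else Suc (2 * Suc (2 * (n div 2))))" for n :: nat
 have f:"(%i. mix e (mix p q) (f i)) = mix e p" for e
 proof
 fix i show "mix e (mix p q) (f i) = mix e p i"
 by (cases i rule: nat_even_odd_cases)
 (simp_all only: f_def mix_simps even_mult_iff even_Suc if_True if_False dvd_refl simp_thms
 nonzero_mult_div_cancel_left Suc_double_div2)
 qed
 have g:"(%i. mix e (mix p q) (g i)) = mix e q" for e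
 proof
 fix i show "mix e (mix p q) (g i) = mix e q i"
 by (cases i rule: nat_even_odd_cases)
 (simp_all only: g_def mix_simps even_mult_iff even_Suc if_True if_False dvd_refl simp_thms
 nonzero_mult_div_cancel_left Suc_double_div2)
 qed
 have "(R e&S e) = sat (mix e (mix p q)) (Conj (ren ph f) (ren ps g))" for e
 by (simp add: 1 2 sat_ren f g)
 moreover have "range (mix p q) <= insert empty C" using 1(1) 2(1) by (auto simp: mix_def image_subset_iff)
 ultimately show ?thesis by (intro dpI)
qed

lemma dp_all [dpi]: assumes "dp C (%e. R (e 0) (%n. e (Suc n)))" shows "dp C (%e. ALL x. R x e)"
proof -
 obtain ph p where 1:"range p <= insert empty C" "!!e. R (e 0) (%n. e (Suc n)) = sat (mix e p) ph"
 using assms by (rule dpE) blast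
 \<comment> \<open>A dummy parameter in front occupies variable 1, which then serves as the bound
   variable: no entry of the environment has to be given up, and \<open>f\<close> undoes the de
   Bruijn shift.\<close>
 define q where "q = case_nat empty p"
 define f where "f n = (if n = 0 then 1 else if even n then n - 2 else n + 2)" for n :: nat
 have f:"(%i. ((mix e q)(Suc 0 := x)) (f i)) = mix (case_nat x e) p" for e x
 proof
 fix i show "((mix e q)(Suc 0 := x)) (f i) = mix (case_nat x e) p i"
 proof (cases i rule: nat_even_odd_cases)
 case (1 m) thus ?thesis by (cases m) (auto simp: f_def)
 next
 case (2 m)
 have "mix e q (Suc (Suc (Suc (2 * m)))) = p m" 
 using mix_simps(2)[of e q "Suc m"] by (simp add: q_def)
 thus ?thesis using 2 by (auto simp: f_def)
 qed
 qed
 have "(ALL x. R x e) = sat (mix e q) (All (Suc 0) (ren ph f))" for e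
 using 1(2)[of "case_nat _ e"] by (simp add: sat_ren f del: fun_upd_apply)
 moreover have "range q <= insert empty C" using 1(1) by (auto simp: q_def image_subset_iff split: nat.splits)
 ultimately show ?thesis by (intro dpI)
qed

lemma dp_disj [dpi]:"dp C R==>dp C S==>dp C (%e. R e \<or> S e)"
 using dp_not[OF dp_conj[OF dp_not dp_not],of C R S] by simp
lemma dp_imp [dpi]:"dp C R==>dp C S==>dp C (%e. R e-->S e)"
 unfolding imp_conv_disj by (intro dp_disj dp_not)
lemma dp_iff [dpi]:"dp C R==>dp C S==>dp C (%e. R e<->S e)"
 unfolding iff_conv_conj_imp by (intro dp_conj dp_imp)
lemma dp_ex [dpi]:"dp C (%e. R (e 0) (%n. e (Suc n)))==>dp C (%e. EX x. R x e)"
 using dp_not[OF dp_all[OF dp_not],of C R] unfolding not_all not_not .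
lemma dp_True [dpi]:"dp C (%e. True)" using dp_var_eq[of C 0 0] by simp
lemma dp_False [dpi]:"dp C (%e. False)" using dp_not[OF dp_True] by simp
lemma dp_const [dpi]:"dp C (%e. b)" by (cases b) (simp_all add: dp_True dp_False)

lemma dt_var [dpi]:"dt C (%e. e i)" unfolding dt_def by (rule dp_var_eq)
lemma dt_const:"c : C==>dt C (%e. c)" unfolding dt_def by (rule dp_const_eq)
lemma dt_const_UNIV [dpi]:"dt UNIV (%e. c)" by (rule dt_const) simp

lemma dt_reindex:"dt C t==>dt C (%e. t (%n. e (f n)))"
 unfolding dt_def by (drule dp_reindex[where f = "case_nat 0 (%n. Suc (f n))"]) simp

text \<open>The language has no terms. Substitution goes through the graph of \<open>t\<close>: some
  \<open>x\<close> equals \<open>t e\<close> and satisfies \<open>R\<close>.\<close>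

lemma dp_subst: assumes "dp C (%e. R (e 0) (%n. e (Suc n)))" "dt C t" shows "dp C (%e. R (t e) e)"
proof -
 have "dp C (%e. EX x. x = t e&R x e)"
 by (rule dp_ex) (rule dp_conj[OF assms(2)[unfolded dt_def] assms(1)])
 thus ?thesis by simp
qed

lemma dp_lift1:"dp C (%e. Q (e 0))==>dt C t==>dp C (%e. Q (t e))"
 by (rule dp_subst)

lemma dp_lift2: assumes "dp C (%e. Q (e 0) (e 1))" "dt C t" "dt C u" shows "dp C (%e. Q (t e) (u e))"
proof -
 have "dp C (%e. Q (t (%n. e (Suc n))) (e 0))"
 by (rule dp_subst[where R = "%x e. Q x (e 0)"]) (use assms dt_reindex in auto)
 from dp_subst[where R = "%x e. Q (t e) x",OF this assms(3)] show ?thesis .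
qed

lemma dp_lift3: assumes "dp C (%e. Q (e 0) (e 1) (e 2))" "dt C t" "dt C u" "dt C v"
 shows "dp C (%e. Q (t e) (u e) (v e))"
proof -
 have 1:"dp C (%e. Q (t (%n. e (Suc (Suc n)))) (e 0) (e 1))"
 by (rule dp_subst[where R = "%x e. Q x (e 0) (e 1)",OF _ dt_reindex[OF assms(2)]])
 (use assms(1) in \<open>simp add: numeral_2_eq_2\<close>)
 have 2:"dp C (%e. Q (t (%n. e (Suc n))) (u (%n. e (Suc n))) (e 0))"
 by (rule dp_subst[where R = "%x e. Q (t (%n. e (Suc n))) x (e 0)",OF _ dt_reindex[OF assms(3)]])
 (use 1 in simp)
 from dp_subst[where R = "%x e. Q (t e) (u e) x",OF 2 assms(4)] show ?thesis .
qed

lemma dp_lift4: assumes "dp C (%e. Q (e 0) (e 1) (e 2) (e 3))" "dt C t" "dt C u" "dt C v" "dt C w"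
 shows "dp C (%e. Q (t e) (u e) (v e) (w e))"
proof -
 have 1:"dp C (%e. Q (t (%n. e (Suc (Suc (Suc n))))) (e 0) (e 1) (e 2))"
 by (rule dp_subst[where R = "%x e. Q x (e 0) (e 1) (e 2)",OF _ dt_reindex[OF assms(2)]])
 (use assms(1) in \<open>simp add: eval_nat_numeral\<close>)
 have 2:"dp C (%e. Q (t (%n. e (Suc (Suc n)))) (u (%n. e (Suc (Suc n)))) (e 0) (e 1))"
 by (rule dp_subst[where R = "%x e. Q (t (%n. e (Suc (Suc n)))) x (e 0) (e 1)",OF _ dt_reindex[OF assms(3)]])
 (use 1 in \<open>simp add: eval_nat_numeral\<close>)
 have 3:"dp C (%e. Q (t (%n. e (Suc n))) (u (%n. e (Suc n))) (v (%n. e (Suc n))) (e 0))"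
 by (rule dp_subst[where R = "%x e. Q (t (%n. e (Suc n))) (u (%n. e (Suc n))) x (e 0)",OF _ dt_reindex[OF assms(4)]])
 (use 2 in simp)
 from dp_subst[where R = "%x e. Q (t e) (u e) (v e) x",OF 3 assms(5)] show ?thesis .
qed

lemma dt_lift1:"dp C (%e. e 0 = F (e 1))==>dt C t==>dt C (%e. F (t e))"
 unfolding dt_def[of C "%e. F (t e)"]
 by (rule dp_lift2[where Q = "%x y. x = F y"],assumption,rule dt_var,erule dt_reindex)
lemma dt_lift2:"dp C (%e. e 0 = F (e 1) (e 2))==>dt C t==>dt C u==>dt C (%e. F (t e) (u e))"
 unfolding dt_def[of C "%e. F (t e) (u e)"]
 by (rule dp_lift3[where Q = "%x y z. x = F y z"],assumption,rule dt_var; erule dt_reindex)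
lemma dp_mem [dpi]:"dt C t==>dt C u==>dp C (%e. t e \<epsilon> u e)"
 by (rule dp_lift2[where Q = "(\<epsilon>)",OF dp_var_mem])
lemma dp_eq [dpi]:"dt C t==>dt C u==>dp C (%e. t e = u e)"
 by (rule dp_lift2[where Q = "(=)",OF dp_var_eq])
lemma dp_ex1 [dpi]:"dp C (%e. R (e 0) (%n. e (Suc n)))==>dp C (%e. EX! x. R x e)"
 unfolding Ex1_def
 apply (rule dp_ex,rule dp_conj,assumption,rule dp_all,rule dp_imp)
 apply (drule dp_reindex[where f = "case_nat 0 (%n. Suc (Suc n))"],simp)
 apply (rule dp_eq; rule dt_var)
 done
lemma dt_if [dpi]: assumes "dp C R" "dt C t" "dt C u" shows "dt C (%e. if R e then t e else u e)"
proof -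
 have "dp C (%e. (R (%n. e (Suc n))&e 0 = t (%n. e (Suc n))) \<or> (~ R (%n. e (Suc n))&e 0 = u (%n. e (Suc n))))"
 by (intro dpi dp_reindex[OF assms(1)] dt_reindex[OF assms(2)] dt_reindex[OF assms(3)])
 thus ?thesis unfolding dt_def by (rule back_subst[where P = "dp C"]) auto
qed

end

section \<open>Zermelo set theory in a well-founded structure\<close>

context set_struct
begin

abbreviation "rtc \<equiv> rat_code"
abbreviation "rlc \<equiv> real_code"

definition isset :: "'v set => bool" where "isset S<->(EX a. ext a = S)"

definition lam :: "'v => ('v => 'v) => 'v" where "lam a f = coll ((%x. pair x (f x)) ` ext a)"

definition un :: "'v => 'v" where "un a = coll {x. EX y. x \<epsilon> y&y \<epsilon> a}"

text \<open>Unlike \<open>app\<close>, this application is definable everywhere.\<close>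

definition ap :: "'v => 'v => 'v" where "ap f x = (if EX! y. pair x y \<epsilon> f then app f x else empty)"

lemma mem_ext [simp]:"x : ext a<->x \<epsilon> a" by (simp add: ext_def)

end

text \<open>Well-foundedness stands in for the axiom of foundation, and neither replacement nor
  choice is included. This is the theory that is verified for the extension.\<close>

locale zf0 = set_struct mem for mem :: "'v => 'v => bool" (infix \<open><:\<close> 50) +
 assumes wf:"wfp mem"
 and ext_inj:"ext a = ext b==>a = b"
 and pairing:"EX c. ext c = {a,b}"
 and union:"EX u. ext u = {x. EX y. x <: y&y <: a}"
 and power:"EX b. ext b = {x. ext x <= ext a}"
 and infinity:"EX w. empty <: w&(ALL x. x <: w-->succ x <: w)"
 and sep0:"EX b. ext b = {x. x <: a&sat (e(0 := x)) ph}"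
begin

lemma mem_induct [case_names step]: assumes "!!x. (!!y. y <: x==>P y)==>P x" shows "P x"
 by (rule wfp_induct_rule[OF wf]) (rule assms)

lemma mem_irrefl:"~ x <: x"
proof (induction x rule: mem_induct)
 case (step x) thus ?case by auto
qed
lemma mem_asym:"x <: y==>~ y <: x"
proof (induction x arbitrary: y rule: mem_induct)
 case (step x) thus ?case by auto
qed

lemma coll_eq:"ext a = S==>coll S = a" unfolding coll_def by (rule the_equality) (simp_all add: ext_inj)
lemma coll_ext [simp]:"coll (ext a) = a" by (rule coll_eq) simp
lemma ext_coll:"isset S==>ext (coll S) = S" unfolding isset_def by (auto simp: coll_eq)
lemma mem_coll:"isset S==>x <: coll S<->x : S" using ext_coll mem_ext by blast
lemma eq_coll:"isset S==>a = coll S<->(ALL x. x <: a<->x : S)"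
 by (metis coll_eq ext_coll mem_ext subset_antisym subsetI)
lemma set_eqI:"(!!x. x <: a<->x <: b)==>a = b" by (rule ext_inj) auto

lemma isset_ext [simp]:"isset (ext a)" by (auto simp: isset_def)
lemma sep: assumes "dp UNIV (%e. Q (e 0))" shows "isset {x. x <: a&Q x}"
proof -
 obtain ph p where 1:"!!e. Q (e 0) = sat (mix e p) ph" using assms by (rule dpE) blast
 have "(mix (%_. undefined) p)(0 := x) = mix ((%_. undefined)(0 := x)) p" for x
 by (auto simp: mix_def fun_eq_iff)
 hence "sat ((mix (%_. undefined) p)(0 := x)) ph = Q x" for x
 using 1[of "(%_. undefined)(0 := x)"] by simp
 thus ?thesis using sep0[of a "mix (%_. undefined) p" ph] unfolding isset_def by simp
qed

lemma isset_sub: assumes "isset T" "S <= T" "dp UNIV (%e. e 0 : S)" shows "isset S"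
proof -
 obtain a where "ext a = T" using assms by (auto simp: isset_def)
 hence "S = {x. x <: a&x : S}" using assms(2) by auto
 thus ?thesis using sep[where Q = "%x. x : S",OF assms(3)] by metis
qed

lemma isset_upair:"isset {a,b}" unfolding isset_def by (rule pairing)
lemma isset_Un: assumes "isset S" "isset T" shows "isset (S \<union> T)"
proof -
 obtain a b c u where "ext a = S" "ext b = T" "ext c = {a,b}" "ext u = {x. EX y. x <: y&y <: c}"
 using assms pairing union unfolding isset_def by metis
 hence "ext u = S \<union> T" by (auto simp: set_eq_iff)
 thus ?thesis by (auto simp: isset_def)
qed
lemma isset_insert:"isset S==>isset (insert a S)" using isset_Un[OF isset_upair[of a a]] by simp
lemma isset_empty:"isset {}" using sep[where Q = "%x. False",OF dp_False] by simp
lemma isset_finite:"finite S==>isset S"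
 by (induction S rule: finite_induct) (auto intro: isset_empty isset_insert)
lemma isset_UN:"isset {x. EX y. x <: y&y <: a}" unfolding isset_def by (rule union)
lemma isset_Pow:"isset {x. ext x <= ext a}" unfolding isset_def by (rule power)
lemma finite_subset_isset:"finite S==>EX a. ext a = S" using isset_finite by (auto simp: isset_def)

lemma mem_un [simp]:"x <: un a<->(EX y. x <: y&y <: a)"
 unfolding un_def by (simp add: mem_coll isset_UN)
lemma mem_powset [simp]:"x <: powset a<->ext x <= ext a"
 unfolding powset_def by (simp add: mem_coll isset_Pow)
lemma mem_empty [simp]:"~ x <: empty" unfolding empty_def by (simp add: mem_coll isset_empty)
lemma ext_empty [simp]:"ext empty = {}" by auto
lemma ext_eq_empty:"ext a = {}<->a = empty" by (metis ext_empty ext_inj)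
lemma ext_succ:"ext (succ a) = insert a (ext a)" 
 unfolding succ_def by (simp add: ext_coll isset_insert)
lemma mem_succ [simp]:"x <: succ a<->x = a \<or> x <: a" using ext_succ mem_ext by blast
lemma mem_coll_upair:"x <: coll {a,b}<->x = a \<or> x = b" by (simp add: mem_coll isset_upair)
lemma mem_coll_sing:"x <: coll {a}<->x = a" using mem_coll_upair[of x a a] by simp
lemma ext_pair:"ext (pair a b) = {coll {a},coll {a,b}}" unfolding pair_def by (simp add: ext_coll isset_upair)

lemma pair_inject [simp]:"pair a b = pair c d<->a = c&b = d"
proof
 assume "pair a b = pair c d"
 hence 1:"{coll {a},coll {a,b}} = {coll {c},coll {c,d}}" by (metis ext_pair)
 have s:"coll {x} = coll {y}<->x = y" for x y by (metis mem_coll_sing)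
 have u:"coll {x,y} = coll {z}<->x = z&y = z" for x y z
 by (metis insert_absorb2 mem_coll_sing mem_coll_upair)
 have v:"coll {x,y} = coll {z,w}<->(x = z&y = w) \<or> (x = w&y = z)" for x y z w
 by (smt (verit) insert_commute mem_coll_upair)
 have "a = c" using 1 s u by (metis doubleton_eq_iff)
 thus "a = c&b = d" using 1 s u v by (metis doubleton_eq_iff)
qed auto

lemma pfst_pair [simp]:"pfst (pair a b) = a" unfolding pfst_def by auto
lemma psnd_pair [simp]:"psnd (pair a b) = b" unfolding psnd_def by auto

lemma dt_fun1:"dt C (%e. f (e 0))==>dt C t==>dt C (%e. f (t e))"
 by (rule dt_lift1[where F = f]) (simp_all add: dt_def)
lemma dt_fun2:"dt C (%e. f (e 0) (e 1))==>dt C t==>dt C u==>dt C (%e. f (t e) (u e))"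
 by (rule dt_lift2[where F = f]) (simp_all add: dt_def numeral_2_eq_2)

text \<open>Equality with a collected set unfolds by \<open>eq_coll\<close> to a formula about
  elements, so the graph of the term is definable as soon as membership in it is.\<close>

lemma dt_coll: assumes "!!e. isset {x. R x e}" "dp C (%e. R (e 0) (%n. e (Suc n)))"
 shows "dt C (%e. coll {x. R x e})"
proof -
 have "dp C (%e. ALL x. x <: e 0<->R x (%n. e (Suc n)))"
 by (intro dp_all dp_iff dp_mem dt_var)
 (use dp_reindex[OF assms(2),of "case_nat 0 (%n. Suc (Suc n))"] in simp)
 thus ?thesis unfolding dt_def eq_coll[OF assms(1)] by simp
qed

lemma dt_empty [dpi]:"dt C (%e. empty)"
 using dt_coll[of "%x e. False" C] isset_empty dp_False unfolding empty_def by simp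
lemma dt_sing [dpi]:"dt C t==>dt C (%e. coll {t e})"
 by (rule dt_lift1[where F = "%x. coll {x}"]) (use dt_coll[of "%x e. x = e 0" C] isset_finite in
 \<open>simp_all add: dt_def dp_var_eq\<close>)
lemma dt_upair [dpi]:"dt C t==>dt C u==>dt C (%e. coll {t e,u e})"
proof (rule dt_lift2[where F = "%x y. coll {x,y}"])
 have "dt C (%e. coll {x. x = e 0 \<or> x = e 1})"
 by (rule dt_coll) (intro isset_finite,simp,intro dpi)
 moreover have "{x. x = a \<or> x = b} = {a,b}" for a b :: 'v by auto
 ultimately show "dp C (%e. e 0 = coll {e 1,e 2})" by (simp add: dt_def numeral_2_eq_2)
qed
lemma dt_pair [dpi]:"dt C t==>dt C u==>dt C (%e. pair (t e) (u e))"
 unfolding pair_def by (intro dpi)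
lemma dp_subset [dpi]:"dt C t==>dt C u==>dp C (%e. ext (t e) <= ext (u e))"
 by (rule dp_lift2[where Q = "%x y. ext x <= ext y"]) (simp only: subset_iff mem_ext,intro dpi)
lemma dt_coll_lift1: assumes "!!a. isset {x. R x a}" "dp C (%e. R (e 0) (e 1))" "dt C t"
 shows "dt C (%e. coll {x. R x (t e)})"
 by (rule dt_lift1[where F = "%a. coll {x. R x a}",OF _ assms(3)])
 (use dt_coll[of "%x e. R x (e 0)" C] assms in \<open>simp add: dt_def\<close>)
lemma dt_un [dpi]:"dt C t==>dt C (%e. un (t e))"
 unfolding un_def by (rule dt_coll_lift1) (rule isset_UN,(intro dpi)+)
lemma dt_powset [dpi]:"dt C t==>dt C (%e. powset (t e))"
 unfolding powset_def by (rule dt_coll_lift1) (rule isset_Pow,(intro dpi)+)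
lemma dt_succ [dpi]:"dt C t==>dt C (%e. succ (t e))"
proof -
 have "succ a = coll {x. x = a \<or> x <: a}" for a 
 unfolding succ_def by (rule arg_cong[where f = coll]) auto
 moreover have "isset {x. x = a \<or> x <: a}" for a using isset_ext[of "succ a"] unfolding ext_def by simp
 moreover assume "dt C t"
 ultimately show ?thesis by (simp only:) (rule dt_coll_lift1,assumption,intro dpi)
qed

lemma un2:"x <: un (coll {a,b})<->x <: a \<or> x <: b" by (auto simp: mem_coll_upair)
lemma isset_prod:"isset {pair x y | x y. x <: a&y <: b}"
proof (rule isset_sub[OF isset_ext[of "powset (powset (un (coll {a,b})))"]])
 show "{pair x y | x y. x <: a&y <: b} <= ext (powset (powset (un (coll {a,b}))))"
 using un2 by (auto simp: ext_pair mem_coll_upair mem_coll_sing)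
 show "dp UNIV (%e. e 0 : {pair x y | x y. x <: a&y <: b})"
 by (simp only: mem_Collect_eq) (intro dpi)
qed
lemma mem_cprod:"z <: cprod a b<->(EX x y. z = pair x y&x <: a&y <: b)"
 unfolding cprod_def by (auto simp: mem_coll isset_prod)
lemma pair_mem_cprod [simp]:"pair x y <: cprod a b<->x <: a&y <: b" by (auto simp: mem_cprod)
lemma dt_cprod [dpi]:"dt C t==>dt C u==>dt C (%e. cprod (t e) (u e))"
 by (rule dt_lift2[where F = cprod])
 (simp_all only: eq_coll[OF isset_prod] cprod_def mem_Collect_eq,intro dpi)

subsection \<open>Functions\<close>

lemma ap_eq:"func_on f a==>x <: a==>ap f x = app f x" by (simp add: ap_def func_on_def)
lemma func_app:"func_on f a==>x <: a==>pair x y <: f<->y = app f x"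
proof -
 assume "func_on f a" "x <: a"
 hence u:"EX! y. pair x y <: f" by (simp add: func_on_def)
 show ?thesis unfolding app_def using theI'[OF u] the1_equality[OF u] by metis
qed
lemma ap_iff:"EX! y. pair x y <: f==>ap f x = y<->pair x y <: f"
proof -
 assume u:"EX! y. pair x y <: f"
 hence "pair x (THE y. pair x y <: f) <: f" by (rule theI')
 moreover have "y = (THE y. pair x y <: f)" if "pair x y <: f" using the1_equality[OF u that] by simp
 moreover have "ap f x = (THE y. pair x y <: f)" using u by (simp add: ap_def app_def)
 ultimately show ?thesis by metis
qed
lemma dt_ap [dpi]:"dt C t==>dt C u==>dt C (%e. ap (t e) (u e))"
proof (rule dt_lift2[where F = ap])
 have "z = ap f x<->((EX! y. pair x y <: f)&pair x z <: f) \<or> ((\<nexists>!y. pair x y <: f)&z = empty)" for z f x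
 proof (cases "EX! y. pair x y <: f")
 case True thus ?thesis using ap_iff[OF True,of z] by auto
 next
 case False thus ?thesis by (simp add: ap_def)
 qed
 moreover have "dp C (%e. ((EX! y. pair (e 2) y <: (e 1))&pair (e 2) (e 0) <: (e 1)) \<or> (~ (EX! y. pair (e 2) y <: (e 1))&e 0 = empty))"
 by (intro dpi)
 ultimately show "dp C (%e. e 0 = ap (e 1) (e 2))" by simp
qed
lemma dp_func_on [dpi]:"dt C t==>dt C u==>dp C (%e. func_on (t e) (u e))"
 by (rule dp_lift2[where Q = func_on]) (unfold func_on_def,intro dpi)
lemma fn_ap:"fn f a b<->func_on f a&(ALL x. x <: a-->ap f x <: b)"
 unfolding fn_def using ap_eq by auto
lemma dp_fn [dpi]:"dt C t==>dt C u==>dt C v==>dp C (%e. fn (t e) (u e) (v e))"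
 by (rule dp_lift3[where Q = fn]) (unfold fn_ap,intro dpi)

lemma isset_lam: assumes "dt UNIV (%e. f (e 0))" "!!x. x <: a==>f x <: b"
 shows "isset ((%x. pair x (f x)) ` ext a)"
proof (rule isset_sub[OF isset_ext[of "cprod a b"]])
 show "(%x. pair x (f x)) ` ext a <= ext (cprod a b)" using assms by auto
 have "e 0 : (%x. pair x (f x)) ` ext a<->(EX x. x <: a&e 0 = pair x (f x))" for e :: "nat => 'v" by auto
 thus "dp UNIV (%e. e 0 : (%x. pair x (f x)) ` ext a)"
 by (simp only:) (intro dpi dt_fun1[OF assms(1)])
qed

lemma func_lam: assumes "isset ((%x. pair x (f x)) ` ext a)" 
 shows "func_on (lam a f) a" "x <: a==>app (lam a f) x = f x" "x <: a==>ap (lam a f) x = f x"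
 "pair x y <: lam a f<->x <: a&y = f x"
proof -
 have 1:"z <: lam a f<->(EX x. x <: a&z = pair x (f x))" for z
 unfolding lam_def using mem_coll[OF assms] by auto
 thus 2:"func_on (lam a f) a" unfolding func_on_def by auto
 show "x <: a==>app (lam a f) x = f x" unfolding app_def using 1 by auto
 thus "x <: a==>ap (lam a f) x = f x" using 2 ap_eq by metis
 show "pair x y <: lam a f<->x <: a&y = f x" using 1 by auto
qed
lemmas lam_fn = func_lam[OF isset_lam]

lemma fn_lam:"dt UNIV (%e. f (e 0))==>(!!x. x <: a==>f x <: b)==>fn (lam a f) a b"
 unfolding fn_def using lam_fn[of f a b] by simp

lemma func_eqI: assumes "func_on f a" "func_on g a" "!!x. x <: a==>app f x = app g x" shows "f = g"
proof (rule set_eqI)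
 fix z show "z <: f<->z <: g"
 using assms(1,2)[unfolded func_on_def] func_app[OF assms(1)] func_app[OF assms(2)] assms(3) by metis
qed

lemma fn_finite: assumes "finite (ext a)" "!!x. x <: a==>f x <: b" shows "fn (lam a f) a b"
 "x <: a==>app (lam a f) x = f x" "x <: a==>ap (lam a f) x = f x"
 using func_lam[OF isset_finite[of "(%x. pair x (f x)) ` ext a"]] assms by (auto simp: fn_def)

lemma fn_mem_pow:"fn f a b==>f <: powset (cprod a b)"
proof -
 assume a:"fn f a b"
 hence f:"func_on f a" by (simp add: fn_def)
 have "z <: cprod a b" if z:"z <: f" for z
 proof -
 obtain x y where "z = pair x y" "x <: a" using z f unfolding func_on_def by blast
 thus ?thesis using func_app[OF f] z a by (auto simp: fn_def)
 qed
 thus ?thesis by auto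
qed

subsection \<open>Natural numbers\<close>

lemma ext_num:"ext (num n) = num ` {..<n}"
 by (induction n) (auto simp: ext_succ lessThan_Suc)
lemma num_mem:"num m <: num n<->m < n"
proof
 show "m < n==>num m <: num n" using ext_num[of n] mem_ext by blast
 assume a:"num m <: num n"
 then obtain k where k:"k < n" "num m = num k" using ext_num[of n] mem_ext by blast
 have "~ num i <: num i" for i using mem_irrefl by blast
 moreover have "num i <: num j" if "i < j" for i j using that ext_num[of j] mem_ext by blast
 ultimately have "m = k" using k(2) by (metis linorder_neqE_nat)
 thus "m < n" using k by simp
qed
lemma num_inj [simp]:"num m = num n<->m = n" by (metis linorder_neqE_nat mem_irrefl num_mem)
lemma inj_num:"inj num" by (simp add: inj_def)
lemma dt_num [dpi]:"dt C (%e. num n)" by (induction n) (auto intro: dpi)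

text \<open>The intersection of all inductive sets contains the numerals. A membership-minimal
  element of it that is not a numeral could be removed, and an inductive set would remain; so
  well-foundedness makes \<open>omega\<close> standard.\<close>

lemma isset_omega:"isset (range num)"
proof -
 obtain w where w:"empty <: w" "!!x. x <: w==>succ x <: w" using infinity by blast
 define Ind where "Ind v<->empty <: v&(ALL x. x <: v-->succ x <: v)" for v
 define N where "N = {x. x <: w&(ALL v. Ind v-->x <: v)}"
 have "isset N" unfolding N_def Ind_def by (rule sep) (intro dpi)
 then obtain n where n:"ext n = N" by (auto simp: isset_def)
 have "num k <: v" if "Ind v" for k v using that by (induction k) (auto simp: Ind_def)
 moreover have "Ind w" using w by (auto simp: Ind_def)
 ultimately have 1:"range num <= N" by (auto simp: N_def)
 have "x : range num" if "x : N" for x using that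
 proof (induction x rule: mem_induct)
 case (step x)
 show ?case
 proof (rule ccontr)
 assume a:"x \<notin> range num"
 have "isset {y. y <: n&y ~= x}" by (rule sep) (intro dpi)
 then obtain v where "ext v = {y. y <: n&y ~= x}" unfolding isset_def by blast
 hence v:"!!y. y <: v<->y <: n&y ~= x" by (simp flip: mem_ext)
 have n': "y <: n<->y : N" for y using n mem_ext by blast
 have "empty <: v" unfolding v n' using 1 a by (metis num.simps(1) range_eqI subsetD)
 moreover have "succ y <: v" if "y <: v" for y
 proof -
 have y:"y : N" "y ~= x" using that v n' by auto
 hence "succ y : N" using w unfolding N_def Ind_def by auto
 moreover have "succ y ~= x"
 proof
 assume e:"succ y = x"
 hence "y : range num" using step y by auto
 thus False using e a by (metis num.simps(2) rangeE range_eqI)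
 qed
 ultimately show ?thesis using v n' by blast
 qed
 ultimately have "Ind v" by (auto simp: Ind_def)
 hence "x <: v" using step.prems by (auto simp: N_def)
 thus False using v by simp
 qed
 qed
 hence "ext n = range num" using 1 n by blast
 thus ?thesis by (auto simp: isset_def)
qed

lemma ext_omega:"ext omega = range num" unfolding omega_def by (rule ext_coll[OF isset_omega])
lemma mem_omega:"x <: omega<->(EX n. x = num n)" using ext_omega mem_ext by blast
lemma num_omega [simp]:"num n <: omega" by (auto simp: mem_omega)
text \<open>The numerals are not given by a formula, but the least inductive set is.\<close>

lemma dt_omega [dpi]:"dt C (%e. omega)"
proof -
 have "y = omega<->(empty <: y&(ALL x. x <: y-->succ x <: y)) &
 (ALL v. empty <: v&(ALL x. x <: v-->succ x <: v)-->ext y <= ext v)" (is "_<->?I y&?L y") for y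
 proof -
 have 1:"num k <: v" if "?I v" for k v using that by (induction k) auto
 have 2:"?I omega" by (metis mem_omega num.simps)
 have 3:"?L omega" using 1 by (auto simp: mem_omega)
 show ?thesis
 proof
 assume "?I y&?L y"
 hence "ext y = ext omega" using 2 3 by blast
 thus "y = omega" by (rule ext_inj)
 qed (use 2 3 in auto)
 qed
 thus ?thesis unfolding dt_def by (simp only:) (intro dpi)
qed

primrec itr :: "'v => ('v => 'v => 'v) => nat => 'v" where
 "itr z g 0 = z" | "itr z g (Suc n) = g (num n) (itr z g n)"

definition nv :: "'v => nat" where "nv x = (THE n. x = num n)"
lemma nv_num [simp]:"nv (num n) = n" by (simp add: nv_def)
text \<open>Iteration along \<open>omega\<close> as a total operation on the structure, with value
  \<open>empty\<close> off \<open>omega\<close>. In contrast to \<open>itr\<close> it has arguments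
  in the structure only, so its graph can be a formula.\<close>

definition rc :: "'v => ('v => 'v => 'v) => 'v => 'v" where
 "rc z g n = (if n <: omega then itr z g (nv n) else empty)"

lemma rc_num [simp]:"rc z g (num n) = itr z g n" by (simp add: rc_def)

text \<open>A finite approximation \<open>s\<close> that records the iteration up to
  \<open>n\<close> witnesses the value. It is a set of the structure because \<open>n\<close> is a
  standard numeral and every finite set of elements is one.\<close>

lemma rc_graph:"y = rc z g n<->(n <: omega&(EX s. pair empty z <: s & 
 (ALL l. l <: n-->(EX v. pair l v <: s&pair (succ l) (g l v) <: s)) &
 (ALL l v v'. pair l v <: s&pair l v' <: s-->v = v')&pair n y <: s)) \<or> (~ n <: omega&y = empty)"
proof (cases "n <: omega")
 case True
 then obtain k where k:"n = num k" by (auto simp: mem_omega)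
 define S where "S = (%l. pair (num l) (itr z g l)) ` {..k}"
 obtain s where s:"ext s = S" using finite_subset_isset[of S] by (auto simp: S_def)
 hence s': "x <: s<->x : S" for x using mem_ext by blast
 have "pair (num 0) z <: s" unfolding s' S_def by (rule image_eqI[of _ _ 0]) auto
 moreover have "pair (num k) (itr z g k) <: s" unfolding s' S_def by (rule image_eqI[of _ _ k]) auto
 moreover have "EX v. pair (num l) v <: s&pair (num (Suc l)) (g (num l) v) <: s" if "l < k" for l
 proof -
 have "pair (num l) (itr z g l) <: s" unfolding s' S_def by (rule image_eqI[of _ _ l]) (use that in auto)
 moreover have "pair (num (Suc l)) (g (num l) (itr z g l)) <: s" unfolding s' S_def
 by (rule image_eqI[of _ _ "Suc l"]) (use that in auto)
 ultimately show ?thesis by blast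
 qed
 moreover have "v = v'" if "pair l v <: s" "pair l v' <: s" for l v v' using that unfolding s' S_def by auto
 moreover have "v = itr z g l" if h:"pair (num 0) z <: s" "ALL l. l <: num k-->(EX v. pair l v <: s&pair (succ l) (g l v) <: s)"
 "ALL l v v'. pair l v <: s&pair l v' <: s-->v = v'" "pair (num l) v <: s" "l <= k" for l v s
 using h(4,5)
 proof (induction l arbitrary: v)
 case 0 thus ?case using h by fastforce
 next
 case (Suc l)
 then obtain u where u:"pair (num l) u <: s" "pair (num (Suc l)) (g (num l) u) <: s"
 using h(2) by (metis Suc_le_lessD num.simps(2) num_mem)
 thus ?case using Suc h(3) by (metis Suc_leD itr.simps(2))
 qed
 ultimately show ?thesis using True unfolding k by (auto simp: ext_num simp flip: mem_ext)
qed (simp add: rc_def)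

lemma dt_rc [dpi]: assumes "dt C z" "dt C (%e. g (%n. e (Suc (Suc n))) (e 0) (e 1))" "dt C n"
 shows "dt C (%e. rc (z e) (g e) (n e))"
proof -
 have g:"dt C (%e. g (%n. e (Suc (Suc (Suc (Suc n))))) (e (Suc 0)) (e 0))"
 using dt_reindex[OF assms(2),of "case_nat (Suc 0) (case_nat 0 (%n. Suc (Suc (Suc (Suc n)))))"] by simp
 show ?thesis unfolding dt_def rc_graph
 by (intro dpi dt_reindex[OF assms(1),of "%n. Suc n"] dt_reindex[OF assms(3),of "%n. Suc n"]
 dt_reindex[OF assms(1),of "%n. Suc (Suc n)"] dt_reindex[OF assms(3),of "%n. Suc (Suc n)"] 
 dt_reindex[OF assms(3),of "%n. Suc (Suc (Suc n))"] g)
qed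

end

subsection \<open>Ordinals and cardinality\<close>

context set_struct
begin
definition lep :: "'v => 'v => bool" where "lep a b<->(EX f. fn f a b&inj_on (app f) (ext a))"
definition fs :: "'v => 'v => 'v" where "fs a b = coll {f. fn f a b}"
text \<open>A relation of the structure that is single-valued and whose values at the elements of
  \<open>n\<close> exhaust \<open>S\<close>. It expresses "at most \<open>n\<close> elements" by a
  formula even when \<open>S\<close> is only a definable class.\<close>

definition fcov :: "'v set => 'v => bool" where
 "fcov S n<->(EX f. (ALL l x y. pair l x \<epsilon> f&pair l y \<epsilon> f-->x = y)&(ALL x. x : S-->(EX l. l \<epsilon> n&pair l x \<epsilon> f)))"
end

context zf0
begin

lemma dp_ordinal [dpi]:"dt C t==>dp C (%e. ordinal (t e))"
 by (rule dp_lift1[where Q = ordinal]) (unfold ordinal_def,intro dpi)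

lemma ordinal_mem:"ordinal a==>x <: a==>ordinal x"
 unfolding ordinal_def by (meson mem_ext subset_iff)
lemma ordinal_trans:"ordinal a==>x <: a==>y <: x==>y <: a"
 unfolding ordinal_def by (meson mem_ext subset_iff)

lemma ordinal_linear:"ordinal a==>ordinal b==>a <: b \<or> a = b \<or> b <: a"
proof (induction a arbitrary: b rule: mem_induct)
 case (step a)
 note IH = step.IH and a = step.prems(1)
 show ?case using step.prems(2)
 proof (induction b rule: mem_induct)
 case (step b)
 show ?case
 proof (rule ccontr)
 assume n:"~ (a <: b \<or> a = b \<or> b <: a)"
 have "x <: b" if "x <: a" for x
 using IH[OF that ordinal_mem[OF a that] step.prems] n that ordinal_trans[OF a that] by auto
 moreover have "x <: a" if "x <: b" for x
 using step.IH[OF that ordinal_mem[OF step.prems that]] n that ordinal_trans[OF step.prems that] by auto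
 ultimately have "a = b" by (intro set_eqI) blast
 thus False using n by blast
 qed
 qed
qed

lemma ordinal_subset:"ordinal a==>ordinal b==>ext a <= ext b<->a <: b \<or> a = b"
proof
 assume a:"ordinal a" "ordinal b" and "ext a <= ext b"
 hence "~ b <: a" using mem_irrefl by auto
 thus "a <: b \<or> a = b" using ordinal_linear a by blast
next
 assume "ordinal a" "ordinal b" "a <: b \<or> a = b" thus "ext a <= ext b" by (auto intro: ordinal_trans)
qed

lemma ordinal_omega:"ordinal omega"
 unfolding ordinal_def by (auto simp: ext_num ext_omega mem_omega simp flip: mem_ext)

lemma least_ordinal: assumes "ordinal a" "Q a"
 obtains b where "ordinal b" "Q b" "!!c. c <: b==>~ Q c" "b = a \<or> b <: a"
proof -
 have "EX b. ordinal b&Q b&(ALL c. c <: b-->~ Q c)&(b = a \<or> b <: a)"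
 using assms
 proof (induction a rule: mem_induct)
 case (step a)
 show ?case
 proof (cases "EX c. c <: a&Q c")
 case True
 then obtain c where c:"c <: a" "Q c" by blast
 thus ?thesis using step.IH[OF c(1) ordinal_mem[OF step.prems(1) c(1)] c(2)]
 ordinal_trans[OF step.prems(1) c(1)] by blast
 qed (use step in blast)
 qed
 thus ?thesis using that by blast
qed

text \<open>The graph is cut out of \<open>cprod a b\<close>, so separation suffices and the lemma
  is usable in the extension.\<close>

lemma fn_rel: assumes "dp UNIV (%e. R (e 0) (e 1))" "!!x. x <: a==>EX y. y <: b&R x y"
 "!!x y y'. x <: a==>y <: b==>y' <: b==>R x y==>R x y'==>y = y'"
 obtains f where "fn f a b" "!!x. x <: a==>R x (app f x)"
proof -
 have R:"dp UNIV (%e. R (t e) (u e))" if "dt UNIV t" "dt UNIV u" for t u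
 by (rule dp_lift2[OF assms(1) that])
 have "isset {z. z <: cprod a b&(EX x y. z = pair x y&R x y)}" by (rule sep) (intro dpi R)
 then obtain f where f:"!!z. z <: f<->z <: cprod a b&(EX x y. z = pair x y&R x y)"
 using mem_coll by blast
 have fo:"func_on f a" unfolding func_on_def f using assms(2,3) by (auto simp: mem_cprod)
 have "pair x (app f x) <: f" if "x <: a" for x using func_app[OF fo that] by simp
 hence "app f x <: b&R x (app f x)" if "x <: a" for x using f that by auto
 thus ?thesis using that[of f] fo unfolding fn_def by blast
qed

lemma lepI: assumes "dt UNIV (%e. f (e 0))" "!!x. x <: a==>f x <: b" "inj_on f (ext a)" shows "lep a b"
proof -
 have "inj_on (app (lam a f)) (ext a)"
 using assms(3) lam_fn(2)[OF assms(1,2),of a] unfolding inj_on_def by auto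
 thus ?thesis unfolding lep_def using fn_lam[OF assms(1,2)] by blast
qed

lemma lepR: assumes "dp UNIV (%e. R (e 0) (e 1))" "!!x. x <: a==>EX y. y <: b&R x y"
 "!!x y y'. x <: a==>y <: b==>y' <: b==>R x y==>R x y'==>y = y'"
 "!!x x' y. x <: a==>x' <: a==>y <: b==>R x y==>R x' y==>x = x'"
 shows "lep a b"
proof -
 obtain f where f:"fn f a b" "!!x. x <: a==>R x (app f x)"
 by (rule fn_rel[OF assms(1),of a b]) (use assms(2,3) in auto)
 have "inj_on (app f) (ext a)"
 proof (rule inj_onI)
 fix x y assume "x : ext a" "y : ext a" "app f x = app f y"
 thus "x = y" using assms(4)[of x y "app f x"] f(1) f(2)[of x] f(2)[of y] unfolding fn_def by auto
 qed
 thus ?thesis unfolding lep_def using f by blast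
qed

lemma lepE: assumes "lep a b"
 obtains f where "fn f a b" "!!x. x <: a==>ap f x <: b" "!!x y. x <: a==>y <: a==>ap f x = ap f y==>x = y"
 "!!x. x <: a==>ap f x = app f x"
proof -
 obtain f where f:"fn f a b" "inj_on (app f) (ext a)" using assms lep_def by blast
 hence "ap f x = app f x" if "x <: a" for x using ap_eq that unfolding fn_def by blast
 thus ?thesis using f that[of f] unfolding fn_def inj_on_def by auto
qed

lemma lep_subset:"ext a <= ext b==>lep a b" by (rule lepI[of "%x. x"]) (auto intro: dpi)
lemma lep_refl:"lep a a" by (rule lep_subset) simp
lemma lep_trans: assumes "lep a b" "lep b c" shows "lep a c"
proof -
 obtain f where f:"!!x. x <: a==>ap f x <: b" "!!x y. x <: a==>y <: a==>ap f x = ap f y==>x = y"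
 using lepE[OF assms(1)] by metis
 obtain g where g:"!!x. x <: b==>ap g x <: c" "!!x y. x <: b==>y <: b==>ap g x = ap g y==>x = y"
 using lepE[OF assms(2)] by metis
 show ?thesis
 by (rule lepI[of "%x. ap g (ap f x)"]) (intro dpi,use f g in \<open>auto simp: inj_on_def\<close>)
qed

lemma lep_ordinal:"ordinal b==>a <: b==>lep a b"
 by (rule lep_subset) (auto intro: ordinal_trans)

lemma equinum_lep:"equinum a b==>lep a b" unfolding equinum_def lep_def bij_betw_def by blast
lemma equinum_lep2: assumes "equinum a b" shows "lep b a"
proof -
 obtain f where f:"fn f a b" "bij_betw (app f) (ext a) (ext b)" using assms equinum_def by blast
 have e:"ap f x = app f x" if "x <: a" for x using ap_eq f that unfolding fn_def by blast
 have i:"x = x'" if "x <: a" "x' <: a" "app f x = app f x'" for x x'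
 using f(2) that unfolding bij_betw_def inj_on_def by auto
 have s:"EX x. x <: a&app f x = y" if "y <: b" for y
 using f(2) that unfolding bij_betw_def by (metis imageE mem_ext)
 show ?thesis
 proof (rule lepR[of "%y x. x <: a&y = ap f x"])
 show "dp UNIV (%e. e 1 <: a&e 0 = ap f (e 1))" by (intro dpi)
 show "EX y. y <: a&y <: a&x = ap f y" if "x <: b" for x using s[OF that] e by auto
 qed (use i e in auto)
qed

theorem cantor_bernstein: assumes "lep a b" "lep b a" shows "equinum a b"
proof -
 obtain f where f:"!!x. x <: a==>ap f x <: b" "!!x y. x <: a==>y <: a==>ap f x = ap f y==>x = y"
 using lepE[OF assms(1)] by metis
 obtain g where g:"!!x. x <: b==>ap g x <: a" "!!x y. x <: b==>y <: b==>ap g x = ap g y==>x = y"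
 using lepE[OF assms(2)] by metis
 \<comment> \<open>\<open>X\<close> will be the least set that contains the points outside the range
   of \<open>g\<close> and is closed under \<open>f\<close> followed by \<open>g\<close>. The
   bijection is \<open>f\<close> on \<open>X\<close> and the inverse of \<open>g\<close>
   elsewhere.\<close>
 define K where "K c<->(ALL y. y <: a&(ALL z. z <: b-->y ~= ap g z)-->y <: c)&(ALL y. y <: c&y <: a-->ap g (ap f y) <: c)" for c
 have "isset {x. x <: a&(ALL c. K c-->x <: c)}" unfolding K_def by (rule sep) (intro dpi)
 then obtain X where X:"!!x. x <: X<->x <: a&(ALL c. K c-->x <: c)" using mem_coll by blast
 have KX:"K X" unfolding K_def X using f g unfolding K_def by auto
 \<comment> \<open>Otherwise \<open>x\<close> could be removed from \<open>X\<close>, against its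
   minimality. This is what makes the two halves of the bijection cover \<open>b\<close>.\<close>
 have inv:"EX y. y <: X&x = ap g (ap f y)" if x:"x <: X" and z:"z <: b" "x = ap g z" for x z
 proof (rule ccontr)
 assume n:"~ ?thesis"
 have "isset {y. y <: X&y ~= x}" by (rule sep) (intro dpi)
 then obtain c where c:"!!y. y <: c<->y <: X&y ~= x" using mem_coll by blast
 have "K c" unfolding K_def c using KX n z unfolding K_def by auto
 thus False using x c X by blast
 qed
 define R where "R x y<->(x <: X&y = ap f x) \<or> (~ x <: X&x = ap g y)" for x y
 have R:"dp UNIV (%e. R (e 0) (e 1))" unfolding R_def by (intro dpi)
 have ex:"EX y. y <: b&R x y" if x:"x <: a" for x
 proof (cases "x <: X")
 case False
 hence "EX z. z <: b&x = ap g z" using KX x unfolding K_def by blast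
 thus ?thesis using False R_def by blast
 qed (use f x R_def in blast)
 obtain h where h:"fn h a b" "!!x. x <: a==>R x (app h x)"
 by (rule fn_rel[OF R ex]) (auto simp: R_def intro: g(2))
 have hb:"app h x <: b" if "x <: a" for x using h that unfolding fn_def by blast
 have Xa:"x <: a" if "x <: X" for x using X that by blast
 have cl:"ap g (ap f x) <: X" if "x <: X" for x using KX Xa[OF that] that unfolding K_def by blast
 have "bij_betw (app h) (ext a) (ext b)"
 proof (rule bij_betw_imageI)
 have mixed: False if "x <: a" "y <: a" "app h x = app h y" "x <: X" "~ y <: X" for x y
 using h(2)[OF that(1)] h(2)[OF that(2)] cl[of x] that unfolding R_def by auto
 show "inj_on (app h) (ext a)"
 proof (rule inj_onI)
 fix x y assume a:"x : ext a" "y : ext a" and e:"app h x = app h y"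
 hence "x <: X<->y <: X" using mixed[of x y] mixed[of y x] by auto
 thus "x = y" using h(2)[of x] h(2)[of y] a e f(2) unfolding R_def by auto
 qed
 have "EX x. x <: a&app h x = y" if y:"y <: b" for y
 proof (cases "ap g y <: X")
 case True
 then obtain x where x:"x <: X" "ap g y = ap g (ap f x)" using inv y by blast
 hence "y = ap f x" using g(2) f(1) y Xa by blast
 thus ?thesis using h(2)[of x] x Xa unfolding R_def by auto
 next
 case False
 hence "ap g y = ap g (app h (ap g y))" using h(2)[OF g(1)[OF y]] unfolding R_def by blast
 hence "y = app h (ap g y)" by (rule g(2)[OF y hb[OF g(1)[OF y]]])
 thus ?thesis using g(1)[OF y] by metis
 qed
 thus "app h ` ext a = ext b" using hb by (auto simp: image_iff Bex_def) metis
 qed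
 thus ?thesis unfolding equinum_def using h by blast
qed

lemma equinum_iff:"equinum a b<->lep a b&lep b a"
 using equinum_lep equinum_lep2 cantor_bernstein by blast

lemma cardinal_not_lep:"cardinal k==>a <: k==>~ lep k a"
 unfolding cardinal_def using lep_ordinal equinum_iff by blast

lemma csuccI: assumes "ordinal k" "cardinal l" "k <: l" "!!b. b <: l==>lep b k" shows "csucc k = l"
 unfolding csucc_def
proof (rule the_equality)
 have lo:"ordinal l" using assms cardinal_def by blast
 have "ext l <= ext m" if m:"cardinal m" "k <: m" for m
 proof -
 have "~ m <: l" using cardinal_not_lep[OF m] assms(4) by blast
 moreover have "ordinal m" using m cardinal_def by blast
 ultimately show ?thesis using ordinal_linear[OF lo] ordinal_subset[OF lo] by blast
 qed
 thus *: "cardinal l&k <: l&(ALL m. cardinal m&k <: m-->ext l <= ext m)" using assms by blast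
 fix m assume "cardinal m&k <: m&(ALL n. cardinal n&k <: n-->ext m <= ext n)"
 hence "ext m = ext l" using * by blast
 thus "m = l" by (rule ext_inj)
qed

lemma lep_prod: assumes "lep a a'" "lep b b'" shows "lep (cprod a b) (cprod a' b')"
proof -
 obtain f where f:"!!x. x <: a==>ap f x <: a'" "!!x y. x <: a==>y <: a==>ap f x = ap f y==>x = y"
 using lepE[OF assms(1)] by metis
 obtain g where g:"!!x. x <: b==>ap g x <: b'" "!!x y. x <: b==>y <: b==>ap g x = ap g y==>x = y"
 using lepE[OF assms(2)] by metis
 show ?thesis
 by (rule lepR[of "%z w. EX x y. z = pair x y&w = pair (ap f x) (ap g y)"])
 ((intro dpi)?,use f g in \<open>auto simp: mem_cprod\<close>)
qed

lemma isset_fs:"isset {f. fn f a b}"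
proof (rule isset_sub[OF isset_ext[of "powset (cprod a b)"]])
 show "{f. fn f a b} <= ext (powset (cprod a b))" using fn_mem_pow mem_ext by blast
 show "dp UNIV (%e. e 0 : {f. fn f a b})" unfolding mem_Collect_eq by (intro dpi)
qed
lemma mem_fs [simp]:"f <: fs a b<->fn f a b" unfolding fs_def by (simp add: mem_coll isset_fs)
lemma dt_fs [dpi]:"dt C t==>dt C u==>dt C (%e. fs (t e) (u e))"
 by (rule dt_lift2[where F = fs]) (simp_all only: eq_coll[OF isset_fs] fs_def mem_Collect_eq,intro dpi)

lemma fn_eqI:"fn f a b==>fn g a c==>(!!x. x <: a==>ap f x = ap g x)==>f = g"
 unfolding fn_ap by (rule func_eqI[of f a g]) (auto simp: ap_eq)

lemma lep_fs: assumes "lep b b'" shows "lep (fs a b) (fs a b')"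
proof -
 obtain h where h:"!!x. x <: b==>ap h x <: b'" "!!x y. x <: b==>y <: b==>ap h x = ap h y==>x = y"
 using lepE[OF assms] by metis
 show ?thesis
 proof (rule lepR[of "%f g. ALL x. x <: a-->ap g x = ap h (ap f x)"])
 show "EX g. g <: fs a b'&(ALL x. x <: a-->ap g x = ap h (ap f x))" if "f <: fs a b" for f
 proof -
 have f:"ap f x <: b" if "x <: a" for x using \<open>f <: fs a b\<close> that by (auto simp: fn_ap)
 have 1:"dt UNIV (%e. ap h (ap f (e 0)))" by (intro dpi)
 have "fn (lam a (%x. ap h (ap f x))) a b'" by (rule fn_lam[OF 1]) (use f h in auto)
 thus ?thesis using lam_fn(3)[OF 1,of a b'] f h by (intro exI[of _ "lam a (%x. ap h (ap f x))"]) auto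
 qed
 show "f = f'" if "f <: fs a b" "f' <: fs a b" "ALL x. x <: a-->ap g x = ap h (ap f x)"
 "ALL x. x <: a-->ap g x = ap h (ap f' x)" for f f' g
 proof -
 have f:"fn f a b" "fn f' a b" using that by auto
 show ?thesis by (rule fn_eqI[OF f]) (use that(3,4) f h(2) in \<open>auto simp: fn_ap\<close>)
 qed
 qed (intro dpi,auto intro: fn_eqI)
qed

lemma fcov_num:"fcov S (num n)<->finite S&card S <= n"
proof
 assume "fcov S (num n)"
 then obtain f where f:"!!l x y. pair l x <: f==>pair l y <: f==>x = y" "!!x. x : S==>EX l. l <: num n&pair l x <: f"
 unfolding fcov_def by blast
 have "\<exists>l<n. pair (num l) x <: f" if "x : S" for x using f(2)[OF that] by (auto simp: ext_num simp flip: mem_ext)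
 then obtain k where k:"!!x. x : S==>k x < n&pair (num (k x)) x <: f" by metis
 hence "inj_on k S" "k ` S <= {..<n}" using f(1) by (auto simp: inj_on_def) metis
 thus "finite S&card S <= n" by (metis card_inj_on_le card_lessThan finite_lessThan inj_on_finite)
next
 assume "finite S&card S <= n"
 then obtain k where k:"inj_on k S" "k ` S <= {..<n}" by (metis card_le_inj card_lessThan finite_lessThan)
 obtain f where f:"ext f = (%x. pair (num (k x)) x) ` S"
 using finite_subset_isset \<open>finite S&card S <= n\<close> by (metis finite_imageI)
 have f': "pair l x <: f<->x : S&l = num (k x)" for l x using f by (auto simp: image_iff simp flip: mem_ext)
 show "fcov S (num n)" unfolding fcov_def
 by (rule exI[of _ f]) (use k in \<open>auto simp: f' num_mem inj_on_def\<close>)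
qed
lemma dp_fcov [dpi]: assumes "dp C (%e. R (e 0) (%n. e (Suc n)))" "dt C n" shows "dp C (%e. fcov {x. R x e} (n e))"
proof -
 have "dp C (%e. R (e 0) (%n. e (Suc (Suc n))))"
 using dp_reindex[OF assms(1),of "case_nat 0 (%n. Suc (Suc n))"] by simp
 thus ?thesis unfolding fcov_def mem_Collect_eq
 by (intro dpi dt_reindex[OF assms(2),of "%n. Suc (Suc (Suc n))"])
qed
text \<open>Because \<open>omega\<close> consists of the standard numerals, finiteness in HOL
  coincides with a first-order property and may occur in definable predicates.\<close>

lemma finite_fcov:"finite S<->(EX n. n <: omega&fcov S n)"
 by (auto simp: mem_omega fcov_num)
lemma dp_finite [dpi]: assumes "dp C (%e. R (e 0) (%n. e (Suc n)))" shows "dp C (%e. finite {x. R x e})"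
 unfolding finite_fcov
 by (intro dpi) (use dp_reindex[OF assms(1),of "case_nat 0 (%n. Suc (Suc n))"] in simp)

subsection \<open>Arithmetic of the numerals\<close>

definition nadd :: "'v => 'v => 'v" where "nadd m n = rc m (%l v. succ v) n"
definition nmul :: "'v => 'v => 'v" where "nmul m n = rc empty (%l v. nadd v m) n"
lemma nadd_num [simp]:"nadd (num m) (num n) = num (m + n)"
 unfolding nadd_def rc_num by (induction n) simp_all
lemma nmul_num [simp]:"nmul (num m) (num n) = num (m * n)"
 unfolding nmul_def rc_num by (induction n) (simp_all add: add.commute)
lemma dt_nadd [dpi]:"dt C t==>dt C u==>dt C (%e. nadd (t e) (u e))"
 unfolding nadd_def by (intro dpi)
lemma dt_nmul [dpi]:"dt C t==>dt C u==>dt C (%e. nmul (t e) (u e))"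
proof (rule dt_lift2[where F = nmul])
 have "dt C (%e. nmul (e 0) (e 1))" unfolding nmul_def by (intro dpi)
 thus "dp C (%e. e 0 = nmul (e 1) (e 2))" by (simp add: dt_def numeral_2_eq_2)
qed

text \<open>With \<open>s = m + n\<close> the code lies in the interval from \<open>s * s\<close> to
  \<open>s * s + s\<close>, and these intervals are disjoint for distinct \<open>s\<close>. So the
  code determines the sum, and then \<open>m\<close>.\<close>

lemma square_pairing_inj: fixes m n m' n' :: nat
 assumes "(m + n) * (m + n) + m = (m' + n') * (m' + n') + m'" shows "m = m'&n = n'"
proof -
 have *: "~ s < s'" if "s * s + a = s' * s' + b" "a <= s" for s s' a b :: nat
 proof
 assume "s < s'"
 hence "Suc s * Suc s <= s' * s'" by (intro mult_le_mono) auto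
 thus False using that by simp
 qed
 have "m + n = m' + n'" using *[OF assms] *[OF assms[symmetric]] by (meson le_add1 linorder_neqE_nat)
 thus ?thesis using assms by simp
qed

lemma lep_omega2:"lep (cprod omega omega) omega"
proof (rule lepR[of "%z w. EX x y. z = pair x y&w = nadd (nmul (nadd x y) (nadd x y)) x"])
 show "EX w. w <: omega&(EX x y. z = pair x y&w = nadd (nmul (nadd x y) (nadd x y)) x)" if "z <: cprod omega omega" for z
 using that by (auto simp: mem_cprod mem_omega)
 show "z = z'" if "z <: cprod omega omega" "z' <: cprod omega omega" 
 "EX x y. z = pair x y&w = nadd (nmul (nadd x y) (nadd x y)) x"
 "EX x y. z' = pair x y&w = nadd (nmul (nadd x y) (nadd x y)) x" for z z' w
 using that by (auto simp: mem_cprod mem_omega) (use square_pairing_inj in blast)+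
qed (intro dpi,auto)

end

section \<open>Replacement and choice\<close>

locale zfc = zf0 mem for mem :: "'v => 'v => bool" (infix \<open><:\<close> 50) +
 assumes rep0:"(ALL x. x <: a-->(EX! y. sat (e(0 := x,1 := y)) ph)) ==>
 EX b. ext b = {y. EX x. x <: a&sat (e(0 := x,1 := y)) ph}"
 and choice0:"(ALL x. x <: a-->ext x ~= {}) &
 (ALL x y. x <: a&y <: a&x ~= y-->ext x \<inter> ext y = {}) ==>
 EX c. ALL x. x <: a-->(EX! z. z <: x&z <: c)"

lemma zfcI: assumes "wfp mem" "set_struct.ZFC mem" shows "zfc mem"
proof -
 note Z = assms(2)[unfolded set_struct.ZFC_def set_struct.extensional_def]
 note Z1 = Z[THEN conjunct1] and Z2 = Z[THEN conjunct2,THEN conjunct2]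
 note Z3 = Z2[THEN conjunct2,THEN conjunct2,THEN conjunct2]
 note Z4 = Z3[THEN conjunct2,THEN conjunct2]
 show ?thesis
 proof (intro_locales; unfold_locales)
 fix a b e ph
 show "wfp mem" by (rule assms)
 show "set_struct.ext mem a = set_struct.ext mem b==>a = b" using Z1 by simp
 show "EX c. set_struct.ext mem c = {a,b}" using Z2[THEN conjunct1] by (elim allE)
 show "EX u. set_struct.ext mem u = {x. EX y. mem x y&mem y a}" 
 using Z2[THEN conjunct2,THEN conjunct1] by (elim allE)
 show "EX b. set_struct.ext mem b = {x. set_struct.ext mem x <= set_struct.ext mem a}"
 using Z2[THEN conjunct2,THEN conjunct2,THEN conjunct1] by (elim allE)
 show "EX w. mem (set_struct.empty mem) w&(ALL x. mem x w-->mem (set_struct.succ mem x) w)"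
 by (rule Z3[THEN conjunct1])
 show "EX b. set_struct.ext mem b = {x. mem x a&set_struct.sat mem (e(0 := x)) ph}"
 using Z3[THEN conjunct2,THEN conjunct1] by (elim allE)
 show "ALL x. mem x a-->(EX! y. set_struct.sat mem (e(0 := x,1 := y)) ph) ==>
 EX b. set_struct.ext mem b = {y. EX x. mem x a&set_struct.sat mem (e(0 := x,1 := y)) ph}"
 using Z4[THEN conjunct1,rule_format] by simp
 show "(ALL x. mem x a-->set_struct.ext mem x ~= {}) &
 (ALL x y. mem x a&mem y a&x ~= y-->set_struct.ext mem x \<inter> set_struct.ext mem y = {}) ==>
 EX c. ALL x. mem x a-->(EX! z. mem z x&mem z c)"
 by (rule Z4[THEN conjunct2,THEN spec,THEN mp])
 qed
qed

context zfc
begin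

lemma rep: assumes "dp UNIV (%e. R (e 0) (e 1))" "!!x y y'. x <: a==>R x y==>R x y'==>y = y'"
 shows "isset {y. EX x. x <: a&R x y}"
proof -
 obtain ph p where p:"!!e. R (e 0) (e 1) = sat (mix e p) ph" using assms(1) by (rule dpE) blast
 \<comment> \<open>The replacement axiom reads its two arguments from variables 0 and 1. The second
   one sits in variable 2 and is moved to 1; all others are moved out of the way by 2.\<close>
 define f where "f n = (if n = 0 then 0 else if n = 2 then 1 else n + 2)" for n :: nat
 define E where "E n = (if odd n then p ((n - 3) div 2) else empty)" for n
 have "(%i. (E(0 := x,1 := y)) (f i)) = mix (%n. if n = 0 then x else if n = 1 then y else empty) p" for x y
 proof
 fix i show "(E(0 := x,1 := y)) (f i) = mix (%n. if n = 0 then x else if n = 1 then y else empty) p i"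
 by (cases i rule: nat_even_odd_cases) (auto simp: f_def E_def)
 qed
 hence s:"sat (E(0 := x,1 := y)) (ren ph f) = R x y" for x y
 using p[of "%n. if n = 0 then x else if n = 1 then y else empty"] by (simp add: sat_ren)
 have R:"dp UNIV (%e. R (t e) (u e))" if "dt UNIV t" "dt UNIV u" for t u
 by (rule dp_lift2[OF assms(1) that])
 \<comment> \<open>The axiom demands a total relation, so \<open>a\<close> is first restricted to
   the points that have a value.\<close>
 have "isset {x. x <: a&(EX y. R x y)}" by (rule sep) (intro dpi R)
 then obtain a' where a': "!!x. x <: a'<->x <: a&(EX y. R x y)" using mem_coll by blast
 have "ALL x. x <: a'-->(EX! y. R x y)" using a' assms(2) by blast
 from rep0[of a' E "ren ph f",unfolded s,OF this]
 have "isset {y. EX x. x <: a'&R x y}" unfolding isset_def .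
 moreover have "{y. EX x. x <: a'&R x y} = {y. EX x. x <: a&R x y}" using a' by blast
 ultimately show ?thesis by simp
qed

lemma rep_image: assumes "dt UNIV (%e. f (e 0))" shows "isset (f ` ext a)"
proof -
 have "dp UNIV (%e. e 1 = f (e 0))" by (intro dpi dt_fun1[OF assms])
 hence "isset {y. EX x. x <: a&y = f x}" by (rule rep[where R = "%x y. y = f x"]) auto
 moreover have "{y. EX x. x <: a&y = f x} = f ` ext a" by auto
 ultimately show ?thesis by simp
qed

lemma isset_graph:"dt UNIV (%e. f (e 0))==>isset ((%x. pair x (f x)) ` ext a)"
 by (rule rep_image[where f = "%x. pair x (f x)"]) (intro dpi)

lemma choice: assumes R:"dp UNIV (%e. R (e 0) (e 1))" and ex:"!!x. x <: a==>EX y. y <: b&R x y"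
 shows "EX f. fn f a b&(ALL x. x <: a-->R x (app f x))"
proof -
 have R': "dp C' (%e. R (t e) (u e))" if "dt UNIV t" "dt UNIV u" "C' = UNIV" for t u C'
 unfolding that(3) by (rule dp_lift2[OF R that(1,2)])
 \<comment> \<open>The candidates for \<open>x\<close> are tagged with \<open>x\<close>. This makes
   the sets pairwise disjoint, as the axiom of choice in its selector form requires.\<close>
 define g where "g x = coll {z. EX y. z = pair x y&y <: b&R x y}" for x
 have i:"isset {z. EX y. z = pair x y&y <: b&R x y}" for x
 proof -
 have "isset {z. z <: cprod (coll {x}) b&(EX y. z = pair x y&y <: b&R x y)}"
 by (rule sep) (intro dpi R' refl)
 moreover have "{z. z <: cprod (coll {x}) b&(EX y. z = pair x y&y <: b&R x y)} = {z. EX y. z = pair x y&y <: b&R x y}"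
 by (auto simp: mem_coll_sing)
 ultimately show ?thesis by simp
 qed
 have g:"z <: g x<->(EX y. z = pair x y&y <: b&R x y)" for z x unfolding g_def by (simp add: mem_coll i)
 have "dt UNIV (%e. g (e 0))" unfolding g_def by (rule dt_coll[OF i]) (intro dpi R' refl)
 hence "isset (g ` ext a)" by (rule rep_image)
 then obtain A where A:"ext A = g ` ext a" unfolding isset_def by blast
 have Am:"w <: A<->(EX x. x <: a&w = g x)" for w using A by (auto simp: image_iff Bex_def simp flip: mem_ext)
 have "EX c. ALL x. x <: A-->(EX! z. z <: x&z <: c)"
 proof (rule choice0,intro conjI allI impI)
 fix w assume "w <: A" thus "ext w ~= {}" using Am ex g by (metis ext_eq_empty mem_empty)
 next
 fix w w' assume "w <: A&w' <: A&w ~= w'"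
 then obtain x x' where "w = g x" "w' = g x'" "x ~= x'" unfolding Am by blast
 thus "ext w \<inter> ext w' = {}" using g by auto
 qed
 then obtain c where c0:"ALL x. x <: A-->(EX! z. z <: x&z <: c)" by (rule exE)
 have c:"EX! z. z <: g x&z <: c" if "x <: a" for x
 proof -
 have "g x <: A" using that Am by blast
 thus ?thesis using c0 by simp
 qed
 have "EX f. fn f a b&(ALL x. x <: a-->R x (app f x)&pair x (app f x) <: c)"
 proof (rule fn_rel[of "%x y. R x y&pair x y <: c" a b])
 show "dp UNIV (%e. R (e 0) (e 1)&pair (e 0) (e 1) <: c)" by (intro dpi R)
 show "EX y. y <: b&R x y&pair x y <: c" if xa:"x <: a" for x
 proof -
 obtain z where "z <: g x" "z <: c" using c[OF xa] by (auto elim: ex1E)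
 thus ?thesis using g by auto
 qed
 show "y = y'" if "x <: a" "y <: b" "y' <: b" "R x y&pair x y <: c" "R x y'&pair x y' <: c" for x y y'
 proof -
 have "pair x y <: g x&pair x y <: c" "pair x y' <: g x&pair x y' <: c" using that g by auto
 hence "pair x y = pair x y'" using c[OF that(1)] by blast
 thus ?thesis by simp
 qed
 qed blast
 thus ?thesis by blast
qed

lemma lep_choice: assumes "dp UNIV (%e. R (e 0) (e 1))" "!!x. x <: a==>EX y. y <: b&R x y"
 "!!x x' y. x <: a==>x' <: a==>y <: b==>R x y==>R x' y==>x = x'"
 shows "lep a b"
proof -
 obtain f where f:"fn f a b" "!!x. x <: a==>R x (app f x)" using choice[OF assms(1,2)] by blast
 have "inj_on (app f) (ext a)"
 proof (rule inj_onI)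
 fix x y assume "x : ext a" "y : ext a" "app f x = app f y"
 thus "x = y" using assms(3)[of x y "app f x"] f(1) f(2)[of x] f(2)[of y] unfolding fn_def by auto
 qed
 thus ?thesis unfolding lep_def using f by blast
qed

text \<open>An enumeration by natural numbers is chosen for every finite piece, and an element is
  sent to a pair of an index and a position at which it is listed. All chain-condition arguments
  below end in this bound.\<close>

lemma finite_cover: assumes Q:"dp UNIV (%e. Q (e 0) (e 1))" and c:"!!y. y <: b==>EX i. i <: L&Q i y"
 and fin:"!!i. i <: L==>finite {y. y <: b&Q i y}"
 shows "lep b (cprod L omega)"
proof -
 have Q': "dp UNIV (%e. Q (t e) (u e))" if "dt UNIV t" "dt UNIV u" for t u
 by (rule dp_lift2[OF Q that])
 define R where "R i f<->(ALL l x y. pair l x <: f&pair l y <: f-->x = y) &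
 (ALL x. x <: b&Q i x-->(EX l. l <: omega&pair l x <: f))" for i f
 have R:"dp UNIV (%e. R (e 0) (e 1))" unfolding R_def by (intro dpi Q')
 have "EX g. fn g L (powset (cprod omega b))&(ALL i. i <: L-->R i (app g i))"
 proof (rule choice[OF R])
 fix i assume "i <: L"
 then obtain n where "n <: omega" "fcov {y. y <: b&Q i y} n" using fin finite_fcov by blast
 then obtain f where f:"!!l x y. pair l x <: f==>pair l y <: f==>x = y"
 "!!x. x <: b==>Q i x==>EX l. l <: n&pair l x <: f" unfolding fcov_def by blast
 \<comment> \<open>Cutting down to one product places all enumerations into a single power set, from
   which choice can select.\<close>
 have "isset {z. z <: f&z <: cprod omega b}" by (rule sep) (intro dpi)
 then obtain f' where f': "!!z. z <: f'<->z <: f&z <: cprod omega b" using mem_coll by blast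
 have "R i f'" unfolding R_def f' using f ordinal_trans[OF ordinal_omega \<open>n <: omega\<close>] by fastforce
 moreover have "f' <: powset (cprod omega b)" using f' by auto
 ultimately show "EX y. y <: powset (cprod omega b)&R i y" by blast
 qed
 then obtain g where g:"fn g L (powset (cprod omega b))" "!!i. i <: L==>R i (app g i)" by blast
 have e:"ap g i = app g i" if "i <: L" for i using g(1) ap_eq that unfolding fn_def by blast
 show ?thesis
 proof (rule lep_choice[of "%y z. EX i l. z = pair i l&i <: L&pair l y <: ap g i"])
 show "EX z. z <: cprod L omega&(EX i l. z = pair i l&i <: L&pair l y <: ap g i)" if "y <: b" for y
 using c[OF that] g(2) e that unfolding R_def by (metis pair_mem_cprod)
 show "y = y'" if "EX i l. z = pair i l&i <: L&pair l y <: ap g i" "EX i l. z = pair i l&i <: L&pair l y' <: ap g i" for y y' z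
 using that g(2) e unfolding R_def by auto
 qed (intro dpi)
qed

subsection \<open>Hartogs numbers and successor cardinals\<close>

lemma inj_ap: assumes "func_on f a"
 shows "inj_on (app f) (ext a)<->(ALL x y. x <: a&y <: a&ap f x = ap f y-->x = y)"
proof
 assume i:"inj_on (app f) (ext a)"
 show "ALL x y. x <: a&y <: a&ap f x = ap f y-->x = y"
 proof (intro allI impI)
 fix x y assume h:"x <: a&y <: a&ap f x = ap f y"
 hence "app f x = app f y" using ap_eq[OF assms,of x] ap_eq[OF assms,of y] by simp
 thus "x = y" using inj_onD[OF i] h by simp
 qed
next
 assume i:"ALL x y. x <: a&y <: a&ap f x = ap f y-->x = y"
 show "inj_on (app f) (ext a)"
 proof (rule inj_onI)
 fix x y assume "x : ext a" "y : ext a" "app f x = app f y"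
 thus "x = y" using i ap_eq[OF assms,of x] ap_eq[OF assms,of y] by simp
 qed
qed

lemma dp_lep [dpi]:"dt C t==>dt C u==>dp C (%e. lep (t e) (u e))"
proof (rule dp_lift2[where Q = lep])
 have "lep a b<->(EX f. fn f a b&(ALL x y. x <: a&y <: a&ap f x = ap f y-->x = y))" for a b
 unfolding lep_def using inj_ap[of _ a] fn_def by metis
 thus "dp C (%e. lep (e 0) (e 1))" by (simp only:) (intro dpi)
qed

text \<open>An ordinal that injects into \<open>k\<close> is determined by the relation on
  \<open>k\<close> to which an injection carries its order. Replacement over such relations collects
  these ordinals; the collection is an ordinal, and would be a member of itself if it injected
  too.\<close>

lemma hartogs:"EX h. ordinal h&~ lep h k"
proof -
 define W where "W r al<->ordinal al&(EX f. fn f al k&(ALL x y. x <: al&y <: al&ap f x = ap f y-->x = y) &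
 (ALL z. z <: r<->(EX x y. x <: al&y <: al&(x <: y \<or> x = y)&z = pair (ap f x) (ap f y))))" for r al
 have uniq:"al = be1" if "W r al" "W r be1" for r al be1
 proof -
 obtain f where f:"fn f al k" "!!x y. x <: al==>y <: al==>ap f x = ap f y==>x = y" and
 fr:"!!z. z <: r<->(EX x y. x <: al&y <: al&(x <: y \<or> x = y)&z = pair (ap f x) (ap f y))" and oa:"ordinal al"
 using \<open>W r al\<close> unfolding W_def by blast
 obtain g where g:"fn g be1 k" "!!x y. x <: be1==>y <: be1==>ap g x = ap g y==>x = y" and
 gr:"!!z. z <: r<->(EX x y. x <: be1&y <: be1&(x <: y \<or> x = y)&z = pair (ap g x) (ap g y))" and ob:"ordinal be1"
 using \<open>W r be1\<close> unfolding W_def by blast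
 have fg:"EX x'. x' <: be1&ap f x = ap g x'" if "x <: al" for x
 using that fr[of "pair (ap f x) (ap f x)"] gr[of "pair (ap f x) (ap f x)"] by auto
 have gf:"EX x. x <: al&ap f x = ap g x'" if "x' <: be1" for x'
 using that fr[of "pair (ap g x') (ap g x')"] gr[of "pair (ap g x') (ap g x')"] by auto
 have main:"x = x'" if "x <: al" "x' <: be1" "ap f x = ap g x'" for x x'
 using that
 proof (induction x arbitrary: x' rule: mem_induct)
 case (step x)
 have ord:"y <: x<->y' <: x'" if y:"y <: al" "y' <: be1" "ap f y = ap g y'" for y y'
 proof -
 have "pair (ap f y) (ap f x) <: r<->y <: x \<or> y = x" using fr y step.prems f(2) by (metis pair_inject)
 moreover have "pair (ap g y') (ap g x') <: r<->y' <: x' \<or> y' = x'" using gr y step.prems g(2) by (metis pair_inject)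
 moreover have "y = x<->y' = x'" using y step.prems f(2) g(2) by metis
 ultimately show ?thesis using y step.prems mem_irrefl by metis
 qed
 show ?case
 proof (rule set_eqI)
 fix y
 show "y <: x<->y <: x'"
 proof
 assume yx:"y <: x"
 hence "y <: al" using ordinal_trans[OF oa] step.prems by blast
 thus "y <: x'" using fg ord yx step.IH by metis
 next
 assume yx:"y <: x'"
 hence "y <: be1" using ordinal_trans[OF ob] step.prems by blast
 thus "y <: x" using gf ord yx step.IH by metis
 qed
 qed
 qed
 show ?thesis
 proof (rule set_eqI)
 fix x show "x <: al<->x <: be1" using main fg gf by metis
 qed
 qed
 have "isset {al. EX r. r <: powset (cprod k k)&W r al}"
 by (rule rep) (unfold W_def,intro dpi,fold W_def,rule uniq)
 then obtain h where h:"!!al. al <: h<->(EX r. r <: powset (cprod k k)&W r al)" using mem_coll by blast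
 have h': "al <: h<->ordinal al&lep al k" for al
 proof
 assume "al <: h"
 then obtain r f where "ordinal al" "fn f al k" "ALL x y. x <: al&y <: al&ap f x = ap f y-->x = y"
 unfolding h W_def by blast
 thus "ordinal al&lep al k" unfolding lep_def using inj_ap[of f al] fn_def by metis
 next
 assume a:"ordinal al&lep al k"
 then obtain f where f:"fn f al k" "!!x. x <: al==>ap f x <: k" "!!x y. x <: al==>y <: al==>ap f x = ap f y==>x = y"
 using lepE by metis
 have "isset {z. z <: cprod k k&(EX x y. x <: al&y <: al&(x <: y \<or> x = y)&z = pair (ap f x) (ap f y))}"
 by (rule sep) (intro dpi)
 then obtain r where r:"!!z. z <: r<->z <: cprod k k&(EX x y. x <: al&y <: al&(x <: y \<or> x = y)&z = pair (ap f x) (ap f y))"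
 using mem_coll by blast
 have "W r al" unfolding W_def r using a f by (intro conjI exI[of _ f]) auto
 thus "al <: h" unfolding h using r by (intro exI[of _ r]) auto
 qed
 have "ordinal h" unfolding ordinal_def
 using h' by (auto intro: ordinal_mem ordinal_trans lep_trans[OF lep_ordinal])
 moreover have "~ lep h k" using h'[of h] calculation mem_irrefl by blast
 ultimately show ?thesis by blast
qed

lemma csucc_props: assumes k:"ordinal k"
 shows "cardinal (csucc k)" "k <: csucc k" "b <: csucc k==>lep b k" "~ lep (csucc k) k"
proof -
 obtain h0 where "ordinal h0" "~ lep h0 k" using hartogs by blast
 then obtain h where h:"ordinal h" "~ lep h k" "!!c. c <: h==>~ ~ lep c k"
 using least_ordinal[of h0 "%h. ~ lep h k"] by metis
 have c:"cardinal h" unfolding cardinal_def using h equinum_iff lep_trans by blast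
 have kh:"k <: h" using ordinal_linear[OF k h(1)] h lep_ordinal[OF k] lep_refl by blast
 have "csucc k = h" by (rule csuccI[OF k c kh]) (use h in blast)
 thus "cardinal (csucc k)" "k <: csucc k" "b <: csucc k==>lep b k" "~ lep (csucc k) k"
 using c kh h by auto
qed

subsection \<open>Cardinal arithmetic\<close>

text \<open>A sequence of subsets of \<open>a\<close> is a subset of the product of \<open>a\<close>
  and \<open>omega\<close>, which the assumed injection brings back into \<open>a\<close>.\<close>

lemma lep_pow_seq: assumes "lep (cprod a omega) a" shows "lep (fs omega (powset a)) (powset a)"
proof -
 obtain h where h:"!!x. x <: cprod a omega==>ap h x <: a"
 "!!x y. x <: cprod a omega==>y <: cprod a omega==>ap h x = ap h y==>x = y"
 using lepE[OF assms] by metis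
 define R where "R f s<->(ALL z. z <: s<->(EX x n. n <: omega&x <: ap f n&x <: a&z = ap h (pair x n)))" for f s
 show ?thesis
 proof (rule lepR[of R])
 show "dp UNIV (%e. R (e 0) (e 1))" unfolding R_def by (intro dpi)
 show "EX s. s <: powset a&R f s" for f
 proof -
 have "isset {z. z <: a&(EX x n. n <: omega&x <: ap f n&x <: a&z = ap h (pair x n))}"
 by (rule sep) (intro dpi)
 then obtain s where "!!z. z <: s<->z <: a&(EX x n. n <: omega&x <: ap f n&x <: a&z = ap h (pair x n))"
 using mem_coll by blast
 thus ?thesis unfolding R_def using h by (intro exI[of _ s]) auto
 qed
 show "s = s'" if "R f s" "R f s'" for f s s' using that unfolding R_def by (intro set_eqI) blast
 show "f = f'" if f:"f <: fs omega (powset a)" "f' <: fs omega (powset a)" and R:"R f s" "R f' s" for f f' s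
 proof -
 have s:"ap f n = ap f' n" if n:"n <: omega" for n
 proof (rule set_eqI)
 have *: "x <: ap F' n" if F:"F <: fs omega (powset a)" "R F s" "R F' s" "x <: ap F n" for F F' x
 proof -
 have xa:"x <: a" using F(1,4) n by (auto simp: fn_ap subset_iff)
 hence "ap h (pair x n) <: s" using F n unfolding R_def by blast
 then obtain y m where "m <: omega" "y <: ap F' m" "y <: a" "ap h (pair x n) = ap h (pair y m)"
 using F(3) unfolding R_def by blast
 thus ?thesis using h(2)[of "pair x n" "pair y m"] xa n by auto
 qed
 fix x show "x <: ap f n<->x <: ap f' n" using * f R by blast
 qed
 show ?thesis by (rule fn_eqI[of _ omega "powset a" _ "powset a"]) (use f s in auto)
 qed
 qed
qed

text \<open>The pair of \<open>x\<close> and \<open>y\<close> is coded by the sequence that starts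
  with \<open>x\<close> and continues with \<open>y\<close> forever.\<close>

lemma lep_square: assumes "lep (fs omega b) b" shows "lep (cprod b b) b"
proof (rule lep_trans[OF _ assms])
 show "lep (cprod b b) (fs omega b)"
 proof (rule lepR[of "%z f. EX x y. z = pair x y&ap f (num 0) = x&(ALL n. n <: omega&n ~= num 0-->ap f n = y)"])
 show "EX f. f <: fs omega b&(EX x y. z = pair x y&ap f (num 0) = x&(ALL n. n <: omega&n ~= num 0-->ap f n = y))"
 if zb:"z <: cprod b b" for z
 proof -
 obtain x y where z:"z = pair x y" "x <: b" "y <: b" using zb by (auto simp: mem_cprod)
 have d:"dt UNIV (%e. if e 0 = num 0 then x else y)" by (intro dpi)
 have b:"!!n. n <: omega==>(if n = num 0 then x else y) <: b" using z by auto
 have "fn (lam omega (%n. if n = num 0 then x else y)) omega b" by (rule fn_lam[OF d b])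
 moreover have "ap (lam omega (%n. if n = num 0 then x else y)) n = (if n = num 0 then x else y)" if "n <: omega" for n
 by (rule lam_fn(3)[OF d b that])
 ultimately show ?thesis using z num_omega[of 0]
 by (intro exI[of _ "lam omega (%n. if n = num 0 then x else y)"]) auto
 qed
 show "f = f'" if "f <: fs omega b" "f' <: fs omega b"
 "EX x y. z = pair x y&ap f (num 0) = x&(ALL n. n <: omega&n ~= num 0-->ap f n = y)"
 "EX x y. z = pair x y&ap f' (num 0) = x&(ALL n. n <: omega&n ~= num 0-->ap f' n = y)" for z f f'
 by (rule fn_eqI[of _ omega b _ b]) (use that in \<open>auto,metis\<close>)
 show "z = z'" if "EX x y. z = pair x y&ap f (num 0) = x&(ALL n. n <: omega&n ~= num 0-->ap f n = y)"
 "EX x y. z' = pair x y&ap f (num 0) = x&(ALL n. n <: omega&n ~= num 0-->ap f n = y)" for z z' f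
 using that num_omega[of 1] num_inj[of 1 0] by (metis zero_neq_one)
 qed (intro dpi)
qed

lemma isset_Fin:"isset {x. ext x <= ext b&finite {y. y <: x}}"
 using sep[of "%x. finite {y. y <: x}" "powset b"] by (simp,elim meta_mp) (intro dpi)

definition Fin :: "'v => 'v" where "Fin b = coll {x. ext x <= ext b&finite {y. y <: x}}"

lemma mem_Fin:"x <: Fin b<->ext x <= ext b&finite (ext x)"
 unfolding Fin_def by (simp add: mem_coll isset_Fin) (simp add: ext_def)

text \<open>A nonempty finite set is the range of a sequence. The two distinct points
  \<open>c\<close> and \<open>c'\<close> are used as an initial flag that separates the empty set
  from the others.\<close>

lemma lep_Fin: assumes "lep (fs omega b) b" "c <: b" "c' <: b" "c ~= c'" shows "lep (Fin b) b"
proof (rule lep_trans[OF _ assms(1)])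
 show "lep (Fin b) (fs omega b)"
 proof (rule lep_choice[of "%x f. (x = empty&ap f (num 0) = c) \<or> (x ~= empty&ap f (num 0) = c' &
 (ALL y. y <: x<->(EX n. n <: omega&ap f (succ n) = y)))"])
 show "EX f. f <: fs omega b&((x = empty&ap f (num 0) = c) \<or> (x ~= empty&ap f (num 0) = c' &
 (ALL y. y <: x<->(EX n. n <: omega&ap f (succ n) = y))))" if x:"x <: Fin b" for x
 proof (cases "x = empty")
 case True
 have d:"dt UNIV (%e. c)" by (intro dpi)
 show ?thesis using fn_lam[OF d] lam_fn(3)[OF d,of omega b] assms True
 by (intro exI[of _ "lam omega (%n. c)"]) (metis mem_fs num_omega)
 next
 case False
 have xf:"finite (ext x)" "ext x <= ext b" using x mem_Fin by auto
 then obtain n h where h:"ext x = h ` {i::nat. i < n}" using finite_imp_nat_seg_image_inj_on[OF xf(1)] by auto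
 have n:"n > 0" using h False ext_eq_empty[of x] by (cases n) auto
 obtain g where g:"ext g = (%i. pair (num (Suc i)) (h i)) ` {..<n}"
 using finite_subset_isset by (metis finite_imageI finite_lessThan)
 have gm:"pair l y <: g<->(\<exists>i<n. l = num (Suc i)&y = h i)" for l y
 using g by (auto simp: image_iff simp del: num.simps simp flip: mem_ext)
 \<comment> \<open>Position 0 carries the flag, the enumeration of \<open>x\<close> is shifted by
   one, and beyond its end the entry \<open>h 0\<close> is repeated; hence the requirement that
   \<open>n\<close> be positive.\<close>
 define k where "k l = (if l = num 0 then c' else if EX y. pair l y <: g then ap g l else h 0)" for l
 have d:"dt UNIV (%e. k (e 0))" unfolding k_def by (intro dpi)
 have ag:"ap g (num (Suc i)) = h i" if "i < n" for i
 using that by (subst ap_iff) (auto simp: gm simp del: num.simps)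
 have k0:"k (num 0) = c'" by (simp add: k_def)
 have k1:"k (num (Suc i)) = (if i < n then h i else h 0)" for i
 unfolding k_def using ag by (auto simp: gm simp del: num.simps)
 have hb:"h i <: b" if "i < n" for i using h xf that by auto
 have b:"k l <: b" if "l <: omega" for l
 proof -
 obtain m where m:"l = num m" using \<open>l <: omega\<close> mem_omega by blast
 show ?thesis unfolding m using k0 k1 hb n assms by (cases m) (simp_all del: num.simps)
 qed
 let ?f = "lam omega k"
 have 1:"fn ?f omega b" "!!l. l <: omega==>ap ?f l = k l" using fn_lam[OF d b] lam_fn(3)[OF d b] by auto
 have 2:"y <: x<->(EX l. l <: omega&ap ?f (succ l) = y)" for y
 proof -
 have "(EX l. l <: omega&ap ?f (succ l) = y)<->(EX i. k (num (Suc i)) = y)"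
 using 1(2) num_omega by (metis mem_omega num.simps(2))
 also have "...<->(\<exists>i<n. h i = y)" unfolding k1 using n by auto
 also have "...<->y <: x" using h by (auto simp flip: mem_ext)
 finally show ?thesis by simp
 qed
 show ?thesis using 1 2 k0 False num_omega[of 0] by (intro exI[of _ ?f]) (auto simp del: num.simps)
 qed
 show "x = x'" if "(x = empty&ap f (num 0) = c) \<or> (x ~= empty&ap f (num 0) = c' &
 (ALL y. y <: x<->(EX n. n <: omega&ap f (succ n) = y)))" "(x' = empty&ap f (num 0) = c) \<or> (x' ~= empty&ap f (num 0) = c' &
 (ALL y. y <: x'<->(EX n. n <: omega&ap f (succ n) = y)))" for x x' f
 using that assms(4) set_eqI by metis
 qed (intro dpi)
qed

end

subsection \<open>Recursion on the membership relation\<close>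

context set_struct
begin
definition trs :: "'v => bool" where "trs t<->(ALL x y. x \<epsilon> t&y \<epsilon> x-->y \<epsilon> t)"
definition is_tc :: "'v => 'v => bool" where
 "is_tc x t<->trs t&ext x <= ext t&(ALL u. trs u&ext x <= ext u-->ext t <= ext u)"
definition tc :: "'v => 'v" where "tc x = (THE t. is_tc x t)"
end

context zfc
begin

lemma dp_is_tc [dpi]:"dt C t==>dt C u==>dp C (%e. is_tc (t e) (u e))"
 by (rule dp_lift2[where Q = is_tc]) (unfold is_tc_def trs_def,intro dpi)

lemma is_tc_unique:"is_tc x t==>is_tc x u==>t = u"
 unfolding is_tc_def by (rule ext_inj) blast

lemma ex_tc:"EX t. is_tc x t"
proof (induction x rule: mem_induct)
 case (step x)
 have "isset {t. EX y. y <: x&is_tc y t}"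
 by (rule rep) (intro dpi,rule is_tc_unique)
 then obtain s where s:"!!t. t <: s<->(EX y. y <: x&is_tc y t)" using mem_coll by blast
 define T where "T = un (coll {x,un s})"
 have T:"z <: T<->z <: x \<or> (EX y t. y <: x&is_tc y t&z <: t)" for z
 by (subst T_def,subst un2) (auto simp: s)
 have "trs T" unfolding trs_def
 proof (intro allI impI)
 fix z w assume "z <: T&w <: z"
 hence zw:"w <: z" and "z <: x \<or> (EX y t. y <: x&is_tc y t&z <: t)" using T by auto
 thus "w <: T"
 proof (elim disjE exE)
 assume "z <: x"
 then obtain t where "is_tc z t" using step by blast
 thus ?thesis using T zw \<open>z <: x\<close> unfolding is_tc_def by (meson mem_ext subset_iff)
 next
 fix y t assume "y <: x&is_tc y t&z <: t"
 thus ?thesis using T zw unfolding is_tc_def trs_def by blast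
 qed
 qed
 moreover have "ext T <= ext u" if u:"trs u" "ext x <= ext u" for u
 proof
 fix z assume "z : ext T"
 then consider "z <: x" | y t where "y <: x" "is_tc y t" "z <: t" using T by auto
 thus "z : ext u"
 proof cases
 case 2
 have "ext y <= ext u" using u 2(1) unfolding trs_def by auto
 hence "ext t <= ext u" using 2(2) u unfolding is_tc_def by blast
 thus ?thesis using 2(3) by (auto simp: subset_iff)
 qed (use u in auto)
 qed
 ultimately have "is_tc x T" unfolding is_tc_def using T by auto
 thus ?case by blast
qed

lemma is_tc_tc:"is_tc x (tc x)"
 unfolding tc_def using ex_tc is_tc_unique by (metis theI')
lemma tc_eq:"is_tc x t<->t = tc x" using is_tc_tc is_tc_unique by blast
lemma dt_tc [dpi]:"dt C t==>dt C (%e. tc (t e))"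
 by (rule dt_lift1[where F = tc]) (simp_all only: tc_eq[symmetric],intro dpi)
lemma trs_tc:"trs (tc x)" using is_tc_tc is_tc_def by blast
lemma tc_trans:"y <: tc x==>z <: y==>z <: tc x" using trs_tc unfolding trs_def by blast
lemma tc_self:"y <: x==>y <: tc x" using is_tc_tc[of x] unfolding is_tc_def by auto
lemma tc_mono:"y <: tc x==>z <: tc y==>z <: tc x"
proof -
 assume y:"y <: tc x" "z <: tc y"
 hence "ext y <= ext (tc x)" using tc_trans by auto
 hence "ext (tc y) <= ext (tc x)" using is_tc_tc[of y] trs_tc[of x] unfolding is_tc_def by blast
 thus ?thesis using y by (auto simp: subset_iff)
qed
lemma tc_cases: assumes "z <: tc x" shows "z <: x \<or> (EX y. y <: x&z <: tc y)"
proof -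
 have "isset {z. z <: tc x&(z <: x \<or> (EX y. y <: x&z <: tc y))}" by (rule sep) (intro dpi)
 then obtain u where u:"!!z. z <: u<->z <: tc x&(z <: x \<or> (EX y. y <: x&z <: tc y))" using mem_coll by blast
 have "trs u" unfolding trs_def u using tc_trans tc_self by blast
 moreover have "ext x <= ext u" using u tc_self by auto
 ultimately have "ext (tc x) <= ext u" using is_tc_tc is_tc_def by blast
 hence "z <: u" using assms by (auto simp: subset_iff)
 thus ?thesis using u by blast
qed
lemma tc_induct [case_names step]: assumes "!!x. (!!y. y <: tc x==>P y)==>P x" shows "P x"
proof -
 have "P x&(ALL y. y <: tc x-->P y)"
 proof (induction x rule: mem_induct)
 case (step x)
 hence "ALL y. y <: tc x-->P y" using tc_cases by blast
 thus ?case using assms by blast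
 qed
 thus ?thesis by blast
qed

text \<open>A function given by recursion over the transitive closure is definable as soon as the
 recursion step is. The step is only specified on the correct values, and \<open>u\<close> is a parameter.\<close>

definition good :: "('v => 'v => 'v => 'v => bool) => 'v => 'v => bool" where
 "good S u f<->(ALL x v w. pair x v <: f&pair x w <: f-->v = w) &
 (ALL x v. pair x v <: f-->(EX g. ext g <= ext f&func_on g (tc x)&S u x g v))"

lemma recursion:
 assumes dS:"dp UNIV (%e. S (e 0) (e 1) (e 2) (e 3))"
 and S:"!!u x g v. func_on g (tc x)==>(!!y. y <: tc x==>app g y = H u y)==>S u x g v<->v = H u x"
 shows "dt UNIV (%e. H (e 0) (e 1))"
proof -
 have S': "dp UNIV (%e. S (t e) (u e) (v e) (w e))" if "dt UNIV t" "dt UNIV u" "dt UNIV v" "dt UNIV w" for t u v w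
 by (rule dp_lift4[OF dS that])
 have dg:"dp UNIV (%e. good S (t e) (f e))" if "dt UNIV t" "dt UNIV f" for t f
 by (rule dp_lift2[where Q = "good S",OF _ that]) (unfold good_def,intro dpi S')
 have corr:"v = H u x" if g:"good S u f" and p:"pair x v <: f" for u f x v
 using p
 proof (induction x arbitrary: v rule: tc_induct)
 case (step x)
 then obtain h where h:"ext h <= ext f" "func_on h (tc x)" "S u x h v" using g unfolding good_def by blast
 have "app h y = H u y" if "y <: tc x" for y
 proof -
 have "pair y (app h y) <: h" using func_app[OF h(2) that] by simp
 thus ?thesis using step.IH[OF that] h(1) by auto
 qed
 thus ?case using S[OF h(2)] h(3) by blast
 qed
 have ex:"EX f. good S u f&(ALL z. z <: f<->(EX y. (y = x \<or> y <: tc x)&z = pair y (H u y)))" for u x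
 proof (induction x rule: tc_induct)
 case (step x)
 \<comment> \<open>Replacement glues the approximations below \<open>x\<close>: by
   \<open>corr\<close> the value at \<open>y\<close> does not depend on the approximation that
   supplies it.\<close>
 have "isset {v. EX y. y <: tc x&(EX f w. good S u f&pair y w <: f&v = pair y w)}"
 by (rule rep) (intro dpi dg,use corr in blast)
 then obtain g where g:"!!z. z <: g<->(EX y. y <: tc x&(EX f w. good S u f&pair y w <: f&z = pair y w))"
 using mem_coll by blast
 have g': "z <: g<->(EX y. y <: tc x&z = pair y (H u y))" for z
 unfolding g using step corr by metis
 have gf:"func_on g (tc x)" unfolding func_on_def g' by auto
 have ga:"app g y = H u y" if "y <: tc x" for y using func_app[OF gf that,of "H u y"] g' that by auto
 have "isset (insert (pair x (H u x)) (ext g))" by (intro isset_insert isset_ext)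
 then obtain f where f:"ext f = insert (pair x (H u x)) (ext g)" unfolding isset_def by blast
 hence f': "z <: f<->(EX y. (y = x \<or> y <: tc x)&z = pair y (H u y))" for z
 using g' by (auto simp flip: mem_ext)
 have "good S u f" unfolding good_def
 proof (intro conjI allI impI)
 fix y v assume "pair y v <: f"
 hence y:"y = x \<or> y <: tc x" "v = H u y" using f' by auto
 show "EX h. ext h <= ext f&func_on h (tc y)&S u y h v"
 proof -
 have "isset {z. z <: g&(EX a b. z = pair a b&a <: tc y)}" by (rule sep) (intro dpi)
 then obtain h where h:"!!z. z <: h<->z <: g&(EX a b. z = pair a b&a <: tc y)" using mem_coll by blast
 have sub:"a <: tc x" if "a <: tc y" for a using y tc_mono that by blast
 have h': "z <: h<->(EX a. a <: tc y&z = pair a (H u a))" for z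
 unfolding h g' using sub by auto
 have hf:"func_on h (tc y)" unfolding func_on_def h' by auto
 have "app h a = H u a" if "a <: tc y" for a using func_app[OF hf that,of "H u a"] h' that by auto
 hence "S u y h v" using S[OF hf] y by blast
 moreover have "ext h <= ext f" using h f by auto
 ultimately show ?thesis using hf by blast
 qed
 qed (use f' in auto)
 thus ?case using f' by blast
 qed
 have "v = H u x<->(EX f. good S u f&pair x v <: f)" for v u x
 using ex[of u x] corr by blast
 thus ?thesis unfolding dt_def by (simp only:) (intro dpi dg)
qed

lemma check_rec:"check u x = coll ((%y. pair (check u y) u) ` ext x)"
proof -
 have w:"wf {(y,x). y <: x}" using wf unfolding wfp_def by simp
 have "check u x = coll ((%y. pair (cut (check u) {(y,x). y <: x} x y) u) ` ext x)"
 unfolding check_def by (subst wfrec[OF w]) simp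
 also have "(%y. pair (cut (check u) {(y,x). y <: x} x y) u) ` ext x = (%y. pair (check u y) u) ` ext x"
 by (rule image_cong) (auto simp: cut_apply)
 finally show ?thesis .
qed

lemma dt_check0:"dt UNIV (%e. check (e 0) (e 1))"
proof (rule recursion[where S = "%u x g v. ALL z. z <: v<->(EX y. y <: x&z = pair (ap g y) u)"])
 show "dp UNIV (%e. ALL z. z <: e 3<->(EX y. y <: e 1&z = pair (ap (e 2) y) (e 0)))" by (intro dpi)
 fix u x g v assume g:"func_on g (tc x)" "!!y. y <: tc x==>app g y = check u y"
 have e:"ap g y = check u y" if "y <: x" for y using g ap_eq[OF g(1)] tc_self[OF that] by simp
 have "isset ((%y. pair (ap g y) u) ` ext x)" by (rule rep_image) (intro dpi)
 moreover have "(%y. pair (ap g y) u) ` ext x = (%y. pair (check u y) u) ` ext x" using e by auto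
 ultimately have i:"isset ((%y. pair (check u y) u) ` ext x)" by simp
 show "(ALL z. z <: v<->(EX y. y <: x&z = pair (ap g y) u))<->v = check u x"
 unfolding check_rec[of u x] eq_coll[OF i] by (simp add: image_iff Bex_def e cong: conj_cong)
qed

lemma dt_check [dpi]:"dt UNIV t==>dt UNIV u==>dt UNIV (%e. check (t e) (u e))"
 by (rule dt_fun2[where f = check,OF dt_check0])

lemma ext_check:"ext (check u x) = (%y. pair (check u y) u) ` ext x"
 by (subst check_rec,rule ext_coll,rule rep_image) (intro dpi)
lemma mem_check:"z <: check u x<->(EX y. y <: x&z = pair (check u y) u)"
 using ext_check[of u x] by (auto simp: image_iff simp flip: mem_ext)
lemma check_empty [simp]:"check u empty = empty" by (rule set_eqI) (simp add: mem_check)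

end

section \<open>Forcing\<close>

context set_struct
begin

lemma dp_upd: assumes "dp C S" "dt C t" shows "dp C (%e. S (e(k := t e)))"
proof (rule dp_subst[where R = "%x e. S (e(k := x))",OF _ assms(2)])
 show "dp C (%e. S ((%n. e (Suc n))(k := e 0)))"
 using dp_reindex[OF assms(1),of "%n. if n = k then 0 else Suc n"] by (simp add: fun_upd_def if_distrib)
qed

text \<open>Only variables below some \<open>N\<close> occur in the defining formula, so finitely
  many substitutions are enough. The terms read the environment shifted by \<open>N\<close>, where
  the substitutions already made cannot disturb them.\<close>

lemma dp_env: assumes "dp C R" "!!n. dt C (ts n)" shows "dp C (%e. R (%n. ts n e))"
proof -
 obtain ph p where 1:"!!e. R e = sat (mix e p) ph" using assms(1) by (rule dpE) blast
 obtain N where N:"!!i. i : vars ph==>i < N" using finite_vars[of ph] finite_nat_set_iff_bounded by auto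
 have "dp C (%e. R (%n. if n < k then ts n (%m. e (m + N)) else e n))" if "k <= N" for k
 using that
 proof (induction k)
 case (Suc k)
 have "dp C (%e. R (%n. if n < k then ts n (%m. (e(k := ts k (%m. e (m + N)))) (m + N)) else (e(k := ts k (%m. e (m + N)))) n))"
 by (rule dp_upd[OF Suc.IH dt_reindex[OF assms(2)]]) (use Suc in simp)
 moreover have "(%n. if n < k then ts n (%m. (e(k := ts k (%m. e (m + N)))) (m + N)) else (e(k := ts k (%m. e (m + N)))) n)
 = (%n. if n < Suc k then ts n (%m. e (m + N)) else e n)" for e :: "nat => 'v"
 proof -
 have "(%m. (e(k := ts k (%m. e (m + N)))) (m + N)) = (%m. e (m + N))" using Suc by auto
 thus ?thesis by (auto simp: less_Suc_eq)
 qed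
 ultimately show ?case by simp
 qed (use assms(1) in simp)
 from dp_reindex[OF this[OF order_refl],of "%n. n - N"]
 have "dp C (%e. R (%n. if n < N then ts n e else e (n - N)))" unfolding add_diff_cancel_right' .
 moreover have "R (%n. if n < N then ts n e else e (n - N)) = R (%n. ts n e)" for e
 unfolding 1 by (rule sat_cong) (auto simp: mix_def dest: N intro!: less_le_trans[OF div_le_dividend[THEN le_less_trans] order_refl])
 ultimately show ?thesis by simp
qed

end

locale po = zfc mem for mem :: "'v => 'v => bool" (infix \<open><:\<close> 50) +
 fixes P :: "'v set" and le :: "'v => 'v => bool" and one :: 'v
 assumes le_refl:"p : P==>le p p" and le_trans:"le p q==>le q r==>le p r"
 and le_in:"le p q==>p : P" "le p q==>q : P" and one_in:"one : P" and le_one:"p : P==>le p one"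
begin

abbreviation "FE \<equiv> forces_eq P le"
abbreviation "FM \<equiv> forces_mem P le"
abbreviation "ck \<equiv> check one"

text \<open>The recursion step of forced equality, with \<open>F\<close> in place of the recursive
  calls. Isolating it allows forced equality to be described as a least fixed point inside the
  structure.\<close>

definition cls :: "('v => 'v => 'v => bool) => 'v => 'v => 'v => bool" where
 "cls F p ta sg<->p : P &
 (ALL pf s q. pair pf s <: ta&le q p&le q s-->(EX r rh t. le r q&pair rh t <: sg&le r t&F r pf rh)) &
 (ALL rh t q. pair rh t <: sg&le q p&le q t-->(EX r pf s. le r q&pair pf s <: ta&le r s&F r pf rh))"

lemma cls_mono:"cls F p ta sg==>(!!r pf rh s t. F r pf rh==>pair pf s <: ta==>pair rh t <: sg==>F' r pf rh)==>cls F' p ta sg"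
 unfolding cls_def by meson

lemma FE_iff:"FE p ta sg<->cls FE p ta sg"
proof
 assume "FE p ta sg" thus "cls FE p ta sg"
 by cases (unfold cls_def,use le_in in meson)
next
 assume c:"cls FE p ta sg"
 show "FE p ta sg"
 by (rule forces_eq.intros) (use c le_in in \<open>unfold cls_def,meson\<close>)+
qed

lemma FM_iff:"FM p ta sg<->(ALL q. le q p-->(EX r rh t. le r q&pair rh t <: sg&le r t&FE r ta rh))"
 unfolding forces_mem_def using le_in by meson

lemma pair_tc: assumes "pair x y <: a" shows "x <: tc a" "y <: tc a"
proof -
 have 1:"pair x y <: tc a" using assms tc_self by blast
 have "coll {x,y} <: pair x y" using ext_pair by (metis insertCI mem_ext)
 hence "coll {x,y} <: tc a" using 1 tc_trans by blast
 thus "x <: tc a" "y <: tc a" using tc_trans mem_coll_upair by blast+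
qed

lemma FE_refl:"p : P==>FE p ta ta"
proof (induction ta arbitrary: p rule: tc_induct)
 case (step ta)
 have "EX r rh t. le r q&pair rh t <: ta&le r t&FE r pf rh" if "pair pf s <: ta" "le q p" "le q s" for pf s q
 using step.IH[OF pair_tc(1)[OF that(1)],of q] that le_in(1) le_refl by blast
 moreover have "EX r pf s. le r q&pair pf s <: ta&le r s&FE r pf rh" if "pair rh t <: ta" "le q p" "le q t" for rh t q
 using step.IH[OF pair_tc(1)[OF that(1)],of q] that le_in(1) le_refl by blast
 ultimately show ?case unfolding FE_iff[of p] cls_def using step.prems by blast
qed

lemma FE_mono:"FE p ta sg==>le q p==>FE q ta sg"
 unfolding FE_iff[of p] FE_iff[of q] cls_def using le_trans le_in by meson
lemma FM_mono:"FM p ta sg==>le q p==>FM q ta sg"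
 unfolding FM_iff using le_trans by meson

lemma FE_check:"p : P==>FE p (ck x) (ck y)<->x = y"
proof (induction x arbitrary: p y rule: mem_induct)
 case (step x)
 show ?case
 proof
 assume "FE p (ck x) (ck y)"
 hence c:"cls FE p (ck x) (ck y)" using FE_iff by blast
 show "x = y"
 proof (rule set_eqI)
 fix z
 show "z <: x<->z <: y"
 proof
 assume z:"z <: x"
 hence "pair (ck z) one <: ck x" by (auto simp: mem_check)
 then obtain r rh t where r:"le r p" "pair rh t <: ck y" "FE r (ck z) rh"
 using c le_refl[OF step.prems] le_one[OF step.prems] unfolding cls_def by meson
 then obtain w where "w <: y" "rh = ck w" by (auto simp: mem_check)
 thus "z <: y" using step.IH[OF z le_in(1)[OF r(1)]] r by simp
 next
 assume z:"z <: y"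
 hence "pair (ck z) one <: ck y" by (auto simp: mem_check)
 then obtain r rh t where r:"le r p" "pair rh t <: ck x" "FE r rh (ck z)"
 using c le_refl[OF step.prems] le_one[OF step.prems] unfolding cls_def by meson
 then obtain w where "w <: x" "rh = ck w" by (auto simp: mem_check)
 thus "z <: x" using step.IH[OF _ le_in(1)[OF r(1)]] r by simp
 qed
 qed
 qed (use FE_refl step in blast)
qed

lemma FM_check: assumes "p : P" shows "FM p (ck x) (ck y)<->x <: y"
proof
 assume "FM p (ck x) (ck y)"
 then obtain r rh t where r:"le r p" "pair rh t <: ck y" "FE r (ck x) rh"
 using le_refl[OF assms] unfolding FM_iff by meson
 then obtain w where "w <: y" "rh = ck w" by (auto simp: mem_check)
 thus "x <: y" using FE_check[OF le_in(1)[OF r(1)]] r by simp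
next
 assume x:"x <: y"
 have "EX r rh t. le r q&pair rh t <: ck y&le r t&FE r (ck x) rh" if "le q p" for q
 using that x le_in[OF that] by (intro exI[of _ q] exI[of _ "ck x"] exI[of _ one])
 (auto simp: mem_check le_refl le_one FE_refl)
 thus "FM p (ck x) (ck y)" unfolding FM_iff by blast
qed

lemma FS_check: assumes "p : P" shows "forces_subset P le p (ck x) (ck y)<->ext x <= ext y"
proof
 assume f:"forces_subset P le p (ck x) (ck y)"
 show "ext x <= ext y"
 proof
 fix z assume "z : ext x"
 hence "pair (ck z) one <: ck x" by (auto simp: mem_check)
 hence "FM p (ck z) (ck y)" using f assms one_in le_refl[OF assms] le_one[OF assms]
 unfolding forces_subset_def by blast
 thus "z : ext y" using FM_check assms by simp
 qed
next
 assume s:"ext x <= ext y"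
 show "forces_subset P le p (ck x) (ck y)" unfolding forces_subset_def
 proof (intro allI ballI impI)
 fix pf s q assume q:"q : P" "pair pf s <: ck x&s : P&le q p&le q s"
 then obtain z where "z <: x" "pf = ck z" unfolding mem_check by auto
 thus "FM q pf (ck y)" using s FM_check[OF q(1),of z y] by auto
 qed
qed

lemma FE_dense: assumes "p : P" "!!q. le q p==>EX r. le r q&FE r ta sg" shows "FE p ta sg"
proof -
 have "EX r' rh t. le r' q&pair rh t <: sg&le r' t&FE r' pf rh" if h:"pair pf s <: ta" "le q p" "le q s" for pf s q
 proof -
 obtain r where r:"le r q" "FE r ta sg" using assms(2)[OF h(2)] by blast
 have "le r s" "le r r" using r h le_trans le_refl le_in by blast+
 then obtain r' rh t where "le r' r" "pair rh t <: sg" "le r' t" "FE r' pf rh"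
 using r(2) h(1) unfolding FE_iff[of r] cls_def by meson
 thus ?thesis using r le_trans by blast
 qed
 moreover have "EX r' pf s. le r' q&pair pf s <: ta&le r' s&FE r' pf rh" if h:"pair rh t <: sg" "le q p" "le q t" for rh t q
 proof -
 obtain r where r:"le r q" "FE r ta sg" using assms(2)[OF h(2)] by blast
 have "le r t" "le r r" using r h le_trans le_refl le_in by blast+
 then obtain r' pf s where "le r' r" "pair pf s <: ta" "le r' s" "FE r' pf rh"
 using r(2) h(1) unfolding FE_iff[of r] cls_def by meson
 thus ?thesis using r le_trans by blast
 qed
 ultimately show ?thesis unfolding FE_iff[of p] cls_def using assms(1) by blast
qed

text \<open>With only negation, conjunction and the universal quantifier, a formula is forced as
  soon as it is forced densely below the condition; see \<open>frc_dense\<close>.\<close>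

primrec frc :: "fm => 'v => (nat => 'v) => bool" where
 "frc (Mem i j) p e = FM p (e i) (e j)"
| "frc (Eql i j) p e = FE p (e i) (e j)"
| "frc (Neg ph) p e = (ALL q. le q p-->~ frc ph q e)"
| "frc (Conj ph ps) p e = (frc ph p e&frc ps p e)"
| "frc (All i ph) p e = (ALL x. frc ph p (e(i := x)))"

lemma frc_mono:"frc ph p e==>le q p==>frc ph q e"
proof (induction ph arbitrary: p q e)
 case (Neg ph) thus ?case by (metis frc.simps(3) le_trans)
next
 case (All i ph) thus ?case by (metis frc.simps(5))
next
 case (Conj ph ps) thus ?case by (metis frc.simps(4))
next
 case (Mem i j) thus ?case using FM_mono by simp
next
 case (Eql i j) thus ?case using FE_mono by simp
qed

lemma frc_dense:"p : P==>(!!q. le q p==>EX r. le r q&frc ph r e)==>frc ph p e"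
proof (induction ph arbitrary: p e)
 case (Mem i j)
 show ?case unfolding frc.simps FM_iff
 proof (intro allI impI)
 fix q assume "le q p"
 then obtain r where r:"le r q" "FM r (e i) (e j)" using Mem(2) by auto
 then obtain s rh t where "le s r" "pair rh t <: e j" "le s t" "FE s (e i) rh"
 using le_refl le_in unfolding FM_iff by meson
 thus "EX r rh t. le r q&pair rh t <: e j&le r t&FE r (e i) rh" using r le_trans by blast
 qed
next
 case (Eql i j) thus ?case using FE_dense by auto
next
 case (Neg ph)
 show ?case unfolding frc.simps
 proof (intro allI impI notI)
 fix q assume q:"le q p" "frc ph q e"
 then obtain r where r:"le r q" "ALL s. le s r-->~ frc ph s e" using Neg.prems(2) by auto
 thus False using frc_mono[OF q(2) r(1)] le_refl le_in by blast
 qed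
next
 case (Conj ph ps) thus ?case by (metis frc.simps(4))
next
 case (All i ph)
 show ?case unfolding frc.simps
 proof
 fix x show "frc ph p (e(i := x))" by (rule All.IH[OF All.prems(1)]) (metis All.prems(2) frc.simps(5))
 qed
qed

end

section \<open>Definability of the forcing relation\<close>

locale forcing = po mem P le one for mem :: "'v => 'v => bool" (infix \<open><:\<close> 50) and P le one +
 assumes isset_P:"isset P" and dle:"dp UNIV (%e. le (e 0) (e 1))"
begin

lemma dp_le [dpi]:"dt UNIV t==>dt UNIV u==>dp UNIV (%e. le (t e) (u e))"
 by (rule dp_lift2[where Q = le,OF dle])
lemma dp_P [dpi]:"dt UNIV t==>dp UNIV (%e. t e : P)"
 using dp_mem[OF _ dt_const_UNIV[of "coll P"],of t] by (simp add: mem_coll isset_P)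

definition tri :: "'v => 'v => 'v => 'v" where "tri p x y = pair p (pair x y)"

definition clos :: "'v => 'v => bool" where
 "clos t R<->(ALL p x y. x <: t&y <: t&cls (%p x y. tri p x y <: R) p x y-->tri p x y <: R)"

lemma dp_clos:"dt UNIV a==>dt UNIV b==>dp UNIV (%e. clos (a e) (b e))"
proof (rule dp_lift2[where Q = clos])
 show "dp UNIV (%e. clos (e 0) (e 1))" unfolding clos_def cls_def tri_def by (intro dpi)
qed

text \<open>An inductive relation is the intersection of all relations closed under its step, and on
  a transitive set \<open>t\<close> containing both names these relations are sets. Conversely, the
  least closed set is a fixed point of the step, and induction on names turns a fixed point into
  forced equality.\<close>

lemma FE_definable:"FE p ta sg<->(EX t. trs t&ta <: t&sg <: t&(ALL R. clos t R-->tri p ta sg <: R))"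
proof
 assume f:"FE p ta sg"
 obtain t where t:"trs t" "ta <: t" "sg <: t" 
 using trs_tc[of "coll {ta,sg}"] tc_self[of _ "coll {ta,sg}"] mem_coll_upair by blast
 have "tri p ta sg <: R" if "clos t R" for R using f t(2,3)
 proof (induction rule: forces_eq.induct)
 case (1 p ta sg)
 have pt:"x <: t" if "pair x y <: z" "z <: t" for x y z
 proof -
 have "pair x y <: t" using that t(1) unfolding trs_def by blast
 moreover have "coll {x,y} <: pair x y" using ext_pair by (metis insertCI mem_ext)
 moreover have "x <: coll {x,y}" by (simp add: mem_coll_upair)
 ultimately show ?thesis using t(1) unfolding trs_def by blast
 qed
 have "EX r rh s. le r q&pair rh s <: sg&le r s&tri r pf rh <: R" if h:"pair pf u <: ta" "le q p" "le q u" for pf u q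
 using 1(2) h le_in pt 1(4,5) by (meson)
 moreover have "EX r pf s. le r q&pair pf s <: ta&le r s&tri r pf rh <: R" if h:"pair rh u <: sg" "le q p" "le q u" for rh u q
 using 1(3) h le_in pt 1(4,5) by (meson)
 ultimately have "cls (%p x y. tri p x y <: R) p ta sg" unfolding cls_def using 1(1) by blast
 thus ?case using that 1(4,5) unfolding clos_def by blast
 qed
 thus "EX t. trs t&ta <: t&sg <: t&(ALL R. clos t R-->tri p ta sg <: R)" using t by blast
next
 assume "EX t. trs t&ta <: t&sg <: t&(ALL R. clos t R-->tri p ta sg <: R)"
 then obtain t where t:"trs t" "ta <: t" "sg <: t" "!!R. clos t R==>tri p ta sg <: R" by blast
 define B where "B = cprod (coll P) (cprod t t)"
 have B:"tri p x y <: B<->p : P&x <: t&y <: t" for p x y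
 unfolding B_def tri_def by (simp add: mem_coll isset_P)
 have "isset {z. z <: B&(ALL R. clos t R-->z <: R)}" by (rule sep) (intro dpi dp_clos)
 then obtain E where E:"!!z. z <: E<->z <: B&(ALL R. clos t R-->z <: R)" using mem_coll by blast
 have cE:"clos t E" unfolding clos_def
 proof (intro allI impI)
 fix p x y assume h:"x <: t&y <: t&cls (%p x y. tri p x y <: E) p x y"
 have "tri p x y <: R" if R:"clos t R" for R
 proof -
 have "cls (%p x y. tri p x y <: R) p x y"
 by (rule cls_mono[of "%p x y. tri p x y <: E"]) (use h E R in auto)
 thus ?thesis using R h unfolding clos_def by blast
 qed
 moreover have "p : P" using h unfolding cls_def by blast
 ultimately show "tri p x y <: E" using E B h by blast
 qed
 \<comment> \<open>The triples in \<open>E\<close> that the step produces from \<open>E\<close>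
   again form a closed set. Minimality then makes \<open>E\<close> a fixed point, so the step can be
   inverted.\<close>
 have "isset {z. z <: E&(EX p x y. z = tri p x y&cls (%p x y. tri p x y <: E) p x y)}"
 by (rule sep) (unfold tri_def cls_def,intro dpi)
 then obtain E0 where E0:"!!z. z <: E0<->z <: E&(EX p x y. z = tri p x y&cls (%p x y. tri p x y <: E) p x y)"
 using mem_coll by blast
 have "clos t E0" unfolding clos_def
 proof (intro allI impI)
 fix p x y assume h:"x <: t&y <: t&cls (%p x y. tri p x y <: E0) p x y"
 have c:"cls (%p x y. tri p x y <: E) p x y"
 by (rule cls_mono[of "%p x y. tri p x y <: E0"]) (use h E0 in auto)
 hence "tri p x y <: E" using cE h unfolding clos_def by blast
 thus "tri p x y <: E0" using E0 c by blast
 qed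
 hence fix0:"cls (%p x y. tri p x y <: E) p x y" if "tri p x y <: E" for p x y
 using E[of "tri p x y"] E0[of "tri p x y"] that unfolding tri_def by auto
 have "FE p x y" if "tri p x y <: E" for p x y using that
 proof (induction x arbitrary: p y rule: tc_induct)
 case (step x)
 have "cls FE p x y"
 by (rule cls_mono[OF fix0[OF step.prems]]) (use step.IH pair_tc(1) in blast)
 thus ?case using FE_iff by blast
 qed
 moreover have "tri p ta sg <: E" using E t(4) cE t B[of p ta sg] by blast
 ultimately show "FE p ta sg" by blast
qed

lemma dp_FE [dpi]:"dt UNIV t==>dt UNIV u==>dt UNIV v==>dp UNIV (%e. FE (t e) (u e) (v e))"
 by (rule dp_lift3[where Q = FE]) (unfold FE_definable trs_def tri_def,intro dpi dp_clos)
lemma dp_FM [dpi]:"dt UNIV t==>dt UNIV u==>dt UNIV v==>dp UNIV (%e. FM (t e) (u e) (v e))"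
 by (rule dp_lift3[where Q = FM]) (unfold FM_iff,intro dpi)

lemma dp_frc0:"dp UNIV (%e. frc ph (e 0) (%n. e (Suc n)))"
proof (induction ph)
 case (Neg ph)
 have "dp UNIV (%e. frc ph (e 0) (%n. e (Suc (Suc n))))"
 using dp_reindex[OF Neg,of "case_nat 0 (%n. Suc (Suc n))"] by simp
 thus ?case unfolding frc.simps by (intro dpi)
next
 case (All i ph)
 have "dp UNIV (%e. frc ph (e (Suc 0)) ((%n. e (Suc (Suc n)))(i := e 0)))"
 using dp_reindex[OF All,of "case_nat (Suc 0) (%n. if n = i then 0 else Suc (Suc n))"] by (simp add: fun_upd_def if_distrib)
 thus ?case unfolding frc.simps by (intro dpi)
next
 case (Conj ph ps) thus ?case unfolding frc.simps by (intro dp_conj)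
next
 case (Eql i j) show ?case unfolding frc.simps by (intro dpi)
next
 case (Mem i j) show ?case unfolding frc.simps by (intro dpi)
qed

lemma dp_frc: assumes "dt UNIV t" "!!n. dt UNIV (%e. s e n)" shows "dp UNIV (%e. frc ph (t e) (s e))"
proof -
 have "dt UNIV (case_nat t (%n e. s e n) n)" for n using assms by (cases n) auto
 from dp_env[OF dp_frc0,of "case_nat t (%n e. s e n)" ph,OF this] show ?thesis by simp
qed

end

subsection \<open>The generic extension\<close>

locale gext = forcing mem P le one for mem :: "'v => 'v => bool" (infix \<open><:\<close> 50) and P le one +
 fixes G :: "'v set" and memW :: "'w => 'w => bool" and val :: "'v => 'w"
 assumes gf:"generic_filter P le G" and ge:"generic_extension mem G memW val"
begin

interpretation W: set_struct memW .

lemmas gfs = gf[unfolded generic_filter_def]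
lemma G_P:"p : G==>p : P" using gfs[THEN conjunct1] by auto
lemma G_up:"p : G==>le p q==>q : G" 
 using gfs[THEN conjunct2,THEN conjunct2,THEN conjunct1] le_in(2)[of p q] by auto
lemma G_dir:"p : G==>q : G==>\<exists>r\<in>G. le r p&le r q"
 using gfs[THEN conjunct2,THEN conjunct2,THEN conjunct2,THEN conjunct1] by auto
lemma G_one:"one : G" using gfs[THEN conjunct2,THEN conjunct1] G_up le_one G_P by blast
lemma G_meets: assumes "dp UNIV (%e. D (e 0))" "!!p. p : P==>EX q. le q p&D q" shows "\<exists>p\<in>G. D p"
proof -
 have "isset {p. p <: coll P&D p}" by (rule sep) (rule assms)
 then obtain d where d:"ext d = {p. p : P&D p}" unfolding isset_def by (auto simp: mem_coll isset_P)
 have "\<forall>p\<in>P. \<exists>q\<in>ext d. le q p" unfolding d using assms(2) le_in by blast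
 moreover have "ext d <= P" using d by auto
 ultimately have "G \<inter> ext d ~= {}"
 using gfs[THEN conjunct2,THEN conjunct2,THEN conjunct2,THEN conjunct2] by auto
 thus ?thesis using d by auto
qed

lemma W_ext_inj:"W.ext a = W.ext b==>a = b" using ge unfolding generic_extension_def W.extensional_def by blast
lemma val_surj:"EX ta. x = val ta" using ge unfolding generic_extension_def by (metis surj_def)
lemma ext_val:"W.ext (val ta) = {val sg | sg. \<exists>p\<in>G. pair sg p <: ta}" using ge unfolding generic_extension_def by blast
lemma mem_val:"memW x (val ta)<->(EX sg p. p : G&pair sg p <: ta&x = val sg)"
 using ext_val[of ta] by (auto simp flip: W.mem_ext)

text \<open>The members of \<open>val ta\<close> are values of names in the transitive closure of
  \<open>ta\<close>, so accessibility follows by induction on names.\<close>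

lemma W_wf:"wfp memW"
proof -
 have "Wellfounded.accp memW (val ta)" for ta
 proof (induction ta rule: tc_induct)
 case (step ta)
 show ?case
 proof (rule accp.intros)
 fix y assume "memW y (val ta)"
 then obtain sg p where "pair sg p <: ta" "y = val sg" unfolding mem_val by auto
 thus "Wellfounded.accp memW y" using step pair_tc(1) by blast
 qed
 qed
 thus ?thesis using val_surj by (metis accp_wfpI)
qed

text \<open>The truth lemma for equality: either some condition in the generic filter forces it, or one of them
 forces an element of one name to lie outside the other.\<close>

lemma FE_sound:"p : G==>FE p ta sg==>val ta = val sg"
proof (induction ta arbitrary: p sg rule: tc_induct)
 case (step ta)
 have c:"cls FE p ta sg" using step.prems FE_iff by blast
 have "memW x (val sg)" if x:"memW x (val ta)" for x
 proof -
 obtain pf s where h:"s : G" "pair pf s <: ta" "x = val pf" using x mem_val by blast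
 obtain q0 where q0:"q0 : G" "le q0 p" "le q0 s" using G_dir step.prems(1) h(1) by blast
 have "\<exists>r\<in>G. le r q0&(EX rh t. pair rh t <: sg&le r t&FE r pf rh)"
 proof -
 have "\<exists>r\<in>G. (le r q0&(EX rh t. pair rh t <: sg&le r t&FE r pf rh)) \<or> ~ (EX u. le u r&le u q0)"
 proof (rule G_meets)
 show "dp UNIV (%e. (le (e 0) q0&(EX rh t. pair rh t <: sg&le (e 0) t&FE (e 0) pf rh)) \<or> ~ (EX u. le u (e 0)&le u q0))"
 by (intro dpi)
 fix r assume r:"r : P"
 show "EX q. le q r&((le q q0&(EX rh t. pair rh t <: sg&le q t&FE q pf rh)) \<or> ~ (EX u. le u q&le u q0))"
 proof (cases "EX u. le u r&le u q0")
 case True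
 then obtain u where u:"le u r" "le u q0" by blast
 hence "le u p" "le u s" using q0 le_trans by blast+
 then obtain v rh t where "le v u" "pair rh t <: sg" "le v t" "FE v pf rh" using c h(2) unfolding cls_def by meson
 thus ?thesis using u le_trans by blast
 qed (use r le_refl in blast)
 qed
 thus ?thesis using G_dir q0(1) by blast
 qed
 then obtain r rh t where r:"r : G" "pair rh t <: sg" "le r t" "FE r pf rh" by blast
 hence "val pf = val rh" using step.IH[OF pair_tc(1)[OF h(2)]] by blast
 thus ?thesis using mem_val r G_up h by blast
 qed
 moreover have "memW x (val ta)" if x:"memW x (val sg)" for x
 proof -
 obtain rh s where h:"s : G" "pair rh s <: sg" "x = val rh" using x mem_val by blast
 obtain q0 where q0:"q0 : G" "le q0 p" "le q0 s" using G_dir step.prems(1) h(1) by blast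
 have "\<exists>r\<in>G. le r q0&(EX pf t. pair pf t <: ta&le r t&FE r pf rh)"
 proof -
 have "\<exists>r\<in>G. (le r q0&(EX pf t. pair pf t <: ta&le r t&FE r pf rh)) \<or> ~ (EX u. le u r&le u q0)"
 proof (rule G_meets)
 show "dp UNIV (%e. (le (e 0) q0&(EX pf t. pair pf t <: ta&le (e 0) t&FE (e 0) pf rh)) \<or> ~ (EX u. le u (e 0)&le u q0))"
 by (intro dpi)
 fix r assume r:"r : P"
 show "EX q. le q r&((le q q0&(EX pf t. pair pf t <: ta&le q t&FE q pf rh)) \<or> ~ (EX u. le u q&le u q0))"
 proof (cases "EX u. le u r&le u q0")
 case True
 then obtain u where u:"le u r" "le u q0" by blast
 hence "le u p" "le u s" using q0 le_trans by blast+
 then obtain v pf t where "le v u" "pair pf t <: ta" "le v t" "FE v pf rh" using c h(2) unfolding cls_def by meson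
 thus ?thesis using u le_trans by blast
 qed (use r le_refl in blast)
 qed
 thus ?thesis using G_dir q0(1) by blast
 qed
 then obtain r pf t where r:"r : G" "pair pf t <: ta" "le r t" "FE r pf rh" by blast
 hence "val pf = val rh" using step.IH[OF pair_tc(1)[OF r(2)]] by blast
 thus ?thesis using mem_val r G_up h by metis
 qed
 ultimately show ?case by (intro W_ext_inj) auto
qed

lemma FE_complete:"val ta = val sg==>\<exists>p\<in>G. FE p ta sg"
proof (induction ta arbitrary: sg rule: tc_induct)
 case (step ta)
 define A where "A p<->(EX pf s. pair pf s <: ta&le p s&~ (EX r rh t. le r p&pair rh t <: sg&le r t&FE r pf rh))" for p
 define B where "B p<->(EX rh t. pair rh t <: sg&le p t&~ (EX r pf s. le r p&pair pf s <: ta&le r s&FE r pf rh))" for p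
 have "\<exists>p\<in>G. FE p ta sg \<or> A p \<or> B p"
 proof (rule G_meets)
 show "dp UNIV (%e. FE (e 0) ta sg \<or> A (e 0) \<or> B (e 0))" unfolding A_def B_def by (intro dpi)
 fix p assume p:"p : P"
 show "EX q. le q p&(FE q ta sg \<or> A q \<or> B q)"
 proof (rule ccontr)
 assume n:"~ ?thesis"
 hence "~ FE p ta sg" using p le_refl by blast
 hence "~ cls FE p ta sg" using FE_iff by blast
 thus False using n p unfolding cls_def A_def B_def by blast
 qed
 qed
 then obtain p where p:"p : G" "FE p ta sg \<or> A p \<or> B p" by blast
 have "~ A p"
 proof
 assume "A p"
 then obtain pf s where h:"pair pf s <: ta" "le p s" "~ (EX r rh t. le r p&pair rh t <: sg&le r t&FE r pf rh)"
 unfolding A_def by blast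
 hence "memW (val pf) (val sg)" using p G_up mem_val step.prems by metis
 then obtain rh t where r:"t : G" "pair rh t <: sg" "val pf = val rh" using mem_val by blast
 then obtain q where q:"q : G" "FE q pf rh" using step.IH[OF pair_tc(1)[OF h(1)]] by blast
 obtain u where u:"u : G" "le u p" "le u t" using G_dir p r by blast
 obtain v where "v : G" "le v u" "le v q" using G_dir u q by blast
 thus False using h(3) u r q FE_mono le_trans by meson
 qed
 moreover have "~ B p"
 proof
 assume "B p"
 then obtain rh t where h:"pair rh t <: sg" "le p t" "~ (EX r pf s. le r p&pair pf s <: ta&le r s&FE r pf rh)"
 unfolding B_def by blast
 hence "memW (val rh) (val ta)" using p G_up mem_val step.prems by metis
 then obtain pf s where r:"s : G" "pair pf s <: ta" "val rh = val pf" using mem_val by blast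
 then obtain q where q:"q : G" "FE q pf rh" using step.IH[OF pair_tc(1)[OF r(2)],of rh] by auto
 obtain u where u:"u : G" "le u p" "le u s" using G_dir p r by blast
 obtain v where "v : G" "le v u" "le v q" using G_dir u q by blast
 thus False using h(3) u r q FE_mono le_trans by meson
 qed
 ultimately show ?case using p by blast
qed

lemma FM_truth:"memW (val ta) (val sg)<->(\<exists>p\<in>G. FM p ta sg)"
proof
 assume "memW (val ta) (val sg)"
 then obtain rh t where r:"t : G" "pair rh t <: sg" "val ta = val rh" using mem_val by blast
 then obtain q where q:"q : G" "FE q ta rh" using FE_complete by blast
 obtain u where u:"u : G" "le u q" "le u t" using G_dir q r by blast
 have "EX r rh t. le r v&pair rh t <: sg&le r t&FE r ta rh" if "le v u" for v
 using that u q r FE_mono le_trans le_refl le_in by meson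
 hence "FM u ta sg" unfolding FM_iff by blast
 thus "\<exists>p\<in>G. FM p ta sg" using u by blast
next
 assume "\<exists>p\<in>G. FM p ta sg"
 then obtain p where p:"p : G" "FM p ta sg" by blast
 have "\<exists>r\<in>G. (EX rh t. pair rh t <: sg&le r t&FE r ta rh) \<or> ~ (EX u. le u r&le u p)"
 proof (rule G_meets)
 show "dp UNIV (%e. (EX rh t. pair rh t <: sg&le (e 0) t&FE (e 0) ta rh) \<or> ~ (EX u. le u (e 0)&le u p))" by (intro dpi)
 fix r assume r:"r : P"
 show "EX q. le q r&((EX rh t. pair rh t <: sg&le q t&FE q ta rh) \<or> ~ (EX u. le u q&le u p))"
 proof (cases "EX u. le u r&le u p")
 case True thus ?thesis using p(2) le_trans unfolding FM_iff by meson
 qed (use r le_refl in blast)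
 qed
 then obtain r rh t where "r : G" "pair rh t <: sg" "le r t" "FE r ta rh" using G_dir p(1) by blast
 thus "memW (val ta) (val sg)" using FE_sound mem_val G_up by metis
qed

theorem truth:"W.sat (%n. val (e n)) ph<->(\<exists>p\<in>G. frc ph p e)"
proof (induction ph arbitrary: e)
 case (Mem i j) thus ?case using FM_truth by simp
next
 case (Eql i j) thus ?case using FE_sound FE_complete by auto
next
 case (Neg ph)
 have "\<exists>p\<in>G. frc ph p e \<or> frc (Neg ph) p e"
 by (rule G_meets) (intro dpi dp_frc,metis frc.simps(3) le_in(2) le_refl)
 moreover have "~ (frc ph p e&frc (Neg ph) q e)" if pq:"p : G" "q : G" for p q
 using G_dir[OF pq] frc_mono frc.simps(3) by meson
 ultimately show ?case using Neg by (auto; blast)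
next
 case (Conj ph ps)
 have "(\<exists>p\<in>G. frc ph p e)&(\<exists>p\<in>G. frc ps p e)<->(\<exists>p\<in>G. frc ph p e&frc ps p e)" (is "?A<->?B")
 proof
 assume ?A
 then obtain p q where pq:"p : G" "q : G" "frc ph p e" "frc ps q e" by auto
 obtain r where "r : G" "le r p" "le r q" using G_dir[OF pq(1,2)] by auto
 thus ?B using frc_mono pq by blast
 qed auto
 thus ?case using Conj by simp
next
 case (All i ph)
 have u:"(%n. val (e n))(i := val sg) = (%n. val ((e(i := sg)) n))" for sg by auto
 have IH:"W.sat ((%n. val (e n))(i := val sg)) ph<->(\<exists>p\<in>G. frc ph p (e(i := sg)))" for sg
 unfolding u by (rule All)
 show ?case
 proof
 assume "W.sat (%n. val (e n)) (All i ph)"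
 hence s:"\<exists>p\<in>G. frc ph p (e(i := sg))" for sg using IH by simp
 \<comment> \<open>If a condition does not force the universal formula, some name is a
   counterexample for it, and by \<open>frc_dense\<close> a stronger condition forces the negation
   for this name.\<close>
 have "\<exists>p\<in>G. frc (All i ph) p e \<or> (EX sg. frc (Neg ph) p (e(i := sg)))"
 proof (rule G_meets)
 show "dp UNIV (%e'. frc (All i ph) (e' 0) e \<or> (EX sg. frc (Neg ph) (e' 0) (e(i := sg))))"
 by (intro dp_disj dp_ex dp_frc dpi) (unfold fun_upd_def,intro dpi)
 fix p assume p:"p : P"
 show "EX q. le q p&(frc (All i ph) q e \<or> (EX sg. frc (Neg ph) q (e(i := sg))))"
 proof (cases "frc (All i ph) p e")
 case False
 then obtain sg where "~ frc ph p (e(i := sg))" by auto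
 then obtain q where "le q p" "ALL r. le r q-->~ frc ph r (e(i := sg))" using frc_dense[OF p] by meson
 thus ?thesis by auto
 qed (use p le_refl in blast)
 qed
 then obtain p where p:"p : G" "frc (All i ph) p e \<or> (EX sg. frc (Neg ph) p (e(i := sg)))" by blast
 moreover have False if h:"frc (Neg ph) p (e(i := sg))" for sg
 proof -
 obtain q where q:"q : G" "frc ph q (e(i := sg))" using s by blast
 obtain r where "r : G" "le r p" "le r q" using G_dir p(1) q(1) by blast
 thus False using h q frc_mono by (metis frc.simps(3))
 qed
 ultimately show "\<exists>p\<in>G. frc (All i ph) p e" by blast
 next
 assume "\<exists>p\<in>G. frc (All i ph) p e"
 hence "W.sat ((%n. val (e n))(i := val sg)) ph" for sg unfolding IH by auto
 thus "W.sat (%n. val (e n)) (All i ph)" using val_surj by (metis W.sat.simps(5))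
 qed
qed

lemma val_env:"EX en. e = (%n. val (en n))" using val_surj by (metis fun_eq_iff)

text \<open>The subset is named by the pairs of a name below \<open>ta\<close> and a condition that
  forces it into \<open>ta\<close> and to satisfy the formula. Definability of forcing gives the
  name, the truth lemma its value.\<close>

lemma W_sep:"EX b. W.ext b = {x. memW x a&W.sat (e(0 := x)) ph}"
proof -
 obtain ta where ta:"a = val ta" using val_surj by blast
 obtain en where en:"e = (%n. val (en n))" using val_env by blast
 have u:"e(0 := val sg) = (%n. val ((en(0 := sg)) n))" for sg using en by auto
 have "isset {z. z <: cprod (tc ta) (coll P)&(EX sg p. z = pair sg p&FM p sg ta&frc ph p (en(0 := sg)))}"
 by (rule sep) (intro dpi dp_frc,unfold fun_upd_def,intro dpi)
 then obtain b where b:"!!z. z <: b<->z <: cprod (tc ta) (coll P)&(EX sg p. z = pair sg p&FM p sg ta&frc ph p (en(0 := sg)))"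
 using mem_coll by blast
 have "memW x (val b)<->memW x a&W.sat (e(0 := x)) ph" for x
 proof
 assume "memW x (val b)"
 then obtain sg p where "p : G" "x = val sg" "FM p sg ta" "frc ph p (en(0 := sg))" unfolding mem_val b by auto
 thus "memW x a&W.sat (e(0 := x)) ph" unfolding ta using FM_truth truth u by metis
 next
 assume h:"memW x a&W.sat (e(0 := x)) ph"
 then obtain sg s where s:"s : G" "pair sg s <: ta" "x = val sg" unfolding ta mem_val by blast
 obtain p where p:"p : G" "FM p sg ta" using h FM_truth unfolding ta s(3) by blast
 obtain q where q:"q : G" "frc ph q (en(0 := sg))" using h unfolding s(3) u truth by blast
 obtain r where r:"r : G" "le r p" "le r q" using G_dir p q by blast
 have "pair sg r <: b" unfolding b using r p q FM_mono frc_mono pair_tc(1)[OF s(2)] G_P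
 by (auto simp: mem_coll isset_P)
 thus "memW x (val b)" unfolding mem_val using r s by blast
 qed
 hence "W.ext (val b) = {x. memW x a&W.sat (e(0 := x)) ph}" unfolding W.ext_def by (rule Collect_cong)
 thus ?thesis by blast
qed

lemma W_bound:"EX b. W.ext b = val ` ext t"
proof -
 have "memW x (val (cprod t (coll {one})))<->x : val ` ext t" for x
 unfolding mem_val using G_one by (auto simp: mem_cprod mem_coll_sing)
 hence "W.ext (val (cprod t (coll {one}))) = val ` ext t" by auto
 thus ?thesis by blast
qed

text \<open>The inclusion of the ground model into the extension.\<close>

definition ii :: "'v => 'w" where "ii x = val (ck x)"

lemma mem_ii:"memW y (ii x)<->(EX z. z <: x&y = ii z)"
 unfolding ii_def mem_val mem_check using G_one by auto
lemma ext_ii:"W.ext (ii x) = ii ` ext x" using mem_ii by auto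

lemma zf0_W:"zf0 memW"
proof
 fix a b :: 'w and e ph
 show "wfp memW" by (rule W_wf)
 show "W.ext a = W.ext b==>a = b" by (rule W_ext_inj)
 show "EX b. W.ext b = {x. memW x a&W.sat (e(0 := x)) ph}" by (rule W_sep)
 obtain ta sg where t:"a = val ta" "b = val sg" using val_surj by meson
 have "val ` ext (coll {ta,sg}) = {a,b}" using t by (auto simp: mem_coll_upair image_iff Bex_def)
 thus "EX c. W.ext c = {a,b}" using W_bound by metis
 obtain B where B:"W.ext B = val ` ext (tc ta)" using W_bound by blast
 hence B': "memW x B<->x : val ` ext (tc ta)" for x using W.mem_ext by blast
 have "W.ext u = {x. EX y. memW x y&memW y a}" 
 if "W.ext u = {x. memW x B&W.sat (((%_. a))(0 := x)) (Neg (All 1 (Neg (Conj (Mem 0 1) (Mem 1 2)))))}" for u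
 unfolding that B' t using mem_val pair_tc(1) tc_mono by (auto simp: image_iff) (metis mem_ext)+
 thus "EX u. W.ext u = {x. EX y. memW x y&memW y a}" using W_sep by metis
 \<comment> \<open>Every subset of \<open>val ta\<close> has a name inside the product of
   \<open>tc ta\<close> and the poset: the pairs whose condition forces membership in the given
   name. So the values of all such names bound the power set.\<close>
 obtain C where C:"W.ext C = val ` ext (powset (cprod (tc ta) (coll P)))" using W_bound by blast
 have pw:"memW x C" if x:"W.ext x <= W.ext a" for x
 proof -
 obtain sg where s:"x = val sg" using val_surj by blast
 have "isset {z. z <: cprod (tc ta) (coll P)&(EX rh p. z = pair rh p&FM p rh sg)}" by (rule sep) (intro dpi)
 then obtain b where b:"!!z. z <: b<->z <: cprod (tc ta) (coll P)&(EX rh p. z = pair rh p&FM p rh sg)"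
 using mem_coll by blast
 have "memW y (val b)<->memW y x" for y
 proof
 assume "memW y (val b)"
 thus "memW y x" unfolding mem_val[of y b] b s using FM_truth by auto
 next
 assume y:"memW y x"
 hence "memW y (val ta)" using x t by auto
 then obtain rh q where r:"pair rh q <: ta" "y = val rh" using mem_val by blast
 obtain p where "p : G" "FM p rh sg" using y FM_truth unfolding s r(2) by blast
 thus "memW y (val b)" unfolding mem_val b using pair_tc(1)[OF r(1)] r(2) G_P
 by (auto simp: mem_coll isset_P)
 qed
 hence "x = val b" by (intro W_ext_inj) auto
 moreover have "b <: powset (cprod (tc ta) (coll P))" using b by auto
 ultimately show ?thesis using C by (metis W.mem_ext image_eqI mem_ext)
 qed
 have "W.ext u = {x. W.ext x <= W.ext a}" 
 if "W.ext u = {x. memW x C&W.sat (((%_. a))(0 := x)) (All 1 (Neg (Conj (Mem 1 0) (Neg (Mem 1 2)))))}" for u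
 unfolding that using pw by auto
 thus "EX b. W.ext b = {x. W.ext x <= W.ext a}" using W_sep by metis
 have cW:"W.coll S = a" if "W.ext a = S" for a S
 unfolding W.coll_def by (rule the_equality) (use that W_ext_inj in auto)
 have e:"W.empty = ii empty" unfolding W.empty_def by (rule cW) (simp add: ext_ii)
 have s:"W.succ (ii x) = ii (succ x)" for x
 unfolding W.succ_def by (rule cW) (simp add: ext_ii ext_succ)
 have "memW W.empty (ii omega)" unfolding e mem_ii using num_omega[of 0] by auto
 moreover have "memW (W.succ x) (ii omega)" if "memW x (ii omega)" for x
 using that s unfolding mem_ii mem_omega by (metis num.simps(2))
 ultimately show "EX w. memW W.empty w&(ALL x. memW x w-->memW (W.succ x) w)" by blast
qed

end

sublocale gext \<subseteq> W: zf0 memW by (rule zf0_W)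

subsection \<open>Homogeneity and semantic forcing\<close>

context gext
begin

text \<open>The generic filters that generate the very same structure \<open>memW\<close>, each with
  its own valuation. Quantifying over them can replace forcing only if one of them passes through
  every condition, which is the assumption \<open>hom\<close> below.\<close>

definition Gen :: "'v set => ('v => 'w) => bool" where
 "Gen H v<->generic_filter P le H&generic_extension mem H memW v"

lemma Gen_self:"Gen G val" using gf ge by (simp add: Gen_def)
lemma Gen_gext:"Gen H v==>gext mem P le one H memW v"
 using forcing_axioms by (auto simp: Gen_def gext_def gext_axioms_def)

lemma val_ck:"Gen H v==>v (ck x) = ii x"
proof (induction x rule: mem_induct)
 case (step x)
 interpret H: gext mem P le one H memW v by (rule Gen_gext[OF step.prems])
 have "W.ext (v (ck x)) = W.ext (ii x)"
 unfolding H.ii_def[symmetric] H.ext_ii ext_ii by (rule image_cong) (use step in \<open>auto simp: H.ii_def\<close>)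
 thus ?case by (rule W_ext_inj)
qed

text \<open>The action on names of a map of the poset, the latter being coded by the function
  \<open>u\<close> of the structure.\<close>

definition pih :: "'v => 'v => 'v" where
 "pih u = wfrec {(y,x). y <: tc x} (%f x. coll {z. EX sg p. pair sg p <: x&p : P&z = pair (f sg) (ap u p)})"

lemma pih_rec:"pih u x = coll {z. EX sg p. pair sg p <: x&p : P&z = pair (pih u sg) (ap u p)}"
proof -
 have w:"wf {(y,x). y <: tc x}" unfolding wf_def
 proof (intro allI impI)
 fix Q x assume "ALL x. (ALL y. (y,x) : {(y,x). y <: tc x}-->Q y)-->Q x"
 thus "Q x" by (intro tc_induct[of Q x]) auto
 qed
 have "pih u x = coll {z. EX sg p. pair sg p <: x&p : P&z = pair (cut (pih u) {(y,x). y <: tc x} x sg) (ap u p)}"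
 unfolding pih_def by (subst wfrec[OF w]) simp
 also have "{z. EX sg p. pair sg p <: x&p : P&z = pair (cut (pih u) {(y,x). y <: tc x} x sg) (ap u p)} =
 {z. EX sg p. pair sg p <: x&p : P&z = pair (pih u sg) (ap u p)}"
 using pair_tc(1)[of _ _ x] by (intro Collect_cong ex_cong1) (auto simp: cut_apply)
 finally show ?thesis .
qed

lemma isset_pih: assumes "dt UNIV (%e. f (e 0))"
 shows "isset {z. EX sg p. pair sg p <: x&p : P&z = pair (f sg) (ap u p)}"
proof -
 have "isset {z. EX w. w <: x&(EX sg p. w = pair sg p&p : P&z = pair (f sg) (ap u p))}"
 by (rule rep) (intro dpi dt_fun1[OF assms],auto)
 moreover have "{z. EX w. w <: x&(EX sg p. w = pair sg p&p : P&z = pair (f sg) (ap u p))} =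
 {z. EX sg p. pair sg p <: x&p : P&z = pair (f sg) (ap u p)}" by blast
 ultimately show ?thesis by simp
qed

lemma dt_pih:"dt UNIV (%e. pih (e 0) (e 1))"
proof (rule recursion[where S = "%u x g v. ALL z. z <: v<->(EX sg p. pair sg p <: x&p : P&z = pair (ap g sg) (ap u p))"])
 show "dp UNIV (%e. ALL z. z <: e 3<->(EX sg p. pair sg p <: e 1&p : P&z = pair (ap (e 2) sg) (ap (e 0) p)))" by (intro dpi)
 fix u x g v assume g:"func_on g (tc x)" "!!y. y <: tc x==>app g y = pih u y"
 have e:"ap g sg = pih u sg" if "pair sg p <: x" for sg p
 using g ap_eq[OF g(1)] pair_tc(1)[OF that] by simp
 have "isset {z. EX sg p. pair sg p <: x&p : P&z = pair (ap g sg) (ap u p)}" by (rule isset_pih) (intro dpi)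
 moreover have e2:"(EX sg p. pair sg p <: x&p : P&z = pair (ap g sg) (ap u p)) <->
 (EX sg p. pair sg p <: x&p : P&z = pair (pih u sg) (ap u p))" for z
 by (intro ex_cong1 conj_cong refl) (simp add: e)
 ultimately have i:"isset {z. EX sg p. pair sg p <: x&p : P&z = pair (pih u sg) (ap u p)}" by simp
 show "(ALL z. z <: v<->(EX sg p. pair sg p <: x&p : P&z = pair (ap g sg) (ap u p)))<->v = pih u x"
 unfolding pih_rec[of u x] eq_coll[OF i] mem_Collect_eq e2 ..
qed

lemma mem_pih:"z <: pih u x<->(EX sg p. pair sg p <: x&p : P&z = pair (pih u sg) (ap u p))"
proof -
 have "dt UNIV (%e. pih u (e 0))" by (rule dt_fun2[OF dt_pih]) (intro dpi)+
 from mem_coll[OF isset_pih[OF this]] show ?thesis by (subst pih_rec) simp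
qed

lemma Gen_aut: assumes d:"dt UNIV (%e. pf (e 0))" and P:"!!p. p : P==>pf p : P" "!!p. p : P==>pf (pf p) = p"
 and le:"!!p q. le p q==>le (pf p) (pf q)"
 shows "EX v. Gen (pf ` G) v"
proof -
 define u where "u = lam (coll P) pf"
 have u:"ap u p = pf p" if "p : P" for p
 unfolding u_def using func_lam(3)[OF isset_graph[OF d],of p "coll P"] that by (simp add: mem_coll isset_P)
 define v where "v ta = val (pih u ta)" for ta
 have piG:"p : pf ` G<->p : P&pf p : G" for p using P G_P by (auto simp: image_iff) metis
 have vm:"memW x (val (pih u ta))<->(EX sg p. p : P&pf p : G&pair sg p <: ta&x = val (pih u sg))" for x ta
 unfolding mem_val mem_pih using u P by (auto,metis+)
 have "val (pih u (pih u ta)) = val ta" for ta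
 proof (induction ta rule: tc_induct)
 case (step ta)
 have "memW x (val (pih u (pih u ta)))<->memW x (val ta)" for x
 proof
 assume "memW x (val (pih u (pih u ta)))"
 then obtain sg p where "p : P" "pf p : G" "pair sg p <: pih u ta" "x = val (pih u sg)" using vm by blast
 then obtain rh q where "q : P" "pair rh q <: ta" "sg = pih u rh" "p = pf q" using mem_pih u by auto
 thus "memW x (val ta)" using step pair_tc(1) P \<open>pf p : G\<close> \<open>x = _\<close> mem_val by metis
 next
 assume "memW x (val ta)"
 then obtain sg p where h:"p : G" "pair sg p <: ta" "x = val sg" using mem_val by blast
 hence "pair (pih u sg) (pf p) <: pih u ta" using mem_pih G_P u by metis
 thus "memW x (val (pih u (pih u ta)))" unfolding vm using h step pair_tc(1)[OF h(2)] P G_P by metis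
 qed
 thus ?case by (intro W_ext_inj) auto
 qed
 hence "surj v" unfolding v_def surj_def using val_surj by metis
 moreover have "W.ext (v ta) = {v sg | sg. \<exists>p\<in>pf ` G. pair sg p <: ta}" for ta
 unfolding v_def W.ext_def vm Bex_def piG by (rule Collect_cong) blast
 moreover have "W.extensional" using ge generic_extension_def by blast
 ultimately have "generic_extension mem (pf ` G) memW v" unfolding generic_extension_def by auto
 moreover have "generic_filter P le (pf ` G)" unfolding generic_filter_def
 proof (intro conjI ballI allI impI)
 show "pf ` G <= P" "pf ` G ~= {}" using piG G_one by auto
 show "q : pf ` G" if h:"p : pf ` G" "q : P" "le p q" for p q using h piG le[OF h(3)] G_up P by blast
 show "\<exists>r\<in>pf ` G. le r p&le r q" if h:"p : pf ` G" "q : pf ` G" for p q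
 proof -
 obtain r where r:"r : G" "le r (pf p)" "le r (pf q)" using G_dir[of "pf p" "pf q"] h piG by blast
 hence "le (pf r) p" "le (pf r) q" using le[OF r(2)] le[OF r(3)] P h piG by auto
 thus ?thesis using r by blast
 qed
 fix d assume D:"ext d <= P&(\<forall>p\<in>P. \<exists>q\<in>ext d. le q p)"
 have "\<exists>p\<in>G. p : P&pf p <: d"
 proof (rule G_meets)
 show "dp UNIV (%e. e 0 : P&pf (e 0) <: d)" by (intro dpi dt_fun1[OF d])
 fix p assume p:"p : P"
 then obtain q where q:"q <: d" "le q (pf p)" using D P by (metis mem_ext)
 have "q : P" using D q by auto
 hence "le (pf q) p" "pf (pf q) <: d" "pf q : P" using le[OF q(2)] P p q by auto
 thus "EX q. le q p&q : P&pf q <: d" by blast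
 qed
 thus "pf ` G \<inter> ext d ~= {}" by auto
 qed
 ultimately show ?thesis unfolding Gen_def by blast
qed

text \<open>Forcing for predicates on the extension rather than for formulas. Statements about sums
  in a Banach space can thus be forced without writing out their syntax.\<close>

definition fc :: "((nat => 'w) => bool) => 'v => (nat => 'v) => bool" where
 "fc R p e<->(ALL H v. Gen H v&p : H-->R (%n. v (e n)))"

end

locale homog = gext mem P le one G memW val
 for mem :: "'v => 'v => bool" (infix \<open><:\<close> 50) and P le one G and memW :: "'w => 'w => bool" and val +
 assumes hom:"p : P==>EX H v. Gen H v&p : H"
begin

lemma Gen_facts: assumes "Gen H v"
 shows "p : H==>p : P" "p : H==>le p q==>q : H" "p : H==>q : H==>\<exists>r\<in>H. le r p&le r q"
 "memW x (v ta)<->(EX sg p. p : H&pair sg p <: ta&x = v sg)" "one : H" "EX ta. x = v ta"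
proof -
 interpret H: gext mem P le one H memW v by (rule Gen_gext[OF assms])
 show "p : H==>p : P" "p : H==>le p q==>q : H" "p : H==>q : H==>\<exists>r\<in>H. le r p&le r q"
 "memW x (v ta)<->(EX sg p. p : H&pair sg p <: ta&x = v sg)" "one : H" "EX ta. x = v ta"
 using H.G_P H.G_up H.G_dir H.mem_val H.G_one H.val_surj by blast+
qed

lemma val_empty:"Gen H v==>v empty = W.empty"
 by (rule W_ext_inj) (use Gen_facts(4)[of H v _ empty] in auto)

text \<open>If the formula is not forced, some stronger condition forces its negation, and a generic
  filter through that condition is a counterexample.\<close>

lemma frc_sem: assumes "p : P" shows "frc ph p e<->(ALL H v. Gen H v&p : H-->W.sat (%n. v (e n)) ph)"
proof
 assume "frc ph p e" thus "ALL H v. Gen H v&p : H-->W.sat (%n. v (e n)) ph"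
 using gext.truth[OF Gen_gext] by blast
next
 assume s:"ALL H v. Gen H v&p : H-->W.sat (%n. v (e n)) ph"
 show "frc ph p e"
 proof (rule ccontr)
 assume "~ frc ph p e"
 then obtain q where q:"le q p" "ALL r. le r q-->~ frc ph r e" using frc_dense[OF assms] by meson
 hence "frc (Neg ph) q e" by simp
 obtain H v where H:"Gen H v" "q : H" using hom q le_in by blast
 hence "W.sat (%n. v (e n)) (Neg ph)" using gext.truth[OF Gen_gext[OF H(1)]] \<open>frc (Neg ph) q e\<close> by blast
 thus False using s H q Gen_facts(2) by (metis W.sat.simps(3))
 qed
qed

text \<open>Without parameters the only constant is the empty set, and the name \<open>empty\<close>
  denotes it under every valuation. So one formula serves all generic filters at once.\<close>

lemma fc_fm: assumes "W.dp {} R"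
 obtains ph where "!!p e. p : P==>fc R p e<->frc ph p (mix e (%_. empty))"
 "!!H v e. Gen H v==>R (%n. v (e n))<->W.sat (%n. v (mix e (%_. empty) n)) ph"
proof -
 obtain ph p where p:"range p <= {W.empty}" "!!e. R e = W.sat (mix e p) ph" using assms by (rule W.dpE) blast
 have p': "p = (%_. W.empty)" using p(1) by auto
 have "(%n. v (mix e (%_. empty) n)) = mix (%n. v (e n)) p" if "Gen H v" for H v e
 unfolding p' using val_empty[OF that] by (auto simp: mix_def fun_eq_iff)
 hence 1:"R (%n. v (e n))<->W.sat (%n. v (mix e (%_. empty) n)) ph" if "Gen H v" for H v e
 using that p(2) by simp
 hence "fc R p e<->frc ph p (mix e (%_. empty))" if "p : P" for p e
 unfolding fc_def frc_sem[OF that] by (intro all_cong1 imp_cong refl) (metis 1)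
 thus ?thesis using that 1 by blast
qed

text \<open>Quantification over generic filters is not a statement about the ground model. The
  detour through \<open>frc\<close> makes it one, which allows replacement and choice to be applied
  to forced statements.\<close>

lemma dp_fc: assumes R:"W.dp {} R" and d:"dt UNIV t" "!!n. dt UNIV (%e. s e n)"
 shows "dp UNIV (%e. t e : P&fc R (t e) (s e))"
proof -
 obtain ph where ph:"!!p e. p : P==>fc R p e<->frc ph p (mix e (%_. empty))" using fc_fm[OF R] by metis
 have "dt UNIV (%e. mix (s e) (%_. empty) n)" for n
 by (cases n rule: nat_even_odd_cases) (auto intro: d dpi)
 hence "dp UNIV (%e. t e : P&frc ph (t e) (mix (s e) (%_. empty)))" by (intro dpi dp_frc d)
 thus ?thesis using ph by (metis (mono_tags,lifting) dp_def)
qed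

lemma fc_truth: assumes R:"W.dp {} R" and G:"Gen H v" "R (%n. v (e n))" shows "\<exists>p\<in>H. fc R p e"
proof -
 obtain ph where ph:"!!p e. p : P==>fc R p e<->frc ph p (mix e (%_. empty))"
 "!!H v e. Gen H v==>R (%n. v (e n))<->W.sat (%n. v (mix e (%_. empty) n)) ph" using fc_fm[OF R] by blast
 have "\<exists>p\<in>H. frc ph p (mix e (%_. empty))"
 using gext.truth[OF Gen_gext[OF G(1)]] G ph(2)[OF G(1)] by blast
 thus ?thesis using ph(1) Gen_facts(1)[OF G(1)] by blast
qed

lemma fc_mono:"fc R p e==>le q p==>fc R q e"
 unfolding fc_def using Gen_facts(2) by blast
lemma fcD:"fc R p e==>Gen H v==>p : H==>R (%n. v (e n))" unfolding fc_def by blast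

end

section \<open>The finite support iteration of Cohen forcing\<close>

context zfc
begin

definition bt :: "bool => 'v" where "bt b = num (if b then 1 else 0)"
lemma bt_inj [simp]:"bt a = bt b<->a = b" by (simp add: bt_def)
lemma mem_num2:"y <: num 2<->(EX b. y = bt b)"
proof -
 have "y <: num 2<->y = num 1 \<or> y = num 0" by (simp add: numeral_2_eq_2)
 also have "...<->(EX b. y = bt b)" unfolding bt_def by (metis (full_types))
 finally show ?thesis .
qed

lemma dp_finite_ext [dpi]:"dt C t==>dp C (%e. finite (ext (t e)))"
 by (rule dp_lift1[where Q = "%x. finite (ext x)"]) (unfold ext_def,intro dpi)

definition cm :: "'v => nat => bool option" where
 "cm q n = (if pair (num n) (bt True) <: q then Some True else if pair (num n) (bt False) <: q then Some False else None)"

definition iscohen :: "'v => bool" where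
 "iscohen q<->finite (ext q)&(ALL z. z <: q-->(EX n b. z = pair (num n) (bt b))) &
 (ALL n. ~ (pair (num n) (bt True) <: q&pair (num n) (bt False) <: q))"

lemma iscohen_iff:"iscohen q<->(EX d. finite (ext d)&ext d <= ext omega&fn q d (num 2))"
proof
 assume q:"iscohen q"
 hence fq:"finite (ext q)" and qz:"!!z. z <: q==>EX n b. z = pair (num n) (bt b)" 
 and qu:"!!n. ~ (pair (num n) (bt True) <: q&pair (num n) (bt False) <: q)" unfolding iscohen_def by auto
 have "finite {x. EX y. pair x y <: q}"
 proof (rule finite_subset)
 show "{x. EX y. pair x y <: q} <= pfst ` ext q" by (auto simp: image_iff) (metis mem_ext pfst_pair)
 qed (use fq in simp)
 then obtain d where d:"ext d = {x. EX y. pair x y <: q}" using finite_subset_isset by blast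
 hence d': "x <: d<->(EX y. pair x y <: q)" for x by (auto simp flip: mem_ext)
 have f:"func_on q d" unfolding func_on_def
 proof (intro conjI allI impI)
 fix z assume "z <: q" thus "EX x y. z = pair x y&x <: d" using qz d' by blast
 next
 fix x assume "x <: d"
 then obtain y where y:"pair x y <: q" using d' by blast
 show "EX! y. pair x y <: q"
 proof (rule ex1I[of _ y],rule y)
 fix y' assume y': "pair x y' <: q"
 obtain n b where 1:"x = num n" "y = bt b" using qz[OF y] by auto
 obtain b' where 2:"y' = bt b'" using qz[OF y'] by auto
 show "y' = y" using qu[of n] y y' unfolding 1 2 by (cases b; cases b') auto
 qed
 qed
 have "app q x <: num 2" if "x <: d" for x
 proof -
 have "pair x (app q x) <: q" using func_app[OF f that] by simp
 thus ?thesis using qz mem_num2 by (metis pair_inject)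
 qed
 hence "fn q d (num 2)" using f unfolding fn_def by blast
 moreover have "finite (ext d)" unfolding d by fact
 moreover have "ext d <= ext omega" unfolding d using qz by (auto simp: mem_omega) (metis pair_inject)
 ultimately show "EX d. finite (ext d)&ext d <= ext omega&fn q d (num 2)" by blast
next
 assume "EX d. finite (ext d)&ext d <= ext omega&fn q d (num 2)"
 then obtain d where d:"finite (ext d)" "ext d <= ext omega" "func_on q d" "!!x. x <: d==>app q x <: num 2"
 unfolding fn_def by blast
 have z:"EX x. x <: d&z = pair x (app q x)" if zq:"z <: q" for z
 proof -
 obtain x y where "z = pair x y" "x <: d" using d(3) zq unfolding func_on_def by blast
 thus ?thesis using func_app[OF d(3)] zq by auto
 qed
 have "ext q <= (%x. pair x (app q x)) ` ext d" using z by (auto simp: image_iff Bex_def)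
 hence "finite (ext q)" using d(1) finite_surj by blast
 moreover have "EX n b. z = pair (num n) (bt b)" if "z <: q" for z
 using z[OF that] d(2,4) mem_num2 by (auto simp: mem_omega subset_iff; metis)
 moreover have "~ (pair (num n) (bt True) <: q&pair (num n) (bt False) <: q)" for n
 proof
 assume h:"pair (num n) (bt True) <: q&pair (num n) (bt False) <: q"
 hence "num n <: d" using z by (metis pair_inject)
 thus False using h func_app[OF d(3)] by (metis bt_inj)
 qed
 ultimately show "iscohen q" unfolding iscohen_def by blast
qed

lemma mem_cohen:"q <: cohen<->iscohen q"
proof -
 have "isset {p. EX d. finite (ext d)&ext d <= ext omega&fn p d (num 2)}"
 proof (rule isset_sub[OF isset_ext[of "powset (cprod omega (num 2))"]])
 show "{p. EX d. finite (ext d)&ext d <= ext omega&fn p d (num 2)} <= ext (powset (cprod omega (num 2)))"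
 proof
 fix q assume "q : {p. EX d. finite (ext d)&ext d <= ext omega&fn p d (num 2)}"
 hence "iscohen q" using iscohen_iff by simp
 hence "z <: cprod omega (num 2)" if "z <: q" for z
 proof -
 have "EX n b. z = pair (num n) (bt b)" using \<open>iscohen q\<close> that unfolding iscohen_def by blast
 thus ?thesis using mem_num2 by auto
 qed
 thus "q : ext (powset (cprod omega (num 2)))" by auto
 qed
 show "dp UNIV (%e. e 0 : {p. EX d. finite (ext d)&ext d <= ext omega&fn p d (num 2)})"
 unfolding mem_Collect_eq by (intro dpi)
 qed
 thus ?thesis unfolding cohen_def by (simp add: mem_coll iscohen_iff)
qed

lemma cm_mem:"iscohen q==>z <: q<->(EX n b. z = pair (num n) (bt b)&cm q n = Some b)"
 unfolding iscohen_def cm_def by (auto split: if_splits) (metis (full_types))+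

lemma cm_le: assumes "iscohen q" "iscohen r" shows "ext q <= ext r<->cm q \<subseteq>\<^sub>m cm r"
proof -
 have m:"pair (num n) (bt b) <: q<->cm q n = Some b" if "iscohen q" for q n b using cm_mem[OF that] by auto
 show ?thesis
 proof
 assume s:"ext q <= ext r"
 have "cm r n = Some b" if "cm q n = Some b" for n b
 using that s unfolding m[OF assms(1),symmetric] m[OF assms(2),symmetric] by auto
 thus "cm q \<subseteq>\<^sub>m cm r" unfolding map_le_def by auto
 next
 assume s:"cm q \<subseteq>\<^sub>m cm r"
 show "ext q <= ext r"
 proof
 fix z assume "z : ext q"
 then obtain n b where "z = pair (num n) (bt b)" "cm q n = Some b" using cm_mem[OF assms(1)] by auto
 moreover have "cm r n = Some b" using s calculation(2) unfolding map_le_def by (metis domI)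
 ultimately show "z : ext r" using m[OF assms(2)] by simp
 qed
 qed
qed

lemma cm_inj: assumes "iscohen q" "iscohen r" "cm q = cm r" shows "q = r"
 by (rule set_eqI) (simp add: cm_mem[OF assms(1)] cm_mem[OF assms(2)] assms(3))

lemma finite_cm: assumes "iscohen q" shows "finite (dom (cm q))"
proof -
 have "inj (%n. num n)" by (rule inj_num)
 moreover have "num ` dom (cm q) <= pfst ` ext q" using cm_mem[OF assms] by (auto simp: image_iff dom_def) (metis mem_ext pfst_pair)
 moreover have "finite (ext q)" using assms iscohen_def by blast
 ultimately show ?thesis by (meson finite_imageD finite_imageI finite_subset inj_on_subset subset_UNIV)
qed

lemma ex_cm: assumes "finite (dom g)" shows "EX q. iscohen q&cm q = g"
proof -
 have "finite ((%n. pair (num n) (bt (the (g n)))) ` dom g)" using assms by simp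
 then obtain q where q:"ext q = (%n. pair (num n) (bt (the (g n)))) ` dom g" using finite_subset_isset by blast
 have q': "z <: q<->(EX n b. z = pair (num n) (bt b)&g n = Some b)" for z
 proof -
 have "z <: q<->z : (%n. pair (num n) (bt (the (g n)))) ` dom g" using q mem_ext by blast
 also have "...<->(EX n b. z = pair (num n) (bt b)&g n = Some b)" by (auto simp: dom_def image_iff; force)
 finally show ?thesis .
 qed
 have "iscohen q" unfolding iscohen_def q' q using assms by auto
 moreover have "cm q = g"
 proof
 fix n show "cm q n = g n" by (cases "g n") (auto simp: cm_def q')
 qed
 ultimately show ?thesis by blast
qed

lemma check_inj:"check u x = check u y<->x = y"
proof (induction x arbitrary: y rule: mem_induct)
 case (step x)
 have "x = y" if e:"check u x = check u y"
 proof (rule set_eqI)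
 fix z
 have "pair (check u w) u <: check u x<->pair (check u w) u <: check u y" for w using e by simp
 hence *: "(EX v. v <: x&check u w = check u v)<->(EX v. v <: y&check u w = check u v)" for w by (simp add: mem_check)
 show "z <: x<->z <: y" using *[of z] step by metis
 qed
 thus ?case by auto
qed

text \<open>The stages of the iteration with all names resolved: finite-support functions whose
  values are canonical names of Cohen conditions.\<close>

definition Pi :: "'v => 'v set" where
 "Pi al = {p. func_on p al&finite {xi. xi <: al&ap p xi ~= empty} &
 (ALL xi. xi <: al-->(EX q. q <: cohen&ap p xi = check (iter_one xi) q))}"
definition cq :: "'v => 'v => 'v" where
 "cq p xi = (THE q. q <: cohen&ap p xi = check (iter_one xi) q)"
definition Le :: "'v => 'v => 'v => bool" where
 "Le al p q<->p : Pi al&q : Pi al&(ALL xi. xi <: al-->ext (cq q xi) <= ext (cq p xi))"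

lemma cq_eq:"q <: cohen==>ap p xi = check (iter_one xi) q==>cq p xi = q"
 unfolding cq_def by (rule the_equality) (auto simp: check_inj)
lemma cq: assumes "p : Pi al" "xi <: al" shows "cq p xi <: cohen" "ap p xi = check (iter_one xi) (cq p xi)"
 using assms cq_eq unfolding Pi_def by auto

lemma empty_cohen:"empty <: cohen" by (simp add: mem_cohen iscohen_def)
lemma iter_one_fn:"func_on (iter_one al) al" "x <: al==>ap (iter_one al) x = empty"
proof -
 have m:"z <: iter_one al<->(EX x. x <: al&z = pair x empty)" for z
 unfolding iter_one_def by (auto simp: mem_cprod mem_coll_sing)
 show f:"func_on (iter_one al) al" unfolding func_on_def m by auto
 show "x <: al==>ap (iter_one al) x = empty" using func_app[OF f,of x empty] ap_eq[OF f,of x] m by auto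
qed
lemma cq_one:"x <: al==>cq (iter_one al) x = empty"
 by (rule cq_eq) (simp_all add: empty_cohen iter_one_fn)
lemma one_Pi:"iter_one al : Pi al"
proof -
 have "{xi. xi <: al&ap (iter_one al) xi ~= empty} = {}" using iter_one_fn by auto
 hence "finite {xi. xi <: al&ap (iter_one al) xi ~= empty}" by (metis finite.emptyI)
 moreover have "EX q. q <: cohen&ap (iter_one al) xi = check (iter_one xi) q" if "xi <: al" for xi
 by (rule exI[of _ empty]) (simp add: iter_one_fn(2)[OF that] empty_cohen)
 ultimately show ?thesis unfolding Pi_def using iter_one_fn(1) by blast
qed

lemma po_Pi:"po mem (Pi al) (Le al) (iter_one al)"
 by unfold_locales (auto simp: Le_def one_Pi cq_one)

lemma restr: assumes "func_on p al" "ext xi <= ext al" 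
 shows "func_on (restr p xi) xi" "et <: xi==>ap (restr p xi) et = ap p et"
proof -
 have "isset {z. z <: p&(EX x y. z = pair x y&x <: xi)}" by (rule sep) (intro dpi)
 hence m:"z <: restr p xi<->z <: p&(EX x y. z = pair x y&x <: xi)" for z unfolding restr_def by (simp add: mem_coll)
 show f:"func_on (restr p xi) xi" unfolding func_on_def m using assms unfolding func_on_def by (auto simp: subset_iff)
 show "ap (restr p xi) et = ap p et" if h:"et <: xi"
 proof -
 have ha:"et <: al" using h assms(2) by auto
 have "pair et (app p et) <: restr p xi" unfolding m using func_app[OF assms(1) ha] h by auto
 thus ?thesis using func_app[OF f h] ap_eq[OF f h] ap_eq[OF assms(1) ha] by metis
 qed
qed

lemma restr_Pi: assumes "p : Pi al" "ext xi <= ext al" shows "restr p xi : Pi xi"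
proof -
 have f:"func_on p al" "finite {xi. xi <: al&ap p xi ~= empty}" using assms(1) Pi_def by auto
 have "{et. et <: xi&ap (restr p xi) et ~= empty} <= {xi. xi <: al&ap p xi ~= empty}"
 using restr(2)[OF f(1) assms(2)] assms(2) by (auto simp: subset_iff)
 hence "finite {et. et <: xi&ap (restr p xi) et ~= empty}" using f(2) finite_subset by blast
 moreover have "EX q. q <: cohen&ap (restr p xi) et = check (iter_one et) q" if "et <: xi" for et
 using assms restr(2)[OF f(1) assms(2) that] that unfolding Pi_def by (auto simp: subset_iff)
 ultimately show ?thesis unfolding Pi_def using restr(1)[OF f(1) assms(2)] by blast
qed

text \<open>Every name in the domain of a canonical name is itself canonical, and forced membership
  and inclusion between canonical names agree with the actual ones. By induction on the stage,
  nothing but these functions with the coordinatewise order can occur.\<close>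

theorem iteration_eq:
 assumes it:"fs_cohen_iteration dl P leP" and dl:"ordinal dl" and "al = dl \<or> al <: dl"
 shows "P al = Pi al&leP al = Le al"
 using assms(3)
proof (induction al rule: mem_induct)
 case (step al)
 have sub:"ext xi <= ext al" "xi = dl \<or> xi <: dl" if "xi <: al" for xi
 proof -
 have "ordinal al" using step.prems dl ordinal_mem by blast
 thus "ext xi <= ext al" using ordinal_trans that by auto
 show "xi = dl \<or> xi <: dl" using step.prems that ordinal_trans[OF dl] by blast
 qed
 have IH:"P xi = Pi xi" "leP xi = Le xi" if "xi <: al" for xi using step.IH[OF that] sub(2)[OF that] by auto
 note U = it[unfolded fs_cohen_iteration_def fs_iteration_def,THEN spec,of al,THEN mp,OF step.prems]
 have key:"(restr p xi : P xi&(EX s. pair (app p xi) s <: check (iter_one xi) cohen) &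
 forces_mem (P xi) (leP xi) (restr p xi) (app p xi) (check (iter_one xi) cohen)) <->
 restr p xi : Pi xi&(EX q. q <: cohen&ap p xi = check (iter_one xi) q)" if p:"func_on p al" and x:"xi <: al" for p xi
 proof -
 interpret X: po mem "Pi xi" "Le xi" "iter_one xi" by (rule po_Pi)
 have "(EX s. pair (app p xi) s <: check (iter_one xi) cohen)<->(EX q. q <: cohen&ap p xi = check (iter_one xi) q)"
 unfolding mem_check ap_eq[OF p x] by auto
 thus ?thesis unfolding IH[OF x] ap_eq[OF p x] using X.FM_check by auto
 qed
 have PP:"P al = Pi al"
 proof -
 have "p : P al<->p : Pi al" for p
 proof
 assume "p : P al"
 hence h:"func_on p al" "finite {xi. xi <: al&app p xi ~= empty}"
 "!!xi. xi <: al==>EX q. q <: cohen&ap p xi = check (iter_one xi) q" using U key by auto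
 have "{xi. xi <: al&app p xi ~= empty} = {xi. xi <: al&ap p xi ~= empty}" using ap_eq[OF h(1)] by auto
 thus "p : Pi al" unfolding Pi_def using h by auto
 next
 assume p:"p : Pi al"
 hence f:"func_on p al" unfolding Pi_def by blast
 have "{xi. xi <: al&app p xi ~= empty} = {xi. xi <: al&ap p xi ~= empty}" using ap_eq[OF f] by auto
 hence "finite {xi. xi <: al&app p xi ~= empty}" using p Pi_def by auto
 moreover have "restr p xi : P xi&(EX s. pair (app p xi) s <: check (iter_one xi) cohen) &
 forces_mem (P xi) (leP xi) (restr p xi) (app p xi) (check (iter_one xi) cohen)" if x:"xi <: al" for xi
 unfolding key[OF f x] using restr_Pi[OF p sub(1)[OF x]] p x unfolding Pi_def by blast
 ultimately show "p : P al" using U f by blast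
 qed
 thus ?thesis by auto
 qed
 moreover have "leP al p q<->Le al p q" for p q
 proof -
 have "forces_subset (P xi) (leP xi) (restr p xi) (app q xi) (app p xi)<->ext (cq q xi) <= ext (cq p xi)"
 if x:"xi <: al" and p:"p : Pi al" and q:"q : Pi al" for xi
 proof -
 interpret X: po mem "Pi xi" "Le xi" "iter_one xi" by (rule po_Pi)
 have "app p xi = check (iter_one xi) (cq p xi)" "app q xi = check (iter_one xi) (cq q xi)"
 using cq(2)[OF p x] cq(2)[OF q x] ap_eq[of _ al xi] x p q unfolding Pi_def by auto
 thus ?thesis unfolding IH[OF x] using X.FS_check[OF restr_Pi[OF p sub(1)[OF x]]] by simp
 qed
 thus ?thesis unfolding Le_def U[THEN conjunct2,THEN spec,THEN spec] PP by auto
 qed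
 ultimately show ?case by auto
qed

end

subsection \<open>Conditions as finite partial maps\<close>

text \<open>Averaging over all total extensions: many small partial maps cannot all be far from compatible.
 This replaces both the countable chain condition and the Delta-system lemma.\<close>

lemma many_compatible:
 fixes f :: "'i => 'x => bool option"
 assumes A:"finite A" "card A > K * 2 ^ n" and f:"!!i. i : A==>finite (dom (f i))&card (dom (f i)) <= n"
 shows "\<exists>B\<subseteq>A. card B = Suc K&(\<forall>i\<in>B. \<forall>j\<in>B. ALL x b c. f i x = Some b-->f j x = Some c-->b = c)"
proof -
 define X where "X = (\<Union>i\<in>A. dom (f i))"
 have X:"finite X" using A f unfolding X_def by blast
 define E where "E i S<->(ALL x b. f i x = Some b-->b = (x : S))" for i S
 have low:"2 ^ card X <= card {S \<in> Pow X. E i S} * 2 ^ n" if i:"i : A" for i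
 proof -
 let ?d = "dom (f i)" and ?t = "{x. f i x = Some True}"
 have d:"?d <= X" "finite ?d" using i f X_def by auto
 have inj:"inj_on (%T. T \<union> ?t) (Pow (X - ?d))" unfolding inj_on_def by blast
 have "(%T. T \<union> ?t) ` Pow (X - ?d) <= {S \<in> Pow X. E i S}"
 using d unfolding E_def by (auto simp: dom_def)
 hence "card (Pow (X - ?d)) <= card {S \<in> Pow X. E i S}"
 using card_inj_on_le[OF inj] X by (simp add: image_subset_iff)
 hence "2 ^ (card X - card ?d) <= card {S \<in> Pow X. E i S}" using X d by (simp add: card_Pow card_Diff_subset)
 hence "2 ^ (card X - card ?d) * 2 ^ card ?d <= card {S \<in> Pow X. E i S} * 2 ^ card ?d" by simp
 moreover have "(2::nat) ^ (card X - card ?d) * 2 ^ card ?d = 2 ^ card X"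
 using card_mono[OF X d(1)] by (simp flip: power_add)
 moreover have "card {S \<in> Pow X. E i S} * 2 ^ card ?d <= card {S \<in> Pow X. E i S} * 2 ^ n"
 using f[OF i] by (intro mult_le_mono2) simp
 ultimately show ?thesis by linarith
 qed
 \<comment> \<open>Pairs of an index and a total extension are counted in both ways. The maps with a
   common total extension are pairwise compatible.\<close>
 have "\<exists>S\<in>Pow X. card {i \<in> A. E i S} > K"
 proof (rule ccontr)
 assume "~ ?thesis"
 hence le:"card {i \<in> A. E i S} <= K" if "S : Pow X" for S using that by (meson not_le)
 have "card A * 2 ^ card X = (\<Sum>i\<in>A. 2 ^ card X)" by simp
 also have "... <= (\<Sum>i\<in>A. card {S \<in> Pow X. E i S} * 2 ^ n)" by (rule sum_mono) (rule low)
 also have "... = (\<Sum>i\<in>A. card {S \<in> Pow X. E i S}) * 2 ^ n" by (simp add: sum_distrib_right)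
 also have "(\<Sum>i\<in>A. card {S \<in> Pow X. E i S}) = (\<Sum>S\<in>Pow X. card {i \<in> A. E i S})"
 using A X by (intro sum_multicount_gen[symmetric]) auto
 also have "... <= (\<Sum>S\<in>Pow X. K)" by (rule sum_mono) (rule le)
 also have "... = K * 2 ^ card X" using X by (simp add: card_Pow)
 finally have "card A * 2 ^ card X <= (K * 2 ^ n) * 2 ^ card X" by (simp add: mult_ac)
 hence "card A <= K * 2 ^ n" by simp
 thus False using A by simp
 qed
 then obtain S where S:"card {i \<in> A. E i S} > K" by blast
 then obtain B where B:"B <= {i \<in> A. E i S}" "card B = Suc K"
 by (metis Suc_leI obtain_subset_with_card_n)
 thus ?thesis unfolding E_def by (intro exI[of _ B]) blast
qed

definition agree :: "('x => bool option) => ('x => bool option) => bool" where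
 "agree f g<->(ALL x b c. f x = Some b-->g x = Some c-->b = c)"

lemma infinite_compatible:
 assumes "infinite A" "!!i. i : A==>finite (dom (f i))&card (dom (f i)) <= n"
 shows "\<exists>B\<subseteq>A. finite B&card B = Suc K&(\<forall>i\<in>B. \<forall>j\<in>B. agree (f i) (f j))"
proof -
 obtain A' where A': "A' <= A" "finite A'" "card A' = Suc (K * 2 ^ n)" using infinite_arbitrarily_large[OF assms(1)] by metis
 have "\<exists>B\<subseteq>A'. card B = Suc K&(\<forall>i\<in>B. \<forall>j\<in>B. ALL x b c. f i x = Some b-->f j x = Some c-->b = c)"
 by (rule many_compatible[where n = n]) (use A' assms(2) in auto)
 then obtain B where B:"B <= A'" "card B = Suc K" "\<forall>i\<in>B. \<forall>j\<in>B. agree (f i) (f j)" unfolding agree_def by blast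
 thus ?thesis using A' finite_subset by (intro exI[of _ B]) auto
qed

text \<open>Otherwise pairwise incompatible maps can be picked one after another without end, and
  \<open>2 ^ n + 1\<close> of them contradict \<open>many_compatible\<close> for
  \<open>K = 1\<close>.\<close>

lemma finite_predense:
 assumes f:"!!i. i : D==>finite (dom (f i))&card (dom (f i)) <= n"
 shows "\<exists>E\<subseteq>D. finite E&(\<forall>i\<in>D. \<exists>j\<in>E. agree (f i) (f j))"
proof (rule ccontr)
 assume n:"~ ?thesis"
 have ex:"\<exists>E\<subseteq>D. finite E&card E = m&(\<forall>i\<in>E. \<forall>j\<in>E. i ~= j-->~ agree (f i) (f j))" for m
 proof (induction m)
 case 0 thus ?case by (intro exI[of _ "{}"]) auto
 next
 case (Suc m)
 then obtain E where E:"E <= D" "finite E" "card E = m" "\<forall>i\<in>E. \<forall>j\<in>E. i ~= j-->~ agree (f i) (f j)" by blast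
 obtain i where i:"i : D" "\<forall>j\<in>E. ~ agree (f i) (f j)" using n E(1,2) by meson
 have "agree (f i) (f i)" unfolding agree_def by simp
 hence "i \<notin> E" using i(2) by blast
 moreover have "agree g h" if "agree h g" for g h :: "'b => bool option"
 using that unfolding agree_def by blast
 ultimately show ?case using E i by (intro exI[of _ "insert i E"]) auto
 qed
 obtain E where E:"E <= D" "finite E" "card E = Suc (1 * 2 ^ n)" "\<forall>i\<in>E. \<forall>j\<in>E. i ~= j-->~ agree (f i) (f j)" using ex by blast
 have "\<exists>B\<subseteq>E. card B = Suc 1&(\<forall>i\<in>B. \<forall>j\<in>B. ALL x b c. f i x = Some b-->f j x = Some c-->b = c)"
 by (rule many_compatible[where n = n]) (use E f in auto)
 then obtain B where B:"B <= E" "card B = 2" "\<forall>i\<in>B. \<forall>j\<in>B. agree (f i) (f j)" unfolding agree_def by auto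
 then obtain i j where "B = {i,j}" "i ~= j" by (meson card_2_iff)
 thus False using B E by blast
qed

context zfc
begin

definition mp :: "'v => 'v => 'v \<times> nat => bool option" where
 "mp dl p = (%(xi,n). if xi <: dl then cm (cq p xi) n else None)"
text \<open>\<open>mp\<close> is a map of HOL and invisible to formulas. Membership of
  \<open>z\<close> in a coordinate of the condition is the first-order statement from which
  \<open>mp\<close> can be recovered.\<close>

definition hb :: "'v => 'v => 'v => bool" where
 "hb p xi z<->(EX q. q <: cohen&ap p xi = check (iter_one xi) q&z <: q)"

lemma dp_hb [dpi]:"dt UNIV t==>dt UNIV u==>dt UNIV v==>dp UNIV (%e. hb (t e) (u e) (v e))"
 by (rule dp_lift3[where Q = hb]) (unfold hb_def iter_one_def,intro dpi)

lemma dp_Pi [dpi]:"dt UNIV t==>dp UNIV (%e. t e : Pi dl)"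
 by (rule dp_lift1[where Q = "%p. p : Pi dl"]) (unfold Pi_def mem_Collect_eq iter_one_def,intro dpi)

lemma cq_iscohen:"p : Pi dl==>xi <: dl==>iscohen (cq p xi)" using cq(1) mem_cohen by blast
lemma hb_cq: assumes "p : Pi dl" "xi <: dl" shows "hb p xi z<->z <: cq p xi"
 unfolding hb_def using cq[OF assms] check_inj by auto
lemma hb_mp: assumes "p : Pi dl" "xi <: dl" shows "hb p xi z<->(EX n b. z = pair (num n) (bt b)&mp dl p (xi,n) = Some b)"
 unfolding hb_cq[OF assms] cm_mem[OF cq_iscohen[OF assms]] mp_def using assms by simp
lemma hb_mp': "p : Pi dl==>xi <: dl==>hb p xi (pair (num n) (bt b))<->mp dl p (xi,n) = Some b"
 by (simp add: hb_mp)

lemma Le_mp:"Le dl p q<->p : Pi dl&q : Pi dl&mp dl q \<subseteq>\<^sub>m mp dl p"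
proof -
 have "(ALL xi. xi <: dl-->ext (cq q xi) <= ext (cq p xi))<->mp dl q \<subseteq>\<^sub>m mp dl p" if pq:"p : Pi dl" "q : Pi dl"
 proof -
 have "(ALL xi. xi <: dl-->ext (cq q xi) <= ext (cq p xi))<->(ALL xi. xi <: dl-->cm (cq q xi) \<subseteq>\<^sub>m cm (cq p xi))"
 using cm_le cq_iscohen pq by auto
 also have "...<->mp dl q \<subseteq>\<^sub>m mp dl p" unfolding map_le_def mp_def by (auto simp: dom_def split: if_splits)
 finally show ?thesis .
 qed
 thus ?thesis unfolding Le_def by blast
qed

lemma dom_mp: assumes "p : Pi dl" shows "finite (dom (mp dl p))" "dom (mp dl p) <= ext dl \<times> UNIV"
proof -
 let ?S = "{xi. xi <: dl&ap p xi ~= empty}"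
 have S:"finite ?S" using assms Pi_def by auto
 have "cm (cq p xi) = Map.empty" if "xi <: dl" "ap p xi = empty" for xi
 using cq_eq[of empty p xi] that empty_cohen by (simp add: cm_def fun_eq_iff)
 hence "dom (mp dl p) <= Sigma ?S (%xi. dom (cm (cq p xi)))" unfolding mp_def by (auto split: if_splits)
 moreover have "finite (Sigma ?S (%xi. dom (cm (cq p xi))))" using S finite_cm cq_iscohen[OF assms] by (intro finite_SigmaI) auto
 ultimately show "finite (dom (mp dl p))" using finite_subset by blast
 show "dom (mp dl p) <= ext dl \<times> UNIV" unfolding mp_def by (auto split: if_splits)
qed

lemma ex_mp: assumes g:"finite (dom g)" "dom g <= ext dl \<times> UNIV" shows "\<exists>p\<in>Pi dl. mp dl p = g"
proof -
 have "finite (dom (%n. g (xi,n)))" for xi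
 proof (rule finite_subset)
 show "dom (%n. g (xi,n)) <= snd ` dom g" by (auto simp: dom_def image_iff; force)
 qed (use g in simp)
 hence "EX q. iscohen q&cm q = (%n. g (xi,n))" for xi using ex_cm by blast
 then obtain qf where qf:"!!xi. iscohen (qf xi)&cm (qf xi) = (%n. g (xi,n))" by metis
 define F where "F = fst ` dom g"
 have F:"finite F" "F <= ext dl" using g unfolding F_def by auto
 obtain f where f:"ext f = F" using finite_subset_isset F by blast
 hence f': "x <: f<->x : F" for x using mem_ext by blast
 have q0:"qf xi = empty" if "xi \<notin> F" for xi
 proof -
 have "cm (qf xi) = (%n. None)" using qf that unfolding F_def by (auto simp: fun_eq_iff image_iff dom_def; force)
 moreover have "cm empty = (%n. None)" "iscohen empty" by (auto simp: cm_def iscohen_def)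
 ultimately show ?thesis using cm_inj qf by metis
 qed
 \<comment> \<open>The family \<open>qf\<close> comes from choice in HOL and is not definable. The
   condition is therefore assembled from the trivial one by exchanging finitely many values.\<close>
 have "isset ({z. z <: iter_one dl&(EX x y. z = pair x y&~ x <: f)} \<union> (%xi. pair xi (check (iter_one xi) (qf xi))) ` F)"
 by (intro isset_Un sep isset_finite finite_imageI F dpi)
 then obtain p where p:"ext p = {z. z <: iter_one dl&(EX x y. z = pair x y&~ x <: f)} \<union> (%xi. pair xi (check (iter_one xi) (qf xi))) ` F"
 unfolding isset_def by blast
 have p': "z <: p<->(EX xi. xi <: dl&z = pair xi (check (iter_one xi) (qf xi)))" for z
 proof -
 have "z <: p<->(EX x. x <: dl&z = pair x empty&x \<notin> F) \<or> (\<exists>x\<in>F. z = pair x (check (iter_one x) (qf x)))"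
 proof -
 have "z <: p<->z : {z. z <: iter_one dl&(EX x y. z = pair x y&~ x <: f)} \<union> (%xi. pair xi (check (iter_one xi) (qf xi))) ` F"
 using p mem_ext by blast
 thus ?thesis unfolding iter_one_def by (auto simp: mem_cprod mem_coll_sing f' image_iff)
 qed
 also have "...<->(EX xi. xi <: dl&z = pair xi (check (iter_one xi) (qf xi)))"
 using q0 F(2) check_empty by (metis mem_ext subsetD)
 finally show ?thesis .
 qed
 have fp:"func_on p dl" unfolding func_on_def p' by auto
 have ap:"ap p xi = check (iter_one xi) (qf xi)" if "xi <: dl" for xi
 using func_app[OF fp that,of "check (iter_one xi) (qf xi)"] ap_eq[OF fp that] p' that by auto
 have "ap p xi = empty" if "xi <: dl" "xi \<notin> F" for xi using ap that q0 by simp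
 hence "{xi. xi <: dl&ap p xi ~= empty} <= F" by auto
 hence "p : Pi dl" unfolding Pi_def using fp ap qf mem_cohen F finite_subset by blast
 moreover have "cq p xi = qf xi" if "xi <: dl" for xi using cq_eq[OF _ ap[OF that]] qf mem_cohen by blast
 hence "mp dl p = g" unfolding mp_def using qf g(2) by (auto simp: fun_eq_iff dom_def split: if_splits; metis domI mem_Sigma_iff mem_ext not_None_eq subsetD)
 ultimately show ?thesis by blast
qed

lemma mp_inj: assumes "p : Pi dl" "q : Pi dl" "mp dl p = mp dl q" shows "p = q"
proof -
 have "ap p xi = ap q xi" if "xi <: dl" for xi
 proof -
 have "cm (cq p xi) = cm (cq q xi)" using assms(3) that unfolding mp_def by (auto simp: fun_eq_iff split: if_splits; metis)
 thus ?thesis using cm_inj cq_iscohen cq(2) assms that by metis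
 qed
 moreover have "func_on p dl" "func_on q dl" using assms unfolding Pi_def by auto
 ultimately show ?thesis using func_eqI[of p dl q] ap_eq by metis
qed

lemma forcing_Pi:"forcing mem (Pi dl) (Le dl) (iter_one dl)"
proof -
 interpret po mem "Pi dl" "Le dl" "iter_one dl" by (rule po_Pi)
 \<comment> \<open>Replacement collects all canonical names of Cohen conditions, so the conditions
   lie among the functions from \<open>dl\<close> to one set.\<close>
 have "isset {y. EX z. z <: cprod dl cohen&(EX xi q. z = pair xi q&y = check (iter_one xi) q)}"
 by (rule rep) (unfold iter_one_def,intro dpi,auto)
 then obtain U where U:"!!y. y <: U<->(EX z. z <: cprod dl cohen&(EX xi q. z = pair xi q&y = check (iter_one xi) q))"
 using mem_coll by blast
 have "p <: fs dl U" if "p : Pi dl" for p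
 using that unfolding mem_fs fn_ap U Pi_def mem_Collect_eq by (metis pair_mem_cprod)
 hence "Pi dl <= ext (fs dl U)" by auto
 hence "isset (Pi dl)" by (rule isset_sub[OF isset_ext]) (intro dpi)
 moreover have "Le dl p q<->p : Pi dl&q : Pi dl&(ALL xi z. xi <: dl&hb q xi z-->hb p xi z)" for p q
 unfolding Le_def using hb_cq by (auto simp: subset_iff)
 hence "dp UNIV (%e. Le dl (e 0) (e 1))" by (simp only:) (intro dpi)
 ultimately show ?thesis by unfold_locales
qed

text \<open>\<open>szle \<delta> p n\<close>: the domain of the condition has at most \<open>n\<close> elements.\<close>

definition szle :: "'v => 'v => 'v => bool" where
 "szle dl p n<->fcov {z. EX xi y. z = pair xi y&xi <: dl&hb p xi y} n"

lemma dp_szle [dpi]:"dt UNIV t==>dt UNIV u==>dp UNIV (%e. szle dl (t e) (u e))"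
 by (rule dp_lift2[where Q = "szle dl"]) (unfold szle_def,intro dpi)

lemma szle_num: assumes "p : Pi dl" shows "szle dl p (num n)<->card (dom (mp dl p)) <= n"
proof -
 let ?f = "%x. pair (fst x) (pair (num (snd x)) (bt (the (mp dl p x))))"
 have "{z. EX xi y. z = pair xi y&xi <: dl&hb p xi y} = ?f ` dom (mp dl p)"
 proof -
 have "z : {z. EX xi y. z = pair xi y&xi <: dl&hb p xi y}<->(EX xi n b. mp dl p (xi,n) = Some b&z = pair xi (pair (num n) (bt b)))" for z
 using hb_mp[OF assms] dom_mp(2)[OF assms] by auto
 also have "... z<->z : ?f ` dom (mp dl p)" for z by (auto simp: image_iff dom_def; force)
 finally show ?thesis by blast
 qed
 moreover have "inj_on ?f (dom (mp dl p))" by (auto simp: inj_on_def)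
 ultimately show ?thesis unfolding szle_def fcov_num using dom_mp(1)[OF assms] by (simp add: card_image)
qed

end

subsection \<open>The Cohen extension\<close>

context zfc
begin

definition flip :: "('v \<times> nat) set => ('v \<times> nat => bool option) => 'v \<times> nat => bool option" where
 "flip D g = (%x. if x : D then map_option Not (g x) else g x)"

lemma flip_flip:"flip D (flip D g) = g" by (auto simp: flip_def fun_eq_iff option.map_comp o_def option.map_ident)
lemma flip_le:"g \<subseteq>\<^sub>m h==>flip D g \<subseteq>\<^sub>m flip D h"
 unfolding map_le_def flip_def by (auto simp: dom_def split: if_splits; metis domI option.simps(9))
lemma dom_flip:"dom (flip D g) = dom g" by (auto simp: flip_def dom_def split: if_splits)

lemma bool_option_eq:"(x::bool option) = y<->(x = Some True<->y = Some True)&(x = Some False<->y = Some False)"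
 by (metis (full_types) not_None_eq)

lemma bool_option_not:"(x::bool option) = map_option Not y<->(x = Some True<->y = Some False)&(x = Some False<->y = Some True)"
 by (cases x; cases y) auto

text \<open>To act on names the automorphism has to be definable. The finite set \<open>D\<close> is
  coded by an element \<open>d\<close>, and the flipped condition is pinned down by its bits via
  \<open>hb\<close>.\<close>

lemma ex_flip: assumes D:"finite D"
 shows "EX pf. dt UNIV (%e. pf (e 0))&(\<forall>p\<in>Pi dl. pf p : Pi dl&mp dl (pf p) = flip D (mp dl p))"
proof -
 obtain d where "ext d = (%x. pair (fst x) (num (snd x))) ` D" using finite_subset_isset D by blast
 hence d:"pair xi (num n) <: d<->(xi,n) : D" for xi n by (auto simp: image_iff simp flip: mem_ext) force
 define r where "r p z<->(ALL xi k. xi <: dl&k <: omega -->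
 (pair xi k <: d-->(hb z xi (pair k (bt True))<->hb p xi (pair k (bt False)))&(hb z xi (pair k (bt False))<->hb p xi (pair k (bt True)))) &
 (~ pair xi k <: d-->(hb z xi (pair k (bt True))<->hb p xi (pair k (bt True)))&(hb z xi (pair k (bt False))<->hb p xi (pair k (bt False)))))" for p z
 have r:"r p z<->mp dl z = flip D (mp dl p)" if p:"p : Pi dl" and z:"z : Pi dl" for p z
 proof -
 have "mp dl z = flip D (mp dl p)<->(ALL xi n. xi <: dl-->mp dl z (xi,n) = flip D (mp dl p) (xi,n))"
 unfolding fun_eq_iff by (auto simp: mp_def flip_def)
 also have "...<->(ALL xi n. xi <: dl-->((xi,n) : D-->(hb z xi (pair (num n) (bt True))<->hb p xi (pair (num n) (bt False))) &
 (hb z xi (pair (num n) (bt False))<->hb p xi (pair (num n) (bt True)))) &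
 ((xi,n) \<notin> D-->(hb z xi (pair (num n) (bt True))<->hb p xi (pair (num n) (bt True))) & 
 (hb z xi (pair (num n) (bt False))<->hb p xi (pair (num n) (bt False)))))"
 by (intro all_cong1 imp_cong refl)
 (simp add: hb_mp'[OF z] hb_mp'[OF p] flip_def bool_option_not bool_option_eq[of "mp dl z _" "mp dl p _"])
 also have "...<->r p z" unfolding r_def mem_omega d[symmetric] by blast
 finally show ?thesis by simp
 qed
 define pf where "pf p = (if p : Pi dl then THE z. z : Pi dl&r p z else empty)" for p
 have ex1:"EX! z. z : Pi dl&r p z" if p:"p : Pi dl" for p
 proof -
 have "\<exists>z\<in>Pi dl. mp dl z = flip D (mp dl p)" using dom_mp[OF p] dom_flip by (intro ex_mp) simp_all
 thus ?thesis using r[OF p] mp_inj by metis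
 qed
 have pi:"pf p : Pi dl&r p (pf p)" if "p : Pi dl" for p using theI'[OF ex1[OF that]] that by (simp add: pf_def)
 have "z = pf p<->(p : Pi dl&z : Pi dl&r p z) \<or> (p \<notin> Pi dl&z = empty)" for p z
 using pi[of p] ex1[of p] by (cases "p : Pi dl") (auto simp: pf_def[of p])
 hence "dt UNIV (%e. pf (e 0))" unfolding dt_def r_def by (simp only:) (intro dpi)
 thus ?thesis using pi r by blast
qed

end

locale cmodel = zfc mem for mem :: "'v => 'v => bool" (infix \<open><:\<close> 50) +
 fixes dl :: 'v and G :: "'v set" and memW :: "'w => 'w => bool" and val :: "'v => 'w"
 assumes gfdl:"generic_filter (Pi dl) (Le dl) G" and gedl:"generic_extension mem G memW val"

sublocale cmodel \<subseteq> gext mem "Pi dl" "Le dl" "iter_one dl" G memW val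
 using forcing_Pi gfdl gedl by (auto simp: gext_def gext_axioms_def)

context cmodel
begin

abbreviation "PP \<equiv> Pi dl"
abbreviation "leq \<equiv> Le dl"
abbreviation "m \<equiv> mp dl"

text \<open>By genericity some \<open>g\<close> in \<open>G\<close> decides all bits that
  \<open>r\<close> decides. Flipping the finitely many bits on which they disagree carries
  \<open>g\<close> below \<open>r\<close>, so the image of \<open>G\<close> passes through
  \<open>r\<close>.\<close>

lemma hom0: assumes r:"r : PP" shows "EX H v. Gen H v&r : H"
proof -
 have "\<exists>g\<in>G. g : PP&(ALL xi k. xi <: dl&(EX b. hb r xi (pair k b))-->(EX b. hb g xi (pair k b)))"
 proof (rule G_meets)
 show "dp UNIV (%e. e 0 : PP&(ALL xi k. xi <: dl&(EX b. hb r xi (pair k b))-->(EX b. hb (e 0) xi (pair k b))))" by (intro dpi)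
 fix p assume p:"p : PP"
 have "\<exists>q\<in>PP. m q = m r ++ m p" using dom_mp[OF p] dom_mp[OF r] by (intro ex_mp) auto
 then obtain q where q:"q : PP" "m q = m r ++ m p" by blast
 have "leq q p" unfolding Le_mp using p q by simp
 moreover have "EX b. hb q xi (pair k b)" if h:"xi <: dl" "hb r xi (pair k b)" for xi k b
 proof -
 obtain n b' where n:"k = num n" "m r (xi,n) = Some b'" using h hb_mp[OF r h(1)] by auto
 hence "m q (xi,n) ~= None" using q by (auto simp: map_add_def split: option.splits)
 thus ?thesis using hb_mp'[OF q(1) h(1)] n by auto
 qed
 ultimately show "EX q. leq q p&q : PP&(ALL xi k. xi <: dl&(EX b. hb r xi (pair k b))-->(EX b. hb q xi (pair k b)))" using q by blast
 qed
 then obtain g where g:"g : G" "g : PP" "!!xi k b. xi <: dl==>hb r xi (pair k b)==>EX b. hb g xi (pair k b)" by blast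
 have dg:"dom (m r) <= dom (m g)"
 proof
 fix x assume "x : dom (m r)"
 then obtain xi n b where x:"x = (xi,n)" "m r (xi,n) = Some b" "xi <: dl" using dom_mp(2)[OF r] by auto
 thus "x : dom (m g)" using g(3)[OF x(3),of "num n" "bt b"] hb_mp'[OF r x(3)] hb_mp[OF g(2) x(3)] by auto
 qed
 define D where "D = {x \<in> dom (m r). m g x ~= m r x}"
 have fD:"finite D" unfolding D_def using dom_mp(1)[OF r] by simp
 obtain pf where pf:"dt UNIV (%e. pf (e 0))" "!!p. p : PP==>pf p : PP&m (pf p) = flip D (m p)"
 using ex_flip[OF fD,of dl] by (elim exE conjE) simp
 have "pf (pf p) = p" if "p : PP" for p
 by (rule mp_inj[of _ dl]) (use pf(2) that flip_flip in auto)
 moreover have "leq (pf p) (pf q)" if "leq p q" for p q using that pf(2) flip_le unfolding Le_mp by auto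
 ultimately have "EX v. Gen (pf ` G) v" by (intro Gen_aut[OF pf(1)]) (simp_all add: pf(2))
 then obtain v where v:"Gen (pf ` G) v" by (rule exE)
 have "m r \<subseteq>\<^sub>m m (pf g)" unfolding map_le_def
 proof
 fix x assume x:"x : dom (m r)"
 then obtain b c where bc:"m r x = Some b" "m g x = Some c" using dg by blast
 thus "m r x = m (pf g) x" using pf(2)[OF g(2)] x unfolding flip_def D_def by auto
 qed
 hence "leq (pf g) r" unfolding Le_mp using pf(2)[OF g(2)] r by blast
 moreover have "pf g : pf ` G" using g by blast
 ultimately have "r : pf ` G" using gext.G_up[OF Gen_gext[OF v]] by blast
 thus ?thesis using v by blast
qed

end

sublocale cmodel \<subseteq> homog mem "Pi dl" "Le dl" "iter_one dl" G memW val
 by unfold_locales (rule hom0)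

context cmodel
begin

lemma ex_union: assumes B:"finite B" "B <= PP" "!!p q. p : B==>q : B==>agree (m p) (m q)"
 shows "\<exists>r\<in>PP. (\<forall>p\<in>B. m p \<subseteq>\<^sub>m m r)&dom (m r) = (\<Union>p\<in>B. dom (m p))"
proof -
 define g where "g x = (if x : (\<Union>p\<in>B. dom (m p)) then Some (\<exists>p\<in>B. m p x = Some True) else None)" for x
 have d:"dom g = (\<Union>p\<in>B. dom (m p))" unfolding g_def by (auto simp: dom_def split: if_splits)
 have "\<exists>r\<in>PP. m r = g" 
 proof (rule ex_mp)
 show "finite (dom g)" unfolding d using dom_mp(1) B(1,2) by blast
 show "dom g <= ext dl \<times> UNIV" unfolding d using dom_mp(2) B(2) by blast
 qed
 moreover have "m p \<subseteq>\<^sub>m g" if p:"p : B" for p unfolding map_le_def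
 proof
 fix x assume "x : dom (m p)"
 then obtain b where b:"m p x = Some b" by blast
 have "(\<exists>q\<in>B. m q x = Some True)<->b" using b p B(3)[OF p] unfolding agree_def by (metis (full_types))
 thus "m p x = g x" unfolding g_def using b p by auto
 qed
 ultimately show ?thesis using d by metis
qed

lemma ex_common:"p : PP==>q : PP==>agree (m p) (m q)==>EX r. leq r p&leq r q"
proof -
 assume h:"p : PP" "q : PP" "agree (m p) (m q)"
 have a:"agree (m x) (m x)" for x unfolding agree_def by auto
 have "agree (m q) (m p)" using h(3) unfolding agree_def by blast
 hence "\<exists>r\<in>PP. (\<forall>p\<in>{p,q}. m p \<subseteq>\<^sub>m m r)&dom (m r) = (\<Union>p\<in>{p,q}. dom (m p))"
 by (intro ex_union) (use h a in auto)
 thus ?thesis unfolding Le_mp using h by blast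
qed

subsubsection \<open>Ground model sets in the extension\<close>

lemma ii_inj [simp]:"ii x = ii y<->x = y"
proof
 assume "ii x = ii y"
 then obtain p where "p : G" "FE p (ck x) (ck y)" using FE_complete unfolding ii_def by blast
 thus "x = y" using FE_check G_P by blast
qed simp
lemma ii_mem [simp]:"memW (ii x) (ii y)<->x <: y" by (auto simp: mem_ii)
lemma ii_coll:"finite S==>ii (coll S) = W.coll (ii ` S)"
 by (rule W.coll_eq[symmetric]) (simp add: ext_ii ext_coll isset_finite)
lemma ii_pair:"ii (pair x y) = W.pair (ii x) (ii y)"
 unfolding pair_def W.pair_def by (simp add: ii_coll)
lemma ii_empty:"ii empty = W.empty" unfolding empty_def W.empty_def by (simp add: ii_coll)
lemma ii_succ:"ii (succ x) = W.succ (ii x)"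
 unfolding W.succ_def by (rule W.coll_eq[symmetric]) (simp add: ext_ii ext_succ)
lemma ii_num:"ii (num n) = W.num n" by (induction n) (simp_all add: ii_empty ii_succ)
lemma ii_omega:"ii omega = W.omega"
 by (rule W_ext_inj) (simp add: ext_ii ext_omega W.ext_omega ii_num image_comp o_def)
lemma ii_finite:"finite (W.ext (ii x))<->finite (ext x)"
 unfolding ext_ii by (rule finite_image_iff) (simp add: inj_on_def)

lemma ii_func:"func_on f a==>W.func_on (ii f) (ii a)"
proof -
 assume f:"func_on f a"
 have "EX x y. z = W.pair x y&memW x (ii a)" if z:"memW z (ii f)" for z
 proof -
 obtain w where w:"w <: f" "z = ii w" using z mem_ii by blast
 then obtain x y where "w = pair x y" "x <: a" using f unfolding func_on_def by blast
 thus ?thesis using w by (intro exI[of _ "ii x"] exI[of _ "ii y"]) (simp add: ii_pair)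
 qed
 moreover have "EX! y. memW (W.pair x y) (ii f)" if x:"memW x (ii a)" for x
 proof -
 obtain z where z:"z <: a" "x = ii z" using x mem_ii by blast
 show ?thesis
 proof (rule ex1I[of _ "ii (app f z)"])
 show "memW (W.pair x (ii (app f z))) (ii f)" unfolding z(2) ii_pair[symmetric] using func_app[OF f z(1)] by simp
 fix y assume "memW (W.pair x y) (ii f)"
 then obtain w where w:"w <: f" "W.pair x y = ii w" using mem_ii by blast
 obtain x' y' where p:"w = pair x' y'" using f w(1) unfolding func_on_def by blast
 hence "x' = z" "y = ii y'" using w(2) z(2) by (simp_all add: ii_pair)
 thus "y = ii (app f z)" using func_app[OF f z(1),of y'] w p by simp
 qed
 qed
 ultimately show ?thesis unfolding W.func_on_def by blast
qed
lemma ii_app: assumes "func_on f a" "x <: a" shows "W.app (ii f) (ii x) = ii (app f x)"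
proof -
 have "W.pair (ii x) (ii (app f x)) = ii (pair x (app f x))" by (simp add: ii_pair)
 moreover have "pair x (app f x) <: f" using func_app[OF assms] by simp
 ultimately show ?thesis using W.func_app[OF ii_func[OF assms(1)],of "ii x"] assms(2) by (metis ii_mem)
qed
lemma ii_fn:"fn f a b==>W.fn (ii f) (ii a) (ii b)"
 unfolding fn_def W.fn_def using ii_func ii_app by (auto simp: mem_ii)
lemma ii_lep: assumes "lep a b" shows "W.lep (ii a) (ii b)"
proof -
 obtain f where f:"fn f a b" "inj_on (app f) (ext a)" using assms lep_def by blast
 hence "inj_on (W.app (ii f)) (W.ext (ii a))"
 unfolding ext_ii inj_on_def using ii_app[of f a] fn_def by auto
 thus ?thesis unfolding W.lep_def using ii_fn f by blast
qed
lemma ii_ordinal:"ordinal a==>W.ordinal (ii a)"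
proof -
 assume a:"ordinal a"
 have "W.ext x <= W.ext (ii a)" if x:"memW x (ii a)" for x
 proof -
 obtain z where "z <: a" "x = ii z" using x mem_ii by blast
 thus ?thesis using a unfolding ordinal_def by (auto simp: ext_ii)
 qed
 moreover have "W.ext y <= W.ext x" if x:"memW x (ii a)" "memW y x" for x y
 proof -
 obtain z where z:"z <: a" "x = ii z" using x mem_ii by blast
 then obtain w where w:"w <: z" "y = ii w" using x mem_ii by blast
 hence "ext w <= ext z" using a z unfolding ordinal_def by blast
 thus ?thesis using z w by (auto simp: ext_ii)
 qed
 ultimately show ?thesis unfolding W.ordinal_def by blast
qed

text \<open>Forcing adds no finite sets: a finite set of ground model elements is already an element
  of the ground model.\<close>

lemma ii_sub: assumes "W.ext x <= W.ext (ii a)" "finite (W.ext x)" shows "EX y. x = ii y&ext y <= ext a"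
proof -
 have "EX S. finite S&S <= ext a&W.ext x = ii ` S" using assms unfolding ext_ii by (metis finite_subset_image)
 then obtain S y where S:"S <= ext a" "W.ext x = ii ` S" "ext y = S" using finite_subset_isset by metis
 hence "x = ii y" by (intro W_ext_inj) (simp add: ext_ii)
 thus ?thesis using S by blast
qed

primrec envl :: "'v list => nat => 'v" where
 "envl [] n = empty" | "envl (x # l) n = (case n of 0 => x | Suc k => envl l k)"

lemma dt_envl:"dt UNIV t==>(!!n. dt UNIV (%e. envl (l e) n))==>dt UNIV (%e. envl (t e # l e) n)"
 by (cases n) auto
lemma dt_envl0:"dt UNIV (%e. envl [] n)" by (simp,intro dpi)

text \<open>Fix a value \<open>y\<close> and a size \<open>n\<close>. Only finitely many
  \<open>x\<close> have a condition of size at most \<open>n\<close> below \<open>p0\<close> that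
  forces \<open>y\<close> to be the image of \<open>x\<close>: among infinitely many, two would have
  compatible conditions, against the injectivity forced by \<open>p0\<close>. One factor
  \<open>omega\<close> accounts for the size, the other for the enumeration of the finite
  fibres.\<close>

lemma lep_reflect: assumes W:"W.lep (ii a) (ii b)" shows "lep a (cprod (cprod b omega) omega)"
proof -
 obtain f where f:"W.fn f (ii a) (ii b)" "inj_on (W.app f) (W.ext (ii a))" using W W.lep_def by blast
 obtain ta where ta:"f = val ta" using val_surj by blast
 define I where "I e<->(ALL x x' y. memW (W.pair x y) (e 0)&memW (W.pair x' y) (e 0)-->x = x')" for e :: "nat => 'w"
 define R where "R e<->memW (W.pair (e 1) (e 2)) (e 0)" for e :: "nat => 'w"
 have dI:"W.dp {} I" and dR:"W.dp {} R" unfolding I_def R_def by (intro dpi)+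
 have ff:"W.func_on f (ii a)" using f W.fn_def by blast
 have "I (%n. val (envl [ta] n))" unfolding I_def
 proof (intro allI impI)
 fix x x' y assume h:"memW (W.pair x y) (val (envl [ta] 0))&memW (W.pair x' y) (val (envl [ta] 0))"
 have "memW u (ii a)" if u:"memW (W.pair u w) f" for u w
 proof -
 obtain u' w' where "W.pair u w = W.pair u' w'" "memW u' (ii a)" using ff u unfolding W.func_on_def by blast
 thus ?thesis by simp
 qed
 hence "memW x (ii a)" "memW x' (ii a)" using h ta by auto
 thus "x = x'" using h f(2) W.func_app[OF ff] ta by (auto simp: inj_on_def)
 qed
 then obtain p0 where p0:"p0 : G" "fc I p0 (envl [ta])" using fc_truth[OF dI Gen_self] by blast
 define Q where "Q z x<->(EX y n. z = pair y n&(EX q. leq q p0&szle dl q n&q : PP&fc R q (envl [ta,ck x,ck y])))" for z x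
 show ?thesis
 proof (rule finite_cover[of Q])
 show "dp UNIV (%e. Q (e 0) (e 1))" unfolding Q_def by (intro dpi dp_fc[OF dR] dt_envl dt_envl0)
 fix x assume x:"x <: a"
 then obtain y where y:"y <: b" "W.app f (ii x) = ii y" using f(1) unfolding W.fn_def by (metis ii_mem mem_ii)
 have "memW (W.pair (ii x) (ii y)) f" using W.func_app[OF ff,of "ii x"] x y by simp
 hence "R (%n. val (envl [ta,ck x,ck y] n))" unfolding R_def by (simp add: ta ii_def numeral_2_eq_2)
 then obtain q0 where q0:"q0 : G" "fc R q0 (envl [ta,ck x,ck y])" using fc_truth[OF dR Gen_self] by blast
 obtain q where q:"q : G" "leq q p0" "leq q q0" using G_dir p0 q0 by blast
 hence "fc R q (envl [ta,ck x,ck y])" "q : PP" using q0 fc_mono G_P by blast+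
 thus "EX i. i <: cprod b omega&Q i x" unfolding Q_def using y q szle_num
 by (intro exI[of _ "pair y (num (card (dom (m q))))"]) auto
 next
 fix i assume "i <: cprod b omega"
 then obtain y n where i:"i = pair y (num n)" by (auto simp: mem_cprod mem_omega)
 show "finite {x. x <: a&Q i x}"
 proof (rule ccontr)
 assume inf:"infinite {x. x <: a&Q i x}"
 define qq where "qq x = (SOME q. leq q p0&szle dl q (num n)&q : PP&fc R q (envl [ta,ck x,ck y]))" for x
 have qq:"leq (qq x) p0" "card (dom (m (qq x))) <= n" "qq x : PP" "fc R (qq x) (envl [ta,ck x,ck y])" if "Q i x" for x
 proof -
 have "EX q. leq q p0&szle dl q (num n)&q : PP&fc R q (envl [ta,ck x,ck y])" using that unfolding Q_def i by auto
 from someI_ex[OF this] show "leq (qq x) p0" "card (dom (m (qq x))) <= n" "qq x : PP" "fc R (qq x) (envl [ta,ck x,ck y])"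
 using szle_num unfolding qq_def by blast+
 qed
 obtain B where B:"B <= {x. x <: a&Q i x}" "card B = Suc 1" "\<forall>x\<in>B. \<forall>y\<in>B. agree (m (qq x)) (m (qq y))"
 proof -
 have "\<exists>B\<subseteq>{x. x <: a&Q i x}. finite B&card B = Suc 1&(\<forall>x\<in>B. \<forall>y\<in>B. agree (m (qq x)) (m (qq y)))"
 by (rule infinite_compatible[OF inf,of "%x. m (qq x)" n 1]) (use qq(2,3) dom_mp(1) in auto)
 thus ?thesis using that by blast
 qed
 then obtain x x' where x:"x : B" "x' : B" "x ~= x'" by (metis card_2_iff' numeral_2_eq_2 One_nat_def)
 hence Q:"Q i x" "Q i x'" using B by auto
 obtain r where r:"leq r (qq x)" "leq r (qq x')" using ex_common qq(3)[OF Q(1)] qq(3)[OF Q(2)] B(3) x by blast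
 obtain H v where H:"Gen H v" "r : H" using hom le_in r by blast
 have Hq:"qq x : H" "qq x' : H" "p0 : H" using Gen_facts(2)[OF H(1)] H(2) r qq(1)[OF Q(1)] le_trans by blast+
 have "R (%n. v (envl [ta,ck x,ck y] n))" "R (%n. v (envl [ta,ck x',ck y] n))"
 using fcD qq(4) Q H(1) Hq by blast+
 hence "memW (W.pair (ii x) (ii y)) (v ta)" "memW (W.pair (ii x') (ii y)) (v ta)"
 unfolding R_def by (simp_all add: numeral_2_eq_2 val_ck[OF H(1)])
 moreover have "I (%n. v (envl [ta] n))" using fcD p0(2) H(1) Hq by blast
 ultimately have "ii x = ii x'" unfolding I_def envl.simps nat.case by blast
 thus False using x(3) by simp
 qed
 qed
qed

end

subsection \<open>Cardinals and the continuum in the extension\<close>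

locale c2 = cmodel mem dl G memW val
 for mem :: "'v => 'v => bool" (infix \<open><:\<close> 50) and dl G and memW :: "'w => 'w => bool" and val +
 assumes GCH: GCH and dl:"dl = aleph2"
begin

lemmas w1 = csucc_props[OF ordinal_omega,folded aleph1_def]
lemma ord_w1:"ordinal aleph1" using w1(1) cardinal_def by blast
lemmas w2 = csucc_props[OF ord_w1,folded aleph2_def,folded dl]
lemma ord_w2:"ordinal dl" using w2(1) cardinal_def by blast

lemma cardinal_omega:"cardinal omega"
 unfolding cardinal_def
proof (intro conjI allI impI notI)
 fix a assume "a <: omega" "equinum a omega"
 then obtain n f where "a = num n" "bij_betw (app f) (ext (num n)) (ext omega)" unfolding equinum_def mem_omega by blast
 hence "finite (ext omega)" using bij_betw_finite ext_num by (metis finite_imageI finite_lessThan)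
 thus False unfolding ext_omega using inj_num by (metis infinite_UNIV_char_0 finite_imageD)
qed (rule ordinal_omega)

lemma pow_w:"equinum (powset omega) aleph1"
 using GCH cardinal_omega unfolding GCH_def aleph1_def by blast
lemma omega_w1:"ext omega <= ext aleph1" using w1(2) ord_w1 ordinal_trans by auto
lemma pow_w1:"equinum (powset aleph1) dl"
 using GCH w1(1) omega_w1 unfolding GCH_def dl aleph2_def by blast

lemma seq_w1:"lep (fs omega aleph1) aleph1"
 using lep_fs[OF equinum_lep2[OF pow_w]] lep_pow_seq[OF lep_omega2] equinum_lep[OF pow_w] lep_trans by meson
lemma sq_w1:"lep (cprod aleph1 aleph1) aleph1" by (rule lep_square[OF seq_w1])
lemma w1_omega:"lep (cprod aleph1 omega) aleph1"
 by (rule lep_trans[OF lep_prod[OF lep_refl lep_ordinal[OF ord_w1 w1(2)]] sq_w1])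
lemma seq_w2:"lep (fs omega dl) dl"
 using lep_fs[OF equinum_lep2[OF pow_w1]] lep_pow_seq[OF w1_omega] equinum_lep[OF pow_w1] lep_trans by meson
lemma sq_w2:"lep (cprod dl dl) dl" by (rule lep_square[OF seq_w2])
lemma w1_w2:"lep aleph1 dl" by (rule lep_ordinal[OF ord_w2 w2(2)])
lemma omega_lep_w1:"lep omega aleph1" by (rule lep_ordinal[OF ord_w1 w1(2)])
lemma num_w1:"num n <: aleph1" using omega_w1 num_omega[of n] by (auto simp: subset_iff)
lemma num_w2:"num n <: dl" using num_w1 ordinal_trans[OF ord_w2 w2(2)] by blast
lemma Fin_w1:"lep (Fin aleph1) aleph1" by (rule lep_Fin[OF seq_w1 num_w1[of 0] num_w1[of 1]]) (simp del: num.simps)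
lemma Fin_w2:"lep (Fin dl) dl" by (rule lep_Fin[OF seq_w2 num_w2[of 0] num_w2[of 1]]) (simp del: num.simps)

lemma lep_Fin_mono: assumes "lep a b" shows "lep (Fin a) (Fin b)"
proof -
 obtain f where f:"!!x. x <: a==>ap f x <: b" "!!x y. x <: a==>y <: a==>ap f x = ap f y==>x = y"
 using lepE[OF assms] by metis
 show ?thesis
 proof (rule lepR[of "%x y. ALL z. z <: y<->(EX w. w <: x&z = ap f w)"])
 show "EX y. y <: Fin b&(ALL z. z <: y<->(EX w. w <: x&z = ap f w))" if x:"x <: Fin a" for x
 proof -
 have "finite (ap f ` ext x)" using x mem_Fin by simp
 then obtain y where "ext y = ap f ` ext x" using finite_subset_isset by blast
 hence y:"z <: y<->(EX w. w <: x&z = ap f w)" for z by (auto simp: image_iff Bex_def simp flip: mem_ext)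
 hence "y <: Fin b" using x f \<open>finite (ap f ` ext x)\<close> \<open>ext y = _\<close> unfolding mem_Fin by (auto simp: subset_iff)
 thus ?thesis using y by blast
 qed
 show "x = x'" if h:"x <: Fin a" "x' <: Fin a" "ALL z. z <: y<->(EX w. w <: x&z = ap f w)" "ALL z. z <: y<->(EX w. w <: x'&z = ap f w)" for x x' y
 proof (rule set_eqI)
 fix w
 have "x <: Fin a==>w <: x==>w <: a" for x w unfolding mem_Fin by auto
 thus "w <: x<->w <: x'" using h f(2) by metis
 qed
 qed (intro dpi,auto intro: set_eqI)
qed

lemma lep3:"lep (cprod (cprod omega omega) omega) omega"
 by (rule lep_trans[OF lep_prod[OF lep_omega2 lep_refl] lep_omega2])

text \<open>An injection of \<open>aleph1\<close> into a smaller ordinal in the extension would be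
  reflected to the ground model at the price of countable factors, which a countable ordinal
  absorbs.\<close>

lemma aleph1_W:"W.aleph1 = ii aleph1"
 unfolding W.aleph1_def
proof (rule W.csuccI)
 show "memW W.omega (ii aleph1)" using w1(2) by (simp flip: ii_omega)
 show "W.lep b W.omega" if "memW b (ii aleph1)" for b
 using that w1(3) ii_lep unfolding mem_ii ii_omega[symmetric] by blast
 show "W.cardinal (ii aleph1)" unfolding W.cardinal_def
 proof (intro conjI allI impI notI)
 show "W.ordinal (ii aleph1)" by (rule ii_ordinal[OF ord_w1])
 fix a assume "memW a (ii aleph1)" "W.equinum a (ii aleph1)"
 hence "W.lep (ii aleph1) a" by (intro W.equinum_lep2)
 then obtain b where b:"b <: aleph1" "W.lep (ii aleph1) (ii b)" using \<open>memW a _\<close> unfolding mem_ii by auto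
 have "lep aleph1 (cprod (cprod b omega) omega)" by (rule lep_reflect[OF b(2)])
 moreover have "lep (cprod (cprod b omega) omega) omega"
 using lep_prod[OF lep_prod[OF w1(3)[OF b(1)] lep_refl] lep_refl] lep3 lep_trans by blast
 ultimately show False using w1(4) lep_trans by blast
 qed
qed (rule W.ordinal_omega)

lemma lep_w1_3: assumes "lep b aleph1" shows "lep (cprod (cprod b omega) omega) aleph1"
 using lep_trans[OF lep_prod[OF lep_trans[OF lep_prod[OF assms lep_refl] w1_omega] lep_refl] w1_omega] .

lemma aleph2_W:"W.aleph2 = ii dl"
 unfolding W.aleph2_def aleph1_W
proof (rule W.csuccI)
 show "memW (ii aleph1) (ii dl)" using w2(2) by simp
 show "W.lep b (ii aleph1)" if "memW b (ii dl)" for b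
 using that w2(3) ii_lep unfolding mem_ii by blast
 show "W.cardinal (ii dl)" unfolding W.cardinal_def
 proof (intro conjI allI impI notI)
 show "W.ordinal (ii dl)" by (rule ii_ordinal[OF ord_w2])
 fix a assume "memW a (ii dl)" "W.equinum a (ii dl)"
 hence "W.lep (ii dl) a" by (intro W.equinum_lep2)
 then obtain b where b:"b <: dl" "W.lep (ii dl) (ii b)" using \<open>memW a _\<close> unfolding mem_ii by auto
 have "lep dl (cprod (cprod b omega) omega)" by (rule lep_reflect[OF b(2)])
 thus False using w2(4) lep_trans lep_w1_3[OF w2(3)[OF b(1)]] by blast
 qed
qed (rule ii_ordinal[OF ord_w1])

text \<open>A name for all Cohen reals at once: the set of pairs of a coordinate and a place at
  which the real of this coordinate is 1.\<close>

definition Cname :: 'v where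
 "Cname = coll {z. EX w. w <: cprod (cprod dl omega) (coll PP) &
 (EX xi k p. w = pair (pair xi k) p&hb p xi (pair k (bt True))&z = pair (ck (pair xi k)) p)}"

lemma mem_Cname:"z <: Cname<->(EX xi k p. xi <: dl&k <: omega&p : PP&hb p xi (pair k (bt True))&z = pair (ck (pair xi k)) p)"
proof -
 have "isset {z. EX w. w <: cprod (cprod dl omega) (coll PP) &
 (EX xi k p. w = pair (pair xi k) p&hb p xi (pair k (bt True))&z = pair (ck (pair xi k)) p)}"
 by (rule rep) (intro dpi,auto)
 from mem_coll[OF this,of z] have "z <: Cname<->(EX w. w <: cprod (cprod dl omega) (coll PP) &
 (EX xi k p. w = pair (pair xi k) p&hb p xi (pair k (bt True))&z = pair (ck (pair xi k)) p))"
 unfolding Cname_def mem_Collect_eq .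
 also have "...<->(EX xi k p. xi <: dl&k <: omega&p : PP&hb p xi (pair k (bt True))&z = pair (ck (pair xi k)) p)"
 using mem_coll[OF isset_P] pair_mem_cprod by blast
 finally show ?thesis .
qed

lemma bit_true: assumes "Gen H v" shows "memW x (v Cname)<->(EX xi n p. p : H&m p (xi,n) = Some True&x = ii (pair xi (num n)))"
proof
 assume "memW x (v Cname)"
 then obtain xi k p where "p : H" "xi <: dl" "k <: omega" "p : PP" "hb p xi (pair k (bt True))" "x = v (ck (pair xi k))"
 unfolding Gen_facts(4)[OF assms] mem_Cname by auto
 thus "EX xi n p. p : H&m p (xi,n) = Some True&x = ii (pair xi (num n))"
 using hb_mp' val_ck[OF assms] by (metis mem_omega)
next
 assume "EX xi n p. p : H&m p (xi,n) = Some True&x = ii (pair xi (num n))"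
 then obtain xi n p where h:"p : H" "m p (xi,n) = Some True" "x = ii (pair xi (num n))" by blast
 hence p:"p : PP" "xi <: dl" using Gen_facts(1)[OF assms] dom_mp(2) by fastforce+
 hence "hb p xi (pair (num n) (bt True))" using hb_mp' h by simp
 hence "pair (ck (pair xi (num n))) p <: Cname" unfolding mem_Cname using p num_omega by blast
 thus "memW x (v Cname)" unfolding Gen_facts(4)[OF assms] using h val_ck[OF assms] by metis
qed

lemma bit_decided: assumes "Gen H v" "p : H" "m p (xi,n) = Some b"
 shows "memW (W.pair (ii xi) (W.num n)) (v Cname)<->b"
proof
 assume "memW (W.pair (ii xi) (W.num n)) (v Cname)"
 then obtain q where q:"q : H" "m q (xi,n) = Some True"
 unfolding bit_true[OF assms(1)] by (auto simp flip: ii_num ii_pair)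
 obtain r where "r : H" "leq r p" "leq r q" using Gen_facts(3)[OF assms(1,2) q(1)] by blast
 hence "m r (xi,n) = Some b" "m r (xi,n) = Some True" using assms(3) q(2) unfolding Le_mp map_le_def by (metis domI)+
 thus b by simp
next
 assume b thus "memW (W.pair (ii xi) (W.num n)) (v Cname)"
 unfolding bit_true[OF assms(1)] using assms by (auto simp flip: ii_num ii_pair)
qed

definition creal :: 'w where "creal = val Cname"

text \<open>A condition is finite, so a place that it mentions at no coordinate can be given
  different bits at the two coordinates.\<close>

lemma bits_differ: assumes "al <: dl" "be1 <: dl" "al ~= be1"
 shows "EX n. memW (W.pair (ii al) (W.num n)) creal&~ memW (W.pair (ii be1) (W.num n)) creal"
proof -
 have "\<exists>p\<in>G. p : PP&(EX k. k <: omega&hb p al (pair k (bt True))&hb p be1 (pair k (bt False)))"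
 proof (rule G_meets)
 show "dp UNIV (%e. e 0 : PP&(EX k. k <: omega&hb (e 0) al (pair k (bt True))&hb (e 0) be1 (pair k (bt False))))" by (intro dpi)
 fix p assume p:"p : PP"
 obtain n where n:"n \<notin> snd ` dom (m p)" using dom_mp(1)[OF p] by (meson ex_new_if_finite finite_imageI infinite_UNIV_nat)
 hence np:"m p (al,n) = None" "m p (be1,n) = None" by (force simp: dom_def image_iff)+
 have "\<exists>q\<in>PP. m q = (m p)((al,n) \<mapsto> True,(be1,n) \<mapsto> False)" using dom_mp[OF p] assms by (intro ex_mp) auto
 then obtain q where q:"q : PP" "m q = (m p)((al,n) \<mapsto> True,(be1,n) \<mapsto> False)" by blast
 have "leq q p" unfolding Le_mp map_le_def using p q np by auto
 moreover have "hb q al (pair (num n) (bt True))" "hb q be1 (pair (num n) (bt False))"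
 using q assms by (auto simp: hb_mp')
 ultimately show "EX q. leq q p&q : PP&(EX k. k <: omega&hb q al (pair k (bt True))&hb q be1 (pair k (bt False)))"
 using q num_omega by blast
 qed
 then obtain p n where p:"p : G" "m p (al,n) = Some True" "m p (be1,n) = Some False"
 using hb_mp' assms by (auto simp: mem_omega)
 thus ?thesis using bit_decided[OF Gen_self p(1)] unfolding creal_def by blast
qed

lemma lep_continuum:"W.lep (ii dl) (W.powset W.omega)"
proof (rule W.lepR[of "%a s. ALL n. memW n s<->memW n W.omega&memW (W.pair a n) creal"])
 show "EX s. memW s (W.powset W.omega)&(ALL n. memW n s<->memW n W.omega&memW (W.pair a n) creal)" for a
 proof -
 have "W.isset {n. memW n W.omega&memW (W.pair a n) creal}" by (rule W.sep) (intro dpi)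
 then obtain s where "!!n. memW n s<->memW n W.omega&memW (W.pair a n) creal" using W.mem_coll by blast
 thus ?thesis by (intro exI[of _ s]) auto
 qed
 show "a = a'" if aa:"memW a (ii dl)" "memW a' (ii dl)" "ALL n. memW n s<->memW n W.omega&memW (W.pair a n) creal"
 "ALL n. memW n s<->memW n W.omega&memW (W.pair a' n) creal" for a a' s
 proof -
 obtain al be1 where ab:"al <: dl" "be1 <: dl" "a = ii al" "a' = ii be1" using aa(1,2) mem_ii by blast
 thus ?thesis using bits_differ[of al be1] bits_differ[of be1 al] aa(3,4) by (metis W.num_omega)
 qed
qed (intro dpi,auto intro: W.set_eqI)

text \<open>The finite predense sets for all \<open>b\<close> and all sizes, chosen together in the
  ground model. For fixed \<open>b\<close>, their union over the sizes is countable and takes over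
  the part of a countable maximal antichain.\<close>

lemma predense_family: assumes D:"dp UNIV (%e. D (e 0) (e 1))"
 shows "EX f. ALL b n. b <: B-->finite (ext (ap f (pair b (num n)))) &
 (ALL q. q <: ap f (pair b (num n))-->q : PP&D b q) &
 (\<forall>q\<in>PP. D b q&card (dom (m q)) <= n-->(EX e r. e <: ap f (pair b (num n))&leq r q&leq r e))"
proof -
 have D': "dp UNIV (%e. D (t e) (u e))" if "dt UNIV t" "dt UNIV u" for t u by (rule dp_lift2[OF D that])
 define R where "R z E<->(EX b n. z = pair b n&finite (ext E)&(ALL q. q <: E-->q : PP&D b q) &
 (ALL q. q : PP&D b q&szle dl q n-->(EX e r. e <: E&leq r q&leq r e)))" for z E
 have dR:"dp UNIV (%e. R (e 0) (e 1))" unfolding R_def by (intro dpi D')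
 have "EX E. E <: powset (coll PP)&R z E" if z:"z <: cprod B omega" for z
 proof -
 obtain b n where bn:"z = pair b (num n)" using z by (auto simp: mem_cprod mem_omega)
 have "\<exists>E\<subseteq>{q \<in> PP. D b q&card (dom (m q)) <= n}. finite E&(\<forall>i\<in>{q \<in> PP. D b q&card (dom (m q)) <= n}. \<exists>j\<in>E. agree (m i) (m j))"
 by (rule finite_predense[where n = n]) (use dom_mp(1) in auto)
 then obtain E where E:"E <= {q \<in> PP. D b q&card (dom (m q)) <= n}" "finite E"
 "\<forall>i\<in>{q \<in> PP. D b q&card (dom (m q)) <= n}. \<exists>j\<in>E. agree (m i) (m j)" by blast
 obtain F where F:"ext F = E" using finite_subset_isset E(2) by blast
 hence Fm:"x <: F<->x : E" for x using mem_ext by blast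
 have "EX e r. e <: F&leq r q&leq r e" if q:"q : PP&D b q&szle dl q (num n)" for q
 proof -
 obtain e where "e : E" "agree (m q) (m e)" using E(3) szle_num q by blast
 thus ?thesis using ex_common[of q e] q E(1) Fm by blast
 qed
 moreover have "ALL q. q <: F-->q : PP&D b q" using Fm E(1) by blast
 ultimately have "R z F" unfolding R_def bn using F E(2) by (rule_tac exI[of _ b],rule_tac exI[of _ "num n"]) simp
 moreover have "F <: powset (coll PP)" using F E(1) by (auto simp: mem_coll isset_P subset_iff)
 ultimately show ?thesis by blast
 qed
 then obtain f where f:"fn f (cprod B omega) (powset (coll PP))" "!!z. z <: cprod B omega==>R z (app f z)"
 using choice[OF dR] by blast
 have "R (pair b (num n)) (ap f (pair b (num n)))" if "b <: B" for b n
 using f that ap_eq[of f "cprod B omega" "pair b (num n)"] unfolding fn_def by auto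
 hence R:"R (pair b (num n)) (ap f (pair b (num n)))" if "b <: B" for b n using that by blast
 show ?thesis
 proof (intro exI[of _ f] allI impI)
 fix b n assume b:"b <: B"
 show "finite (ext (ap f (pair b (num n))))&(ALL q. q <: ap f (pair b (num n))-->q : PP&D b q) &
 (\<forall>q\<in>PP. D b q&card (dom (m q)) <= n-->(EX e r. e <: ap f (pair b (num n))&leq r q&leq r e))"
 using R[OF b,of n] szle_num unfolding R_def by auto
 qed
qed

definition memR :: "(nat => 'w) => bool" where "memR e<->memW (e 1) (e 0)"
lemma dp_memR:"W.dp {} memR" unfolding memR_def by (intro dpi)

definition Gname :: 'v where "Gname = coll ((%p. pair (ck p) p) ` PP)"
lemma mem_Gname:"memW x (val Gname)<->(\<exists>p\<in>G. x = ii p)"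
proof -
 have "isset ((%p. pair (ck p) p) ` ext (coll PP))" by (rule rep_image) (intro dpi)
 hence "isset ((%p. pair (ck p) p) ` PP)" by (simp add: ext_coll isset_P)
 from mem_coll[OF this] show ?thesis unfolding mem_val Gname_def ii_def using G_P by (auto simp: image_iff)
qed

text \<open>Codes for nice names of reals. A sequence lists triples of a flag, a number and a
  condition; flag 1 means that the condition puts the number into the real, and flag 0 marks a
  filler.\<close>

definition Zset :: 'v where "Zset = fs omega (cprod (num 2) (cprod omega (coll PP)))"

lemma lep_PP:"lep (coll PP) dl"
proof -
 define B0 where "B0 = cprod dl (cprod omega (num 2))"
 have "lep (coll PP) (Fin B0)"
 proof (rule lepR[of "%p s. ALL z. z <: s<->(EX xi y. z = pair xi y&xi <: dl&hb p xi y)"])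
 show "EX s. s <: Fin B0&(ALL z. z <: s<->(EX xi y. z = pair xi y&xi <: dl&hb p xi y))" if "p <: coll PP" for p
 proof -
 have p:"p : PP" using that by (simp add: mem_coll isset_P)
 have "szle dl p (num (card (dom (m p))))" using szle_num[OF p] by simp
 hence "finite {z. EX xi y. z = pair xi y&xi <: dl&hb p xi y}" unfolding szle_def fcov_num by blast
 moreover from this obtain s where "ext s = {z. EX xi y. z = pair xi y&xi <: dl&hb p xi y}" using finite_subset_isset by blast
 ultimately have s:"ext s = {z. EX xi y. z = pair xi y&xi <: dl&hb p xi y}" "finite (ext s)" by simp_all
 hence s': "z <: s<->(EX xi y. z = pair xi y&xi <: dl&hb p xi y)" for z by (auto simp flip: mem_ext)
 hence "s <: Fin B0" unfolding mem_Fin B0_def using s(2) hb_mp[OF p] mem_num2 by (auto simp: subset_iff)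
 thus ?thesis using s' by blast
 qed
 show "p = q" if h:"p <: coll PP" "q <: coll PP" "ALL z. z <: s<->(EX xi y. z = pair xi y&xi <: dl&hb p xi y)"
 "ALL z. z <: s<->(EX xi y. z = pair xi y&xi <: dl&hb q xi y)" for p q s
 proof -
 have pq:"p : PP" "q : PP" using h by (simp_all add: mem_coll isset_P)
 have "hb p xi y<->hb q xi y" if "xi <: dl" for xi y using h(3)[THEN spec,of "pair xi y"] h(4)[THEN spec,of "pair xi y"] that by auto
 hence "leq p q" "leq q p" unfolding Le_def using pq hb_cq by (auto simp: subset_iff)
 thus ?thesis using pq mp_inj map_le_antisym unfolding Le_mp by blast
 qed
 qed (intro dpi,auto intro: set_eqI)
 moreover have "lep B0 dl"
 proof -
 have "lep (cprod omega (num 2)) dl"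
 using lep_prod[OF lep_refl[of omega] lep_ordinal[OF ordinal_omega num_omega[of 2]]] lep_omega2 omega_lep_w1 w1_w2 lep_trans by meson
 thus ?thesis unfolding B0_def using lep_prod[OF lep_refl] sq_w2 lep_trans by meson
 qed
 ultimately show ?thesis using lep_Fin_mono Fin_w2 lep_trans by meson
qed

lemma lep_Zset:"lep Zset dl"
proof -
 have o:"lep omega dl" using omega_lep_w1 w1_w2 lep_trans by blast
 have "lep (cprod omega (coll PP)) dl" using lep_prod[OF o lep_PP] sq_w2 lep_trans by blast
 moreover have "lep (num 2) dl" using lep_ordinal[OF ord_w2 num_w2] .
 ultimately have "lep (cprod (num 2) (cprod omega (coll PP))) dl" using lep_prod sq_w2 lep_trans by meson
 thus ?thesis unfolding Zset_def using lep_fs seq_w2 lep_trans by meson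
qed

text \<open>For each number, finite predense sets of conditions that force it into \<open>x\<close>
  are taken for all sizes. The resulting pairs form a countable set \<open>U\<close>, and genericity
  ensures that a number belongs to \<open>x\<close> exactly if one of its conditions lies in
  \<open>G\<close>.\<close>

lemma rlc: assumes x:"W.ext x <= W.ext W.omega"
 shows "EX z. z <: Zset&(ALL n. memW (W.num n) x<->(EX k q. k <: omega&ap z k = pair (num 1) (pair (num n) q)&q : G))"
proof -
 obtain ta where ta:"x = val ta" using val_surj by blast
 define D where "D b q<->q : PP&fc memR q (envl [ta,ck b])" for b q
 have dD:"dp UNIV (%e. D (e 0) (e 1))" unfolding D_def by (intro dp_fc[OF dp_memR] dt_envl dt_envl0 dpi)
 obtain f where f:"!!b n. b <: omega==>finite (ext (ap f (pair b (num n)))) &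
 (ALL q. q <: ap f (pair b (num n))-->q : PP&D b q) &
 (\<forall>q\<in>PP. D b q&card (dom (m q)) <= n-->(EX e r. e <: ap f (pair b (num n))&leq r q&leq r e))"
 using predense_family[OF dD,of omega] by blast
 have "isset {u. u <: cprod omega (coll PP)&(EX b q n. u = pair b q&n <: omega&q <: ap f (pair b n))}" by (rule sep) (intro dpi)
 then obtain U where U:"!!u. u <: U<->u <: cprod omega (coll PP)&(EX b q n. u = pair b q&n <: omega&q <: ap f (pair b n))"
 using mem_coll by blast
 have "lep U (cprod (cprod omega omega) omega)"
 proof (rule finite_cover[of "%i u. EX b n q. i = pair b n&u = pair b q&q <: ap f (pair b n)"])
 show "EX i. i <: cprod omega omega&(EX b n q. i = pair b n&u = pair b q&q <: ap f (pair b n))" if "u <: U" for u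
 using that unfolding U mem_cprod by (metis pair_inject)
 fix i assume "i <: cprod omega omega"
 then obtain b n where i:"i = pair b (num n)" "b <: omega" by (auto simp: mem_cprod mem_omega)
 have "{u. u <: U&(EX b n q. i = pair b n&u = pair b q&q <: ap f (pair b n))} <= (%q. pair b q) ` ext (ap f i)"
 using i by auto
 thus "finite {u. u <: U&(EX b n q. i = pair b n&u = pair b q&q <: ap f (pair b n))}"
 using finite_surj[of "ext (ap f i)"] f[OF i(2),of n] i(1) by blast
 qed (intro dpi)
 hence "lep U omega" using lep3 lep_trans by blast
 then obtain h where h:"!!u. u <: U==>ap h u <: omega" "!!u v. u <: U==>v <: U==>ap h u = ap h v==>u = v"
 using lepE by metis
 \<comment> \<open>Positions outside the range of the injection \<open>h\<close> receive a filler
   with flag 0.\<close>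
 define R where "R k y<->(EX u. u <: U&k = ap h u&y = pair (num 1) u) \<or> (~ (EX u. u <: U&k = ap h u)&y = pair (num 0) (pair (num 0) (iter_one dl)))" for k y
 have dR:"dp UNIV (%e. R (e 0) (e 1))" unfolding R_def by (intro dpi)
 have "EX z. fn z omega (cprod (num 2) (cprod omega (coll PP)))&(ALL k. k <: omega-->R k (app z k))"
 proof (rule fn_rel[OF dR,of omega "cprod (num 2) (cprod omega (coll PP))"])
 show "EX y. y <: cprod (num 2) (cprod omega (coll PP))&R k y" for k
 proof (cases "EX u. u <: U&k = ap h u")
 case True
 then obtain u where u:"u <: U" "k = ap h u" by blast
 hence "pair (num 1) u <: cprod (num 2) (cprod omega (coll PP))" using U by (simp add: num_mem del: num.simps)
 thus ?thesis using u unfolding R_def by blast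
 next
 case False
 have "pair (num 0) (pair (num 0) (iter_one dl)) <: cprod (num 2) (cprod omega (coll PP))"
 using one_in by (simp add: num_mem mem_coll isset_P del: num.simps)
 thus ?thesis using False unfolding R_def by blast
 qed
 show "y = y'" if "R k y" "R k y'" for k y y' using that h(2) unfolding R_def by auto
 qed blast
 then obtain z where z:"fn z omega (cprod (num 2) (cprod omega (coll PP)))" "!!k. k <: omega==>R k (app z k)" by blast
 have za:"ap z k = app z k" if "k <: omega" for k using z(1) ap_eq that unfolding fn_def by blast
 have rng:"(EX k. k <: omega&ap z k = pair (num 1) u)<->u <: U" for u
 proof
 assume "EX k. k <: omega&ap z k = pair (num 1) u"
 then obtain k where k:"k <: omega" "app z k = pair (num 1) u" using za by auto
 have "R k (pair (num 1) u)" using z(2)[OF k(1)] k(2) by simp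
 thus "u <: U" unfolding R_def by (auto simp del: num.simps)
 next
 assume u:"u <: U"
 thus "EX k. k <: omega&ap z k = pair (num 1) u" using z(2)[OF h(1)[OF u]] za h u unfolding R_def by metis
 qed
 have "memW (W.num n) x<->(EX q. pair (num n) q <: U&q : G)" for n
 proof
 assume "memW (W.num n) x"
 hence "memR (%i. val (envl [ta,ck (num n)] i))" unfolding memR_def by (simp add: ta ii_num[symmetric] ii_def)
 then obtain q0 where q0:"q0 : G" "fc memR q0 (envl [ta,ck (num n)])" using fc_truth[OF dp_memR Gen_self] by blast
 have "\<exists>r\<in>G. (EX k q. k <: omega&q <: ap f (pair (num n) k)&leq r q) \<or> ~ (EX u. leq u r&leq u q0)"
 proof (rule G_meets)
 show "dp UNIV (%e. (EX k q. k <: omega&q <: ap f (pair (num n) k)&leq (e 0) q) \<or> ~ (EX u. leq u (e 0)&leq u q0))" by (intro dpi)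
 fix r assume r:"r : PP"
 show "EX s. leq s r&((EX k q. k <: omega&q <: ap f (pair (num n) k)&leq s q) \<or> ~ (EX u. leq u s&leq u q0))"
 proof (cases "EX u. leq u r&leq u q0")
 case True
 then obtain u where u:"leq u r" "leq u q0" by blast
 hence "u : PP" "D (num n) u" unfolding D_def using q0 fc_mono le_in by blast+
 then obtain e s where "e <: ap f (pair (num n) (num (card (dom (m u)))))" "leq s u" "leq s e"
 using f[OF num_omega,of n "card (dom (m u))"] by blast
 thus ?thesis using u le_trans num_omega by blast
 qed (use r le_refl in blast)
 qed
 then obtain r k q where "r : G" "k <: omega" "q <: ap f (pair (num n) k)" "leq r q" using G_dir q0(1) by blast
 moreover from this have "q : G" "q : PP" using G_up le_in by blast+
 ultimately show "EX q. pair (num n) q <: U&q : G"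
 unfolding U using pair_mem_cprod[of "num n" q omega "coll PP"] num_omega mem_coll[OF isset_P] by blast
 next
 assume "EX q. pair (num n) q <: U&q : G"
 then obtain q k where q:"q : G" "k <: omega" "q <: ap f (pair (num n) k)" unfolding U by auto
 hence "fc memR q (envl [ta,ck (num n)])" using f[OF num_omega] D_def by (metis mem_omega)
 hence "memR (%i. val (envl [ta,ck (num n)] i))" using fcD Gen_self q(1) by blast
 thus "memW (W.num n) x" unfolding memR_def by (simp add: ta ii_num[symmetric] ii_def)
 qed
 hence "memW (W.num n) x<->(EX k q. k <: omega&ap z k = pair (num 1) (pair (num n) q)&q : G)" for n
 using rng by blast
 thus ?thesis using z(1) unfolding Zset_def by (intro exI[of _ z]) auto
qed

text \<open>The lower bound is given by the Cohen reals. For the upper bound a real is sent to the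
  least ordinal that codes, in the ground model, a nice name from which the generic filter computes
  it; leastness replaces a choice of the name.\<close>

theorem continuum:"W.equinum (W.powset W.omega) W.aleph2"
proof -
 obtain g where g:"fn g Zset dl" "!!x y. x <: Zset==>y <: Zset==>ap g x = ap g y==>x = y" "!!x. x <: Zset==>ap g x <: dl"
 using lepE[OF lep_Zset] by metis
 define R where "R x z<->(ALL n. memW n W.omega-->(memW n x<->(EX k q. memW k W.omega&W.ap z k = W.pair (W.num 1) (W.pair n q)&memW q (val Gname))))" for x z
 define T where "T x a<->(EX z. memW z (ii Zset)&a = W.ap (ii g) z&R x z)" for x a
 have gi:"W.ap (ii g) (ii z) = ii (ap g z)" if "z <: Zset" for z
 using g(1) that ii_app[of g Zset z] ii_func[of g Zset] ap_eq[of g Zset z] W.ap_eq[of "ii g" "ii Zset" "ii z"] unfolding fn_def by simp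
 have ex:"EX a. W.ordinal a&memW a (ii dl)&T x a" if x:"W.ext x <= W.ext W.omega" for x
 proof -
 obtain z where z:"z <: Zset" "!!n. memW (W.num n) x<->(EX k q. k <: omega&ap z k = pair (num 1) (pair (num n) q)&q : G)"
 using rlc[OF x] by blast
 have zf:"func_on z omega" using z(1) unfolding Zset_def by (auto simp: fn_def)
 have zi:"W.ap (ii z) (ii k) = ii (ap z k)" if "k <: omega" for k
 using that zf ii_app[of z omega k] ii_func[of z omega] ap_eq[of z omega k] W.ap_eq[of "ii z" "ii omega" "ii k"] by simp
 have "R x (ii z)" unfolding R_def
 proof (intro allI impI)
 fix n assume "memW n W.omega"
 then obtain n' where n': "n = ii (num n')" by (auto simp: W.mem_omega ii_num)
 have "(EX k q. memW k W.omega&W.ap (ii z) k = W.pair (W.num 1) (W.pair n q)&memW q (val Gname)) <->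
 (EX k q. k <: omega&ap z k = pair (num 1) (pair (num n') q)&q : G)" (is "?A<->?B")
 proof
 assume ?A
 then obtain k q where k:"memW k (ii omega)" "W.ap (ii z) k = W.pair (W.num 1) (W.pair n (ii q))" "q : G"
 using mem_Gname ii_omega by metis
 then obtain k' where k': "k' <: omega" "k = ii k'" using mem_ii by blast
 hence "ii (ap z k') = ii (pair (num 1) (pair (num n') q))" using k(2) zi by (simp add: n' ii_pair ii_num[symmetric] del: ii_inj num.simps W.num.simps)
 thus ?B using k k' by auto
 next
 assume ?B
 then obtain k q where "k <: omega" "ap z k = pair (num 1) (pair (num n') q)" "q : G" by blast
 hence "memW (ii k) W.omega&W.ap (ii z) (ii k) = W.pair (W.num 1) (W.pair n (ii q))&memW (ii q) (val Gname)"
 unfolding zi[OF \<open>k <: omega\<close>] n' mem_Gname by (auto simp: ii_pair ii_num[symmetric] ii_omega[symmetric] simp del: num.simps W.num.simps)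
 thus ?A by blast
 qed
 thus "memW n x<->(EX k q. memW k W.omega&W.ap (ii z) k = W.pair (W.num 1) (W.pair n q)&memW q (val Gname))"
 using z(2)[of n'] n' ii_num by metis
 qed
 hence "T x (ii (ap g z))" unfolding T_def using z(1) gi by (intro exI[of _ "ii z"]) simp
 thus ?thesis using g(3)[OF z(1)] ii_ordinal ord_w2 ordinal_mem by (metis ii_mem)
 qed
 have "W.lep (W.powset W.omega) (ii dl)"
 proof (rule W.lepR[of "%x a. W.ordinal a&T x a&(ALL b. memW b a-->~ T x b)"])
 show "W.dp UNIV (%e. W.ordinal (e 1)&T (e 0) (e 1)&(ALL b. memW b (e 1)-->~ T (e 0) b))"
 unfolding T_def R_def by (intro dpi)
 show "EX a. memW a (ii dl)&W.ordinal a&T x a&(ALL b. memW b a-->~ T x b)" if "memW x (W.powset W.omega)" for x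
 proof -
 obtain a where a:"W.ordinal a" "memW a (ii dl)" "T x a" using ex \<open>memW x _\<close> by auto
 obtain b where "W.ordinal b" "T x b" "!!c. memW c b==>~ T x c" "b = a \<or> memW b a" using W.least_ordinal[of a "T x"] a by metis
 thus ?thesis using a W.ordinal_trans[OF ii_ordinal[OF ord_w2]] by blast
 qed
 show "a = a'" if "W.ordinal a&T x a&(ALL b. memW b a-->~ T x b)" "W.ordinal a'&T x a'&(ALL b. memW b a'-->~ T x b)" for x a a'
 using that W.ordinal_linear[of a a'] by blast
 show "x = x'" if h:"memW x (W.powset W.omega)" "memW x' (W.powset W.omega)"
 "W.ordinal a&T x a&(ALL b. memW b a-->~ T x b)" "W.ordinal a&T x' a&(ALL b. memW b a-->~ T x' b)" for x x' a
 proof -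
 obtain z z' where z:"z <: Zset" "z' <: Zset" "W.ap (ii g) (ii z) = W.ap (ii g) (ii z')" "R x (ii z)" "R x' (ii z')"
 using h unfolding T_def mem_ii by metis
 hence "z = z'" using gi g(2) by simp
 hence "memW n x<->memW n x'" for n using z(4,5) h(1,2) unfolding R_def by (metis W.mem_ext W.mem_powset subsetD)
 thus ?thesis by (rule W.set_eqI)
 qed
 qed
 thus ?thesis unfolding aleph2_W by (rule W.cantor_bernstein[OF _ lep_continuum])
qed

end

section \<open>Real numbers of a structure\<close>

context zf0
begin

definition qn :: "rat => nat \<times> nat \<times> nat" where
 "qn q = (case quotient_of q of (a,b) => (nat a,nat (- a),nat b))"
abbreviation "qa q \<equiv> fst (qn q)"
abbreviation "qb q \<equiv> fst (snd (qn q))"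
abbreviation "qc q \<equiv> snd (snd (qn q))"

lemma qn:"qc q > 0" "q = (of_nat (qa q) - of_nat (qb q)) / of_nat (qc q)" "qa q = 0 \<or> qb q = 0" "coprime (qa q + qb q) (qc q)"
 "rtc q = pair (pair (num (qa q)) (num (qb q))) (num (qc q))"
proof -
 obtain a b where ab:"quotient_of q = (a,b)" by fastforce
 hence b:"b > 0" "q = of_int a / of_int b" "coprime a b" using quotient_of_denom_pos quotient_of_div quotient_of_coprime by auto
 show "qc q > 0" using ab b by (simp add: qn_def)
 have "(of_nat (nat a) :: rat) - of_nat (nat (- a)) = of_int a" by (cases "a >= 0") (simp_all add: of_nat_nat)
 thus "q = (of_nat (qa q) - of_nat (qb q)) / of_nat (qc q)" using ab b by (simp add: qn_def of_nat_nat)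
 show "qa q = 0 \<or> qb q = 0" using ab by (simp add: qn_def) linarith
 have "int (nat a + nat (- a)) = \<bar>a\<bar>" by (simp add: abs_if)
 moreover have "coprime \<bar>a\<bar> b" using b by simp
 ultimately have "coprime (int (nat a + nat (- a))) (int (nat b))" using b by simp
 thus "coprime (qa q + qb q) (qc q)" using ab by (simp only: qn_def case_prod_conv fst_conv snd_conv coprime_int_iff)
 show "rtc q = pair (pair (num (qa q)) (num (qb q))) (num (qc q))" using ab by (simp add: rat_code_def qn_def)
qed

lemma rat_code_inj [simp]:"rtc p = rtc q<->p = q"
 using qn(2)[of p] qn(2)[of q] unfolding qn(5) by (metis num_inj pair_inject)

lemma ex_rat_code: assumes "a = 0 \<or> b = 0" "c > 0" "coprime (a + b) c"
 shows "EX q. rtc q = pair (pair (num a) (num b)) (num c)"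
proof -
 have "coprime (int a - int b) (int c)"
 proof -
 have "\<bar>int a - int b\<bar> = int (a + b)" using assms(1) by auto
 moreover have "coprime (int (a + b)) (int c)" using assms(3) by (simp only: coprime_int_iff)
 ultimately show ?thesis by (metis coprime_abs_left_iff)
 qed
 hence "quotient_of (Fract (int a - int b) (int c)) = (int a - int b,int c)"
 using assms(2) by (simp add: quotient_of_Fract normalize_stable)
 thus ?thesis using assms(1) by (intro exI[of _ "Fract (int a - int b) (int c)"]) (auto simp: rat_code_def)
qed

text \<open>The codes are exactly the reduced ones: nonzero denominator, positive or negative part
  zero, and no common divisor other than 1. As one part vanishes, the absolute value of the
  numerator is \<open>a + b\<close>, so coprimality is a statement of natural arithmetic.\<close>

lemma isset_Rat:"isset (range rtc)"
proof -
 have "isset {z. z <: cprod (cprod omega omega) omega&(EX a b c. z = pair (pair a b) c&c ~= empty&(a = empty \<or> b = empty) &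
 (ALL d x y. d <: omega&x <: omega&y <: omega&nmul d x = nadd a b&nmul d y = c-->d = num 1))}" (is "isset ?S")
 by (rule sep) (intro dpi)
 moreover have "z : range rtc<->z : ?S" for z
 proof
 assume "z : range rtc"
 then obtain q where q:"z = pair (pair (num (qa q)) (num (qb q))) (num (qc q))" using qn(5) by auto
 have "d = num 1" if h:"d <: omega" "x <: omega" "y <: omega" "nmul d x = nadd (num (qa q)) (num (qb q))" "nmul d y = num (qc q)" for d x y
 proof -
 obtain d' x' y' where d:"d = num d'" "x = num x'" "y = num y'" using h mem_omega by auto
 hence "d' * x' = qa q + qb q" "d' * y' = qc q" using h(4,5) by simp_all
 hence "d' dvd qa q + qb q" "d' dvd qc q" by (metis dvd_triv_left)+
 thus ?thesis using qn(4)[of q] d by (simp add: coprime_def)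
 qed
 moreover have "num (qc q) ~= empty" using qn(1)[of q] num_inj[of "qc q" 0] by simp
 moreover have "num (qa q) = empty \<or> num (qb q) = empty" using qn(3)[of q] num.simps(1) by metis
 ultimately show "z : ?S" unfolding q by (auto simp del: num.simps)
 next
 assume "z : ?S"
 then obtain a' b' c' where h0:"z <: cprod (cprod omega omega) omega" "z = pair (pair a' b') c'" "c' ~= empty" "a' = empty \<or> b' = empty"
 "ALL d x y. d <: omega&x <: omega&y <: omega&nmul d x = nadd a' b'&nmul d y = c'-->d = num 1" by blast
 hence "a' <: omega" "b' <: omega" "c' <: omega" by simp_all
 then obtain a b c where abc:"a' = num a" "b' = num b" "c' = num c" unfolding mem_omega by blast
 note z = h0(2)[unfolded abc] and h = h0(3,4)[unfolded abc] h0(5)[unfolded abc,rule_format,OF conjI[OF _ conjI[OF _ conjI[OF _ conjI]]]]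
 have z0:"num k = empty<->k = 0" for k using num_inj[of k 0] by simp
 have "a = 0 \<or> b = 0" "c > 0" using h(1,2) by (simp_all add: z0)
 moreover have "coprime (a + b) c"
 proof (rule coprimeI)
 fix d assume "d dvd a + b" "d dvd c"
 then obtain x y where "a + b = d * x" "c = d * y" by (auto elim!: dvdE)
 hence "num d = num 1" using h(3)[of "num d" "num x" "num y"] by (simp del: num.simps)
 thus "d dvd 1" by (simp del: num.simps)
 qed
 ultimately show "z : range rtc" using ex_rat_code z by (metis rangeI)
 qed
 ultimately show ?thesis by (metis (no_types,lifting) Collect_mem_eq Collect_cong)
qed

definition Rat :: 'v where "Rat = coll (range rtc)"
lemma mem_Rat:"z <: Rat<->(EX q. z = rtc q)" unfolding Rat_def by (auto simp: mem_coll isset_Rat)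

text \<open>A code stands for \<open>(a - b) / c\<close>. Order, sum and product are stated with
  denominators cleared and negative terms moved to the other side, which leaves natural
  arithmetic.\<close>

definition QLT :: "'v => 'v => bool" where
 "QLT x y<->(EX a b c a' b' c'. x = pair (pair a b) c&y = pair (pair a' b') c'&nadd (nmul a c') (nmul b' c) <: nadd (nmul a' c) (nmul b c'))"
definition QADD :: "'v => 'v => 'v => bool" where
 "QADD x y z<->(EX a b c a' b' c' a'' b'' c''. x = pair (pair a b) c&y = pair (pair a' b') c'&z = pair (pair a'' b'') c'' &
 nadd (nadd (nmul a (nmul c' c'')) (nmul a' (nmul c c''))) (nmul b'' (nmul c c')) =
 nadd (nadd (nmul b (nmul c' c'')) (nmul b' (nmul c c''))) (nmul a'' (nmul c c')))"
definition QMUL :: "'v => 'v => 'v => bool" where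
 "QMUL x y z<->(EX a b c a' b' c' a'' b'' c''. x = pair (pair a b) c&y = pair (pair a' b') c'&z = pair (pair a'' b'') c'' &
 nadd (nadd (nmul (nmul a a') c'') (nmul (nmul b b') c'')) (nmul b'' (nmul c c')) =
 nadd (nadd (nmul (nmul a b') c'') (nmul (nmul b a') c'')) (nmul a'' (nmul c c')))"

lemma dp_QLT [dpi]:"dt C t==>dt C u==>dp C (%e. QLT (t e) (u e))"
 by (rule dp_lift2[where Q = QLT]) (unfold QLT_def,intro dpi)
lemma dp_QADD [dpi]:"dt C t==>dt C u==>dt C v==>dp C (%e. QADD (t e) (u e) (v e))"
 by (rule dp_lift3[where Q = QADD]) (unfold QADD_def,intro dpi)
lemma dp_QMUL [dpi]:"dt C t==>dt C u==>dt C v==>dp C (%e. QMUL (t e) (u e) (v e))"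
 by (rule dp_lift3[where Q = QMUL]) (unfold QMUL_def,intro dpi)

lemma frac_arith: fixes a b c a' b' c' a'' b'' c'' :: nat
 assumes "c > 0" "c' > 0" "c'' > 0"
 shows "(of_nat a - of_nat b) / of_nat c < ((of_nat a' - of_nat b') / of_nat c' :: rat)<->a * c' + b' * c < a' * c + b * c'"
 "(of_nat a - of_nat b) / of_nat c + (of_nat a' - of_nat b') / of_nat c' = ((of_nat a'' - of_nat b'') / of_nat c'' :: rat) <->
 a * (c' * c'') + a' * (c * c'') + b'' * (c * c') = b * (c' * c'') + b' * (c * c'') + a'' * (c * c')"
 "(of_nat a - of_nat b) / of_nat c * ((of_nat a' - of_nat b') / of_nat c') = ((of_nat a'' - of_nat b'') / of_nat c'' :: rat) <->
 a * a' * c'' + b * b' * c'' + b'' * (c * c') = a * b' * c'' + b * a' * c'' + a'' * (c * c')"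
proof -
 have p:"(of_nat c :: rat) > 0" "(of_nat c' :: rat) > 0" "(of_nat c'' :: rat) > 0" using assms by auto
 have "a * c' + b' * c < a' * c + b * c'<->(of_nat (a * c' + b' * c) :: rat) < of_nat (a' * c + b * c')" by (simp only: of_nat_less_iff)
 thus "(of_nat a - of_nat b) / of_nat c < ((of_nat a' - of_nat b') / of_nat c' :: rat)<->a * c' + b' * c < a' * c + b * c'"
 using p by (simp add: field_simps)
 have "x = y<->(of_nat x :: rat) = of_nat y" for x y :: nat by simp
 note eq = this
 show "(of_nat a - of_nat b) / of_nat c + (of_nat a' - of_nat b') / of_nat c' = ((of_nat a'' - of_nat b'') / of_nat c'' :: rat) <->
 a * (c' * c'') + a' * (c * c'') + b'' * (c * c') = b * (c' * c'') + b' * (c * c'') + a'' * (c * c')"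
 unfolding eq[of "_ + _"] using p by (simp add: divide_simps) (simp add: algebra_simps; linarith?)
 show "(of_nat a - of_nat b) / of_nat c * ((of_nat a' - of_nat b') / of_nat c') = ((of_nat a'' - of_nat b'') / of_nat c'' :: rat) <->
 a * a' * c'' + b * b' * c'' + b'' * (c * c') = a * b' * c'' + b * a' * c'' + a'' * (c * c')"
 unfolding eq[of "_ + _"] using p by (simp add: divide_simps) (simp add: algebra_simps; linarith?)
qed

lemma QLT_iff:"QLT (rtc p) (rtc q)<->p < q"
 unfolding QLT_def qn(5) by (simp add: num_mem del: num.simps) (subst (2) qn(2)[of p],subst (2) qn(2)[of q],subst frac_arith,auto simp: qn(1))
lemma QADD_iff:"QADD (rtc p) (rtc q) (rtc r)<->p + q = r"
proof -
 have "QADD (rtc p) (rtc q) (rtc r)<->qa p * (qc q * qc r) + qa q * (qc p * qc r) + qb r * (qc p * qc q) = qb p * (qc q * qc r) + qb q * (qc p * qc r) + qa r * (qc p * qc q)"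
 unfolding QADD_def qn(5) by (simp del: num.simps)
 also have "...<->p + q = r" 
 by (rule frac_arith(2)[OF qn(1)[of p] qn(1)[of q] qn(1)[of r],of "qa p" "qb p" "qa q" "qb q" "qa r" "qb r",
 folded qn(2)[of p] qn(2)[of q] qn(2)[of r],symmetric])
 finally show ?thesis .
qed
lemma QMUL_iff:"QMUL (rtc p) (rtc q) (rtc r)<->p * q = r"
proof -
 have "QMUL (rtc p) (rtc q) (rtc r)<->qa p * qa q * qc r + qb p * qb q * qc r + qb r * (qc p * qc q) = qa p * qb q * qc r + qb p * qa q * qc r + qa r * (qc p * qc q)"
 unfolding QMUL_def qn(5) by (simp del: num.simps)
 also have "...<->p * q = r" 
 by (rule frac_arith(3)[OF qn(1)[of p] qn(1)[of q] qn(1)[of r],of "qa p" "qb p" "qa q" "qb q" "qa r" "qb r",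
 folded qn(2)[of p] qn(2)[of q] qn(2)[of r],symmetric])
 finally show ?thesis .
qed

subsection \<open>Cuts\<close>

abbreviation "isr c \<equiv> (EX r. is_real c r)"

lemma mem_real:"is_real c r==>z <: c<->(EX q. z = rtc q&of_rat q < r)"
 unfolding is_real_def by (auto simp: image_iff simp flip: mem_ext)
lemma rat_mem_real:"is_real c r==>rtc q <: c<->of_rat q < r" by (simp add: mem_real)

lemma is_real_unique: assumes "is_real c r" "is_real c s" shows "r = s"
proof -
 have "~ x < y" if h:"is_real c x" "is_real c y" for x y
 proof
 assume "x < y"
 then obtain q where "x < of_rat q" "of_rat q < y" using of_rat_dense by blast
 thus False using rat_mem_real[OF h(1),of q] rat_mem_real[OF h(2),of q] by simp
 qed
 thus ?thesis using assms by (meson linorder_neqE_linordered_idom)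
qed
lemma is_real_inj:"is_real c r==>is_real d r==>c = d" unfolding is_real_def by (intro ext_inj) simp
lemma real_val_eq:"is_real c r==>real_val c = r" unfolding real_val_def using is_real_unique by blast
lemma real_code_eq:"is_real c r==>rlc r = c" unfolding real_code_def using is_real_inj by blast
lemma is_real_code:"r : Reals_in==>is_real (rlc r) r" unfolding Reals_in_def using real_code_eq by auto
lemma real_val_code [simp]:"r : Reals_in==>real_val (rlc r) = r" using real_val_eq is_real_code by blast
lemma real_code_inj:"r : Reals_in==>s : Reals_in==>rlc r = rlc s<->r = s" by (metis real_val_code)
lemma Reals_inI:"isset {z. EX q. z = rtc q&of_rat q < r}==>r : Reals_in"
proof -
 have e:"{z. EX q. z = rtc q&of_rat q < r} = rtc ` {q. of_rat q < r}" by auto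
 assume "isset {z. EX q. z = rtc q&of_rat q < r}"
 thus ?thesis unfolding isset_def Reals_in_def is_real_def e by simp
qed
lemma isr_val:"isr c==>real_val c : Reals_in&rlc (real_val c) = c&is_real c (real_val c)"
 using real_val_eq real_code_eq unfolding Reals_in_def by auto

lemma Reals_sep: assumes "dp UNIV (%e. Q (e 0))" "!!q. Q (rtc q)<->of_rat q < r" shows "r : Reals_in"
proof (rule Reals_inI)
 have "isset {z. z <: Rat&Q z}" by (rule sep[OF assms(1)])
 moreover have "{z. z <: Rat&Q z} = {z. EX q. z = rtc q&of_rat q < r}" using assms(2) by (auto simp: mem_Rat)
 ultimately show "isset {z. EX q. z = rtc q&of_rat q < r}" by simp
qed

text \<open>These are Dedekind's conditions on a left cut; the real number is the supremum taken in
  HOL. They make being a real of the structure definable.\<close>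

lemma isr_iff:"isr c<->(ALL z. z <: c-->z <: Rat)&(EX z. z <: c)&(EX z. z <: Rat&~ z <: c) &
 (ALL z y. z <: c&y <: Rat&QLT y z-->y <: c)&(ALL z. z <: c-->(EX y. y <: c&QLT z y))" (is "_<->?R")
proof
 assume "isr c"
 then obtain r where r:"is_real c r" by blast
 obtain q0 where q0:"of_rat q0 < r" using of_rat_dense[of "r - 1" r] by auto
 obtain q1 where q1:"~ of_rat q1 < r" using of_rat_dense[of r "r + 1"] by (meson less_add_one not_less_iff_gr_or_eq)
 have up:"EX q'. of_rat q' < r&q < q'" if "of_rat q < r" for q
 using of_rat_dense[OF that] by (auto simp: of_rat_less)
 have down:"of_rat p < r" if "of_rat q < r" "p < q" for p q
 using that of_rat_less[of p q,where ?'a = real] by linarith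
 note mr = mem_real[OF r]
 show ?R
 proof (intro conjI allI impI)
 show "z <: Rat" if "z <: c" for z using that mr mem_Rat by blast
 show "EX z. z <: c" using q0 mr by blast
 show "EX z. z <: Rat&~ z <: c" using q1 rat_mem_real[OF r] mem_Rat by blast
 show "y <: c" if h:"z <: c&y <: Rat&QLT y z" for z y
 proof -
 obtain q where q:"z = rtc q" "of_rat q < r" using h mr by blast
 obtain p where p:"y = rtc p" using h mem_Rat by blast
 thus ?thesis using down[OF q(2),of p] h q rat_mem_real[OF r] by (simp add: QLT_iff)
 qed
 show "EX y. y <: c&QLT z y" if h:"z <: c" for z
 proof -
 obtain q where q:"z = rtc q" "of_rat q < r" using h mr by blast
 obtain q' where "of_rat q' < r" "q < q'" using up[OF q(2)] by blast
 thus ?thesis using q rat_mem_real[OF r] QLT_iff by blast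
 qed
 qed
next
 assume R: ?R
 define S where "S = {of_rat q :: real | q. rtc q <: c}"
 obtain q0 where q0:"rtc q0 <: c" using R mem_Rat by metis
 obtain q1 where q1:"~ rtc q1 <: c" using R mem_Rat by metis
 have down:"rtc p <: c" if "rtc q <: c" "p < q" for p q using R that QLT_iff mem_Rat by metis
 have ub:"x <= of_rat q1" if "x : S" for x
 using that q1 down unfolding S_def by (auto simp: of_rat_less_eq) (metis linorder_not_le)
 have S:"S ~= {}" "bdd_above S" using q0 ub unfolding S_def bdd_above_def by blast+
 have "rtc q <: c<->of_rat q < Sup S" for q
 proof
 assume "rtc q <: c"
 then obtain y where "y <: c" "QLT (rtc q) y" using R by blast
 then obtain q' where "rtc q' <: c" "q < q'" using R mem_Rat QLT_iff by metis
 hence "of_rat q' <= Sup S" using S cSup_upper[of "of_rat q'" S] unfolding S_def by blast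
 thus "of_rat q < Sup S" using \<open>q < q'\<close> by (simp add: of_rat_less order.strict_trans2[of "of_rat q" "of_rat q'"])
 next
 assume "of_rat q < Sup S"
 then obtain q' where "rtc q' <: c" "of_rat q < (of_rat q' :: real)" using less_cSup_iff[OF S] unfolding S_def by auto
 thus "rtc q <: c" using down by (simp add: of_rat_less)
 qed
 moreover have "EX q. z = rtc q" if "z <: c" for z using R that mem_Rat by blast
 ultimately have "is_real c (Sup S)" unfolding is_real_def by (auto simp: image_iff; metis)
 thus "isr c" by blast
qed

lemma dt_Rat [dpi]:"dt UNIV (%e. Rat)" by (rule dt_const_UNIV)
lemma dp_isr [dpi]:"dt UNIV t==>dp UNIV (%e. isr (t e))"
 by (rule dp_lift1[where Q = "%c. isr c"]) (simp only: isr_iff,intro dpi)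

lemma isset_reals:"isset {c. isr c}"
proof (rule isset_sub[OF isset_ext[of "powset Rat"]])
 have "z <: Rat" if "is_real c r" "z <: c" for z c r using mem_real[OF that(1)] that(2) mem_Rat by blast
 thus "{c. isr c} <= ext (powset Rat)" by auto
 show "dp UNIV (%e. e 0 : {c. isr c})" unfolding mem_Collect_eq by (intro dpi)
qed
lemma mem_reals:"c <: reals<->isr c" unfolding reals_def by (simp add: mem_coll isset_reals)
lemma mem_reals': "c <: reals<->(\<exists>r\<in>Reals_in. c = rlc r)"
 unfolding mem_reals by (metis isr_val is_real_code)
lemma real_code_reals [simp]:"r : Reals_in==>rlc r <: reals" using mem_reals' by blast

lemma rat_Reals:"of_rat p : Reals_in"
 by (rule Reals_sep[of "%z. QLT z (rtc p)"]) (intro dpi,simp add: QLT_iff of_rat_less)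

lemma add_cut: assumes "is_real c r" "is_real d s"
 shows "(EX x y. x <: c&y <: d&QADD x y (rtc q))<->of_rat q < r + s"
proof
 assume "EX x y. x <: c&y <: d&QADD x y (rtc q)"
 thus "of_rat q < r + s" using mem_real[OF assms(1)] mem_real[OF assms(2)] by (auto simp: QADD_iff of_rat_add)
next
 assume "of_rat q < r + s"
 then obtain p where p:"of_rat q - s < of_rat p" "of_rat p < r" using of_rat_dense[of "of_rat q - s" r] by auto
 hence "rtc p <: c" "rtc (q - p) <: d" using rat_mem_real[OF assms(1)] rat_mem_real[OF assms(2)] by (auto simp: of_rat_diff)
 moreover have "QADD (rtc p) (rtc (q - p)) (rtc q)" by (simp add: QADD_iff)
 ultimately show "EX x y. x <: c&y <: d&QADD x y (rtc q)" by blast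
qed

text \<open>A bilinear function on a rectangle is bounded below by its values at the
  corners.\<close>

lemma mult_corners: fixes r s q :: real
 assumes "a <= r" "r <= b" "a' <= s" "s <= b'" "q < a * a'" "q < a * b'" "q < b * a'" "q < b * b'" shows "q < r * s"
proof -
 have l:"q < x * s" if "q < x * a'" "q < x * b'" for x
 proof (cases "x >= 0")
 case True thus ?thesis using that mult_left_mono[OF assms(3) True] by linarith
 next
 case False thus ?thesis using that mult_left_mono_neg[OF assms(4),of x] by linarith
 qed
 have 1:"q < a * s" "q < b * s" using l assms by auto
 show ?thesis
 proof (cases "s >= 0")
 case True thus ?thesis using 1 mult_right_mono[OF assms(1) True] by linarith
 next
 case False thus ?thesis using 1 mult_right_mono_neg[OF assms(2),of s] by linarith
 qed
qed

text \<open>Multiplication by interval arithmetic: \<open>z\<close> lies below the products at the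
  four corners of a rational box around the two numbers. No distinction of signs is needed.\<close>

definition mcut :: "'v => 'v => 'v => bool" where
 "mcut c d z<->(EX a b a' b' p1 p2 p3 p4. a <: c&b <: Rat&~ b <: c&a' <: d&b' <: Rat&~ b' <: d &
 p1 <: Rat&p2 <: Rat&p3 <: Rat&p4 <: Rat&QMUL a a' p1&QMUL a b' p2&QMUL b a' p3&QMUL b b' p4&QLT z p1&QLT z p2&QLT z p3&QLT z p4)"

lemma mult_cut: assumes "is_real c r" "is_real d s" shows "mcut c d (rtc q)<->of_rat q < r * s"
proof
 assume "mcut c d (rtc q)"
 then obtain a b a' b' where "of_rat a < r" "~ of_rat b < r" "of_rat a' < s" "~ of_rat b' < s" "q < a * a'" "q < a * b'" "q < b * a'" "q < b * b'"
 using mem_real[OF assms(1)] mem_real[OF assms(2)] unfolding mcut_def mem_Rat by (auto simp: QMUL_iff QLT_iff)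
 thus "of_rat q < r * s"
 by (intro mult_corners[of "of_rat a" r "of_rat b" "of_rat a'" s "of_rat b'"]) (auto simp: of_rat_less simp flip: of_rat_mult)
next
 assume q:"of_rat q < r * s"
 \<comment> \<open>A perturbation of both factors by less than \<open>e\<close>, with
   \<open>e\<close> at most 1, changes the product by at most \<open>e\<close> times the sum of the
   absolute values and 1. The summand 2 makes this strictly less than the available room.\<close>
 define e where "e = min 1 ((r * s - of_rat q) / (\<bar>r\<bar> + \<bar>s\<bar> + 2))"
 have e:"0 < e" "e <= 1" "e * (\<bar>r\<bar> + \<bar>s\<bar> + 2) <= r * s - of_rat q" 
 proof -
 have M:"0 < \<bar>r\<bar> + \<bar>s\<bar> + 2" by (simp add: add_nonneg_pos)
 show "0 < e" "e <= 1" using q M unfolding e_def by simp_all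
 have "e <= (r * s - of_rat q) / (\<bar>r\<bar> + \<bar>s\<bar> + 2)" unfolding e_def by simp
 thus "e * (\<bar>r\<bar> + \<bar>s\<bar> + 2) <= r * s - of_rat q" using M by (simp only: pos_le_divide_eq)
 qed
 obtain a where a:"r - e < of_rat a" "of_rat a < r" using of_rat_dense[of "r - e" r] e by auto
 obtain b where b:"r < of_rat b" "of_rat b < r + e" using of_rat_dense[of r "r + e"] e by auto
 obtain a' where a': "s - e < of_rat a'" "of_rat a' < s" using of_rat_dense[of "s - e" s] e by auto
 obtain b' where b': "s < of_rat b'" "of_rat b' < s + e" using of_rat_dense[of s "s + e"] e by auto
 have near:"q < x * y" if "\<bar>of_rat x - r\<bar> < e" "\<bar>of_rat y - s\<bar> < e" for x y
 proof -
 have "\<bar>of_rat x * of_rat y - r * s\<bar> = \<bar>(of_rat x - r) * s + r * (of_rat y - s) + (of_rat x - r) * (of_rat y - s)\<bar>" by (simp add: algebra_simps)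
 also have "... <= \<bar>of_rat x - r\<bar> * \<bar>s\<bar> + \<bar>r\<bar> * \<bar>of_rat y - s\<bar> + \<bar>of_rat x - r\<bar> * \<bar>of_rat y - s\<bar>"
 by (simp only: abs_mult[symmetric]; linarith)
 also have "... <= e * \<bar>s\<bar> + \<bar>r\<bar> * e + e * 1"
 using that e by (intro add_mono mult_mono) auto
 also have "... < e * (\<bar>r\<bar> + \<bar>s\<bar> + 2)" using e by (simp add: algebra_simps)
 finally have "of_rat q < (of_rat x * of_rat y :: real)" using e by linarith
 thus ?thesis by (simp add: of_rat_less flip: of_rat_mult)
 qed
 have P1:"q < a * a'" "q < a * b'" "q < b * a'" "q < b * b'" using a b a' b' by (auto intro!: near)
 have P2:"rtc a <: c" "~ rtc b <: c" "rtc a' <: d" "~ rtc b' <: d"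
 using a b a' b' rat_mem_real[OF assms(1)] rat_mem_real[OF assms(2)] by auto
 have P3:"rtc x <: Rat" for x using mem_Rat by blast
 show "mcut c d (rtc q)" unfolding mcut_def
 by (rule exI[of _ "rtc a"],rule exI[of _ "rtc b"],rule exI[of _ "rtc a'"],rule exI[of _ "rtc b'"],rule exI[of _ "rtc (a * a')"],rule exI[of _ "rtc (a * b')"],rule exI[of _ "rtc (b * a')"],rule exI[of _ "rtc (b * b')"]) (simp add: QMUL_iff QLT_iff P1 P2 P3)
qed

lemma dp_mcut [dpi]:"dt UNIV t==>dt UNIV u==>dt UNIV v==>dp UNIV (%e. mcut (t e) (u e) (v e))"
 by (rule dp_lift3[where Q = mcut]) (unfold mcut_def,intro dpi)

lemma Reals_add: assumes "r : Reals_in" "s : Reals_in" shows "r + s : Reals_in"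
 by (rule Reals_sep[OF _ add_cut[OF is_real_code[OF assms(1)] is_real_code[OF assms(2)]]]) (intro dpi)
lemma Reals_mult: assumes "r : Reals_in" "s : Reals_in" shows "r * s : Reals_in"
 by (rule Reals_sep[OF _ mult_cut[OF is_real_code[OF assms(1)] is_real_code[OF assms(2)]]]) (intro dpi)
lemma Reals_of_int:"of_int n : Reals_in" using rat_Reals[of "of_int n"] by simp
lemma Reals_const:"0 : Reals_in" "1 : Reals_in" "of_nat n : Reals_in" using Reals_of_int[of 0] Reals_of_int[of 1] Reals_of_int[of "int n"] by auto
lemma Reals_minus:"r : Reals_in==>- r : Reals_in" using Reals_mult[OF Reals_of_int[of "-1"]] by simp
definition rad :: "'v => 'v => 'v" where "rad c d = (if isr c&isr d then rlc (real_val c + real_val d) else empty)"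
definition rmu :: "'v => 'v => 'v" where "rmu c d = (if isr c&isr d then rlc (real_val c * real_val d) else empty)"

lemma isr_code:"r : Reals_in==>isr (rlc r)" using is_real_code by blast
lemma rad_code [simp]:"r : Reals_in==>s : Reals_in==>rad (rlc r) (rlc s) = rlc (r + s)"
 by (simp add: rad_def isr_code)
lemma rmu_code [simp]:"r : Reals_in==>s : Reals_in==>rmu (rlc r) (rlc s) = rlc (r * s)"
 by (simp add: rmu_def isr_code)

lemma real_code_cut: assumes "r : Reals_in" "!!q. Q (rtc q)<->of_rat q < r"
 shows "y = rlc r<->(ALL z. z <: y<->z <: Rat&Q z)"
proof -
 have "z <: rlc r<->z <: Rat&Q z" for z using mem_real[OF is_real_code[OF assms(1)]] assms(2) by (auto simp: mem_Rat)
 thus ?thesis using set_eqI[of y "rlc r"] by auto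
qed

lemma dt_rad [dpi]:"dt UNIV t==>dt UNIV u==>dt UNIV (%e. rad (t e) (u e))"
proof (rule dt_lift2[where F = rad])
 have "y = rad c d<->(isr c&isr d&(ALL z. z <: y<->z <: Rat&(EX x x'. x <: c&x' <: d&QADD x x' z))) \<or> (~ (isr c&isr d)&y = empty)" for y c d
 proof (cases "isr c&isr d")
 case True
 hence "is_real c (real_val c)" "is_real d (real_val d)" "real_val c + real_val d : Reals_in" using isr_val Reals_add by blast+
 thus ?thesis using real_code_cut[OF _ add_cut[of c _ d],of "real_val c" "real_val d" y] True by (simp add: rad_def)
 next
 case False thus ?thesis by (simp only: rad_def if_False) blast
 qed
 thus "dp UNIV (%e. e 0 = rad (e 1) (e 2))" by (simp only:) (intro dpi)
qed
lemma dt_rmu [dpi]:"dt UNIV t==>dt UNIV u==>dt UNIV (%e. rmu (t e) (u e))"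
proof (rule dt_lift2[where F = rmu])
 have "y = rmu c d<->(isr c&isr d&(ALL z. z <: y<->z <: Rat&mcut c d z)) \<or> (~ (isr c&isr d)&y = empty)" for y c d
 proof (cases "isr c&isr d")
 case True
 hence "is_real c (real_val c)" "is_real d (real_val d)" "real_val c * real_val d : Reals_in" using isr_val Reals_mult by blast+
 thus ?thesis using real_code_cut[OF _ mult_cut[of c _ d],of "real_val c" "real_val d" y] True by (simp add: rmu_def)
 next
 case False thus ?thesis by (simp only: rmu_def if_False) blast
 qed
 thus "dp UNIV (%e. e 0 = rmu (e 1) (e 2))" by (simp only:) (intro dpi)
qed

definition rlt :: "'v => 'v => bool" where "rlt c d<->(EX z. z <: Rat&z <: d&~ z <: c)"
lemma dp_rlt [dpi]:"dt UNIV t==>dt UNIV u==>dp UNIV (%e. rlt (t e) (u e))"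
 by (rule dp_lift2[where Q = rlt]) (unfold rlt_def,intro dpi)
lemma rlt_code: assumes "r : Reals_in" "s : Reals_in" shows "rlt (rlc r) (rlc s)<->r < s"
proof -
 have "rlt (rlc r) (rlc s)<->(EX q. of_rat q < s&~ of_rat q < r)"
 unfolding rlt_def mem_Rat using rat_mem_real[OF is_real_code[OF assms(1)]] rat_mem_real[OF is_real_code[OF assms(2)]] by auto
 also have "...<->r < s" using of_rat_dense[of r s] by (meson dual_order.strict_trans linorder_not_less order.strict_trans1 less_imp_le)
 finally show ?thesis .
qed

definition rq :: "'v => 'v" where "rq z = coll {y. y <: Rat&QLT y z}"
lemma rq_code:"rq (rtc q) = rlc (of_rat q)"
proof -
 have "ALL z. z <: rq (rtc q)<->z <: Rat&QLT z (rtc q)" unfolding rq_def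
 using mem_coll[OF sep[of "%y. QLT y (rtc q)" Rat]] dp_QLT[OF dt_var dt_const_UNIV] by blast
 thus ?thesis using real_code_cut[OF rat_Reals,of "%z. QLT z (rtc q)" q "rq (rtc q)"] by (simp add: QLT_iff of_rat_less)
qed
lemma dt_rq [dpi]:"dt UNIV t==>dt UNIV (%e. rq (t e))"
 unfolding rq_def by (rule dt_coll_lift1) (rule sep,(intro dpi)+)

lemma cring_scalars:"cring scalars"
 unfolding scalars_def
 by (intro cringI abelian_groupI comm_monoidI)
 (auto simp: Reals_add Reals_mult Reals_const algebra_simps intro!: bexI[of _ "- _"] Reals_minus)

end

section \<open>A smooth norm from a graph\<close>

text \<open>Weights \<open>w\<close> of total mass at most one on every clique define a lattice norm through
 \<open>inf (\<Sum> x\<^sup>4 / w)\<close>: it is the \<open>\<ell>\<^sub>2\<close> norm on cliques and the \<open>\<ell>\<^sub>4\<close> norm on anticliques.\<close>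

definition feas :: "('i => 'i => bool) => 'i set => ('i => real) => bool" where
 "feas Q F w<->(\<forall>i\<in>F. 0 < w i)&(\<forall>K\<subseteq>F. (\<forall>i\<in>K. \<forall>j\<in>K. i ~= j-->Q i j)-->(\<Sum>i\<in>K. w i) <= 1)"
definition N4 :: "('i => 'i => bool) => 'i set => ('i => real) => real" where
 "N4 Q F x = Inf {\<Sum>i\<in>F. x i ^ 4 / w i | w. feas Q F w}"
definition nf :: "('i => 'i => bool) => 'i set => ('i => real) => real" where
 "nf Q F x = root 4 (N4 Q F x)"

lemma feas_mono: assumes "feas Q F w" "E <= F" shows "feas Q E w"
 unfolding feas_def
proof (intro conjI ballI allI impI)
 show "0 < w i" if "i : E" for i using assms that unfolding feas_def by auto
 show "(\<Sum>i\<in>K. w i) <= 1" if "K <= E" "\<forall>i\<in>K. \<forall>j\<in>K. i ~= j-->Q i j" for K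
 by (rule assms(1)[unfolded feas_def,THEN conjunct2,rule_format]) (use assms(2) that in auto)
qed
lemma feas_le_1:"feas Q F w==>i : F==>w i <= 1"
proof -
 assume w:"feas Q F w" and i:"i : F"
 have "(\<Sum>i\<in>{i}. w i) <= 1" by (rule w[unfolded feas_def,THEN conjunct2,rule_format]) (use i in auto)
 thus ?thesis by simp
qed
lemma feas_convex: assumes "feas Q F w" "feas Q F w'" "0 < a" "0 < (b::real)"
 shows "feas Q F (%i. (a * w i + b * w' i) / (a + b))"
 unfolding feas_def
proof (intro conjI ballI allI impI)
 show "0 < (a * w i + b * w' i) / (a + b)" if "i : F" for i
 using assms that unfolding feas_def by (auto intro!: divide_pos_pos add_pos_pos mult_pos_pos)
 fix K assume K:"K <= F" "\<forall>i\<in>K. \<forall>j\<in>K. i ~= j-->Q i j"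
 hence s:"(\<Sum>i\<in>K. w i) <= 1" "(\<Sum>i\<in>K. w' i) <= 1" using assms unfolding feas_def by auto
 have "(\<Sum>i\<in>K. (a * w i + b * w' i) / (a + b)) = (a * (\<Sum>i\<in>K. w i) + b * (\<Sum>i\<in>K. w' i)) / (a + b)"
 by (simp add: sum_divide_distrib[symmetric] sum.distrib sum_distrib_left)
 also have "... <= (a * 1 + b * 1) / (a + b)"
 using assms s by (intro divide_right_mono add_mono mult_left_mono) auto
 finally show "(\<Sum>i\<in>K. (a * w i + b * w' i) / (a + b)) <= 1" using assms by simp
qed

lemma feas_const: assumes "finite F" shows "feas Q F (%i. 1 / (real (card F) + 1))"
 unfolding feas_def
proof (intro conjI ballI allI impI)
 fix K assume "K <= F"
 hence "card K <= card F" using assms card_mono by blast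
 thus "(\<Sum>i\<in>K. 1 / (real (card F) + 1)) <= 1" by simp
qed simp

lemma feas_sum_nonneg:"feas Q F w==>0 <= (\<Sum>i\<in>F. x i ^ 4 / w i)"
 unfolding feas_def by (intro sum_nonneg divide_nonneg_pos) auto

lemma N4_lower:"feas Q F w==>N4 Q F x <= (\<Sum>i\<in>F. x i ^ 4 / w i)"
 unfolding N4_def by (rule cInf_lower) (auto intro: bdd_belowI[of _ 0] feas_sum_nonneg)
lemma N4_greatest:"finite F==>(!!w. feas Q F w==>c <= (\<Sum>i\<in>F. x i ^ 4 / w i))==>c <= N4 Q F x"
 unfolding N4_def by (rule cInf_greatest) (use feas_const in blast)+
lemma N4_nonneg:"finite F==>0 <= N4 Q F x" by (rule N4_greatest) (auto intro: feas_sum_nonneg)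
lemma N4_approx: assumes "finite F" "N4 Q F x < c" shows "EX w. feas Q F w&(\<Sum>i\<in>F. x i ^ 4 / w i) < c"
 using N4_greatest[OF assms(1),of Q c x] assms(2) by (meson linorder_not_le)

lemma nf_nonneg:"finite F==>0 <= nf Q F x" unfolding nf_def by (simp add: N4_nonneg)
lemma nf_pow4:"finite F==>nf Q F x ^ 4 = N4 Q F x" unfolding nf_def by (simp add: N4_nonneg)
lemma nf_leI: assumes "finite F" "feas Q F w" "(\<Sum>i\<in>F. x i ^ 4 / w i) <= a ^ 4" "0 <= a" shows "nf Q F x <= a"
proof -
 have "nf Q F x ^ 4 <= a ^ 4" using N4_lower[OF assms(2)] assms nf_pow4 by (metis order_trans)
 thus ?thesis using power_mono_iff[of "nf Q F x" a 4] nf_nonneg[OF assms(1)] assms(4) by simp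
qed
lemma nf_lessE: assumes "finite F" "nf Q F x < a"
 obtains w where "feas Q F w" "(\<Sum>i\<in>F. x i ^ 4 / w i) <= a ^ 4"
proof -
 have "N4 Q F x < a ^ 4" using assms power_strict_mono[of "nf Q F x" a 4] nf_nonneg[OF assms(1)] nf_pow4[OF assms(1)] by auto
 thus ?thesis using N4_approx[OF assms(1)] that by (meson less_imp_le)
qed
lemma nf_geI: assumes "finite F" "!!w. feas Q F w==>a ^ 4 <= (\<Sum>i\<in>F. x i ^ 4 / w i)" shows "a <= nf Q F x"
proof -
 have "a ^ 4 <= nf Q F x ^ 4" unfolding nf_pow4[OF assms(1)] by (rule N4_greatest[OF assms])
 thus ?thesis using power_mono_iff[of a "nf Q F x" 4] nf_nonneg[OF assms(1),of Q x] by (cases "0 <= a") auto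
qed

lemma nf_mono: assumes "finite F" "E <= F" shows "nf Q E x <= nf Q F x"
proof (rule nf_geI[OF assms(1)])
 fix w assume w:"feas Q F w"
 have fE:"finite E" using assms finite_subset by blast
 have "nf Q E x ^ 4 <= (\<Sum>i\<in>E. x i ^ 4 / w i)" unfolding nf_pow4[OF fE] by (rule N4_lower[OF feas_mono[OF w assms(2)]])
 also have "... <= (\<Sum>i\<in>F. x i ^ 4 / w i)" using assms w unfolding feas_def by (intro sum_mono2 divide_nonneg_pos) auto
 finally show "nf Q E x ^ 4 <= (\<Sum>i\<in>F. x i ^ 4 / w i)" .
qed

lemma nf_cong:"(!!i. i : F==>x i = y i)==>nf Q F x = nf Q F y"
 unfolding nf_def N4_def by (auto intro!: arg_cong[where f = Inf] cong: sum.cong)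

text \<open>The Cauchy-Schwarz inequality in the form of Titu and Engel, for two terms.\<close>

lemma titu: fixes u v a b w w' :: real assumes "0 < w" "0 < w'" "0 < a" "0 < b"
 shows "(u + v)\<^sup>2 / (a * w + b * w') <= u\<^sup>2 / (a * w) + v\<^sup>2 / (b * w')"
proof -
 define p q where "p = a * w" and "q = b * w'"
 have pq:"0 < p" "0 < q" using assms by (auto simp: p_def q_def)
 have "(u\<^sup>2 / p + v\<^sup>2 / q) * (p + q) - (u + v)\<^sup>2 = (u * q - v * p)\<^sup>2 / (p * q)"
 using pq by (simp add: field_simps power2_eq_square)
 moreover have "0 <= (u * q - v * p)\<^sup>2 / (p * q)" using pq by simp
 ultimately have "(u + v)\<^sup>2 <= (u\<^sup>2 / p + v\<^sup>2 / q) * (p + q)" by linarith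
 thus ?thesis unfolding p_def[symmetric] q_def[symmetric] using pq by (simp add: pos_divide_le_eq)
qed

text \<open>Both the triangle inequality and smoothness come from mixing the weights of the two vectors.\<close>

lemma nf_triangle: assumes F:"finite F" shows "nf Q F (%i. x i + y i) <= nf Q F x + nf Q F y"
proof (rule field_le_epsilon)
 fix e :: real assume e:"0 < e"
 \<comment> \<open>Numbers strictly above the two norms are positive and come with nearly optimal
   weights; these weights are mixed in the proportion of \<open>a\<close> to
   \<open>b\<close>.\<close>
 define a b where "a = nf Q F x + e / 2" and "b = nf Q F y + e / 2"
 have ab:"0 < a" "0 < b" using nf_nonneg[OF F,of Q] e unfolding a_def b_def by (auto intro: add_nonneg_pos)
 obtain w where w:"feas Q F w" "(\<Sum>i\<in>F. x i ^ 4 / w i) <= a ^ 4" using nf_lessE[OF F,of Q x a] e unfolding a_def by auto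
 obtain w' where w': "feas Q F w'" "(\<Sum>i\<in>F. y i ^ 4 / w' i) <= b ^ 4" using nf_lessE[OF F,of Q y b] e unfolding b_def by auto
 have "nf Q F (%i. x i + y i) <= a + b"
 proof (rule nf_leI[OF F feas_convex[OF w(1) w'(1) ab]])
 have "(x i + y i) ^ 4 / ((a * w i + b * w' i) / (a + b)) <= (a + b) ^ 3 * (x i ^ 4 / w i / a ^ 3 + y i ^ 4 / w' i / b ^ 3)" if i:"i : F" for i
 proof -
 have p:"0 < w i" "0 < w' i" using w(1) w'(1) i unfolding feas_def by auto
 have "(x i + y i)\<^sup>2 / (a * 1 + b * 1) <= (x i)\<^sup>2 / (a * 1) + (y i)\<^sup>2 / (b * 1)" by (rule titu) (use ab in auto)
 hence "(x i + y i)\<^sup>2 <= (a + b) * ((x i)\<^sup>2 / a + (y i)\<^sup>2 / b)" using ab by (simp add: pos_divide_le_eq mult.commute)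
 hence "((x i + y i)\<^sup>2)\<^sup>2 <= ((a + b) * ((x i)\<^sup>2 / a + (y i)\<^sup>2 / b))\<^sup>2" by (intro power_mono) auto
 hence "(x i + y i) ^ 4 / (a * w i + b * w' i) <= (a + b)\<^sup>2 * (((x i)\<^sup>2 / a + (y i)\<^sup>2 / b)\<^sup>2 / (a * w i + b * w' i))"
 using p ab by (simp add: power_mult_distrib divide_right_mono add_nonneg_nonneg flip: power_mult)
 also have "... <= (a + b)\<^sup>2 * (((x i)\<^sup>2 / a)\<^sup>2 / (a * w i) + ((y i)\<^sup>2 / b)\<^sup>2 / (b * w' i))"
 by (intro mult_left_mono titu) (use p ab in auto)
 also have "... = (a + b)\<^sup>2 * (x i ^ 4 / w i / a ^ 3 + y i ^ 4 / w' i / b ^ 3)"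
 by (simp add: power_divide power3_eq_cube power2_eq_square power4_eq_xxxx mult_ac)
 finally have "(x i + y i) ^ 4 / (a * w i + b * w' i) * (a + b) <= (a + b)\<^sup>2 * (x i ^ 4 / w i / a ^ 3 + y i ^ 4 / w' i / b ^ 3) * (a + b)"
 using ab by (intro mult_right_mono) auto
 thus ?thesis using ab by (simp add: power3_eq_cube power2_eq_square mult_ac)
 qed
 hence "(\<Sum>i\<in>F. (x i + y i) ^ 4 / ((a * w i + b * w' i) / (a + b))) <= (\<Sum>i\<in>F. (a + b) ^ 3 * (x i ^ 4 / w i / a ^ 3 + y i ^ 4 / w' i / b ^ 3))"
 by (rule sum_mono)
 also have "... = (a + b) ^ 3 * ((\<Sum>i\<in>F. x i ^ 4 / w i) / a ^ 3 + (\<Sum>i\<in>F. y i ^ 4 / w' i) / b ^ 3)"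
 by (simp add: sum_distrib_left sum.distrib sum_divide_distrib distrib_left)
 also have "... <= (a + b) ^ 3 * (a ^ 4 / a ^ 3 + b ^ 4 / b ^ 3)"
 using ab w(2) w'(2) by (intro mult_left_mono add_mono divide_right_mono) auto
 also have "... = (a + b) ^ 4" using ab by (simp add: power_diff[symmetric] flip: power_Suc2; simp add: power4_eq_xxxx power3_eq_cube)
 finally show "(\<Sum>i\<in>F. (x i + y i) ^ 4 / ((a * w i + b * w' i) / (a + b))) <= (a + b) ^ 4" .
 qed (use ab in auto)
 thus "nf Q F (%i. x i + y i) <= nf Q F x + nf Q F y + e" unfolding a_def b_def by simp
qed

lemma nf_smooth: assumes F:"finite F" and a:"nf Q F x < a" and b:"nf Q F h < b"
 shows "nf Q F (%i. x i + h i) ^ 4 + nf Q F (%i. x i - h i) ^ 4 <= 2 * (a\<^sup>2 + 3 * b\<^sup>2)\<^sup>2"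
proof -
 have ab:"0 < a" "0 < b" using nf_nonneg[OF F,of Q] a b by (meson le_less_trans)+
 obtain w where w:"feas Q F w" "(\<Sum>i\<in>F. x i ^ 4 / w i) <= a ^ 4" using nf_lessE[OF F a] by blast
 obtain w' where w': "feas Q F w'" "(\<Sum>i\<in>F. h i ^ 4 / w' i) <= b ^ 4" using nf_lessE[OF F b] by blast
 \<comment> \<open>The proportion is suggested by the identity that equates the sum of the fourth
   powers of \<open>x + h\<close> and \<open>x - h\<close> with
   \<open>2 (x^2 + 3 h^2)^2 - 16 h^4\<close>. With these values the mixed bound collapses to twice
   the square of \<open>A + B\<close>.\<close>
 define A B where "A = a\<^sup>2" and "B = 3 * b\<^sup>2"
 have AB:"0 < A" "0 < B" using ab unfolding A_def B_def by auto
 let ?v = "%i. (A * w i + B * w' i) / (A + B)"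
 have v:"feas Q F ?v" by (rule feas_convex[OF w(1) w'(1) AB])
 have "nf Q F (%i. x i + h i) ^ 4 + nf Q F (%i. x i - h i) ^ 4 <= (\<Sum>i\<in>F. (x i + h i) ^ 4 / ?v i) + (\<Sum>i\<in>F. (x i - h i) ^ 4 / ?v i)"
 unfolding nf_pow4[OF F] by (intro add_mono N4_lower v)
 also have "... = (\<Sum>i\<in>F. ((x i + h i) ^ 4 + (x i - h i) ^ 4) / ?v i)" by (simp add: sum.distrib add_divide_distrib)
 also have "... <= (\<Sum>i\<in>F. 2 * ((A + B) * (x i ^ 4 / w i / A + 9 * (h i ^ 4 / w' i) / B)))"
 proof (rule sum_mono)
 fix i assume i:"i : F"
 have p:"0 < w i" "0 < w' i" using w(1) w'(1) i unfolding feas_def by auto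
 have "(x i + h i) ^ 4 + (x i - h i) ^ 4 = 2 * ((x i)\<^sup>2 + 3 * (h i)\<^sup>2)\<^sup>2 - 16 * (h i ^ 4)"
 by (simp add: power4_eq_xxxx power2_eq_square algebra_simps)
 also have "... <= 2 * ((x i)\<^sup>2 + 3 * (h i)\<^sup>2)\<^sup>2" by simp
 finally have "((x i + h i) ^ 4 + (x i - h i) ^ 4) / (A * w i + B * w' i) <= 2 * (((x i)\<^sup>2 + 3 * (h i)\<^sup>2)\<^sup>2 / (A * w i + B * w' i))"
 using p AB by (simp add: divide_right_mono add_nonneg_nonneg)
 also have "... <= 2 * (((x i)\<^sup>2)\<^sup>2 / (A * w i) + (3 * (h i)\<^sup>2)\<^sup>2 / (B * w' i))"
 by (intro mult_left_mono titu) (use p AB in auto)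
 also have "... = 2 * (x i ^ 4 / w i / A + 9 * (h i ^ 4 / w' i) / B)" by (simp add: power2_eq_square power4_eq_xxxx mult_ac)
 finally have "((x i + h i) ^ 4 + (x i - h i) ^ 4) / (A * w i + B * w' i) * (A + B) <= 2 * (x i ^ 4 / w i / A + 9 * (h i ^ 4 / w' i) / B) * (A + B)"
 using AB by (intro mult_right_mono) auto
 thus "((x i + h i) ^ 4 + (x i - h i) ^ 4) / ?v i <= 2 * ((A + B) * (x i ^ 4 / w i / A + 9 * (h i ^ 4 / w' i) / B))"
 by (simp add: mult_ac)
 qed
 also have "... = 2 * ((A + B) * ((\<Sum>i\<in>F. x i ^ 4 / w i) / A + 9 * (\<Sum>i\<in>F. h i ^ 4 / w' i) / B))"
 by (simp add: sum_distrib_left sum.distrib sum_divide_distrib distrib_left)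
 also have "... <= 2 * ((A + B) * (a ^ 4 / A + 9 * b ^ 4 / B))"
 using AB w(2) w'(2) by (intro mult_left_mono add_mono divide_right_mono) auto
 also have "a ^ 4 / A + 9 * b ^ 4 / B = A + B"
 using ab unfolding A_def B_def by (simp add: power4_eq_xxxx power2_eq_square)
 finally show ?thesis unfolding A_def B_def by (simp add: power2_eq_square)
qed

lemma nf_scale: assumes F:"finite F" shows "nf Q F (%i. c * x i) = \<bar>c\<bar> * nf Q F x"
proof -
 have le:"nf Q F (%i. c * x i) <= \<bar>c\<bar> * nf Q F x" for c x
 proof -
 have "(\<bar>c\<bar> * nf Q F x) ^ 4 = c ^ 4 * N4 Q F x" by (simp add: power_mult_distrib nf_pow4[OF F] power_even_abs)
 moreover have "N4 Q F (%i. c * x i) <= c ^ 4 * N4 Q F x"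
 proof (cases "c = 0")
 case True
 hence "N4 Q F (%i. c * x i) <= (\<Sum>i\<in>F. (c * x i) ^ 4 / (1 / (real (card F) + 1)))" by (intro N4_lower feas_const F)
 thus ?thesis using True by simp
 next
 case False
 have "N4 Q F (%i. c * x i) / c ^ 4 <= N4 Q F x"
 proof (rule N4_greatest[OF F])
 fix w assume "feas Q F w"
 hence "N4 Q F (%i. c * x i) <= (\<Sum>i\<in>F. (c * x i) ^ 4 / w i)" by (rule N4_lower)
 also have "... = c ^ 4 * (\<Sum>i\<in>F. x i ^ 4 / w i)" by (simp add: sum_distrib_left power_mult_distrib)
 finally show "N4 Q F (%i. c * x i) / c ^ 4 <= (\<Sum>i\<in>F. x i ^ 4 / w i)" using False by (simp add: pos_divide_le_eq zero_less_power_eq mult.commute)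
 qed
 thus ?thesis using False by (simp add: pos_divide_le_eq zero_less_power_eq mult.commute)
 qed
 ultimately have "nf Q F (%i. c * x i) ^ 4 <= (\<bar>c\<bar> * nf Q F x) ^ 4" by (simp add: nf_pow4[OF F])
 thus ?thesis using power_mono_iff[of "nf Q F (%i. c * x i)" "\<bar>c\<bar> * nf Q F x" 4] nf_nonneg[OF F,of Q] by simp
 qed
 show ?thesis
 proof (cases "c = 0")
 case True
 thus ?thesis using le[of 0 x] nf_nonneg[OF F,of Q "%i. 0"] by auto
 next
 case False
 have "nf Q F (%i. inverse c * (c * x i)) <= \<bar>inverse c\<bar> * nf Q F (%i. c * x i)" by (rule le)
 moreover have "(%i. inverse c * (c * x i)) = x" using False by (simp add: fun_eq_iff)
 ultimately have "\<bar>c\<bar> * nf Q F x <= \<bar>c\<bar> * (\<bar>inverse c\<bar> * nf Q F (%i. c * x i))" by (intro mult_left_mono) auto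
 also have "... = nf Q F (%i. c * x i)" using False by (simp flip: abs_mult mult.assoc)
 finally show ?thesis using le[of c x] by simp
 qed
qed

lemma nf_coord: assumes "finite F" "i : F" shows "\<bar>x i\<bar> <= nf Q F x"
proof (rule nf_geI[OF assms(1)])
 fix w assume w:"feas Q F w"
 have wi:"0 < w i" using w[unfolded feas_def,THEN conjunct1] assms(2) by blast
 have wi1:"w i <= 1" by (rule feas_le_1[OF w assms(2)])
 have "x i ^ 4 * w i <= x i ^ 4 * 1" using wi1 by (intro mult_left_mono) auto
 moreover have "\<bar>x i\<bar> ^ 4 = x i ^ 4" by (rule power_even_abs) simp
 ultimately have "\<bar>x i\<bar> ^ 4 <= x i ^ 4 / w i" using wi by (simp add: pos_le_divide_eq)
 also have "... <= (\<Sum>i\<in>F. x i ^ 4 / w i)" using assms w unfolding feas_def by (intro member_le_sum) auto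
 finally show "\<bar>x i\<bar> ^ 4 <= (\<Sum>i\<in>F. x i ^ 4 / w i)" .
qed

text \<open>Feasible weights restrict to feasible weights on both parts, so fourth powers of norms
  on disjoint sets add up to at most that on the union. This lower 4-estimate is what makes tails
  small.\<close>

lemma nf_lower4: assumes "finite E" "finite F" "E \<inter> F = {}" shows "nf Q E x ^ 4 + nf Q F x ^ 4 <= nf Q (E \<union> F) x ^ 4"
proof -
 have "N4 Q E x + N4 Q F x <= N4 Q (E \<union> F) x"
 proof (rule N4_greatest)
 fix w assume w:"feas Q (E \<union> F) w"
 have "N4 Q E x <= (\<Sum>i\<in>E. x i ^ 4 / w i)" "N4 Q F x <= (\<Sum>i\<in>F. x i ^ 4 / w i)"
 by (intro N4_lower feas_mono[OF w] Un_upper1 Un_upper2)+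
 thus "N4 Q E x + N4 Q F x <= (\<Sum>i\<in>E \<union> F. x i ^ 4 / w i)" using assms by (simp add: sum.union_disjoint)
 qed (use assms in simp)
 thus ?thesis using assms by (simp add: nf_pow4)
qed

lemma N4_le: assumes "finite F" shows "N4 Q F x <= (real (card F) + 1) * (\<Sum>i\<in>F. x i ^ 4)"
 using N4_lower[OF feas_const[OF assms],of Q x] by (simp add: sum_distrib_left mult.commute)

text \<open>With \<open>k\<close> points, \<open>1 / w\<close> lies above its tangent
  \<open>2 k - k^2 w\<close> at \<open>w = 1 / k\<close>. Summed over a clique, whose total weight
  is at most 1, this gives at least \<open>k^2\<close>.\<close>

lemma nf_clique: assumes "finite F" "\<forall>i\<in>F. \<forall>j\<in>F. i ~= j-->Q i j" shows "sqrt (card F) <= nf Q F (%i. 1)"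
proof (rule nf_geI[OF assms(1)])
 fix w assume w:"feas Q F w"
 have s:"(\<Sum>i\<in>F. w i) <= 1" using w assms unfolding feas_def by auto
 have p:"0 < w i" if "i : F" for i using w that unfolding feas_def by auto
 have "2 * real (card F) - real (card F) ^ 2 * w i * 1 <= 2 * real (card F) - real (card F) ^ 2 * w i" for i by simp
 have "(\<Sum>i\<in>F. 2 * real (card F) - (real (card F))\<^sup>2 * w i) <= (\<Sum>i\<in>F. 1 ^ 4 / w i)"
 proof (rule sum_mono)
 fix i assume i:"i : F"
 have "0 <= (1 - real (card F) * w i)\<^sup>2 / w i" using p[OF i] by simp
 also have "... = 1 / w i - (2 * real (card F) - (real (card F))\<^sup>2 * w i)"
 using p[OF i] by (simp add: field_simps power2_eq_square)
 finally show "2 * real (card F) - (real (card F))\<^sup>2 * w i <= 1 ^ 4 / w i" by simp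
 qed
 moreover have "(\<Sum>i\<in>F. 2 * real (card F) - (real (card F))\<^sup>2 * w i) = 2 * (real (card F))\<^sup>2 - (real (card F))\<^sup>2 * (\<Sum>i\<in>F. w i)"
 by (simp add: sum_subtractf sum_distrib_left power2_eq_square)
 moreover have "(real (card F))\<^sup>2 * (\<Sum>i\<in>F. w i) <= (real (card F))\<^sup>2 * 1" using s by (intro mult_left_mono) auto
 ultimately have "(real (card F))\<^sup>2 <= (\<Sum>i\<in>F. 1 ^ 4 / w i)" by linarith
 moreover have "sqrt (card F) ^ 4 = (real (card F))\<^sup>2" by (simp add: power4_eq_xxxx power2_eq_square)
 ultimately show "sqrt (card F) ^ 4 <= (\<Sum>i\<in>F. 1 ^ 4 / w i)" by simp
qed

text \<open>All weights may be 1, since a clique inside an anticlique has at most one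
  element.\<close>

lemma nf_anticlique: assumes "finite F" "\<forall>i\<in>F. \<forall>j\<in>F. i ~= j-->~ Q i j" shows "nf Q F (%i. 1) <= sqrt (sqrt (card F))"
proof (rule nf_leI[OF assms(1),where w = "%i. 1"])
 show "feas Q F (%i. 1)" unfolding feas_def
 proof (intro conjI ballI allI impI)
 fix K assume K:"K <= F" "\<forall>i\<in>K. \<forall>j\<in>K. i ~= j-->Q i j"
 hence "card K <= 1" using assms by (metis card_le_Suc0_iff_eq finite_subset subsetD One_nat_def)
 thus "(\<Sum>i\<in>K. 1) <= (1::real)" by simp
 qed simp
 have "sqrt (sqrt (card F)) ^ 4 = (sqrt (sqrt (card F)) ^ 2) ^ 2"
 using power_mult[of "sqrt (sqrt (card F))" 2 2] by simp
 thus "(\<Sum>i\<in>F. 1 ^ 4 / 1) <= sqrt (sqrt (card F)) ^ 4" by simp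
qed simp

text \<open>Convexity makes the difference quotients increasing. Any number between the left and the
  right ones works for \<open>D\<close>, because the second-order bound makes the gap between the
  quotients at \<open>t\<close> and \<open>- t\<close> at most \<open>c * t\<close>.\<close>

lemma convex_smooth_differentiable:
 fixes ph :: "real => real"
 assumes conv:"!!s t u. 0 <= u==>u <= 1==>ph (u * s + (1 - u) * t) <= u * ph s + (1 - u) * ph t"
 and sm:"!!t. ph t + ph (- t) - 2 * ph 0 <= c * t\<^sup>2"
 shows "EX D. ALL t. t ~= 0-->\<bar>(ph t - ph 0) / t - D\<bar> <= c * \<bar>t\<bar>"
proof -
 define q where "q t = (ph t - ph 0) / t" for t
 have mono:"q s <= q t" if "0 < s" "s <= t" for s t
 proof -
 have "ph ((s / t) * t + (1 - s / t) * 0) <= (s / t) * ph t + (1 - s / t) * ph 0" using that by (intro conv) auto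
 thus ?thesis using that unfolding q_def by (simp add: field_simps)
 qed
 have opp:"q (- s) <= q t" if "0 < s" "0 < t" for s t
 proof -
 have "ph ((t / (s + t)) * (- s) + (1 - t / (s + t)) * t) <= (t / (s + t)) * ph (- s) + (1 - t / (s + t)) * ph t"
 using that by (intro conv) auto
 moreover have "(t / (s + t)) * (- s) + (1 - t / (s + t)) * t = 0" using that by (simp add: field_simps)
 moreover have "1 - t / (s + t) = s / (s + t)" using that by (simp add: field_simps)
 ultimately have "ph 0 <= (t * ph (- s) + s * ph t) / (s + t)" by (simp add: add_divide_distrib)
 hence "ph 0 * (s + t) <= t * ph (- s) + s * ph t" using that by (simp add: pos_le_divide_eq)
 thus ?thesis using that unfolding q_def by (simp add: field_simps)
 qed
 define D where "D = Inf (q ` {0<..})"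
 have bd:"bdd_below (q ` {0<..})" using opp[of 1] by (auto intro!: bdd_belowI[of _ "q (- 1)"])
 have D1:"D <= q t" if "0 < t" for t unfolding D_def using that bd by (intro cInf_lower) auto
 have D2:"q (- t) <= D" if "0 < t" for t unfolding D_def using that opp by (intro cInf_greatest) auto
 have gap:"q t - q (- t) <= c * t" if "0 < t" for t
 proof -
 have "q t - q (- t) = (ph t + ph (- t) - 2 * ph 0) / t" using that unfolding q_def by (simp add: field_simps)
 also have "... <= c * t\<^sup>2 / t" using sm[of t] that by (intro divide_right_mono) auto
 finally show ?thesis using that by (simp add: power2_eq_square)
 qed
 have "\<bar>q t - D\<bar> <= c * \<bar>t\<bar>" if "t ~= 0" for t
 proof (cases "0 < t")
 case True thus ?thesis using D1[of t] D2[of t] gap[of t] by auto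
 next
 case False
 hence "0 < - t" using that by auto
 thus ?thesis using D1[of "- t"] D2[of "- t"] gap[of "- t"] by auto
 qed
 thus ?thesis unfolding q_def by blast
qed

section \<open>The norm on arbitrary index sets\<close>

definition bd :: "('i => 'i => bool) => 'i set => ('i => real) => bool" where
 "bd Q I x<->(EX M. ALL F. finite F&F <= I-->nf Q F x <= M)"
definition nX :: "('i => 'i => bool) => 'i set => ('i => real) => real" where
 "nX Q I x = Sup {nf Q F x | F. finite F&F <= I}"

lemma nX_ge:"bd Q I x==>finite F==>F <= I==>nf Q F x <= nX Q I x"
 unfolding nX_def bd_def by (rule cSup_upper) (auto simp: bdd_above_def)
lemma nX_le:"(!!F. finite F==>F <= I==>nf Q F x <= M)==>nX Q I x <= M"
 unfolding nX_def by (rule cSup_least) auto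
lemma bdI:"(!!F. finite F==>F <= I==>nf Q F x <= M)==>bd Q I x" unfolding bd_def by blast
lemma nX_nonneg:"bd Q I x==>0 <= nX Q I x"
 using nX_ge[of Q I x "{}"] nf_nonneg[of "{}" Q x] by simp
lemma nX_approx: assumes "c < nX Q I x" shows "EX F. finite F&F <= I&c < nf Q F x"
 using assms nX_le[of I Q x c] by (meson linorder_not_le)
lemma nX_cong: assumes "!!i. i : I==>x i = y i" shows "nX Q I x = nX Q I y" "bd Q I x = bd Q I y"
proof -
 have e:"nf Q F x = nf Q F y" if "F <= I" for F using assms that by (intro nf_cong) auto
 show "bd Q I x = bd Q I y" unfolding bd_def using e by auto
 have "{nf Q F x | F. finite F&F <= I} = {nf Q F y | F. finite F&F <= I}"
 by (intro Collect_cong ex_cong1) (auto simp: e)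
 thus "nX Q I x = nX Q I y" unfolding nX_def by simp
qed

lemma nX_add: assumes "bd Q I x" "bd Q I y"
 shows "bd Q I (%i. x i + y i)" "nX Q I (%i. x i + y i) <= nX Q I x + nX Q I y"
proof -
 have *: "nf Q F (%i. x i + y i) <= nX Q I x + nX Q I y" if "finite F" "F <= I" for F
 using nf_triangle[OF that(1),of Q x y] nX_ge[OF assms(1) that] nX_ge[OF assms(2) that] by linarith
 show "bd Q I (%i. x i + y i)" by (rule bdI[OF *])
 show "nX Q I (%i. x i + y i) <= nX Q I x + nX Q I y" by (rule nX_le[OF *])
qed

lemma nX_scale: assumes "bd Q I x" shows "bd Q I (%i. c * x i)" "nX Q I (%i. c * x i) = \<bar>c\<bar> * nX Q I x"
proof -
 have *: "nf Q F (%i. c * x i) <= \<bar>c\<bar> * nX Q I x" if "finite F" "F <= I" for F c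
 using nf_scale[OF that(1),of Q c x] nX_ge[OF assms that] by (simp add: mult_left_mono)
 show b:"bd Q I (%i. c * x i)" by (rule bdI[OF *])
 have le:"nX Q I (%i. c * x i) <= \<bar>c\<bar> * nX Q I x" by (rule nX_le[OF *])
 have "\<bar>c\<bar> * nX Q I x <= nX Q I (%i. c * x i)"
 proof (cases "c = 0")
 case True thus ?thesis using nX_nonneg[OF b] by simp
 next
 case False
 have "nX Q I x <= nX Q I (%i. c * x i) / \<bar>c\<bar>"
 proof (rule nX_le)
 fix F assume F:"finite F" "F <= I"
 have "\<bar>c\<bar> * nf Q F x <= nX Q I (%i. c * x i)" using nX_ge[OF b F] nf_scale[OF F(1),of Q c x] by simp
 thus "nf Q F x <= nX Q I (%i. c * x i) / \<bar>c\<bar>" using False by (simp add: pos_le_divide_eq mult.commute)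
 qed
 thus ?thesis using False by (simp add: pos_le_divide_eq mult.commute)
 qed
 thus "nX Q I (%i. c * x i) = \<bar>c\<bar> * nX Q I x" using le by simp
qed

lemma nX_diff: assumes "bd Q I x" "bd Q I y"
 shows "bd Q I (%i. x i - y i)" "nX Q I (%i. x i - y i) <= nX Q I x + nX Q I y"
 using nX_add[OF assms(1) nX_scale(1)[OF assms(2),of "- 1"]] nX_scale(2)[OF assms(2),of "- 1"] by simp_all

lemma nX_coord:"bd Q I x==>i : I==>\<bar>x i\<bar> <= nX Q I x"
 using nf_coord[of "{i}" i x Q] nX_ge[of Q I x "{i}"] by simp

lemma nX_smooth: assumes x:"bd Q I x" and h:"bd Q I h"
 shows "nX Q I (%i. x i + h i) ^ 4 + nX Q I (%i. x i - h i) ^ 4 <= 2 * ((nX Q I x)\<^sup>2 + 3 * (nX Q I h)\<^sup>2)\<^sup>2"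
proof -
 define A B a b where "A = nX Q I (%i. x i + h i)" and "B = nX Q I (%i. x i - h i)" and "a = nX Q I x" and "b = nX Q I h"
 have AB:"0 <= A" "0 <= B" unfolding A_def B_def using nX_nonneg nX_add(1)[OF x h] nX_diff(1)[OF x h] by blast+
 \<comment> \<open>The union of two finite sets, one nearly attaining each supremum, serves both
   with a loss of \<open>e\<close>, which then tends to 0.\<close>
 have key:"(max 0 (A - e)) ^ 4 + (max 0 (B - e)) ^ 4 <= 2 * ((a + e)\<^sup>2 + 3 * (b + e)\<^sup>2)\<^sup>2" if e:"0 < e" for e
 proof -
 obtain F where F:"finite F" "F <= I" "A - e < nf Q F (%i. x i + h i)"
 using nX_approx[of "A - e" Q I "%i. x i + h i"] e unfolding A_def by auto
 obtain E where E:"finite E" "E <= I" "B - e < nf Q E (%i. x i - h i)"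
 using nX_approx[of "B - e" Q I "%i. x i - h i"] e unfolding B_def by auto
 have FE:"finite (F \<union> E)" "F \<union> E <= I" using F E by auto
 have "max 0 (A - e) <= nf Q (F \<union> E) (%i. x i + h i)" "max 0 (B - e) <= nf Q (F \<union> E) (%i. x i - h i)"
 using F(3) E(3) nf_mono[OF FE(1),of F Q "%i. x i + h i"] nf_mono[OF FE(1),of E Q "%i. x i - h i"] nf_nonneg[OF FE(1),of Q] by auto
 hence "(max 0 (A - e)) ^ 4 + (max 0 (B - e)) ^ 4 <= nf Q (F \<union> E) (%i. x i + h i) ^ 4 + nf Q (F \<union> E) (%i. x i - h i) ^ 4"
 by (intro add_mono power_mono) auto
 also have "... <= 2 * ((a + e)\<^sup>2 + 3 * (b + e)\<^sup>2)\<^sup>2"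
 using nX_ge[OF x FE] nX_ge[OF h FE] e unfolding a_def b_def by (intro nf_smooth[OF FE(1)]) auto
 finally show ?thesis .
 qed
 have T1:"((%e. (max 0 (A - e)) ^ 4 + (max 0 (B - e)) ^ 4) \<longlongrightarrow> (max 0 (A - 0)) ^ 4 + (max 0 (B - 0)) ^ 4) (at_right 0)"
 by (intro tendsto_intros)
 have T2:"((%e. 2 * ((a + e)\<^sup>2 + 3 * (b + e)\<^sup>2)\<^sup>2) \<longlongrightarrow> 2 * ((a + 0)\<^sup>2 + 3 * (b + 0)\<^sup>2)\<^sup>2) (at_right 0)"
 by (intro tendsto_intros)
 have "(max 0 (A - 0)) ^ 4 + (max 0 (B - 0)) ^ 4 <= 2 * ((a + 0)\<^sup>2 + 3 * (b + 0)\<^sup>2)\<^sup>2"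
 by (rule tendsto_le[OF trivial_limit_at_right_real T2 T1],rule eventually_mono[OF eventually_at_right_less]) (rule key)
 thus ?thesis using AB unfolding A_def[symmetric] B_def[symmetric] a_def[symmetric] b_def[symmetric] by (simp add: max_def)
qed

text \<open>The bound on fourth powers becomes a second-order bound by using the inequality between
  arithmetic and quadratic mean twice and \<open>1 + 3 z <= (1 + 3 z / 2)^2\<close>. The constant
  depends on \<open>h\<close> only, hence the uniformity in \<open>x\<close>.\<close>

lemma nX_UG: assumes x:"bd Q I x" "nX Q I x = 1" and h:"bd Q I h"
 shows "EX D. ALL t. t ~= 0-->\<bar>(nX Q I (%i. x i + t * h i) - 1) / t - D\<bar> <= 3 * (nX Q I h)\<^sup>2 * \<bar>t\<bar>"
proof -
 define ph where "ph t = nX Q I (%i. x i + t * h i)" for t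
 have b:"bd Q I (%i. x i + t * h i)" for t by (rule nX_add(1)[OF x(1) nX_scale(1)[OF h]])
 have "EX D. ALL t. t ~= 0-->\<bar>(ph t - ph 0) / t - D\<bar> <= 3 * (nX Q I h)\<^sup>2 * \<bar>t\<bar>"
 proof (rule convex_smooth_differentiable)
 fix s t u :: real assume u:"0 <= u" "u <= 1"
 have "ph (u * s + (1 - u) * t) = nX Q I (%i. u * (x i + s * h i) + (1 - u) * (x i + t * h i))"
 unfolding ph_def by (rule arg_cong[where f = "nX Q I"]) (auto simp: algebra_simps)
 also have "... <= nX Q I (%i. u * (x i + s * h i)) + nX Q I (%i. (1 - u) * (x i + t * h i))"
 by (rule nX_add(2)[OF nX_scale(1)[OF b] nX_scale(1)[OF b]])
 also have "... = u * ph s + (1 - u) * ph t" using nX_scale(2)[OF b,of u s] nX_scale(2)[OF b,of "1 - u" t] u unfolding ph_def by simp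
 finally show "ph (u * s + (1 - u) * t) <= u * ph s + (1 - u) * ph t" .
 next
 fix t :: real
 define z where "z = t\<^sup>2 * (nX Q I h)\<^sup>2"
 have z:"0 <= z" unfolding z_def by simp
 have "ph t ^ 4 + ph (- t) ^ 4 <= 2 * (1\<^sup>2 + 3 * (nX Q I (%i. t * h i))\<^sup>2)\<^sup>2"
 using nX_smooth[OF x(1) nX_scale(1)[OF h,of t]] x(2) unfolding ph_def by simp
 also have "... = 2 * (1 + 3 * z)\<^sup>2" unfolding nX_scale(2)[OF h] z_def by (simp add: power_mult_distrib)
 finally have 4:"ph t ^ 4 + ph (- t) ^ 4 <= 2 * (1 + 3 * z)\<^sup>2" .
 define p q where "p = ph t" and "q = ph (- t)"
 have pm:"((r + s) / 2)\<^sup>2 <= (r\<^sup>2 + s\<^sup>2) / 2" for r s :: real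
 using sum_squares_bound[of r s] by (simp add: power2_eq_square field_simps)
 have "(((p + q) / 2)\<^sup>2)\<^sup>2 <= ((p\<^sup>2 + q\<^sup>2) / 2)\<^sup>2" by (intro power_mono pm) auto
 also have "... <= ((p\<^sup>2)\<^sup>2 + (q\<^sup>2)\<^sup>2) / 2" by (rule pm)
 also have "... <= (1 + 3 * z)\<^sup>2" using 4 unfolding p_def q_def by (simp flip: power_mult)
 finally have "(((p + q) / 2)\<^sup>2)\<^sup>2 <= (1 + 3 * z)\<^sup>2" .
 hence "((p + q) / 2)\<^sup>2 <= 1 + 3 * z" by (rule power2_le_imp_le) (use z in simp)
 also have "... <= (1 + 3 / 2 * z)\<^sup>2" using z by (simp add: power2_eq_square algebra_simps)
 finally have "((p + q) / 2)\<^sup>2 <= (1 + 3 / 2 * z)\<^sup>2" .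
 hence "(p + q) / 2 <= 1 + 3 / 2 * z" by (rule power2_le_imp_le) (use z in simp)
 thus "ph t + ph (- t) - 2 * ph 0 <= 3 * (nX Q I h)\<^sup>2 * t\<^sup>2"
 using x(2) unfolding p_def q_def z_def by (simp add: ph_def[of 0] mult_ac)
 qed
 thus ?thesis unfolding ph_def using x(2) by simp
qed

text \<open>Weights have to be positive even where \<open>y\<close> vanishes. Shrinking the weights
  on \<open>E\<close> by a factor \<open>th1\<close> frees the mass \<open>1 - th1\<close> for the
  remaining points, at the cost of this factor alone, which then tends to 1.\<close>

lemma nf_zero: assumes F:"finite F" "E <= F" "!!i. i : F==>i \<notin> E==>y i = 0" shows "nf Q F y <= nf Q E y"
proof -
 have fE:"finite E" using F finite_subset by blast
 have "N4 Q F y <= N4 Q E y"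
 proof (rule N4_greatest[OF fE],rule field_le_mult_one_interval)
 fix w and th1 :: real assume w:"feas Q E w" and t:"0 < th1" "th1 < 1"
 define w' where "w' i = (if i : E then th1 * w i else (1 - th1) / (real (card F) + 1))" for i
 have "feas Q F w'" unfolding feas_def
 proof (intro conjI ballI allI impI)
 show "0 < w' i" if "i : F" for i using w t unfolding feas_def w'_def by (auto intro!: divide_pos_pos add_nonneg_pos)
 fix K assume K:"K <= F" "\<forall>i\<in>K. \<forall>j\<in>K. i ~= j-->Q i j"
 have fK:"finite K" using K F finite_subset by blast
 have "(\<Sum>i\<in>K. w' i) = (\<Sum>i\<in>K \<inter> E. w' i) + (\<Sum>i\<in>K - E. w' i)"
 by (subst sum.union_disjoint[symmetric]) (use fK in \<open>auto intro!: arg_cong2[where f = sum]\<close>)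
 also have "(\<Sum>i\<in>K \<inter> E. w' i) = th1 * (\<Sum>i\<in>K \<inter> E. w i)" unfolding w'_def by (simp add: sum_distrib_left)
 also have "(\<Sum>i\<in>K - E. w' i) = real (card (K - E)) * ((1 - th1) / (real (card F) + 1))" unfolding w'_def by simp
 also have "th1 * (\<Sum>i\<in>K \<inter> E. w i) <= th1 * 1" using w K t unfolding feas_def by (intro mult_left_mono) auto
 also have "real (card (K - E)) * ((1 - th1) / (real (card F) + 1)) <= 1 - th1"
 proof -
 have "card (K - E) <= card F" using K F by (meson Diff_subset card_mono subset_trans)
 hence "real (card (K - E)) / (real (card F) + 1) <= 1" by simp
 hence "(1 - th1) * (real (card (K - E)) / (real (card F) + 1)) <= (1 - th1) * 1" using t by (intro mult_left_mono) auto
 thus ?thesis by (simp add: mult_ac)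
 qed
 finally show "(\<Sum>i\<in>K. w' i) <= 1" by simp
 qed
 hence "N4 Q F y <= (\<Sum>i\<in>F. y i ^ 4 / w' i)" by (rule N4_lower)
 also have "... = (\<Sum>i\<in>E. y i ^ 4 / w' i)" using F by (intro sum.mono_neutral_right) auto
 also have "... = (\<Sum>i\<in>E. y i ^ 4 / w i) / th1" unfolding w'_def by (simp add: sum_divide_distrib mult.commute)
 finally show "th1 * N4 Q F y <= (\<Sum>i\<in>E. y i ^ 4 / w i)" using t by (simp add: pos_le_divide_eq mult.commute)
 qed
 thus ?thesis unfolding nf_def by simp
qed

lemma nX_fin: assumes "finite K" "K <= I" "!!i. i : I==>i \<notin> K==>y i = 0" shows "bd Q I y" "nX Q I y = nf Q K y"
proof -
 have *: "nf Q F y <= nf Q K y" if "finite F" "F <= I" for F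
 using nf_mono[of "F \<union> K" F Q y] nf_zero[of "F \<union> K" K y Q] assms that by fastforce
 show b:"bd Q I y" by (rule bdI[OF *])
 show "nX Q I y = nf Q K y" by (rule antisym[OF nX_le[OF *] nX_ge[OF b assms(1,2)]])
qed

text \<open>Take \<open>F\<close> on which the fourth power of the norm misses that of
  \<open>M\<close> by less than \<open>e ^ 4\<close>. By the lower 4-estimate no finite set disjoint
  from \<open>F\<close> can carry norm \<open>e\<close> or more.\<close>

lemma nX_tail: assumes x:"bd Q I x" and e:"0 < e"
 shows "EX F. finite F&F <= I&bd Q I (%i. if i : F then 0 else x i)&nX Q I (%i. if i : F then 0 else x i) <= e"
proof -
 define M where "M = nX Q I x"
 have M:"0 <= M" unfolding M_def using nX_nonneg[OF x] .
 have "EX F. finite F&F <= I&M ^ 4 - e ^ 4 < nf Q F x ^ 4"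
 proof (cases "M ^ 4 < e ^ 4")
 case True
 hence "M ^ 4 - e ^ 4 < nf Q {} x ^ 4" using nf_nonneg[of "{}" Q x] by (smt (verit) finite.emptyI zero_le_power)
 thus ?thesis by blast
 next
 case False
 define c where "c = root 4 (M ^ 4 - e ^ 4)"
 have c:"c ^ 4 = M ^ 4 - e ^ 4" "0 <= c" using False unfolding c_def by auto
 hence "c ^ 4 < M ^ 4" using e by simp
 hence "c < M" using M power_less_imp_less_base by blast
 then obtain F where "finite F" "F <= I" "c < nf Q F x" using nX_approx[of c Q I x] unfolding M_def by auto
 thus ?thesis using c power_strict_mono[of c "nf Q F x" 4] by auto
 qed
 then obtain F where F:"finite F" "F <= I" "M ^ 4 - e ^ 4 < nf Q F x ^ 4" by blast
 let ?y = "%i. if i : F then 0 else x i"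
 have *: "nf Q E ?y <= e" if E:"finite E" "E <= I" for E
 proof -
 have "nf Q E ?y <= nf Q (E - F) ?y" by (rule nf_zero) (use E in auto)
 also have "nf Q (E - F) ?y = nf Q (E - F) x" by (rule nf_cong) auto
 finally have 1:"nf Q E ?y <= nf Q (E - F) x" .
 have "nf Q F x ^ 4 + nf Q (E - F) x ^ 4 <= nf Q (F \<union> (E - F)) x ^ 4" by (rule nf_lower4) (use E F in auto)
 also have "... <= M ^ 4" unfolding M_def using nX_ge[OF x,of "F \<union> (E - F)"] E F nf_nonneg[of "F \<union> (E - F)" Q x] by (intro power_mono) auto
 finally have "nf Q (E - F) x ^ 4 < e ^ 4" using F by linarith
 hence "nf Q (E - F) x < e" using e power_less_imp_less_base[of _ 4 e] by auto
 thus ?thesis using 1 by linarith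
 qed
 show ?thesis using F(1,2) bdI[OF *] nX_le[OF *] by blast
qed

lemma nX_limit: assumes xs:"!!n. bd Q I (xs n)" and c:"!!e. 0 < e==>EX N. \<forall>n\<ge>N. \<forall>k\<ge>N. nX Q I (%i. xs n i - xs k i) < e"
 and lim:"!!i. i : I==>(%n. xs n i) \<longlonglongrightarrow> x i"
 shows "bd Q I x" "!!e. 0 < e==>EX N. \<forall>n\<ge>N. nX Q I (%i. xs n i - x i) < e"
proof -
 \<comment> \<open>On a fixed finite set the norm is controlled by the coordinates through
   \<open>N4_le\<close>, so a late member of the sequence may be replaced by the limit. The bound
   does not depend on the set and passes to the supremum.\<close>
 have key:"nf Q F (%i. xs n i - x i) <= e" if N:"\<forall>n\<ge>N. \<forall>k\<ge>N. nX Q I (%i. xs n i - xs k i) < e" and n:"n >= N" and F:"finite F" "F <= I" for N n F e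
 proof (rule field_le_epsilon)
 fix et :: real assume h:"0 < et"
 have "(%k. (real (card F) + 1) * (\<Sum>i\<in>F. (xs k i - x i) ^ 4)) \<longlonglongrightarrow> (real (card F) + 1) * (\<Sum>i\<in>F. (x i - x i) ^ 4)"
 using F(2) by (intro tendsto_intros lim) auto
 hence "\<forall>\<^sub>F k in sequentially. (real (card F) + 1) * (\<Sum>i\<in>F. (xs k i - x i) ^ 4) < et ^ 4"
 by (rule order_tendstoD(2)) (use h in simp)
 then obtain k where k:"k >= N" "(real (card F) + 1) * (\<Sum>i\<in>F. (xs k i - x i) ^ 4) < et ^ 4" unfolding eventually_sequentially by (metis nat_le_linear)
 have "nf Q F (%i. xs k i - x i) ^ 4 < et ^ 4" using N4_le[OF F(1),of Q "%i. xs k i - x i"] k nf_pow4[OF F(1)] by (metis le_less_trans)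
 hence "nf Q F (%i. xs k i - x i) < et" using h power_less_imp_less_base[of _ 4 et] by auto
 moreover have "nf Q F (%i. xs n i - xs k i) < e" using nX_ge[OF nX_diff(1)[OF xs xs] F] N n k(1) le_less_trans by blast
 moreover have "nf Q F (%i. (xs n i - xs k i) + (xs k i - x i)) <= nf Q F (%i. xs n i - xs k i) + nf Q F (%i. xs k i - x i)"
 by (rule nf_triangle[OF F(1)])
 ultimately show "nf Q F (%i. xs n i - x i) <= e + et" by simp
 qed
 obtain N where N:"\<forall>n\<ge>N. \<forall>k\<ge>N. nX Q I (%i. xs n i - xs k i) < 1" using c[of 1] by auto
 have "bd Q I (%i. xs N i - x i)" by (rule bdI) (rule key[OF N order_refl])
 from nX_diff(1)[OF xs[of N] this] show "bd Q I x" by simp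
 fix e :: real assume e:"0 < e"
 obtain N where N:"\<forall>n\<ge>N. \<forall>k\<ge>N. nX Q I (%i. xs n i - xs k i) < e / 2" using c[of "e / 2"] e by auto
 show "EX N. \<forall>n\<ge>N. nX Q I (%i. xs n i - x i) < e"
 proof (intro exI[of _ N] allI impI)
 fix n assume "N <= n"
 hence "nX Q I (%i. xs n i - x i) <= e / 2" by (intro nX_le key[OF N])
 thus "nX Q I (%i. xs n i - x i) < e" using e by linarith
 qed
qed

text \<open>Inside a structure the norm must be computed from the data that it contains, so rational
  weights have to suffice. Shrinking arbitrary feasible weights by a factor less than 1 leaves room
  for rational ones, which stay feasible because they are smaller.\<close>

lemma nX_cut: assumes x:"bd Q I x" and V:"!!q. of_rat q : V"
 shows "of_rat q < nX Q I x<->q < 0 \<or> (EX F r. finite F&F <= I&q < r&0 <= r &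
 (ALL w. (\<forall>i\<in>F. w i : V)&feas Q F w-->of_rat (r ^ 4) <= (\<Sum>i\<in>F. x i ^ 4 / w i)))" (is "_<->_ \<or> ?R")
proof
 assume a:"of_rat q < nX Q I x"
 show "q < 0 \<or> ?R"
 proof (cases "q < 0")
 case False
 obtain F where F:"finite F" "F <= I" "of_rat q < nf Q F x" using nX_approx[OF a] by blast
 obtain r where r:"of_rat q < (of_rat r :: real)" "of_rat r < nf Q F x" using of_rat_dense[OF F(3)] by blast
 have qr:"q < r" using r by (simp add: of_rat_less)
 have "of_rat (r ^ 4) <= (\<Sum>i\<in>F. x i ^ 4 / w i)" if "feas Q F w" for w
 proof -
 have "of_rat r ^ 4 <= nf Q F x ^ 4" using r qr False by (intro power_mono) (auto simp: zero_le_of_rat_iff)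
 thus ?thesis using N4_lower[OF that,of x] nf_pow4[OF F(1),of Q x] by (simp add: of_rat_power)
 qed
 thus ?thesis using F qr False by (intro disjI2 exI[of _ F] exI[of _ r]) auto
 qed simp
next
 assume "q < 0 \<or> ?R"
 thus "of_rat q < nX Q I x"
 proof
 assume "q < 0"
 hence "of_rat q < (0::real)" by simp
 thus ?thesis using nX_nonneg[OF x] by linarith
 next
 assume ?R
 then obtain F r where F:"finite F" "F <= I" "q < r" "0 <= r"
 and w:"!!w. (\<forall>i\<in>F. w i : V)==>feas Q F w==>of_rat (r ^ 4) <= (\<Sum>i\<in>F. x i ^ 4 / w i)" by blast
 have "of_rat r <= nf Q F x"
 proof (rule nf_geI[OF F(1)],rule field_le_mult_one_interval)
 fix w and z :: real assume f:"feas Q F w" and z:"0 < z" "z < 1"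
 have p:"0 < w i" if "i : F" for i using f[unfolded feas_def,THEN conjunct1] that by blast
 have "EX t. z * w i < of_rat t&of_rat t < w i" if "i : F" for i
 using of_rat_dense[of "z * w i" "w i"] p[OF that] z by (auto simp: mult_less_cancel_right1)
 then obtain t where t:"!!i. i : F==>z * w i < of_rat (t i)&of_rat (t i) < w i" by metis
 define v where "v i = (of_rat (t i) :: real)" for i
 have v0:"0 < v i" if "i : F" for i using t[OF that] p[OF that] z unfolding v_def by (meson less_trans mult_pos_pos)
 have "feas Q F v" unfolding feas_def
 proof (intro conjI ballI allI impI)
 fix K assume K:"K <= F" "\<forall>i\<in>K. \<forall>j\<in>K. i ~= j-->Q i j"
 have "(\<Sum>i\<in>K. v i) <= (\<Sum>i\<in>K. w i)" unfolding v_def using t K(1) by (intro sum_mono) (meson less_imp_le subsetD)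
 also have "... <= 1" by (rule f[unfolded feas_def,THEN conjunct2,rule_format]) (use K in auto)
 finally show "(\<Sum>i\<in>K. v i) <= 1" .
 qed (use v0 in auto)
 hence "of_rat (r ^ 4) <= (\<Sum>i\<in>F. x i ^ 4 / v i)" using V unfolding v_def by (intro w) auto
 also have "... <= (\<Sum>i\<in>F. x i ^ 4 / (z * w i))"
 proof (rule sum_mono)
 fix i assume i:"i : F"
 show "x i ^ 4 / v i <= x i ^ 4 / (z * w i)" 
 using t[OF i] v0[OF i] z(1) p[OF i] unfolding v_def by (intro divide_left_mono mult_pos_pos) auto
 qed
 also have "... = (\<Sum>i\<in>F. x i ^ 4 / w i) / z" by (simp add: sum_divide_distrib mult.commute)
 finally show "z * of_rat r ^ 4 <= (\<Sum>i\<in>F. x i ^ 4 / w i)" using z by (simp add: pos_le_divide_eq mult.commute of_rat_power)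
 qed
 thus ?thesis using nX_ge[OF x F(1,2)] F(3) by (metis of_rat_less le_less_trans less_le_trans order.strict_trans2)
 qed
qed

section \<open>The Banach spaces\<close>

text \<open>The cut of the norm computed with rational weights. It also makes sense for unbounded
  families, where it contains all rationals; so boundedness can be read off from it.\<close>

definition HC :: "('i => 'i => bool) => 'i set => ('i => real) => rat => bool" where
 "HC Q I x q<->q < 0 \<or> (EX F r. finite F&F <= I&q < r&0 <= r &
 (ALL w. (\<forall>i\<in>F. w i : range of_rat)&feas Q F w-->of_rat (r ^ 4) <= (\<Sum>i\<in>F. x i ^ 4 / w i)))"

lemma HC_nX:"bd Q I x==>HC Q I x q<->of_rat q < nX Q I x"
 unfolding HC_def using nX_cut[of Q I x "range of_rat" q] by simp

lemma HC_bd:"bd Q I x<->(EX q. ~ HC Q I x q)"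
proof
 assume b:"bd Q I x"
 obtain q where "nX Q I x < of_rat q" using of_rat_dense[of "nX Q I x" "nX Q I x + 1"] by auto
 thus "EX q. ~ HC Q I x q" using HC_nX[OF b,of q] by (intro exI[of _ q]) simp
next
 assume "EX q. ~ HC Q I x q"
 then obtain q where q:"~ HC Q I x q" by blast
 show "bd Q I x"
 proof (rule bdI,rule ccontr)
 fix F assume F:"finite F" "F <= I" "~ nf Q F x <= of_rat q"
 have f:"bd Q F x" "nX Q F x = nf Q F x" using nX_fin[of F F x Q] F by auto
 hence "HC Q F x q" using HC_nX[OF f(1),of q] F(3) by simp
 hence "HC Q I x q" unfolding HC_def using F(2) by (meson subset_trans)
 thus False using q by blast
 qed
qed

lemma feas_cong:"(!!i. i : F==>w i = w' i)==>feas Q F w = feas Q F w'"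
proof -
 assume e:"!!i. i : F==>w i = w' i"
 have "sum w K = sum w' K" if "K <= F" for K using e that by (intro sum.cong) auto
 thus ?thesis unfolding feas_def using e by auto
qed

section \<open>Finite sums and real-valued functions inside a structure\<close>

context zf0
begin

definition p4 :: "'v => 'v" where "p4 c = rmu (rmu c c) (rmu c c)"
lemma dt_p4 [dpi]:"dt UNIV t==>dt UNIV (%e. p4 (t e))" unfolding p4_def by (intro dpi)
lemma p4_code [simp]:"r : Reals_in==>p4 (rlc r) = rlc (r ^ 4)" "r : Reals_in==>r ^ 4 : Reals_in"
 using Reals_mult[of r r] Reals_mult[of "r * r" "r * r"] by (simp_all add: p4_def power4_eq_xxxx mult.assoc)

definition rsm :: "('v => 'v) => 'v => 'v" where "rsm g n = rc (rlc 0) (%l v. rad v (g l)) n"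
lemma dt_rsm [dpi]: assumes "dt UNIV (%e. g (%n. e (Suc n)) (e 0))" "dt UNIV n"
 shows "dt UNIV (%e. rsm (g e) (n e))"
proof -
 have "dt UNIV (%e. g (%n. e (Suc (Suc n))) (e 0))"
 using dt_reindex[OF assms(1),of "%n. case n of 0 => 0 | Suc k => Suc (Suc k)"] by simp
 thus ?thesis unfolding rsm_def by (intro dpi assms(2))
qed
lemma rsm_num: assumes "!!l. l < n==>f l : Reals_in&g (num l) = rlc (f l)"
 shows "(\<Sum>l<n. f l) : Reals_in&rsm g (num n) = rlc (\<Sum>l<n. f l)"
 using assms unfolding rsm_def rc_num
proof (induction n)
 case (Suc n) thus ?case using Reals_add by simp
qed (simp add: Reals_const)

text \<open>A function presented by the relation that is its graph. When the relation depends
  definably on a parameter, so does the function; this is \<open>dt_gr\<close>, needed to collect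
  the whole family of spaces.\<close>

definition gr :: "'v => 'v => ('v => 'v => bool) => 'v" where
 "gr A B R = coll {z. z <: cprod A B&(EX x y. z = pair x y&R x y)}"
lemma gr: assumes d:"dp UNIV (%e. R (e 0) (e 1))"
 and f:"!!x. x <: A==>f x <: B" "!!x y. x <: A==>y <: B==>R x y<->y = f x"
 shows "fn (gr A B R) A B" "!!x. x <: A==>app (gr A B R) x = f x"
proof -
 have S:"isset {z. z <: cprod A B&(EX x y. z = pair x y&R x y)}" by (rule sep) (intro dpi dp_lift2[OF d])
 have m:"pair x y <: gr A B R<->x <: A&y = f x" for x y unfolding gr_def mem_coll[OF S] using f by auto
 have fo:"func_on (gr A B R) A" unfolding func_on_def
 proof (intro conjI allI impI)
 fix z assume "z <: gr A B R"
 hence "z <: cprod A B" unfolding gr_def mem_coll[OF S] by blast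
 thus "EX x y. z = pair x y&x <: A" by (auto simp: mem_cprod)
 next
 fix x assume "x <: A" thus "EX! y. pair x y <: gr A B R" by (simp add: m)
 qed
 show a:"app (gr A B R) x = f x" if "x <: A" for x using func_app[OF fo that,of "f x"] m that by simp
 show "fn (gr A B R) A B" using fo f(1) a by (simp add: fn_def)
qed
lemma dt_gr: assumes "dt UNIV (%e. A (e 0))" "dt UNIV (%e. B (e 0))" "dp UNIV (%e. R (e 0) (e 1) (e 2))" "dt UNIV t"
 shows "dt UNIV (%e. gr (A (t e)) (B (t e)) (R (t e)))"
 unfolding gr_def by (rule dt_coll_lift1[OF _ _ assms(4)])
 (rule sep,(intro dpi dp_lift3[OF assms(3)] dt_fun1[OF assms(1)] dt_fun1[OF assms(2)])+)

definition ev :: "'v => 'v => real" where "ev x i = real_val (ap x i)"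
lemma ev: assumes "fn x I reals" "i <: I" shows "ap x i = rlc (ev x i)" "ev x i : Reals_in" "isr (ap x i)" "ap x i <: reals"
proof -
 show a:"ap x i <: reals" using assms by (simp add: fn_ap)
 thus i:"isr (ap x i)" by (simp add: mem_reals)
 thus "ap x i = rlc (ev x i)" "ev x i : Reals_in" using isr_val[OF i] by (simp_all add: ev_def)
qed
lemma ev_eqI: assumes "fn x I reals" "fn y I reals" "!!i. i <: I==>ev x i = ev y i" shows "x = y"
 by (rule fn_eqI[OF assms(1,2)]) (simp add: ev(1)[OF assms(1)] ev(1)[OF assms(2)] assms(3))

definition mk :: "'v => ('v => 'v) => 'v" where "mk I g = lam I g"
lemma mk: assumes "dt UNIV (%e. g (e 0))" "!!i. i <: I==>h i : Reals_in&g i = rlc (h i)"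
 shows "fn (mk I g) I reals" "!!i. i <: I==>ev (mk I g) i = h i" "!!i. i <: I==>ap (mk I g) i = g i"
proof -
 have a:"g i <: reals" if "i <: I" for i using assms(2)[OF that] by simp
 show "fn (mk I g) I reals" unfolding mk_def by (rule fn_lam[OF assms(1) a])
 show b:"ap (mk I g) i = g i" if "i <: I" for i unfolding mk_def by (rule lam_fn(3)[OF assms(1) a that])
 show "ev (mk I g) i = h i" if "i <: I" for i using b[OF that] assms(2)[OF that] by (simp add: ev_def)
qed

end

section \<open>A uniformly definable family of normed spaces\<close>

locale bspace = zf0 mem for mem :: "'v => 'v => bool" (infix \<open><:\<close> 50) +
 fixes I :: 'v and Q :: "'v => 'v => 'v => bool"
 assumes dQ:"dp UNIV (%e. Q (e 0) (e 1) (e 2))"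
begin

lemma dp_Q:"dt UNIV t==>dt UNIV u==>dt UNIV v==>dp UNIV (%e. Q (t e) (u e) (v e))"
 by (rule dp_lift3[OF dQ])

text \<open>Feasibility of rational weights stated internally: \<open>f\<close> enumerates the
  finite set, \<open>w\<close> lists the weights and \<open>v\<close> their reciprocals, so that no
  division is required.\<close>

definition wok :: "'v => 'v => 'v => 'v => 'v => bool" where
"wok a n f w v<->fn w n Rat&fn v n Rat&(ALL l. l <: n-->QMUL (ap w l) (ap v l) (rtc 1)&QLT (rtc 0) (ap w l)) &
 (ALL k. ext k <= ext n&(ALL l l'. l <: k&l' <: k&l ~= l'-->Q a (ap f l) (ap f l')) -->
 ~ rlt (rlc 1) (rsm (%l. if l <: k then rq (ap w l) else rlc 0) n))"
text \<open>The internal counterpart of \<open>HC\<close>: finite sets become injective enumerations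
  by a numeral.\<close>

definition ncut :: "'v => 'v => 'v => bool" where
"ncut a x z<->QLT z (rtc 0) \<or> (EX n f r. n <: omega&fn f n I&(ALL l l'. l <: n&l' <: n&ap f l = ap f l'-->l = l') &
 r <: Rat&QLT z r&~ QLT r (rtc 0) &
 (ALL w v. wok a n f w v-->~ rlt (rsm (%l. rmu (p4 (ap x (ap f l))) (rq (ap v l))) n) (p4 (rq r))))"

lemma dp_ncut:"dt UNIV t==>dt UNIV u==>dt UNIV v==>dp UNIV (%e. ncut (t e) (u e) (v e))"
 by (rule dp_lift3[where Q = ncut]) (unfold ncut_def wok_def,intro dpi dp_Q)

lemma wok_iff: assumes f:"inj_on g {..<n}" "!!l. l < n==>ap f (num l) = g l"
 and w:"fn w (num n) Rat" "fn v (num n) Rat" "!!l. l < n==>0 < om l&ap w (num l) = rtc (om l)&ap v (num l) = rtc (1 / om l)"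
 shows "wok a (num n) f w v<->feas (Q a) (g ` {..<n}) (%i. of_rat (om (inv_into {..<n} g i)))"
proof -
 let ?W = "%i. of_rat (om (inv_into {..<n} g i)) :: real"
 have W:"?W (g l) = of_rat (om l)" if "l < n" for l using f(1) that by simp
 have A:"ALL l. l <: num n-->QMUL (ap w l) (ap v l) (rtc 1)&QLT (rtc 0) (ap w l)"
 proof (intro allI impI)
 fix l assume "l <: num n"
 then obtain k where k:"l = num k" "k < n" using ext_num[of n] by (auto simp flip: mem_ext)
 thus "QMUL (ap w l) (ap v l) (rtc 1)&QLT (rtc 0) (ap w l)" using w(3)[OF k(2)] by (simp add: QMUL_iff QLT_iff)
 qed
 have B:"\<forall>i\<in>g ` {..<n}. 0 < ?W i" using W w(3) by auto
 let ?P = "%k. (ALL l l'. l <: k&l' <: k&l ~= l'-->Q a (ap f l) (ap f l')) -->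
 ~ rlt (rlc 1) (rsm (%l. if l <: k then rq (ap w l) else rlc 0) (num n))"
 let ?R = "%K. (\<forall>i\<in>K. \<forall>j\<in>K. i ~= j-->Q a i j)-->(\<Sum>i\<in>K. ?W i) <= 1"
 have C:"?P k<->?R (g ` L)" if L:"L <= {..<n}" "ext k = num ` L" for k L
 proof -
 have k:"num l <: k<->l : L" for l using L(2) by (auto simp flip: mem_ext)
 have 1:"(ALL l l'. l <: k&l' <: k&l ~= l'-->Q a (ap f l) (ap f l'))<->(\<forall>i\<in>L. \<forall>j\<in>L. i ~= j-->Q a (g i) (g j))" (is "?a<->?b")
 proof
 assume ?a thus ?b using k f(2) L(1) by (metis lessThan_iff num_inj subsetD)
 next
 assume b: ?b
 show ?a
 proof (intro allI impI)
 fix l l' assume h:"l <: k&l' <: k&l ~= l'"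
 then obtain i j where ij:"l = num i" "i : L" "l' = num j" "j : L" using L(2) mem_ext by (metis (no_types,lifting) imageE)
 hence "i ~= j" using h by auto
 hence "Q a (g i) (g j)" using b ij by blast
 thus "Q a (ap f l) (ap f l')" using f(2)[of i] f(2)[of j] ij subsetD[OF L(1) ij(2)] subsetD[OF L(1) ij(4)] by simp
 qed
 qed
 have gi:"g i = g j<->i = j" if "i : L" "j : L" for i j using f(1) that L(1) by (auto simp: inj_on_def)
 have 2:"(\<forall>i\<in>g ` L. \<forall>j\<in>g ` L. i ~= j-->Q a i j)<->(\<forall>i\<in>L. \<forall>j\<in>L. i ~= j-->Q a (g i) (g j))" using gi by auto
 have s:"(\<Sum>l<n. if l : L then of_rat (om l) else 0) : Reals_in&rsm (%l. if l <: k then rq (ap w l) else rlc 0) (num n) =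
 rlc (\<Sum>l<n. if l : L then of_rat (om l) else 0)"
 by (rule rsm_num) (use w(3) in \<open>auto simp: k rq_code rat_Reals Reals_const\<close>)
 have "(\<Sum>i\<in>g ` L. ?W i) = (\<Sum>l\<in>L. ?W (g l))" using f(1) L(1) by (intro sum.reindex_cong[of g]) (auto intro: inj_on_subset)
 also have "... = (\<Sum>l\<in>L. of_rat (om l))" using W L(1) by (intro sum.cong) auto
 also have "... = (\<Sum>l<n. if l : L then of_rat (om l) else 0)" using L(1) by (simp add: sum.If_cases Int_absorb1)
 finally have "~ rlt (rlc 1) (rsm (%l. if l <: k then rq (ap w l) else rlc 0) (num n))<->(\<Sum>i\<in>g ` L. ?W i) <= 1"
 using rlt_code[OF Reals_const(2) conjunct1[OF s]] s by (simp add: linorder_not_less)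
 thus ?thesis using 1 2 by simp
 qed
 have D:"(ALL k. ext k <= ext (num n)-->?P k)<->(\<forall>K\<subseteq>g ` {..<n}. ?R K)"
 proof
 assume h:"ALL k. ext k <= ext (num n)-->?P k"
 show "\<forall>K\<subseteq>g ` {..<n}. ?R K"
 proof (intro allI impI)
 fix K assume "K <= g ` {..<n}" and K:"\<forall>i\<in>K. \<forall>j\<in>K. i ~= j-->Q a i j"
 then obtain L where L:"L <= {..<n}" "K = g ` L" using subset_imageE by metis
 hence "finite (num ` L)" by (metis finite_imageI finite_lessThan finite_subset)
 then obtain k where k:"ext k = num ` L" using finite_subset_isset by blast
 have e:"ext k <= ext (num n)" unfolding k ext_num by (rule image_mono[OF L(1)])
 have "?P k" by (rule h[THEN spec,THEN mp,OF e])
 hence "?R (g ` L)" by (simp only: C[OF L(1) k])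
 thus "(\<Sum>i\<in>K. ?W i) <= 1" using K unfolding L(2) by (rule mp)
 qed
 next
 assume h:"\<forall>K\<subseteq>g ` {..<n}. ?R K"
 have "?P k" if k:"ext k <= ext (num n)" for k
 proof -
 obtain L where L:"L <= {..<n}" "ext k = num ` L" by (rule subset_imageE[OF k[unfolded ext_num]])
 have "?R (g ` L)" by (rule h[THEN spec,THEN mp,OF image_mono[OF L(1)]])
 thus ?thesis by (simp only: C[OF L])
 qed
 thus "ALL k. ext k <= ext (num n)-->?P k" by blast
 qed
 show ?thesis unfolding wok_def feas_def imp_conjL using w(1,2) D[unfolded imp_conjL] by (simp only: simp_thms eqTrueI[OF A] eqTrueI[OF B])
qed

text \<open>Numerals are standard and every HOL function on a finite set of elements is a set of the
  structure. Hence internal enumerations and weights range over exactly the finite sets and rational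
  weights of \<open>HC\<close>.\<close>

lemma ncut_HC: assumes x:"fn x I reals" shows "ncut a x (rtc q)<->HC (Q a) (ext I) (ev x) q"
proof -
 define S where "S f v n = rsm (%l. rmu (p4 (ap x (ap f l))) (rq (ap v l))) n" for f v n
 have val:"~ rlt (S f v (num n)) (p4 (rq (rtc r)))<->of_rat (r ^ 4) <= (\<Sum>i\<in>g ` {..<n}. ev x i ^ 4 / W i)"
 if g:"inj_on g {..<n}" "!!l. l < n==>ap f (num l) = g l&g l <: I" 
 and v:"!!l. l < n==>ap v (num l) = rtc (1 / om l)" and W:"!!l. l < n==>W (g l) = of_rat (om l)" for g f v n r om and W :: "'v => real"
 proof -
 have s:"(\<Sum>l<n. ev x (g l) ^ 4 * of_rat (1 / om l)) : Reals_in&S f v (num n) = rlc (\<Sum>l<n. ev x (g l) ^ 4 * of_rat (1 / om l))"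
 unfolding S_def
 proof (rule rsm_num)
 fix l assume l:"l < n"
 have gl:"g l <: I" "ap f (num l) = g l" using g(2) l by auto
 show "ev x (g l) ^ 4 * of_rat (1 / om l) : Reals_in&rmu (p4 (ap x (ap f (num l)))) (rq (ap v (num l))) = rlc (ev x (g l) ^ 4 * of_rat (1 / om l))"
 unfolding gl(2) v[OF l] rq_code ev(1)[OF x gl(1)] using ev(2)[OF x gl(1)] rat_Reals Reals_mult by simp
 qed
 have "(\<Sum>i\<in>g ` {..<n}. ev x i ^ 4 / W i) = (\<Sum>l<n. ev x (g l) ^ 4 / W (g l))" using g(1) by (intro sum.reindex_cong[of g]) auto
 also have "... = (\<Sum>l<n. ev x (g l) ^ 4 * of_rat (1 / om l))" using W by (intro sum.cong) (auto simp: of_rat_divide)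
 finally show ?thesis using rlt_code[OF conjunct1[OF s] p4_code(2)[OF rat_Reals[of r]]] s rat_Reals[of r]
 by (simp add: rq_code linorder_not_less of_rat_power)
 qed
 have inner:"(ALL w v. wok a (num n) f w v-->~ rlt (S f v (num n)) (p4 (rq (rtc r)))) <->
 (ALL w. (\<forall>i\<in>g ` {..<n}. w i : range of_rat)&feas (Q a) (g ` {..<n}) w-->of_rat (r ^ 4) <= (\<Sum>i\<in>g ` {..<n}. ev x i ^ 4 / w i))" (is "?L<->?R")
 if g:"inj_on g {..<n}" "!!l. l < n==>ap f (num l) = g l&g l <: I" for g f n r
 proof
 assume L: ?L
 show ?R
 proof (intro allI impI)
 fix W assume h:"(\<forall>i\<in>g ` {..<n}. W i : range of_rat)&feas (Q a) (g ` {..<n}) W"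
 define om where "om l = (SOME c. W (g l) = of_rat c)" for l
 have o:"W (g l) = of_rat (om l)" if "l < n" for l 
 proof -
 have "W (g l) : range of_rat" using conjunct1[OF h] that by (metis imageI lessThan_iff)
 hence "EX c. W (g l) = of_rat c" by blast
 thus ?thesis unfolding om_def by (rule someI_ex)
 qed
 have pos:"0 < om l" if l:"l < n" for l
 proof -
 have "0 < W (g l)" using h l unfolding feas_def by auto
 thus ?thesis using o[OF l] by simp
 qed
 define w v where "w = lam (num n) (%z. rtc (om (nv z)))" and "v = lam (num n) (%z. rtc (1 / om (nv z)))"
 have fin:"finite (ext (num n))" by (simp add: ext_num)
 have R:"rtc c <: Rat" for c using mem_Rat by blast
 have w:"fn w (num n) Rat" "fn v (num n) Rat" "!!l. l < n==>ap w (num l) = rtc (om l)&ap v (num l) = rtc (1 / om l)"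
 unfolding w_def v_def using fn_finite(1)[OF fin R] fn_finite(3)[OF fin R,of "num _"] by (simp_all add: num_mem)
 have "W i = of_rat (om (inv_into {..<n} g i))" if "i : g ` {..<n}" for i using that o g(1) by auto
 hence "feas (Q a) (g ` {..<n}) (%i. of_rat (om (inv_into {..<n} g i)))"
 using h feas_cong[of "g ` {..<n}" W "%i. of_rat (om (inv_into {..<n} g i))" "Q a"] by blast
 hence "wok a (num n) f w v" using wok_iff[OF g(1) _ w(1,2),of f om a] g(2) w(3) pos by blast
 thus "of_rat (r ^ 4) <= (\<Sum>i\<in>g ` {..<n}. ev x i ^ 4 / W i)" using L val[OF g,of v om W r] w(3) o by blast
 qed
 next
 assume R: ?R
 show ?L
 proof (intro allI impI)
 fix w v assume h:"wok a (num n) f w v"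
 have wv:"fn w (num n) Rat" "fn v (num n) Rat" "ALL l. l <: num n-->QMUL (ap w l) (ap v l) (rtc 1)&QLT (rtc 0) (ap w l)"
 using h unfolding wok_def by blast+
 define om where "om l = (SOME c. ap w (num l) = rtc c)" for l
 have o:"0 < om l&ap w (num l) = rtc (om l)&ap v (num l) = rtc (1 / om l)" if l:"l < n" for l
 proof -
 have ln:"num l <: num n" using l num_mem by blast
 have "ap w (num l) <: Rat" "ap v (num l) <: Rat" using wv ln unfolding fn_ap by blast+
 then obtain c d where cd:"ap w (num l) = rtc c" "ap v (num l) = rtc d" using mem_Rat by auto
 have "om l = c" unfolding om_def using cd by auto
 moreover have "c * d = 1" "0 < c" using wv(3) ln cd by (auto simp: QMUL_iff QLT_iff)
 moreover have "d = 1 / c" using calculation by (simp add: field_simps)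
 ultimately show ?thesis using cd by simp
 qed
 let ?W = "%i. of_rat (om (inv_into {..<n} g i)) :: real"
 have W:"?W (g l) = of_rat (om l)" if "l < n" for l using g(1) that by simp
 have fe:"feas (Q a) (g ` {..<n}) ?W" using wok_iff[OF g(1) _ wv(1,2),of f om a] g(2) o h by blast
 have "of_rat (r ^ 4) <= (\<Sum>i\<in>g ` {..<n}. ev x i ^ 4 / ?W i)" by (rule R[THEN spec,THEN mp,OF conjI[OF _ fe]]) simp
 moreover have "!!l. l < n==>ap v (num l) = rtc (1 / om l)" using o by blast
 ultimately show "~ rlt (S f v (num n)) (p4 (rq (rtc r)))" using val[OF g,of v om ?W r] W by blast
 qed
 qed
 show ?thesis
 proof
 assume h:"ncut a x (rtc q)"
 show "HC (Q a) (ext I) (ev x) q"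
 proof (cases "q < 0")
 case False
 then obtain n' f r' where *: "n' <: omega" "fn f n' I" "ALL l l'. l <: n'&l' <: n'&ap f l = ap f l'-->l = l'"
 "r' <: Rat" "QLT (rtc q) r'" "~ QLT r' (rtc 0)" "ALL w v. wok a n' f w v-->~ rlt (S f v n') (p4 (rq r'))"
 using h unfolding ncut_def S_def[symmetric] QLT_iff by blast
 obtain n r where n:"n' = num n" "r' = rtc r" using *(1,4) mem_omega mem_Rat by blast
 define g where "g l = ap f (num l)" for l
 have g:"inj_on g {..<n}" "!!l. l < n==>ap f (num l) = g l&g l <: I"
 proof -
 show "inj_on g {..<n}" unfolding inj_on_def g_def using *(3) unfolding n by (metis lessThan_iff num_inj num_mem)
 show "ap f (num l) = g l&g l <: I" if "l < n" for l using *(2) that unfolding g_def n fn_ap by (simp add: num_mem)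
 qed
 show ?thesis unfolding HC_def
 using inner[OF g,of r] *(5,6,7) g(2) unfolding n QLT_iff
 by (intro disjI2 exI[of _ "g ` {..<n}"] exI[of _ r]) auto
 qed (simp add: HC_def)
 next
 assume h:"HC (Q a) (ext I) (ev x) q"
 show "ncut a x (rtc q)"
 proof (cases "q < 0")
 case True thus ?thesis by (simp add: ncut_def QLT_iff)
 next
 case False
 then obtain F r where F:"finite F" "F <= ext I" "q < r" "0 <= r"
 "ALL w. (\<forall>i\<in>F. w i : range of_rat)&feas (Q a) F w-->of_rat (r ^ 4) <= (\<Sum>i\<in>F. ev x i ^ 4 / w i)" using h unfolding HC_def by blast
 obtain g where g0:"bij_betw g {..<card F} F" using ex_bij_betw_nat_finite[OF F(1)] by (auto simp: atLeast0LessThan)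
 define n f where "n = card F" and "f = lam (num n) (%z. g (nv z))"
 have gF:"inj_on g {..<n}" "g ` {..<n} = F" using g0 unfolding bij_betw_def n_def by auto
 have gI:"g l <: I" if "l < n" for l using gF(2) F(2) that by (auto simp flip: mem_ext)
 have z:"\<exists>l<n. z = num l" if "z <: num n" for z using that ext_num[of n] by (auto simp flip: mem_ext)
 have gz:"g (nv z) <: I" if "z <: num n" for z using z[OF that] gI by auto
 have f:"fn f (num n) I" "!!l. l < n==>ap f (num l) = g l"
 using fn_finite(1)[OF _ gz] fn_finite(3)[OF _ gz] unfolding f_def by (auto simp: ext_num num_mem)
 have i:"l = l'" if h:"l <: num n" "l' <: num n" "ap f l = ap f l'" for l l'
 proof -
 obtain i j where ij:"i < n" "l = num i" "j < n" "l' = num j" using z h by blast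
 hence "g i = g j" using h(3) f(2) by simp
 thus ?thesis using gF(1) ij by (auto simp: inj_on_def)
 qed
 have fin:"ALL w v. wok a (num n) f w v-->~ rlt (S f v (num n)) (p4 (rq (rtc r)))"
 using inner[OF gF(1),of f r] f(2) gI F(5) gF(2) by blast
 have R:"rtc r <: Rat" "QLT (rtc q) (rtc r)" "~ QLT (rtc r) (rtc 0)" using mem_Rat F(3,4) by (auto simp: QLT_iff)
 show ?thesis unfolding ncut_def S_def[symmetric]
 by (rule disjI2,rule exI[of _ "num n"],rule exI[of _ f],rule exI[of _ "rtc r"]) (use f(1) i fin R in auto)
 qed
 qed
qed

text \<open>The bounded real families, by \<open>HC_bd\<close>: some rational is missing from the
  internal cut of the norm.\<close>

definition pts :: "'v => 'v" where "pts a = coll {x. x <: fs I reals&(EX q. q <: Rat&~ ncut a x q)}"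
lemma isset_pts:"isset {x. x <: fs I reals&(EX q. q <: Rat&~ ncut a x q)}" by (rule sep) (intro dpi dp_ncut)
lemma mem_pts:"x <: pts a<->fn x I reals&bd (Q a) (ext I) (ev x)"
 unfolding pts_def mem_coll[OF isset_pts] unfolding mem_Collect_eq mem_fs
proof (rule conj_cong[OF refl])
 assume x:"fn x I reals"
 have "(EX q. q <: Rat&~ ncut a x q)<->(EX q. ~ ncut a x (rtc q))" unfolding mem_Rat by blast
 thus "(EX q. q <: Rat&~ ncut a x q)<->bd (Q a) (ext I) (ev x)" by (simp add: HC_bd ncut_HC[OF x])
qed
lemma dt_pts:"dt UNIV t==>dt UNIV (%e. pts (t e))" unfolding pts_def
 by (rule dt_coll_lift1[OF isset_pts]) (intro dpi dp_ncut)

definition pl :: "'v => 'v" where "pl a = gr (cprod (pts a) (pts a)) (pts a)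
 ((%a u w. EX x y. u = pair x y&(ALL i. i <: I-->ap w i = rad (ap x i) (ap y i))) a)"
definition sc :: "'v => 'v" where "sc a = gr (cprod reals (pts a)) (pts a)
 ((%a u w. EX c x. u = pair c x&(ALL i. i <: I-->ap w i = rmu c (ap x i))) a)"
definition nm :: "'v => 'v" where "nm a = gr (pts a) reals ((%a x c. ALL z. z <: c<->z <: Rat&ncut a x z) a)"
definition X :: "'v => 'v" where "X a = pair (pair (pts a) (pl a)) (pair (sc a) (nm a))"
definition N :: "'v => 'v => real" where "N a x = nX (Q a) (ext I) (ev x)"

lemma dt_X:"dt UNIV t==>dt UNIV (%e. X (t e))"
proof (rule dt_fun1[of _ X])
 show "dt UNIV (%e. X (e 0))" unfolding X_def pl_def sc_def nm_def
 by (intro dpi dt_pts dt_gr dp_ncut)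
qed

lemma X_parts:"points (X a) = pts a" "plus_of (X a) = pl a" "scale_of (X a) = sc a" "norm_of (X a) = nm a"
 by (simp_all add: X_def points_def plus_of_def scale_of_def norm_of_def)

definition vad :: "'v => 'v => 'v" where "vad x y = mk I (%i. rad (ap x i) (ap y i))"
definition vsc :: "'v => 'v => 'v" where "vsc c x = mk I (%i. rmu c (ap x i))"
definition vz :: 'v where "vz = mk I (%i. rlc 0)"

lemma vad: assumes "x <: pts a" "y <: pts a"
 shows "vad x y <: pts a" "i <: I==>ev (vad x y) i = ev x i + ev y i" "i <: I==>ap (vad x y) i = rad (ap x i) (ap y i)"
proof -
 have f:"fn x I reals" "fn y I reals" using assms mem_pts by blast+
 have d:"dt UNIV (%e. rad (ap x (e 0)) (ap y (e 0)))" by (intro dpi)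
 have h:"ev x i + ev y i : Reals_in&rad (ap x i) (ap y i) = rlc (ev x i + ev y i)" if "i <: I" for i
 using ev(1,2)[OF f(1) that] ev(1,2)[OF f(2) that] Reals_add by simp
 have m1:"fn (vad x y) I reals" unfolding vad_def by (rule mk(1)[where h = "%i. ev x i + ev y i",OF d h])
 have m2:"i <: I==>ev (vad x y) i = ev x i + ev y i" for i unfolding vad_def by (rule mk(2)[where h = "%i. ev x i + ev y i",OF d h])
 have m3:"i <: I==>ap (vad x y) i = rad (ap x i) (ap y i)" for i unfolding vad_def by (rule mk(3)[where h = "%i. ev x i + ev y i",OF d h])
 note m = m1 m2 m3
 show "i <: I==>ev (vad x y) i = ev x i + ev y i" "i <: I==>ap (vad x y) i = rad (ap x i) (ap y i)" using m(2,3) by simp_all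
 have "bd (Q a) (ext I) (ev (vad x y))" using nX_add(1)[of "Q a" "ext I" "ev x" "ev y"] assms mem_pts
 nX_cong(2)[of "ext I" "ev (vad x y)" "%i. ev x i + ev y i" "Q a"] m(2) by simp
 thus "vad x y <: pts a" using m(1) mem_pts by blast
qed
lemma vsc: assumes "r : Reals_in" "x <: pts a"
 shows "vsc (rlc r) x <: pts a" "i <: I==>ev (vsc (rlc r) x) i = r * ev x i" "i <: I==>ap (vsc (rlc r) x) i = rmu (rlc r) (ap x i)"
proof -
 have f:"fn x I reals" using assms mem_pts by blast
 have d:"dt UNIV (%e. rmu (rlc r) (ap x (e 0)))" by (intro dpi)
 have h:"r * ev x i : Reals_in&rmu (rlc r) (ap x i) = rlc (r * ev x i)" if "i <: I" for i
 using ev(1,2)[OF f that] assms(1) Reals_mult by simp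
 have m1:"fn (vsc (rlc r) x) I reals" unfolding vsc_def by (rule mk(1)[where h = "%i. r * ev x i",OF d h])
 have m2:"i <: I==>ev (vsc (rlc r) x) i = r * ev x i" for i unfolding vsc_def by (rule mk(2)[where h = "%i. r * ev x i",OF d h])
 have m3:"i <: I==>ap (vsc (rlc r) x) i = rmu (rlc r) (ap x i)" for i unfolding vsc_def by (rule mk(3)[where h = "%i. r * ev x i",OF d h])
 note m = m1 m2 m3
 show "i <: I==>ev (vsc (rlc r) x) i = r * ev x i" "i <: I==>ap (vsc (rlc r) x) i = rmu (rlc r) (ap x i)" using m(2,3) by simp_all
 have "bd (Q a) (ext I) (ev (vsc (rlc r) x))" using nX_scale(1)[of "Q a" "ext I" "ev x" r] assms mem_pts
 nX_cong(2)[of "ext I" "ev (vsc (rlc r) x)" "%i. r * ev x i" "Q a"] m(2) by simp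
 thus "vsc (rlc r) x <: pts a" using m(1) mem_pts by blast
qed
lemma vz:"vz <: pts a" "i <: I==>ev vz i = 0"
proof -
 note m = mk[of "%i. rlc 0" I "%i. 0",folded vz_def,OF dt_const_UNIV,simplified Reals_const,simplified]
 show "i <: I==>ev vz i = 0" using m(2) by blast
 have "bd (Q a) (ext I) (ev vz)" by (rule nX_fin(1)[of "{}"]) (use m(2) in auto)
 thus "vz <: pts a" using m(1) mem_pts by blast
qed

lemma pl:"fn (pl a) (cprod (pts a) (pts a)) (pts a)" "x <: pts a==>y <: pts a==>app (pl a) (pair x y) = vad x y"
proof -
 let ?R = "%u w. EX x y. u = pair x y&(ALL i. i <: I-->ap w i = rad (ap x i) (ap y i))"
 have d:"dp UNIV (%e. ?R (e 0) (e 1))" by (intro dpi)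
 have 1:"vad (pfst u) (psnd u) <: pts a" if "u <: cprod (pts a) (pts a)" for u using that vad(1) by (auto simp: mem_cprod)
 have 2:"?R u w<->w = vad (pfst u) (psnd u)" if h:"u <: cprod (pts a) (pts a)" "w <: pts a" for u w
 proof -
 obtain x y where u:"u = pair x y" "x <: pts a" "y <: pts a" using h(1) mem_cprod by blast
 have "(ALL i. i <: I-->ap w i = rad (ap x i) (ap y i))<->w = vad x y"
 (is "?a = ?b")
 proof
 have f:"fn w I reals" "fn (vad x y) I reals" using h(2) vad(1)[OF u(2,3)] mem_pts by blast+
 show "?a==>?b" using vad(3)[OF u(2,3)] by (intro fn_eqI[OF f]) simp
 show "?b==>?a" using vad(3)[OF u(2,3)] by simp
 qed
 thus ?thesis using u by simp
 qed
 note g = gr[of ?R "cprod (pts a) (pts a)" "%u. vad (pfst u) (psnd u)" "pts a",OF d 1 2]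
 show "fn (pl a) (cprod (pts a) (pts a)) (pts a)" unfolding pl_def using g(1) by blast
 show "app (pl a) (pair x y) = vad x y" if "x <: pts a" "y <: pts a" unfolding pl_def using g(2)[of "pair x y"] that by simp
qed
lemma sc:"fn (sc a) (cprod reals (pts a)) (pts a)" "r : Reals_in==>x <: pts a==>app (sc a) (pair (rlc r) x) = vsc (rlc r) x"
proof -
 let ?R = "%u w. EX c x. u = pair c x&(ALL i. i <: I-->ap w i = rmu c (ap x i))"
 have d:"dp UNIV (%e. ?R (e 0) (e 1))" by (intro dpi)
 have 1:"vsc (pfst u) (psnd u) <: pts a" if "u <: cprod reals (pts a)" for u using that vsc(1) by (auto simp: mem_cprod mem_reals')
 have 2:"?R u w<->w = vsc (pfst u) (psnd u)" if h:"u <: cprod reals (pts a)" "w <: pts a" for u w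
 proof -
 obtain r x where u:"u = pair (rlc r) x" "r : Reals_in" "x <: pts a" using h(1) by (auto simp: mem_cprod mem_reals')
 have "(ALL i. i <: I-->ap w i = rmu (rlc r) (ap x i))<->w = vsc (rlc r) x"
 (is "?a = ?b")
 proof
 have f:"fn w I reals" "fn (vsc (rlc r) x) I reals" using h(2) vsc(1)[OF u(2,3)] mem_pts by blast+
 show "?a==>?b" using vsc(3)[OF u(2,3)] by (intro fn_eqI[OF f]) simp
 show "?b==>?a" using vsc(3)[OF u(2,3)] by simp
 qed
 thus ?thesis using u by simp
 qed
 note g = gr[of ?R "cprod reals (pts a)" "%u. vsc (pfst u) (psnd u)" "pts a",OF d 1 2]
 show "fn (sc a) (cprod reals (pts a)) (pts a)" unfolding sc_def using g(1) by blast
 show "app (sc a) (pair (rlc r) x) = vsc (rlc r) x" if "r : Reals_in" "x <: pts a"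
 unfolding sc_def using g(2)[of "pair (rlc r) x"] that by simp
qed
lemma nm:"fn (nm a) (pts a) reals" "x <: pts a==>nrm (nm a) x = N a x" "x <: pts a==>N a x : Reals_in"
proof -
 let ?R = "%x c. ALL z. z <: c<->z <: Rat&ncut a x z"
 have c:"ncut a x (rtc q)<->of_rat q < N a x" if "x <: pts a" for x q
 using that ncut_HC[of x a q] HC_nX[of "Q a" "ext I" "ev x" q] mem_pts[of x a] by (simp add: N_def)
 have r:"N a x : Reals_in" if "x <: pts a" for x by (rule Reals_sep[OF _ c[OF that]]) (intro dpi dp_ncut)
 thus "x <: pts a==>N a x : Reals_in" .
 have d:"dp UNIV (%e. ?R (e 0) (e 1))" by (intro dpi dp_ncut)
 have 1:"rlc (N a x) <: reals" if "x <: pts a" for x using r[OF that] by simp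
 have 2:"?R x y<->y = rlc (N a x)" if "x <: pts a" "y <: reals" for x y using real_code_cut[OF r[OF that(1)] c[OF that(1)],of y] by blast
 note g = gr[of ?R "pts a" "%x. rlc (N a x)" reals,OF d 1 2]
 show "fn (nm a) (pts a) reals" unfolding nm_def using g(1) by blast
 show "nrm (nm a) x = N a x" if "x <: pts a" 
 proof -
 have "app (nm a) x = rlc (N a x)" unfolding nm_def using g(2)[of x] that by blast
 thus ?thesis using r[OF that] by (simp add: nrm_def)
 qed
qed

end

section \<open>Vector space laws, completeness, smoothness and density\<close>

context bspace
begin

lemma pts_fn:"x <: pts a==>fn x I reals" "x <: pts a==>bd (Q a) (ext I) (ev x)" using mem_pts by auto
lemma pts_eqI:"x <: pts a==>y <: pts a==>(!!i. i <: I==>ev x i = ev y i)==>x = y"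
 by (rule ev_eqI[OF pts_fn(1) pts_fn(1)])
lemma N_cong:"(!!i. i <: I==>ev x i = g i)==>N a x = nX (Q a) (ext I) g" unfolding N_def by (rule nX_cong(1)) simp

lemma X_vec:"carrier (vec (X a)) = ext (pts a)"
 "x <: pts a==>y <: pts a==>x \<oplus>\<^bsub>vec (X a)\<^esub> y = vad x y"
 "r : Reals_in==>x <: pts a==>r \<odot>\<^bsub>vec (X a)\<^esub> x = vsc (rlc r) x"
 "\<zero>\<^bsub>vec (X a)\<^esub> = vz"
proof -
 show "carrier (vec (X a)) = ext (pts a)" by (simp add: vec_def X_parts)
 show "x <: pts a==>y <: pts a==>x \<oplus>\<^bsub>vec (X a)\<^esub> y = vad x y" by (simp add: vec_def X_parts pl)
 show "r : Reals_in==>x <: pts a==>r \<odot>\<^bsub>vec (X a)\<^esub> x = vsc (rlc r) x" by (simp add: vec_def X_parts sc)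
 have "(THE z. z <: pts a&(ALL x. x <: pts a-->app (pl a) (pair z x) = x)) = vz"
 proof (rule the_equality)
 have "vad vz x = x" if x:"x <: pts a" for x
 by (rule pts_eqI[OF vad(1)[OF vz(1) x] x]) (simp add: vad(2)[OF vz(1) x] vz(2))
 thus "vz <: pts a&(ALL x. x <: pts a-->app (pl a) (pair vz x) = x)" using vz(1) pl(2) by simp
 next
 fix z assume z:"z <: pts a&(ALL x. x <: pts a-->app (pl a) (pair z x) = x)"
 hence z1:"z <: pts a" and "app (pl a) (pair z vz) = vz" using vz(1) by blast+
 hence e:"vad z vz = vz" using pl(2)[OF z1 vz(1)] by simp
 show "z = vz"
 proof (rule pts_eqI[OF z1 vz(1)])
 fix i assume i:"i <: I"
 show "ev z i = ev vz i" using vad(2)[OF z1 vz(1) i] unfolding e by (simp add: vz(2)[OF i])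
 qed
 qed
 thus "\<zero>\<^bsub>vec (X a)\<^esub> = vz" by (simp add: vec_def X_parts)
qed

lemma X_abelian:"abelian_group (vec (X a))"
proof (rule abelian_groupI)
 note V = X_vec[where a = a] vad[where a = a] vz(1)[where a = a] vz(2)
 show "x \<oplus>\<^bsub>vec (X a)\<^esub> y : carrier (vec (X a))" if "x : carrier (vec (X a))" "y : carrier (vec (X a))" for x y using that by (simp add: V)
 show "\<zero>\<^bsub>vec (X a)\<^esub> : carrier (vec (X a))" by (simp add: V)
 show "x \<oplus>\<^bsub>vec (X a)\<^esub> y \<oplus>\<^bsub>vec (X a)\<^esub> z = x \<oplus>\<^bsub>vec (X a)\<^esub> (y \<oplus>\<^bsub>vec (X a)\<^esub> z)"
 if "x : carrier (vec (X a))" "y : carrier (vec (X a))" "z : carrier (vec (X a))" for x y z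
 using that by (simp add: V) (rule pts_eqI[of _ a],simp_all add: V)
 show "x \<oplus>\<^bsub>vec (X a)\<^esub> y = y \<oplus>\<^bsub>vec (X a)\<^esub> x" if "x : carrier (vec (X a))" "y : carrier (vec (X a))" for x y
 using that by (simp add: V) (rule pts_eqI[of _ a],simp_all add: V)
 show "\<zero>\<^bsub>vec (X a)\<^esub> \<oplus>\<^bsub>vec (X a)\<^esub> x = x" if "x : carrier (vec (X a))" for x
 using that by (simp add: V) (rule pts_eqI[of _ a],simp_all add: V)
 show "\<exists>y\<in>carrier (vec (X a)). y \<oplus>\<^bsub>vec (X a)\<^esub> x = \<zero>\<^bsub>vec (X a)\<^esub>" if "x : carrier (vec (X a))" for x
 proof -
 have x:"x <: pts a" using that by (simp add: V)
 have r:"- 1 : Reals_in" using Reals_minus[OF Reals_const(2)] by simp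
 note y = vsc[OF r x]
 have "vad (vsc (rlc (- 1)) x) x = vz"
 by (rule pts_eqI[OF vad(1)[OF y(1) x] vz(1)]) (simp add: vad(2)[OF y(1) x] y vz)
 thus ?thesis using y(1) x by (intro bexI[of _ "vsc (rlc (- 1)) x"]) (simp_all add: V)
 qed
qed

lemma X_module:"module scalars (vec (X a))"
proof (rule moduleI[OF cring_scalars X_abelian])
 note V = X_vec[where a = a] vad[where a = a] vz(1)[where a = a] vz(2) vsc[where a = a]
 have c:"r : carrier scalars<->r : Reals_in" "r \<oplus>\<^bsub>scalars\<^esub> s = r + s" "r \<otimes>\<^bsub>scalars\<^esub> s = r * s" "\<one>\<^bsub>scalars\<^esub> = 1" for r s
 by (simp_all add: scalars_def)
 show "r \<odot>\<^bsub>vec (X a)\<^esub> x : carrier (vec (X a))" if "r : carrier scalars" "x : carrier (vec (X a))" for r x using that by (simp add: c V)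
 show "(r \<oplus>\<^bsub>scalars\<^esub> s) \<odot>\<^bsub>vec (X a)\<^esub> x = r \<odot>\<^bsub>vec (X a)\<^esub> x \<oplus>\<^bsub>vec (X a)\<^esub> s \<odot>\<^bsub>vec (X a)\<^esub> x"
 if "r : carrier scalars" "s : carrier scalars" "x : carrier (vec (X a))" for r s x
 using that by (simp add: c V Reals_add) (rule pts_eqI[of _ a],simp_all add: V Reals_add algebra_simps)
 show "r \<odot>\<^bsub>vec (X a)\<^esub> (x \<oplus>\<^bsub>vec (X a)\<^esub> y) = r \<odot>\<^bsub>vec (X a)\<^esub> x \<oplus>\<^bsub>vec (X a)\<^esub> r \<odot>\<^bsub>vec (X a)\<^esub> y"
 if "r : carrier scalars" "x : carrier (vec (X a))" "y : carrier (vec (X a))" for r x y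
 using that by (simp add: c V) (rule pts_eqI[of _ a],simp_all add: V algebra_simps)
 show "(r \<otimes>\<^bsub>scalars\<^esub> s) \<odot>\<^bsub>vec (X a)\<^esub> x = r \<odot>\<^bsub>vec (X a)\<^esub> (s \<odot>\<^bsub>vec (X a)\<^esub> x)"
 if "r : carrier scalars" "s : carrier scalars" "x : carrier (vec (X a))" for r s x
 using that by (simp add: c V Reals_mult) (rule pts_eqI[of _ a],simp_all add: V Reals_mult algebra_simps)
 show "\<one>\<^bsub>scalars\<^esub> \<odot>\<^bsub>vec (X a)\<^esub> x = x" if "x : carrier (vec (X a))" for x
 using that by (simp add: c V Reals_const) (rule pts_eqI[of _ a],simp_all add: V Reals_const)
qed

lemma X_minus: assumes x:"x <: pts a" and y:"y <: pts a"
 shows "x \<ominus>\<^bsub>vec (X a)\<^esub> y <: pts a" "i <: I==>ev (x \<ominus>\<^bsub>vec (X a)\<^esub> y) i = ev x i - ev y i"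
 "N a (x \<ominus>\<^bsub>vec (X a)\<^esub> y) = nX (Q a) (ext I) (%i. ev x i - ev y i)"
proof -
 have yc:"y : carrier (vec (X a))" using y by (simp add: X_vec)
 define n where "n = \<ominus>\<^bsub>vec (X a)\<^esub> y"
 have n:"n <: pts a" using abelian_group.a_inv_closed[OF X_abelian yc] by (simp add: X_vec n_def)
 have "vad y n = vz" using abelian_group.r_neg[OF X_abelian yc] X_vec(2)[OF y n] X_vec(4) by (simp add: n_def)
 hence e:"i <: I==>ev y i + ev n i = 0" for i using vad(2)[OF y n,of i] vz(2)[of i] by simp
 have d:"x \<ominus>\<^bsub>vec (X a)\<^esub> y = vad x n" using X_vec(2)[OF x n] by (simp add: a_minus_def n_def)
 show "x \<ominus>\<^bsub>vec (X a)\<^esub> y <: pts a" unfolding d by (rule vad(1)[OF x n])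
 show i:"i <: I==>ev (x \<ominus>\<^bsub>vec (X a)\<^esub> y) i = ev x i - ev y i" for i unfolding d using vad(2)[OF x n,of i] e[of i] by simp
 show "N a (x \<ominus>\<^bsub>vec (X a)\<^esub> y) = nX (Q a) (ext I) (%i. ev x i - ev y i)" by (rule N_cong[OF i])
qed

lemma X_norm:"is_norm (X a) (nm a)"
 unfolding is_norm_def X_parts X_vec(1,4)
proof (intro conjI ballI)
 show "fn (nm a) (pts a) reals" by (rule nm)
next
 fix x assume "x : ext (pts a)"
 hence x:"x <: pts a" by simp
 show "0 <= nrm (nm a) x" using nX_nonneg[OF pts_fn(2)[OF x]] by (simp add: nm(2)[OF x] N_def)
 show "nrm (nm a) x = 0-->x = vz"
 proof
 assume "nrm (nm a) x = 0"
 hence "ev x i = 0" if "i <: I" for i using nX_coord[OF pts_fn(2)[OF x],of i] that by (simp add: nm(2)[OF x] N_def)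
 thus "x = vz" by (intro pts_eqI[OF x vz(1)]) (simp add: vz)
 qed
 show "nrm (nm a) (r \<odot>\<^bsub>vec (X a)\<^esub> x) = \<bar>r\<bar> * nrm (nm a) x" if r:"r : Reals_in" for r
 using N_cong[OF vsc(2)[OF r x],of a] nX_scale(2)[OF pts_fn(2)[OF x],of r]
 by (simp add: X_vec r x nm(2)[OF x] nm(2)[OF vsc(1)[OF r x]] N_def)
 show "nrm (nm a) (x \<oplus>\<^bsub>vec (X a)\<^esub> y) <= nrm (nm a) x + nrm (nm a) y" if "y : ext (pts a)" for y
 proof -
 have y:"y <: pts a" using that by simp
 show ?thesis using N_cong[OF vad(2)[OF x y],of a] nX_add(2)[OF pts_fn(2)[OF x] pts_fn(2)[OF y]]
 by (simp add: X_vec x y nm(2)[OF x] nm(2)[OF y] nm(2)[OF vad(1)[OF x y]] N_def)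
 qed
qed

lemma X_complete:"is_complete (X a) (nm a)"
 unfolding is_complete_def X_parts X_vec(1)
proof (intro allI impI)
 fix s assume h:"fn s omega (pts a)&(\<forall>e>0. EX N. \<forall>i\<ge>N. \<forall>j\<ge>N. nrm (nm a) (app s (num i) \<ominus>\<^bsub>vec (X a)\<^esub> app s (num j)) < e)"
 have s:"app s (num n) <: pts a" "ap s (num n) = app s (num n)" for n using h ap_eq[of s omega "num n"] unfolding fn_def by auto
 define xs where "xs n = ev (app s (num n))" for n
 have b:"bd (Q a) (ext I) (xs n)" for n unfolding xs_def by (rule pts_fn(2)[OF s(1)])
 have n:"nrm (nm a) (app s (num i) \<ominus>\<^bsub>vec (X a)\<^esub> app s (num j)) = nX (Q a) (ext I) (%k. xs i k - xs j k)" for i j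
 unfolding xs_def nm(2)[OF X_minus(1)[OF s(1) s(1)]] by (rule X_minus(3)[OF s(1) s(1)])
 have c:"EX N. \<forall>i\<ge>N. \<forall>j\<ge>N. nX (Q a) (ext I) (%k. xs i k - xs j k) < e" if "0 < e" for e
 using h that unfolding n by blast
 define L where "L i = lim (%n. xs n i)" for i
 have lim:"(%n. xs n i) \<longlonglongrightarrow> L i" if i:"i <: I" for i
 proof -
 have "Cauchy (%n. xs n i)"
 proof (rule CauchyI)
 fix e :: real assume "0 < e"
 then obtain M where M:"\<forall>k\<ge>M. \<forall>j\<ge>M. nX (Q a) (ext I) (%i. xs k i - xs j i) < e" using c by blast
 have "norm (xs k i - xs j i) < e" if "k >= M" "j >= M" for k j
 proof -
 have "\<bar>xs k i - xs j i\<bar> <= nX (Q a) (ext I) (%i. xs k i - xs j i)" using nX_coord[OF nX_diff(1)[OF b[of k] b[of j]],of i] i by simp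
 also have "... < e" using M that by blast
 finally show ?thesis by simp
 qed
 thus "EX M. \<forall>m\<ge>M. \<forall>n\<ge>M. norm (xs m i - xs n i) < e" by blast
 qed
 thus ?thesis unfolding L_def by (simp add: Cauchy_convergent_iff convergent_LIMSEQ_iff)
 qed
 \<comment> \<open>The coordinatewise limit is formed in HOL and still has to be found in the
   structure. Its cut is definable from the sequence: \<open>z\<close> is below the limit iff some
   larger rational is eventually below the coordinates.\<close>
 define Z where "Z z i<->z <: Rat&(EX r N. r <: Rat&QLT z r&N <: omega&(ALL n. n <: omega&N <: n-->r <: ap (ap s n) i))" for z i
 have sx:"rtc r <: ap (ap s (num n)) i<->of_rat r < xs n i" if i:"i <: I" for r n i
 unfolding s(2) xs_def using ev(1,2)[OF pts_fn(1)[OF s(1)[of n]] i] rat_mem_real[OF is_real_code] by simp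
 have Z:"Z (rtc q) i<->of_rat q < L i" if i:"i <: I" for q i
 proof
 assume "Z (rtc q) i"
 then obtain r' M' where "r' <: Rat" "QLT (rtc q) r'" "M' <: omega" and M0:"ALL n. n <: omega&M' <: n-->r' <: ap (ap s n) i" unfolding Z_def by blast
 then obtain r M where rM:"r' = rtc r" "q < r" "M' = num M" unfolding mem_Rat mem_omega by (auto simp: QLT_iff)
 have "of_rat r <= xs k i" if "k >= Suc M" for k
 using M0[THEN spec,of "num k"] that sx[OF i,of r k] by (simp add: rM num_mem)
 hence "of_rat r <= L i" using LIMSEQ_le_const[OF lim[OF i]] by blast
 thus "of_rat q < L i" using rM(2) of_rat_less[of q r,where ?'a = real] by linarith
 next
 assume "of_rat q < L i"
 then obtain r where r:"of_rat q < (of_rat r :: real)" "of_rat r < L i" using of_rat_dense by blast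
 obtain M where M:"\<forall>k\<ge>M. of_rat r < xs k i" using order_tendstoD(1)[OF lim[OF i] r(2)] unfolding eventually_sequentially by blast
 have "rtc r <: ap (ap s n) i" if n:"n <: omega&num M <: n" for n
 proof -
 obtain k where k:"n = num k" using n mem_omega by blast
 hence "M < k" using n num_mem by simp
 thus ?thesis using M sx[OF i,of r k] k by simp
 qed
 moreover have "rtc q <: Rat" "rtc r <: Rat" "QLT (rtc q) (rtc r)" using mem_Rat r(1) by (auto simp: QLT_iff of_rat_less)
 ultimately show "Z (rtc q) i" unfolding Z_def using num_omega by blast
 qed
 have LR:"L i : Reals_in" if i:"i <: I" for i by (rule Reals_sep[OF _ Z[OF i]]) (unfold Z_def,intro dpi)
 have Zset:"isset {z. Z z i}" for i unfolding Z_def by (rule sep) (intro dpi)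
 have g:"coll {z. Z z i} = rlc (L i)" if i:"i <: I" for i
 using real_code_cut[OF LR[OF i] Z[OF i],of "coll {z. Z z i}"] mem_coll[OF Zset] by (auto simp: Z_def)
 have gd:"dt UNIV (%e. coll {z. Z z (e 0)})" by (rule dt_coll_lift1[OF Zset]) (unfold Z_def,(intro dpi)+)
 have LG:"L i : Reals_in&coll {z. Z z i} = rlc (L i)" if "i <: I" for i using LR g that by blast
 define x where "x = mk I (%i. coll {z. Z z i})"
 have xf:"fn x I reals" unfolding x_def by (rule mk(1)[OF gd LG])
 have xe:"i <: I==>ev x i = L i" for i unfolding x_def by (rule mk(2)[OF gd LG])
 have lim': "!!i. i : ext I==>(%n. xs n i) \<longlonglongrightarrow> ev x i" using lim xe by simp
 note l = nX_limit[of "Q a" "ext I" xs "ev x",OF b c lim']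
 have xp:"x <: pts a" using xf l(1) mem_pts by blast
 have n': "nrm (nm a) (app s (num i) \<ominus>\<^bsub>vec (X a)\<^esub> x) = nX (Q a) (ext I) (%k. xs i k - ev x k)" for i
 unfolding xs_def nm(2)[OF X_minus(1)[OF s(1) xp]] by (rule X_minus(3)[OF s(1) xp])
 show "\<exists>x\<in>ext (pts a). \<forall>e>0. EX N. \<forall>i\<ge>N. nrm (nm a) (app s (num i) \<ominus>\<^bsub>vec (X a)\<^esub> x) < e"
 using l(2) xp unfolding n'[symmetric] by (intro bexI[of _ x]) auto
qed

theorem X_banach:"banach (X a)"
 unfolding banach_def vector_space_def X_parts using X_norm X_complete X_module pl(1) sc(1) by (simp add: X_def)

theorem X_UG:"UG (X a)"
 unfolding UG_def
proof (intro exI[of _ "nm a"] conjI X_norm)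
 show "equivalent_norms (X a) (norm_of (X a)) (nm a)" unfolding equivalent_norms_def X_parts by (intro exI[of _ 1]) simp
 show "uniformly_Gateaux (X a) (nm a)" unfolding uniformly_Gateaux_def X_vec(1)
 proof (rule ballI)
 fix h assume "h : ext (pts a)"
 hence h:"h <: pts a" by simp
 define n where "n = 3 * (N a h)\<^sup>2"
 have n0:"0 <= n" by (simp add: n_def)
 have "EX D. ALL t. t ~= 0-->\<bar>(nX (Q a) (ext I) (%i. ev x i + t * ev h i) - 1) / t - D\<bar> <= n * \<bar>t\<bar>" if x:"x <: pts a" "N a x = 1" for x
 using nX_UG[OF pts_fn(2)[OF x(1)] x(2)[unfolded N_def] pts_fn(2)[OF h]] unfolding n_def N_def .
 then obtain D where D:"!!x t. x <: pts a==>N a x = 1==>t ~= 0==>\<bar>(nX (Q a) (ext I) (%i. ev x i + t * ev h i) - 1) / t - D x\<bar> <= n * \<bar>t\<bar>" by metis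
 have "\<exists>d>0. \<forall>x\<in>ext (pts a). \<forall>t\<in>Reals_in. nrm (nm a) x = 1&0 < \<bar>t\<bar>&\<bar>t\<bar> < d -->
 \<bar>(nrm (nm a) (x \<oplus>\<^bsub>vec (X a)\<^esub> t \<odot>\<^bsub>vec (X a)\<^esub> h) - nrm (nm a) x) / t - D x\<bar> < e" if e:"0 < e" for e
 proof (intro exI[of _ "e / (n + 1)"] conjI ballI impI)
 show "0 < e / (n + 1)" using e n0 by simp
 fix x t assume x': "x : ext (pts a)" and t:"t : Reals_in" and a:"nrm (nm a) x = 1&0 < \<bar>t\<bar>&\<bar>t\<bar> < e / (n + 1)"
 have x:"x <: pts a" using x' by simp
 have nx:"N a x = 1" using a nm(2)[OF x] by simp
 note th = vsc[OF t h]
 have "nrm (nm a) (x \<oplus>\<^bsub>vec (X a)\<^esub> t \<odot>\<^bsub>vec (X a)\<^esub> h) = N a (vad x (vsc (rlc t) h))"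
 using nm(2)[OF vad(1)[OF x th(1)]] by (simp add: X_vec(3)[OF t h] X_vec(2)[OF x th(1)])
 also have "... = nX (Q a) (ext I) (%i. ev x i + t * ev h i)" by (rule N_cong) (simp add: vad(2)[OF x th(1)] th(2))
 finally have e1:"nrm (nm a) (x \<oplus>\<^bsub>vec (X a)\<^esub> t \<odot>\<^bsub>vec (X a)\<^esub> h) = nX (Q a) (ext I) (%i. ev x i + t * ev h i)" .
 have "n * \<bar>t\<bar> < e"
 proof -
 have "(n + 1) * \<bar>t\<bar> < e" using a n0 by (simp add: field_simps)
 moreover have "n * \<bar>t\<bar> <= (n + 1) * \<bar>t\<bar>" by (simp add: mult_right_mono)
 ultimately show ?thesis by linarith
 qed
 thus "\<bar>(nrm (nm a) (x \<oplus>\<^bsub>vec (X a)\<^esub> t \<odot>\<^bsub>vec (X a)\<^esub> h) - nrm (nm a) x) / t - D x\<bar> < e"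
 using D[OF x nx,of t] a unfolding e1 by (smt (verit))
 qed
 thus "EX D. \<forall>e>0. \<exists>d>0. \<forall>x\<in>ext (pts a). \<forall>t\<in>Reals_in. nrm (nm a) x = 1&0 < \<bar>t\<bar>&\<bar>t\<bar> < d -->
 \<bar>(nrm (nm a) (x \<oplus>\<^bsub>vec (X a)\<^esub> t \<odot>\<^bsub>vec (X a)\<^esub> h) - nrm (nm a) x) / t - D x\<bar> < e" by blast
 qed
qed

definition bas :: "'v => 'v" where "bas i = mk I (%j. if j = i then rlc 1 else rlc 0)"
lemma bas: assumes "i <: I"
 shows "bas i <: pts a" "j <: I==>ev (bas i) j = (if j = i then 1 else 0)" "j <: I==>ap (bas i) j = (if j = i then rlc 1 else rlc 0)"
proof -
 have d:"dt UNIV (%e. if e 0 = i then rlc 1 else rlc 0)" by (intro dpi)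
 have h:"(if j = i then 1 else 0) : Reals_in&(if j = i then rlc 1 else rlc 0) = rlc (if j = i then 1 else 0)" if "j <: I" for j
 by (simp add: Reals_const)
 have m1:"fn (bas i) I reals" unfolding bas_def by (rule mk(1)[OF d h])
 show m2:"j <: I==>ev (bas i) j = (if j = i then 1 else 0)" for j unfolding bas_def by (rule mk(2)[OF d h])
 show "j <: I==>ap (bas i) j = (if j = i then rlc 1 else rlc 0)" unfolding bas_def by (rule mk(3)[OF d h])
 have "bd (Q a) (ext I) (ev (bas i))" by (rule nX_fin(1)[of "{i}"]) (use assms m2 in auto)
 thus "bas i <: pts a" using m1 mem_pts by blast
qed

definition Dset :: "'v => 'v" where
 "Dset a = coll {x. x <: pts a&finite {i. i <: I&ap x i ~= rlc 0}&(ALL i. i <: I-->(EX q. q <: Rat&ap x i = rq q))}"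
lemma mem_Dset:"x <: Dset a<->x <: pts a&finite {i. i <: I&ap x i ~= rlc 0}&(ALL i. i <: I-->(EX q. q <: Rat&ap x i = rq q))"
proof -
 have "isset {x. x <: pts a&finite {i. i <: I&ap x i ~= rlc 0}&(ALL i. i <: I-->(EX q. q <: Rat&ap x i = rq q))}"
 by (rule sep) (intro dpi)
 thus ?thesis unfolding Dset_def by (simp only: mem_coll mem_Collect_eq)
qed

lemma Dset_dense:"dense_in (X a) (Dset a)"
 unfolding dense_in_def X_parts X_vec(1)
proof (intro conjI ballI allI impI)
 show "ext (Dset a) <= ext (pts a)" using mem_Dset by auto
 fix x and e :: real assume x': "x : ext (pts a)" and e:"0 < e"
 have x:"x <: pts a" using x' by simp
 obtain F where F:"finite F" "F <= ext I" "bd (Q a) (ext I) (%i. if i : F then 0 else ev x i)"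
 "nX (Q a) (ext I) (%i. if i : F then 0 else ev x i) <= e / 4" using nX_tail[OF pts_fn(2)[OF x],of "e / 4"] e by auto
 \<comment> \<open>The divisor absorbs the factor \<open>card F + 1\<close> from
   \<open>N4_le\<close>: the fourth power of the norm on \<open>F\<close> is at most that of
   \<open>(card F + 1) * et\<close>, which equals \<open>e / 4\<close>.\<close>
 define et where "et = (e / 4) / (real (card F) + 1)"
 have et:"0 < et" using e unfolding et_def by simp
 have c0:"0 < real (card F) + 1" by simp
 have "c * (t / c) = t" if "0 < c" for c t :: real using that by simp
 hence etc:"(real (card F) + 1) * et = e / 4" unfolding et_def using c0 by blast
 have "EX q. \<bar>ev x i - of_rat q\<bar> < et" for i using of_rat_dense[of "ev x i" "ev x i + et"] et by (auto simp: abs_less_iff) (metis add.commute less_diff_eq diff_less_eq add_less_cancel_right less_add_same_cancel1 order.strict_trans)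
 then obtain q where q:"!!i. \<bar>ev x i - of_rat (q i)\<bar> < et" by metis
 obtain f where f:"ext f = F" using finite_subset_isset[OF F(1)] by blast
 define w where "w = lam f (%i. rlc (of_rat (q i)))"
 have w:"ap w i = rlc (of_rat (q i))" if "i <: f" for i unfolding w_def
 by (rule fn_finite(3)[of f _ reals]) (use F(1) f that rat_Reals in auto)
 have fF:"i <: f<->i : F" for i using f by auto
 define y where "y = mk I (%i. if i <: f then ap w i else rlc 0)"
 have d:"dt UNIV (%e. if e 0 <: f then ap w (e 0) else rlc 0)" by (intro dpi)
 have hh:"(if i : F then of_rat (q i) else 0) : Reals_in&(if i <: f then ap w i else rlc 0) = rlc (if i : F then of_rat (q i) else 0)" if "i <: I" for i
 using w fF rat_Reals Reals_const by simp
 have y1:"fn y I reals" unfolding y_def by (rule mk(1)[OF d hh])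
 have y2:"i <: I==>ev y i = (if i : F then of_rat (q i) else 0)" for i unfolding y_def by (rule mk(2)[OF d hh])
 have "bd (Q a) (ext I) (ev y)" by (rule nX_fin(1)[OF F(1,2)]) (simp add: y2)
 hence yp:"y <: pts a" using y1 mem_pts by blast
 have ay:"ap y i = rq (rtc (if i : F then q i else 0))" if "i <: I" for i
 using ev(1)[OF y1 that] y2[OF that] by (simp add: rq_code)
 have "{i. i <: I&ap y i ~= rlc 0} <= F" using ev(1)[OF y1] y2 by (auto split: if_splits)
 hence "finite {i. i <: I&ap y i ~= rlc 0}" using F(1) by (rule finite_subset)
 moreover have "EX q. q <: Rat&ap y i = rq q" if "i <: I" for i
 by (rule exI[of _ "rtc (if i : F then q i else 0)"]) (use ay[OF that] mem_Rat in simp)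
 ultimately have yD:"y <: Dset a" unfolding mem_Dset using yp by simp
 define z where "z i = (if i : F then ev x i - of_rat (q i) else 0)" for i
 have zf:"bd (Q a) (ext I) z" "nX (Q a) (ext I) z = nf (Q a) F z" using nX_fin[OF F(1,2),of z "Q a"] by (simp_all add: z_def)
 have "N4 (Q a) F z <= (e / 4) ^ 4"
 proof -
 have "(\<Sum>i\<in>F. z i ^ 4) <= (\<Sum>i\<in>F. et ^ 4)"
 proof (rule sum_mono)
 fix i assume "i : F"
 hence "\<bar>z i\<bar> <= et" using q[of i] by (simp add: z_def)
 hence "\<bar>z i\<bar> ^ 4 <= et ^ 4" by (intro power_mono) auto
 thus "z i ^ 4 <= et ^ 4" by (simp add: power_even_abs)
 qed
 hence s:"(\<Sum>i\<in>F. z i ^ 4) <= real (card F) * et ^ 4" by simp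
 have "N4 (Q a) F z <= (real (card F) + 1) * (\<Sum>i\<in>F. z i ^ 4)" by (rule N4_le[OF F(1)])
 also have "... <= (real (card F) + 1) * (real (card F) * et ^ 4)" using s by (intro mult_left_mono) auto
 also have "... <= (real (card F) + 1) ^ 4 * et ^ 4"
 proof -
 have "(real (card F) + 1) * real (card F) <= (real (card F) + 1) ^ 2" by (simp add: power2_eq_square)
 also have "... <= (real (card F) + 1) ^ 4" by (rule power_increasing) auto
 finally show ?thesis using et by (simp add: mult_right_mono flip: mult.assoc)
 qed
 also have "... = ((real (card F) + 1) * et) ^ 4" by (simp add: power_mult_distrib)
 also have "(real (card F) + 1) * et = e / 4" by (rule etc)
 finally show ?thesis .
 qed
 hence n4:"nf (Q a) F z ^ 4 <= (e / 4) ^ 4" by (simp only: nf_pow4[OF F(1)])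
 have "(nf (Q a) F z ^ 4 <= (e / 4) ^ 4) = (nf (Q a) F z <= e / 4)" by (rule power_mono_iff) (use e nf_nonneg[OF F(1)] in auto)
 hence z4:"nf (Q a) F z <= e / 4" using n4 by (rule iffD1)
 have "N a (x \<ominus>\<^bsub>vec (X a)\<^esub> y) = nX (Q a) (ext I) (%i. ev x i - ev y i)" by (rule X_minus(3)[OF x yp])
 also have "... = nX (Q a) (ext I) (%i. (if i : F then 0 else ev x i) + z i)" by (rule nX_cong(1)) (simp add: y2 z_def)
 also have "... <= nX (Q a) (ext I) (%i. if i : F then 0 else ev x i) + nX (Q a) (ext I) z" by (rule nX_add(2)[OF F(3) zf(1)])
 also have "... < e" using F(4) z4 zf(2) e by simp
 finally have "nrm (nm a) (x \<ominus>\<^bsub>vec (X a)\<^esub> y) < e" using nm(2)[OF X_minus(1)[OF x yp]] by simp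
 thus "\<exists>y\<in>ext (Dset a). nrm (nm a) (x \<ominus>\<^bsub>vec (X a)\<^esub> y) < e" using yD by (intro bexI[of _ y]) auto
qed

lemma lep_Rat:"lep Rat omega"
proof -
 have "z <: cprod (cprod omega omega) omega" if "z <: Rat" for z using that by (auto simp: mem_Rat qn(5) simp del: num.simps)
 hence "lep Rat (cprod (cprod omega omega) omega)" by (intro lep_subset) auto
 thus ?thesis by (rule lep_trans[OF lep_trans lep_omega2]) (rule lep_prod[OF lep_omega2 lep_refl])
qed

definition finset :: "'v => 'v" where "finset b = coll {y. y <: powset b&finite (ext y)}"
lemma mem_finset:"y <: finset b<->ext y <= ext b&finite (ext y)"
proof -
 have d:"dp UNIV (%e. finite {x. x <: e 0})" by (intro dpi)
 have "{x. x <: y} = ext y" for y by auto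
 hence "isset {y. y <: powset b&finite (ext y)}" using sep[of "%y. finite {x. x <: y}" "powset b",OF d] by (simp only:)
 thus ?thesis unfolding finset_def by (simp add: mem_coll)
qed

text \<open>A finitely supported rational vector is determined by the finite set of its nonzero
  entries, each a pair of an index and the number of a rational.\<close>

lemma lep_Dset:"lep (Dset a) (finset (cprod I omega))"
proof -
 obtain h where h:"!!q. q <: Rat==>ap h q <: omega" "!!q r. q <: Rat==>r <: Rat==>ap h q = ap h r==>q = r"
 using lepE[OF lep_Rat] by metis
 define g where "g x = coll {z. z <: cprod I omega&(EX i q. z = pair i (ap h q)&q <: Rat&ap x i ~= rlc 0&ap x i = rq q)}" for x
 have S:"isset {z. z <: cprod I omega&(EX i q. z = pair i (ap h q)&q <: Rat&ap x i ~= rlc 0&ap x i = rq q)}" for x by (rule sep) (intro dpi)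
 have g:"z <: g x<->(EX i q. z = pair i (ap h q)&i <: I&q <: Rat&ap x i ~= rlc 0&ap x i = rq q)" for z x
 unfolding g_def mem_coll[OF S] using h(1) by auto
 have rqi:"q = r" if h:"q <: Rat" "r <: Rat" "rq q = rq r" for q r
 proof -
 obtain s t where "q = rtc s" "r = rtc t" using h(1,2) mem_Rat by blast
 thus ?thesis using h(3) real_code_inj[OF rat_Reals[of s] rat_Reals[of t]] by (simp add: rq_code)
 qed
 show ?thesis
 proof (rule lepI)
 show "dt UNIV (%e. g (e 0))" unfolding g_def by (rule dt_coll_lift1[OF S]) (intro dpi)+
 fix x assume x:"x <: Dset a"
 have "EX q. i <: I-->q <: Rat&ap x i = rq q" for i using x unfolding mem_Dset by blast
 then obtain r where r:"!!i. i <: I==>r i <: Rat&ap x i = rq (r i)" by metis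
 have sub:"ext (g x) <= (%i. pair i (ap h (r i))) ` {i. i <: I&ap x i ~= rlc 0}"
 proof
 fix z assume "z : ext (g x)"
 hence "z <: g x" by simp
 then obtain i q where z:"z = pair i (ap h q)" "i <: I" "q <: Rat" "ap x i ~= rlc 0" "ap x i = rq q" using g by blast
 have "q = r i" using rqi[OF z(3),of "r i"] r[OF z(2)] z(5) by simp
 thus "z : (%i. pair i (ap h (r i))) ` {i. i <: I&ap x i ~= rlc 0}" using z by (intro image_eqI[of _ _ i]) simp_all
 qed
 have "finite {i. i <: I&ap x i ~= rlc 0}" using x unfolding mem_Dset by simp
 hence "finite (ext (g x))" using sub by (rule finite_surj)
 moreover have "ext (g x) <= ext (cprod I omega)" using g h(1) by auto
 ultimately show "g x <: finset (cprod I omega)" by (simp add: mem_finset)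
 next
 have sub:"ap y i = ap x i" if xy:"x <: Dset a" "g x = g y" "i <: I" "ap x i ~= rlc 0" for x y i
 proof -
 obtain q where q:"q <: Rat" "ap x i = rq q" using xy(1,3) unfolding mem_Dset by blast
 hence "pair i (ap h q) <: g x" using g xy(3,4) by blast
 hence "pair i (ap h q) <: g y" using xy(2) by simp
 then obtain q' where "ap h q = ap h q'" "q' <: Rat" "ap y i = rq q'" using g by auto
 thus ?thesis using h(2)[OF q(1)] q by simp
 qed
 show "inj_on g (ext (Dset a))"
 proof (rule inj_onI)
 fix x y assume h': "x : ext (Dset a)" "y : ext (Dset a)" "g x = g y"
 hence xy:"x <: Dset a" "y <: Dset a" by simp_all
 hence f:"fn x I reals" "fn y I reals" unfolding mem_Dset using pts_fn by blast+
 show "x = y"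
 proof (rule fn_eqI[OF f])
 fix i assume i:"i <: I"
 show "ap x i = ap y i" using sub[OF xy(1) h'(3) i] sub[OF xy(2) h'(3)[symmetric] i] by metis
 qed
 qed
 qed
qed

text \<open>A vector within 1/2 of the \<open>i\<close>-th unit vector exceeds 1/2 at
  \<open>i\<close> and at no other index, so it determines \<open>i\<close>. Distinct indices
  therefore need distinct elements of a dense set.\<close>

lemma lep_dense: assumes d:"dense_in (X a) d" and l:"ordinal l" "lep d l" shows "lep I l"
proof -
 obtain g where g:"!!y. y <: d==>ap g y <: l" "!!x y. x <: d==>y <: d==>ap g x = ap g y==>x = y" using lepE[OF l(2)] by metis
 define nr where "nr i y<->rtc (1 / 2) <: ap y i&(ALL j. j <: I&j ~= i-->~ rtc (1 / 2) <: ap y j)" for i y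
 define R where "R i b<->(EX y. y <: d&ap g y = b&nr i y)" for i b
 have ex:"EX y. y <: d&nr i y" if i:"i <: I" for i
 proof -
 have "bas i : carrier (vec (X a))" using bas(1)[OF i] by (simp add: X_vec)
 then obtain y where y:"y <: d" "nrm (nm a) (bas i \<ominus>\<^bsub>vec (X a)\<^esub> y) < 1 / 2" using d[unfolded dense_in_def X_parts,THEN conjunct2,THEN bspec,of "bas i",THEN spec,of "1 / 2"] by auto
 have yp:"y <: pts a" using d y(1) unfolding dense_in_def X_vec by auto
 have k:"\<bar>ev (bas i) j - ev y j\<bar> < 1 / 2" if "j <: I" for j
 proof -
 have "\<bar>ev (bas i) j - ev y j\<bar> <= nX (Q a) (ext I) (%i'. ev (bas i) i' - ev y i')"
 using nX_coord[OF nX_diff(1)[OF pts_fn(2)[OF bas(1)[OF i]] pts_fn(2)[OF yp]],of j] that by simp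
 thus ?thesis using y(2) X_minus(3)[OF bas(1)[OF i] yp] nm(2)[OF X_minus(1)[OF bas(1)[OF i] yp]] by simp
 qed
 have r:"rtc (1 / 2) <: ap y j<->1 / 2 < ev y j" if "j <: I" for j
 using ev(1,2)[OF pts_fn(1)[OF yp] that] rat_mem_real[OF is_real_code,of "ev y j" "1 / 2"] by (simp add: of_rat_divide)
 have "1 / 2 < ev y i" using k[OF i] bas(2)[OF i i] by (simp add: abs_if split: if_splits)
 moreover have "~ 1 / 2 < ev y j" if "j <: I" "j ~= i" for j using k[OF that(1)] bas(2)[OF i that(1)] that(2) by simp
 ultimately have "nr i y" unfolding nr_def using r i by blast
 thus ?thesis using y(1) by blast
 qed
 have dR:"dp UNIV (%e. R (e 0) (e 1))" unfolding R_def nr_def by (intro dpi)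
 have mem_ord:"ordinal b" if "b <: l" for b using l(1) that ordinal_mem by blast
 \<comment> \<open>Approximations are selected by their least ordinal number under \<open>g\<close>,
   as no choice is available here.\<close>
 show ?thesis
 proof (rule lepR[of "%i b. R i b&(ALL c. c <: b-->~ R i c)"])
 show "dp UNIV (%e. R (e 0) (e 1)&(ALL c. c <: e 1-->~ R (e 0) c))" by (intro dpi dp_lift2[OF dR])
 next
 fix i assume i:"i <: I"
 obtain y where y:"y <: d" "nr i y" using ex[OF i] by blast
 have b:"ordinal (ap g y)" "R i (ap g y)" using mem_ord[OF g(1)[OF y(1)]] y unfolding R_def by blast+
 obtain c where c:"R i c" "!!x. x <: c==>~ R i x" "c = ap g y \<or> c <: ap g y" using least_ordinal[of _ "R i",OF b] by metis
 have "c <: l" using c(3) g(1)[OF y(1)] ordinal_trans[OF l(1)] by blast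
 thus "EX y. y <: l&R i y&(ALL c. c <: y-->~ R i c)" using c by blast
 next
 fix i b c assume "i <: I" "b <: l" "c <: l" "R i b&(ALL x. x <: b-->~ R i x)" "R i c&(ALL x. x <: c-->~ R i x)"
 thus "b = c" using ordinal_linear[OF mem_ord mem_ord,of b c] by blast
 next
 fix i j b assume ij:"i <: I" "j <: I" and h:"R i b&(ALL x. x <: b-->~ R i x)" "R j b&(ALL x. x <: b-->~ R j x)"
 obtain y z where yz:"y <: d" "ap g y = b" "nr i y" "z <: d" "ap g z = b" "nr j z" using h unfolding R_def by blast
 hence "y = z" using g(2) by metis
 thus "i = j" using yz(3,6) ij unfolding nr_def by blast
 qed
qed

theorem X_density: assumes k:"cardinal k" "lep k I" "lep (finset (cprod I omega)) k" shows "has_density (X a) k"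
 unfolding has_density_def
proof (intro conjI allI impI)
 have "lep I (Dset a)"
 proof (rule lepR[of "%i y. ALL j. j <: I-->ap y j = (if j = i then rlc 1 else rlc 0)"])
 show "dp UNIV (%e. ALL j. j <: I-->ap (e 1) j = (if j = e 0 then rlc 1 else rlc 0))" by (intro dpi)
 next
 fix i assume i:"i <: I"
 have "{j. j <: I&ap (bas i) j ~= rlc 0} <= {i}" using bas(3)[OF i] by (auto split: if_splits)
 moreover have "EX q. q <: Rat&ap (bas i) j = rq q" if "j <: I" for j
 proof (rule exI[of _ "rtc (if j = i then 1 else 0)"])
 show "rtc (if j = i then 1 else 0) <: Rat&ap (bas i) j = rq (rtc (if j = i then 1 else 0))"
 using bas(3)[OF i that] mem_Rat by (simp add: rq_code)
 qed
 ultimately have "bas i <: Dset a" unfolding mem_Dset using bas(1)[OF i] finite_subset by blast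
 thus "EX y. y <: Dset a&(ALL j. j <: I-->ap y j = (if j = i then rlc 1 else rlc 0))" using bas(3)[OF i] by blast
 next
 fix i y z assume h:"y <: Dset a" "z <: Dset a" "ALL j. j <: I-->ap y j = (if j = i then rlc 1 else rlc 0)"
 "ALL j. j <: I-->ap z j = (if j = i then rlc 1 else rlc 0)"
 have f:"fn y I reals" "fn z I reals" using h(1,2) unfolding mem_Dset using pts_fn by blast+
 show "y = z" by (rule fn_eqI[OF f]) (use h in simp)
 next
 fix i i' y assume h:"i <: I" "i' <: I" "ALL j. j <: I-->ap y j = (if j = i then rlc 1 else rlc 0)"
 "ALL j. j <: I-->ap y j = (if j = i' then rlc 1 else rlc 0)"
 have "rlc 1 ~= rlc 0" using real_code_inj[OF Reals_const(2,1)] by simp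
 thus "i = i'" using h by metis
 qed
 hence "lep k (Dset a)" using k(2) lep_trans by blast
 moreover have "lep (Dset a) k" using lep_Dset k(3) lep_trans by blast
 ultimately show "EX d. dense_in (X a) d&equinum d k" using Dset_dense equinum_iff by blast
next
 fix d l assume h:"dense_in (X a) d&l <: k"
 show "~ equinum d l"
 proof
 assume e:"equinum d l"
 have "ordinal l" using k(1) h ordinal_mem unfolding cardinal_def by blast
 hence "lep I l" using lep_dense h equinum_lep[OF e] by blast
 hence "lep k l" using k(2) lep_trans by blast
 thus False using cardinal_not_lep[OF k(1)] h by blast
 qed
qed

end

section \<open>Sums of unit vectors and the set of all spaces\<close>

context bspace
begin

primrec bsum :: "(nat => 'v) => nat => 'v" where
 "bsum g 0 = vz" | "bsum g (Suc n) = vad (bsum g n) (bas (g n))"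

lemma bsum: assumes "!!l. l < n==>g l <: I" "inj_on g {..<n}"
 shows "bsum g n <: pts a&(ALL i. i <: I-->ev (bsum g n) i = (if i : g ` {..<n} then 1 else 0))"
 using assms
proof (induction n)
 case (Suc n)
 have IH:"bsum g n <: pts a" "!!i. i <: I==>ev (bsum g n) i = (if i : g ` {..<n} then 1 else 0)"
 using Suc.IH Suc.prems by (simp_all add: inj_on_def)
 have gn:"g n <: I" using Suc.prems(1) by simp
 have ni:"g n \<notin> g ` {..<n}" 
 proof
 assume "g n : g ` {..<n}"
 then obtain l where "l < n" "g n = g l" by auto
 thus False using inj_onD[OF Suc.prems(2),of n l] by simp
 qed
 have "ev (bsum g (Suc n)) i = (if i : g ` {..<Suc n} then 1 else 0)" if "i <: I" for i
 using vad(2)[OF IH(1) bas(1)[OF gn] that] IH(2)[OF that] bas(2)[OF gn that] ni by (auto simp: lessThan_Suc)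
 thus ?case using vad(1)[OF IH(1) bas(1)[OF gn]] by simp
qed (simp add: vz)

lemma N_bsum: assumes "!!l. l < n==>g l <: I" "inj_on g {..<n}"
 shows "N a (bsum g n) = nf (Q a) (g ` {..<n}) (%i. 1)"
proof -
 have "N a (bsum g n) = nX (Q a) (ext I) (%i. if i : g ` {..<n} then 1 else 0)"
 using bsum[OF assms,of a] by (intro N_cong) blast
 also have "... = nf (Q a) (g ` {..<n}) (%i. if i : g ` {..<n} then 1 else 0)"
 by (rule nX_fin(2)) (use assms(1) in auto)
 also have "... = nf (Q a) (g ` {..<n}) (%i. 1)" by (rule nf_cong) simp
 finally show ?thesis .
qed

lemma X_eq: assumes "X a = X b" "x <: pts a" shows "N a x = N b x"
proof -
 have e:"pts a = pts b" "nm a = nm b" using assms(1) unfolding X_def by simp_all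
 thus ?thesis using nm(2)[OF assms(2)] nm(2)[of x b] assms(2) by simp
qed

text \<open>There is no replacement to collect the spaces. They are separated from one set
  \<open>?T\<close> that bounds underlying sets, operations and norms uniformly in the
  parameter.\<close>

lemma isset_family:"isset {z. EX a. a <: D&z = X a}"
proof -
 let ?A = "fs I reals"
 let ?T = "cprod (cprod (powset ?A) (powset (cprod (cprod ?A ?A) ?A))) (cprod (powset (cprod (cprod reals ?A) ?A)) (powset (cprod ?A reals)))"
 have s:"y <: ?A" if "y <: pts a" for y a using pts_fn(1)[OF that] by simp
 have "X a <: ?T" for a
 proof -
 have "ext (pl a) <= ext (cprod (cprod (pts a) (pts a)) (pts a))" "ext (sc a) <= ext (cprod (cprod reals (pts a)) (pts a))"
 "ext (nm a) <= ext (cprod (pts a) reals)"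
 using fn_mem_pow[OF pl(1)[of a]] fn_mem_pow[OF sc(1)[of a]] fn_mem_pow[OF nm(1)[of a]] by simp_all
 moreover have "ext (cprod (cprod (pts a) (pts a)) (pts a)) <= ext (cprod (cprod ?A ?A) ?A)"
 "ext (cprod (cprod reals (pts a)) (pts a)) <= ext (cprod (cprod reals ?A) ?A)" "ext (cprod (pts a) reals) <= ext (cprod ?A reals)"
 "ext (pts a) <= ext ?A" using s by (auto simp: mem_cprod simp del: mem_fs)
 ultimately show ?thesis unfolding X_def by (simp del: mem_fs) blast
 qed
 hence "{z. EX a. a <: D&z = X a} = {z. z <: ?T&(EX a. a <: D&z = X a)}" by auto
 thus ?thesis using sep[of "%z. EX a. a <: D&z = X a" ?T] by (simp del: mem_fs) (rule meta_mp,assumption,intro dpi dt_X)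
qed

lemma equinum_family: assumes "!!a b. a <: D==>b <: D==>X a = X b==>a = b"
 shows "equinum (coll {z. EX a. a <: D&z = X a}) D"
 unfolding equinum_iff
proof
 show "lep (coll {z. EX a. a <: D&z = X a}) D"
 by (rule lepR[of "%z a. z = X a"]) (use assms in \<open>auto simp: mem_coll[OF isset_family] intro!: dpi dt_X\<close>)
 show "lep D (coll {z. EX a. a <: D&z = X a})"
 proof (rule lepI[of X])
 show "dt UNIV (%e. X (e 0))" by (intro dt_X dpi)
 show "X a <: coll {z. EX a. a <: D&z = X a}" if "a <: D" for a using that unfolding mem_coll[OF isset_family] by blast
 show "inj_on X (ext D)" using assms by (auto intro: inj_onI)
 qed
qed

end

section \<open>The graphs given by the Cohen reals\<close>

context c2
begin

text \<open>The set \<open>c\<close> of all bits is an argument instead of the constant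
  \<open>creal\<close>, because forcing is available only for predicates definable without
  parameters.\<close>

definition QC :: "'w => 'w => 'w => 'w => bool" where
 "QC c a x y<->(EX n. memW n W.omega&~ (memW n x<->memW n y)&(ALL k. memW k n-->(memW k x<->memW k y))&memW (W.pair a n) c)"
lemma dp_QC:"W.dt C t==>W.dt C u==>W.dt C v==>W.dt C w==>W.dp C (%e. QC (t e) (u e) (v e) (w e))"
 by (rule W.dp_lift4[where Q = QC]) (unfold QC_def,intro dpi)
definition QW :: "'w => 'w => 'w => bool" where "QW = QC creal"

definition df :: "'v => 'v => nat => bool" where
 "df x y n<->~ (num n <: x<->num n <: y)&(\<forall>k<n. num k <: x<->num k <: y)"
lemma df_ex: assumes "x <: powset omega" "y <: powset omega" "x ~= y" shows "EX n. df x y n"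
proof -
 have "EX n. ~ (num n <: x<->num n <: y)"
 proof (rule ccontr)
 assume "~ ?thesis"
 hence "z <: x<->z <: y" for z using assms(1,2) mem_omega[of z] by (auto simp: subset_iff)
 thus False using assms(3) set_eqI by blast
 qed
 thus ?thesis using exists_least_iff[of "%n. ~ (num n <: x<->num n <: y)"] unfolding df_def by blast
qed
lemma df_unique:"df x y n==>df x y k==>n = k" unfolding df_def by (metis linorder_neqE_nat)
lemma df_sym:"df x y n<->df y x n" unfolding df_def by auto
lemma num_ii:"memW (W.num n) (ii x)<->num n <: x" by (simp only: ii_num[symmetric] ii_mem)
lemma QC_iff:"QC c a (ii x) (ii y)<->(EX n. df x y n&memW (W.pair a (W.num n)) c)"
proof -
 have k:"(ALL k. memW k (W.num n)-->P k)<->(\<forall>k<n. P (W.num k))" for n P using W.ext_num[of n] W.num_mem by (metis (no_types,lifting) W.mem_ext imageE lessThan_iff)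
 have o:"(EX n. memW n W.omega&P n)<->(EX n. P (W.num n))" for P by (auto simp: W.mem_omega)
 show ?thesis unfolding QC_def o k num_ii df_def by (simp only: conj_assoc)
qed
lemma QC_df:"df x y n==>QC c a (ii x) (ii y)<->memW (W.pair a (W.num n)) c" unfolding QC_iff using df_unique by blast

end

sublocale c2 \<subseteq> B: bspace memW "ii (powset omega)" QW
proof unfold_locales
 show "W.dp UNIV (%e. QW (e 0) (e 1) (e 2))" unfolding QW_def by (intro dp_QC dpi)
qed

context c2
begin

lemma ii_cprod:"W.cprod (ii a) (ii b) = ii (cprod a b)"
proof (rule W.set_eqI)
 fix z
 show "memW z (W.cprod (ii a) (ii b))<->memW z (ii (cprod a b))"
 unfolding W.mem_cprod mem_ii mem_cprod by (auto simp: ii_pair; metis ii_pair)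
qed

lemma cardinal_w1_W:"W.cardinal (ii aleph1)" unfolding W.cardinal_def
proof (intro conjI allI impI notI)
 show "W.ordinal (ii aleph1)" by (rule ii_ordinal[OF ord_w1])
 fix a assume a:"memW a (ii aleph1)" "W.equinum a (ii aleph1)"
 hence "W.lep (ii aleph1) a" by (intro W.equinum_lep2)
 then obtain b where b:"b <: aleph1" "W.lep (ii aleph1) (ii b)" using a(1) unfolding mem_ii by auto
 have "lep aleph1 (cprod (cprod b omega) omega)" by (rule lep_reflect[OF b(2)])
 moreover have "lep (cprod (cprod b omega) omega) omega"
 using lep_prod[OF lep_prod[OF w1(3)[OF b(1)] lep_refl] lep_refl] lep3 lep_trans by blast
 ultimately show False using w1(4) lep_trans by blast
qed

text \<open>The index set has size \<open>aleph1\<close> since CH holds in the ground model. Finite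
  sets of pairs of an index and a number are ground model sets, so their number in the extension is
  bounded by a count made in the ground model.\<close>

theorem B_density:"W.has_density (B.X a) W.aleph1"
 unfolding aleph1_W
proof (rule B.X_density[OF cardinal_w1_W])
 show "W.lep (ii aleph1) (ii (powset omega))" by (rule ii_lep[OF equinum_lep2[OF pow_w]])
 let ?b = "cprod (powset omega) omega"
 have "lep ?b aleph1" using lep_prod[OF equinum_lep[OF pow_w] lep_refl] w1_omega lep_trans by blast
 hence "lep (Fin ?b) aleph1" using lep_Fin_mono Fin_w1 lep_trans by blast
 hence 1:"W.lep (ii (Fin ?b)) (ii aleph1)" by (rule ii_lep)
 have "memW y (ii (Fin ?b))" if "memW y (B.finset (W.cprod (ii (powset omega)) W.omega))" for y
 proof -
 have y:"W.ext y <= W.ext (ii ?b)" "finite (W.ext y)" using that unfolding B.mem_finset ii_omega[symmetric] ii_cprod by blast+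
 obtain z where z:"y = ii z" "ext z <= ext ?b" using ii_sub[OF y] by blast
 have "z <: Fin ?b" using z y(2) ii_finite[of z] by (simp only: mem_Fin)
 thus ?thesis using z by simp
 qed
 hence "W.ext (B.finset (W.cprod (ii (powset omega)) W.omega)) <= W.ext (ii (Fin ?b))" by auto
 thus "W.lep (B.finset (W.cprod (ii (powset omega)) W.omega)) (ii aleph1)" using W.lep_subset 1 W.lep_trans by blast
qed

text \<open>At a place \<open>n\<close> where the two reals differ, the indices \<open>empty\<close>
  and the singleton of \<open>n\<close> are joined in one of the graphs only. The sum of their unit
  vectors has norm at least \<open>sqrt 2\<close> in one space and at most the fourth root of 2 in
  the other.\<close>

lemma X_inj: assumes ab:"al <: dl" "be1 <: dl" "B.X (ii al) = B.X (ii be1)" shows "al = be1"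
proof (rule ccontr)
 assume "al ~= be1"
 then obtain n where n:"memW (W.pair (ii al) (W.num n)) creal" "~ memW (W.pair (ii be1) (W.num n)) creal" using bits_differ ab by blast
 define y where "y = coll {num n}"
 have my:"z <: y<->z = num n" for z unfolding y_def by (rule mem_coll_sing)
 have d:"df empty y n" unfolding df_def by (simp add: my del: num.simps)
 have d': "df y empty n" using d df_sym by blast
 define g where "g l = (if l = 0 then ii empty else ii y)" for l :: nat
 have gI:"memW (g l) (ii (powset omega))" for l unfolding g_def using my by auto
 have ne:"empty ~= y" using my mem_empty by metis
 have gi:"inj_on g {..<2}" unfolding g_def using ne by (auto simp: inj_on_def less_2_cases_iff split: if_splits)
 have im:"g ` {..<2} = {ii empty,ii y}" unfolding g_def by (auto simp: image_iff less_2_cases_iff)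
 have c:"card {ii empty,ii y} = 2" using ne by simp
 have NN:"B.N a (B.bsum g 2) = nf (QC creal a) {ii empty,ii y} (%i. 1)" for a using B.N_bsum[OF gI gi,of a] unfolding im by (simp only: QW_def)
 have "sqrt 2 <= B.N (ii al) (B.bsum g 2)" using nf_clique[of "{ii empty,ii y}" "QC creal (ii al)"] c n(1) QC_df[OF d] QC_df[OF d']
 unfolding NN by auto
 moreover have "B.N (ii be1) (B.bsum g 2) <= sqrt (sqrt 2)" using nf_anticlique[of "{ii empty,ii y}" "QC creal (ii be1)"] c n(2) QC_df[OF d] QC_df[OF d']
 unfolding NN by auto
 moreover have "B.N (ii al) (B.bsum g 2) = B.N (ii be1) (B.bsum g 2)" using B.X_eq[OF ab(3)] B.bsum[OF gI gi] by blast
 moreover have "sqrt (sqrt 2) < sqrt 2" using sqrt2_less_2 by (rule real_sqrt_less_mono)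
 ultimately show False by linarith
qed

definition Fam :: 'w where "Fam = W.coll {z. EX a. memW a (ii dl)&z = B.X a}"
lemma mem_Fam:"memW z Fam<->(EX al. al <: dl&z = B.X (ii al))"
 unfolding Fam_def W.mem_coll[OF B.isset_family] unfolding mem_Collect_eq mem_ii by auto
lemma equinum_Fam:"W.equinum Fam W.aleph2"
 unfolding Fam_def aleph2_W by (rule B.equinum_family) (use X_inj in \<open>auto simp: mem_ii\<close>)

lemma lep_succ: assumes "lep b aleph1" shows "lep (succ b) aleph1"
proof -
 obtain h where h:"!!x. x <: b==>ap h x <: aleph1" "!!x y. x <: b==>y <: b==>ap h x = ap h y==>x = y" using lepE[OF assms] by metis
 have "lep (succ b) (cprod aleph1 omega)"
 proof (rule lepI[of "%x. if x = b then pair (num 0) (num 1) else pair (ap h x) (num 0)"])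
 show "dt UNIV (%e. if e 0 = b then pair (num 0) (num 1) else pair (ap h (e 0)) (num 0))" by (intro dpi)
 show "(if x = b then pair (num 0) (num 1) else pair (ap h x) (num 0)) <: cprod aleph1 omega" if "x <: succ b" for x
 using that h(1) num_w1[of 0] by (auto simp del: num.simps)
 show "inj_on (%x. if x = b then pair (num 0) (num 1) else pair (ap h x) (num 0)) (ext (succ b))"
 using h(2) by (auto simp: inj_on_def simp del: num.simps split: if_splits)
 qed
 thus ?thesis using w1_omega lep_trans by blast
qed

lemma succ_w2: assumes "xi <: dl" shows "succ xi <: dl"
proof -
 have o:"ordinal xi" using ord_w2 assms ordinal_mem by blast
 have t:"z <: xi" if "x <: xi" "z <: x" for x z using ordinal_trans[OF o that] .
 have t2:"z <: x" if "x <: xi" "y <: x" "z <: y" for x y z using ordinal_trans[OF ordinal_mem[OF o that(1)] that(2,3)] .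
 have os:"ordinal (succ xi)" unfolding ordinal_def
 proof (intro conjI allI impI subsetI)
 show "z : ext (succ xi)" if "x <: succ xi" "z : ext x" for x z using that t[of x z] by auto
 show "z : ext x" if "x <: succ xi&y <: x" "z : ext y" for x y z using that t[of y z] t2[of x y z] by auto
 qed
 have "succ xi ~= dl" using lep_succ[OF w2(3)[OF assms]] w2(4) by auto
 moreover have "~ dl <: succ xi" using assms mem_irrefl mem_asym by auto
 ultimately show ?thesis using ordinal_linear[OF os ord_w2] by blast
qed

text \<open>The second cardinal of the ground model is regular, in the form of a pigeonhole principle for definable colourings in the extension.\<close>

lemma unbounded_fiber: assumes dR:"W.dp UNIV (%e. R (e 0) (e 1))" and L:"W.lep L (ii aleph1)"
 and R:"!!al. al <: dl==>EX p. memW p L&R p (ii al)"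
 shows "EX p. memW p L&(ALL be1. be1 <: dl-->(EX al. al <: dl&~ al <: be1&R p (ii al)))"
proof (rule ccontr)
 assume "~ ?thesis"
 hence bnd:"EX be1. be1 <: dl&(ALL al. al <: dl&R p (ii al)-->al <: be1)" if "memW p L" for p using that by blast
 \<comment> \<open>Injections of all ordinals below \<open>dl\<close> into \<open>aleph1\<close> are
   chosen at once in the ground model, where choice holds, and then carried over to the
   extension.\<close>
 obtain f where f:"fn f dl (powset (cprod dl aleph1))"
 and fi:"!!be1. be1 <: dl==>fn (app f be1) be1 aleph1&(ALL x y. x <: be1&y <: be1&ap (app f be1) x = ap (app f be1) y-->x = y)"
 proof -
 have "EX f. fn f dl (powset (cprod dl aleph1))&(ALL be1. be1 <: dl-->fn (app f be1) be1 aleph1&(ALL x y. x <: be1&y <: be1&ap (app f be1) x = ap (app f be1) y-->x = y))"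
 proof (rule choice)
 show "dp UNIV (%e. fn (e 1) (e 0) aleph1&(ALL x y. x <: e 0&y <: e 0&ap (e 1) x = ap (e 1) y-->x = y))" by (intro dpi)
 fix be1 assume b:"be1 <: dl"
 obtain g where g:"fn g be1 aleph1" "!!x y. x <: be1==>y <: be1==>ap g x = ap g y==>x = y" using lepE[OF w2(3)[OF b]] by metis
 have "ext g <= ext (cprod be1 aleph1)" using fn_mem_pow[OF g(1)] by simp
 moreover have "ext (cprod be1 aleph1) <= ext (cprod dl aleph1)" using ordinal_trans[OF ord_w2 b] by (auto simp: mem_cprod)
 ultimately have "g <: powset (cprod dl aleph1)" by simp
 thus "EX y. y <: powset (cprod dl aleph1)&fn y be1 aleph1&(ALL x x'. x <: be1&x' <: be1&ap y x = ap y x'-->x = x')" using g by blast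
 qed
 thus ?thesis using that by blast
 qed
 have ff:"func_on f dl" using f fn_def by blast
 have F:"W.ap (W.ap (ii f) (ii b)) (ii a) = ii (ap (app f b) a)" if h:"b <: dl" "a <: b" for a b
 proof -
 have g:"func_on (app f b) b" using fi[OF h(1)] fn_def by blast
 have "W.ap (ii f) (ii b) = ii (app f b)" using W.ap_eq[OF ii_func[OF ff],of "ii b"] ii_app[OF ff h(1)] h(1) by simp
 thus ?thesis using W.ap_eq[OF ii_func[OF g],of "ii a"] ii_app[OF g h(2)] h(2) ap_eq[OF g h(2)] by simp
 qed
 obtain h where h:"!!p. memW p L==>memW (W.ap h p) (ii aleph1)" "!!p q. memW p L==>memW q L==>W.ap h p = W.ap h q==>p = q"
 using W.lepE[OF L] by metis
 have ow1:"W.ordinal (ii aleph1)" and ow2:"W.ordinal (ii dl)" using ii_ordinal ord_w1 ord_w2 by blast+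
 \<comment> \<open>\<open>T\<close> picks for \<open>al\<close> its colour with the least code, and
   \<open>V\<close> picks for a colour the least bound of its fibre. Both are unique without
   choice.\<close>
 define T where "T p al<->memW p L&R p al&(ALL p'. memW p' L&R p' al-->~ memW (W.ap h p') (W.ap h p))" for p al
 define U where "U p be1<->(ALL al. memW al (ii dl)&R p al-->memW al be1)" for p be1
 define V where "V p be1<->memW be1 (ii dl)&U p be1&(ALL be1'. memW be1' be1-->~ U p be1')" for p be1
 have T1:"EX p. T p (ii al)" if a:"al <: dl" for al
 proof -
 obtain p where p:"memW p L" "R p (ii al)" using R[OF a] by blast
 have o:"W.ordinal (W.ap h p)" using W.ordinal_mem[OF ow1 h(1)[OF p(1)]] .
 have "EX p'. memW p' L&R p' (ii al)&W.ap h p' = W.ap h p" using p by blast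
 then obtain b where b:"EX p'. memW p' L&R p' (ii al)&W.ap h p' = b" "!!c. memW c b==>~ (EX p'. memW p' L&R p' (ii al)&W.ap h p' = c)"
 using W.least_ordinal[OF o,of "%b. EX p'. memW p' L&R p' (ii al)&W.ap h p' = b"] by metis
 thus ?thesis unfolding T_def by blast
 qed
 have T2:"p = q" if "T p al" "T q al" for p q al
 proof -
 have pq:"memW p L" "memW q L" "~ memW (W.ap h p) (W.ap h q)" "~ memW (W.ap h q) (W.ap h p)" using that unfolding T_def by blast+
 thus ?thesis using W.ordinal_linear[OF W.ordinal_mem[OF ow1 h(1)] W.ordinal_mem[OF ow1 h(1)],of p q] h(2) by blast
 qed
 have V1:"EX be1. be1 <: dl&V p (ii be1)" if p:"memW p L" for p
 proof -
 obtain be1 where b:"be1 <: dl" "ALL al. al <: dl&R p (ii al)-->al <: be1" using bnd[OF p] by blast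
 have "U p (ii be1)" unfolding U_def mem_ii using b(2) by auto
 then obtain c where c:"U p c" "!!x. memW x c==>~ U p x" "c = ii be1 \<or> memW c (ii be1)"
 using W.least_ordinal[of "ii be1" "U p"] ii_ordinal ordinal_mem[OF ord_w2 b(1)] by metis
 have "memW c (ii dl)" using c(3) b(1) W.ordinal_trans[OF ow2,of "ii be1"] by auto
 then obtain z where z:"c = ii z" "z <: dl" using mem_ii by blast
 have "V p c" unfolding V_def using c(1,2) \<open>memW c (ii dl)\<close> by blast
 thus ?thesis using z by blast
 qed
 have V2:"be1 = be1'" if "V p be1" "V p be1'" for p be1 be1'
 proof -
 have b:"memW be1 (ii dl)" "memW be1' (ii dl)" "~ memW be1 be1'" "~ memW be1' be1" using that unfolding V_def by blast+
 thus ?thesis using W.ordinal_linear[OF W.ordinal_mem[OF ow2] W.ordinal_mem[OF ow2],of be1 be1'] by blast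
 qed
 \<comment> \<open>An ordinal is determined by the code of its colour together with its image under
   the injection of the bound of that fibre. If all fibres were bounded, \<open>dl\<close> would
   inject into the square of \<open>aleph1\<close>.\<close>
 define Z where "Z al z<->(EX p be1. T p al&V p be1&z = W.pair (W.ap h p) (W.ap (W.ap (ii f) be1) al))" for al z
 have key:"EX p b. T p (ii a)&b <: dl&V p (ii b)&a <: b&z = W.pair (W.ap h p) (ii (ap (app f b) a))" if z:"Z (ii a) z" "a <: dl" for a z
 proof -
 obtain p be1 where p:"T p (ii a)" "V p be1" "z = W.pair (W.ap h p) (W.ap (W.ap (ii f) be1) (ii a))" using z(1) unfolding Z_def by blast
 obtain b where b:"be1 = ii b" "b <: dl" using p(2) unfolding V_def mem_ii by blast
 have "R p (ii a)" "U p (ii b)" using p(1,2) unfolding T_def V_def b(1) by blast+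
 moreover have "memW (ii a) (ii dl)" using z(2) by simp
 ultimately have "memW (ii a) (ii b)" unfolding U_def by blast
 thus ?thesis using p b F[OF b(2),of a] by auto
 qed
 have "W.lep (ii dl) (W.cprod (ii aleph1) (ii aleph1))"
 proof (rule W.lepR[of Z])
 show "W.dp UNIV (%e. Z (e 0) (e 1))" unfolding Z_def T_def V_def U_def by (intro dpi W.dp_lift2[OF dR])
 next
 fix x assume "memW x (ii dl)"
 then obtain a where a:"x = ii a" "a <: dl" using mem_ii by blast
 obtain p where p:"T p (ii a)" using T1[OF a(2)] by blast
 hence pL:"memW p L" unfolding T_def by blast
 obtain b where b:"b <: dl" "V p (ii b)" using V1[OF pL] by blast
 have ab:"a <: b" using p b(2) a(2) unfolding T_def V_def U_def by (metis ii_mem)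
 have fb:"ap (app f b) a <: aleph1" using fi[OF b(1)] ab unfolding fn_ap by blast
 have "Z (ii a) (W.pair (W.ap h p) (ii (ap (app f b) a)))" unfolding Z_def using p b(2) F[OF b(1) ab] by metis
 thus "EX y. memW y (W.cprod (ii aleph1) (ii aleph1))&Z x y" unfolding a(1)
 using h(1)[OF pL] fb by (intro exI[of _ "W.pair (W.ap h p) (ii (ap (app f b) a))"]) simp
 next
 fix x y y' assume "Z x y" "Z x y'"
 thus "y = y'" unfolding Z_def using T2 V2 by metis
 next
 fix x x' y assume x:"memW x (ii dl)" "memW x' (ii dl)" and z:"Z x y" "Z x' y"
 obtain a a' where a:"x = ii a" "a <: dl" "x' = ii a'" "a' <: dl" using x mem_ii by blast
 obtain p b where p:"T p (ii a)" "b <: dl" "V p (ii b)" "a <: b" "y = W.pair (W.ap h p) (ii (ap (app f b) a))" using key z(1) a by blast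
 obtain p' b' where p': "T p' (ii a')" "b' <: dl" "V p' (ii b')" "a' <: b'" "y = W.pair (W.ap h p') (ii (ap (app f b') a'))" using key z(2) a by blast
 have "memW p L" "memW p' L" using p(1) p'(1) unfolding T_def by blast+
 hence pp:"p = p'" using h(2) p(5) p'(5) by simp
 hence "ii b = ii b'" using V2 p(3) p'(3) by blast
 hence bb:"b = b'" by simp
 hence "ap (app f b) a = ap (app f b) a'" using p(5) p'(5) by simp
 hence "a = a'" using fi[OF p(2)] p(4) p'(4) bb by blast
 thus "x = x'" using a by simp
 qed
 hence "lep dl (cprod (cprod (cprod aleph1 aleph1) omega) omega)" unfolding ii_cprod by (rule lep_reflect)
 hence "lep dl aleph1" using lep_w1_3[OF sq_w1] lep_trans by blast
 thus False using w2(4) by blast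
qed

end

section \<open>No set of tuples separates cliques from anticliques\<close>

context c2
begin

text \<open>\<open>RP j S c a I k w\<close>: the map \<open>j\<close> sends every injective \<open>k\<close>-tuple of \<open>I\<close> that is a clique (for the
 colouring \<open>a\<close>) into \<open>S\<close>, and every one that is an anticlique outside of \<open>S\<close>.\<close>

definition RP :: "'w => 'w => 'w => 'w => 'w => 'w => 'w => bool" where
 "RP j S c a I k w<->W.fn j I w&(ALL f t. W.fn f k I&(ALL l l'. memW l k&memW l' k&W.ap f l = W.ap f l'-->l = l') &
 W.fn t k w&(ALL l. memW l k-->W.ap t l = W.ap j (W.ap f l)) -->
 ((ALL l l'. memW l k&memW l' k&l ~= l'-->QC c a (W.ap f l) (W.ap f l'))-->memW t S) &
 ((ALL l l'. memW l k&memW l' k&l ~= l'-->~ QC c a (W.ap f l) (W.ap f l'))-->~ memW t S))"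
definition RPe :: "(nat => 'w) => bool" where "RPe e<->RP (e 0) (e 1) (e 2) (e 3) (e 4) (e 5) (e 6)"
lemma dp_RPe:"W.dp {} RPe" unfolding RPe_def RP_def by (intro dpi dp_QC)
definition NR :: "(nat => 'w) => bool" where "NR e<->~ memR e"
lemma dp_NR:"W.dp {} NR" unfolding NR_def by (intro dpi dp_memR)

lemma memR_env:"Gen H v==>memR (%n. v (envl [ta,ck b] n))<->memW (ii b) (v ta)"
 unfolding memR_def by (simp add: val_ck)

text \<open>Were \<open>C\<close> unbounded, every ordinal below \<open>dl\<close> could be coloured
  by an element of \<open>C\<close> that it does not exceed. The fibre of a single element is
  bounded by the successor of that element, against \<open>unbounded_fiber\<close>.\<close>

lemma bounded_w2: assumes "ext C <= ext dl" "lep C aleph1" shows "EX be1. be1 <: dl&ext C <= ext be1"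
proof (rule ccontr)
 assume n:"~ ?thesis"
 have d:"W.dp UNIV (%e. memW (e 1) (e 0) \<or> e 1 = e 0)" by (intro dpi)
 have ex:"EX p. memW p (ii C)&(memW (ii al) p \<or> ii al = p)" if a:"al <: dl" for al
 proof -
 have "~ ext C <= ext al" using n a by blast
 then obtain xi where x:"xi <: C" "~ xi <: al" by (auto simp: subset_iff)
 hence "xi <: dl" using assms(1) by auto
 hence "al <: xi \<or> al = xi" using ordinal_linear[OF ordinal_mem[OF ord_w2 a] ordinal_mem[OF ord_w2],of xi] x by blast
 thus ?thesis using x by (intro exI[of _ "ii xi"]) auto
 qed
 obtain p where p:"memW p (ii C)" "ALL be1. be1 <: dl-->(EX al. al <: dl&~ al <: be1&(memW (ii al) p \<or> ii al = p))"
 using unbounded_fiber[of "%p al. memW al p \<or> al = p",OF d ii_lep[OF assms(2)] ex] by blast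
 obtain xi where x:"p = ii xi" "xi <: C" using p(1) mem_ii by blast
 hence "xi <: dl" using assms(1) by auto
 hence "succ xi <: dl" by (rule succ_w2)
 then obtain al where "~ al <: succ xi" "memW (ii al) p \<or> ii al = p" using p(2) by blast
 thus False using x by auto
qed

text \<open>\<open>S\<close> will be the set of tuples from a dense set whose sum has large norm,
  and \<open>j\<close> sends an index to the number of an approximate image. The bound
  \<open>be1\<close> depends on \<open>S\<close> but not on \<open>j\<close>, so it can be fixed
  before the embedding is considered.\<close>

theorem core: assumes K:"0 < K"
 shows "EX be1. be1 <: dl&(ALL al j. al <: dl&~ al <: be1-->~ RP j S creal (ii al) (ii (powset omega)) (W.num K) (ii aleph1))"
proof -
 obtain taS where taS:"S = val taS" using val_surj by blast
 define BB where "BB = fs (num K) aleph1"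
 \<comment> \<open>The conditions that decide whether the tuple \<open>b\<close> belongs to
   \<open>S\<close>.\<close>
 define D where "D b q<->(q : PP&fc memR q (envl [taS,ck b])) \<or> (q : PP&fc NR q (envl [taS,ck b]))" for b q
 have dD:"dp UNIV (%e. D (e 0) (e 1))" unfolding D_def by (intro dpi dp_fc[OF dp_memR] dp_fc[OF dp_NR] dt_envl dt_envl0)
 obtain E where E:"!!b n. b <: BB==>finite (ext (ap E (pair b (num n)))) &
 (ALL q. q <: ap E (pair b (num n))-->q : PP&D b q) &
 (\<forall>q\<in>PP. D b q&card (dom (m q)) <= n-->(EX e r. e <: ap E (pair b (num n))&leq r q&leq r e))"
 using predense_family[OF dD,of BB] by blast
 \<comment> \<open>\<open>C\<close> collects the coordinates mentioned by the chosen conditions for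
   all tuples and sizes. Finitely many belong to each of \<open>aleph1\<close> many indices, so
   \<open>C\<close> is bounded, and an \<open>al\<close> beyond the bound is mentioned by none of
   these conditions.\<close>
 define cc where "cc i xi<->(EX z e. e <: ap E i&hb e xi z)" for i xi
 define L where "L = cprod BB omega"
 define C where "C = coll {xi. xi <: dl&(EX i. i <: L&cc i xi)}"
 have "isset {xi. xi <: dl&(EX i. i <: L&cc i xi)}" unfolding cc_def by (rule sep) (intro dpi)
 hence C:"xi <: C<->xi <: dl&(EX i. i <: L&cc i xi)" for xi unfolding C_def by (simp add: mem_coll)
 have "lep C (cprod L omega)"
 proof (rule finite_cover[of cc])
 show "dp UNIV (%e. cc (e 0) (e 1))" unfolding cc_def by (intro dpi)
 show "EX i. i <: L&cc i xi" if "xi <: C" for xi using that C by blast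
 fix i assume "i <: L"
 then obtain b n where i:"i = pair b (num n)" "b <: BB" unfolding L_def by (auto simp: mem_cprod mem_omega)
 have "{xi. xi <: C&cc i xi} <= (\<Union>e\<in>ext (ap E i). fst ` dom (m e))"
 proof
 fix xi assume "xi : {xi. xi <: C&cc i xi}"
 then obtain z e where h:"xi <: dl" "e <: ap E i" "hb e xi z" using C unfolding cc_def by blast
 have "e : PP" using E[OF i(2),of n] h(2) i(1) by blast
 then obtain k b' where "m e (xi,k) = Some b'" using hb_mp[OF _ h(1)] h(3) by blast
 hence x:"xi : fst ` dom (m e)" by (force simp: image_iff)
 have "e : ext (ap E i)" using h(2) by simp
 thus "xi : (\<Union>e\<in>ext (ap E i). fst ` dom (m e))" using x by (rule UN_I)
 qed
 moreover have "finite (\<Union>e\<in>ext (ap E i). fst ` dom (m e))"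
 proof (rule finite_UN_I)
 show "finite (ext (ap E i))" using E[OF i(2),of n] i(1) by blast
 fix e assume "e : ext (ap E i)"
 hence "e : PP" using E[OF i(2),of n] i(1) by simp
 thus "finite (fst ` dom (m e))" using dom_mp(1) by blast
 qed
 ultimately show "finite {xi. xi <: C&cc i xi}" by (rule finite_subset)
 qed
 moreover have "lep BB aleph1"
 proof -
 have "y <: Fin (cprod omega aleph1)" if "y <: BB" for y
 proof -
 have f:"fn y (num K) aleph1" using that unfolding BB_def by simp
 have sub:"ext y <= ext (cprod (num K) aleph1)" using fn_mem_pow[OF f] by simp
 have "x <: omega" if "x <: num K" for x using that ext_num[of K] mem_omega mem_ext by (metis imageE)
 hence "ext (cprod (num K) aleph1) <= ext (cprod omega aleph1)" by (auto simp: mem_cprod)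
 moreover have "finite (ext y)"
 proof (rule finite_subset)
 show "ext y <= (%l. pair l (app y l)) ` ext (num K)"
 proof
 fix z assume z:"z : ext y"
 have fo:"func_on y (num K)" using f fn_def by blast
 obtain l w where l:"z = pair l w" "l <: num K" using z fo unfolding func_on_def by auto
 hence "w = app y l" using func_app[OF fo l(2)] z by simp
 thus "z : (%l. pair l (app y l)) ` ext (num K)" using l by simp
 qed
 show "finite ((%l. pair l (app y l)) ` ext (num K))" by (simp add: ext_num)
 qed
 ultimately show ?thesis using sub by (auto simp: mem_Fin)
 qed
 hence "lep BB (Fin (cprod omega aleph1))" by (intro lep_subset) auto
 moreover have "lep (cprod omega aleph1) aleph1" using lep_prod[OF omega_lep_w1 lep_refl] sq_w1 lep_trans by blast
 ultimately show ?thesis using lep_Fin_mono Fin_w1 lep_trans by blast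
 qed
 hence "lep (cprod L omega) aleph1" unfolding L_def by (rule lep_w1_3)
 ultimately have "lep C aleph1" using lep_trans by blast
 moreover have "ext C <= ext dl" using C by auto
 ultimately obtain be1 where be1:"be1 <: dl" "ext C <= ext be1" using bounded_w2 by blast
 have "False" if al:"al <: dl" "~ al <: be1" and rp:"RP j S creal (ii al) (ii (powset omega)) (W.num K) (ii aleph1)" for al j
 proof -
 have alC:"~ al <: C" using al(2) be1(2) by auto
 obtain taj where taj:"j = val taj" using val_surj by blast
 define e0 where "e0 = envl [taj,taS,Cname,ck al,ck (powset omega),ck (num K),ck aleph1]"
 have ev0:"RPe (%n. v (e0 n))<->RP (v taj) (v taS) (v Cname) (ii al) (ii (powset omega)) (W.num K) (ii aleph1)" if "Gen H v" for H v
 unfolding RPe_def e0_def by (simp add: numeral_eq_Suc val_ck[OF that] ii_num del: num.simps W.num.simps)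
 have "RPe (%n. val (e0 n))" using rp unfolding ev0[OF Gen_self] taj taS creal_def .
 then obtain p0 where p0:"p0 : G" "fc RPe p0 e0" using fc_truth[OF dp_RPe Gen_self] by blast
 have RPH:"RP (v taj) (v taS) (v Cname) (ii al) (ii (powset omega)) (W.num K) (ii aleph1)" if "Gen H v" "p0 : H" for H v
 using fcD[OF p0(2) that] unfolding ev0[OF that(1)] .
 \<comment> \<open>An index is coloured by a size \<open>n\<close> and a bound \<open>M\<close> such
   that a condition of that size below \<open>p0\<close> decides its image and mentions the
   coordinate \<open>al\<close> at places below \<open>M\<close> only.\<close>
 define Qc where "Qc z xi<->(EX n M. z = pair n M&(EX p ga1. leq p p0&szle dl p n&(ALL y. hb p al y-->(EX k b. y = pair k b&k <: M)) &
 ga1 <: aleph1&p : PP&fc memR p (envl [taj,ck (pair xi ga1)])))" for z xi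
 have dQc:"dp UNIV (%e. Qc (e 0) (e 1))" unfolding Qc_def by (intro dpi dp_fc[OF dp_memR] dt_envl dt_envl0)
 have exQ:"EX i. i <: cprod omega omega&Qc i xi" if x:"xi <: powset omega" for xi
 proof -
 have fj:"W.fn j (ii (powset omega)) (ii aleph1)" using rp unfolding RP_def by blast
 have xx:"memW (ii xi) (ii (powset omega))" using x by (simp only: ii_mem)
 have fo:"W.func_on j (ii (powset omega))" using fj W.fn_def by blast
 have "memW (W.app j (ii xi)) (ii aleph1)" using fj xx unfolding W.fn_def by blast
 then obtain ga1 where g:"W.app j (ii xi) = ii ga1" "ga1 <: aleph1" using mem_ii by blast
 have "memW (ii (pair xi ga1)) (val taj)" using W.func_app[OF fo xx,of "ii ga1"] g(1) by (simp add: ii_pair taj)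
 hence "memR (%n. val (envl [taj,ck (pair xi ga1)] n))" by (simp only: memR_env[OF Gen_self])
 then obtain q0 where q0:"q0 : G" "fc memR q0 (envl [taj,ck (pair xi ga1)])" using fc_truth[OF dp_memR Gen_self] by blast
 obtain q where q:"q : G" "leq q p0" "leq q q0" using G_dir p0 q0 by blast
 have qP:"q : PP" using q(1) G_P by blast
 have fq:"fc memR q (envl [taj,ck (pair xi ga1)])" using fc_mono[OF q0(2) q(3)] .
 have "finite (snd ` dom (m q))" using dom_mp(1)[OF qP] by blast
 then obtain M where M:"\<forall>k\<in>snd ` dom (m q). k < M" using finite_nat_set_iff_bounded by blast
 have hM:"EX k b. y = pair k b&k <: num M" if y:"hb q al y" for y
 proof -
 obtain k b where k:"y = pair (num k) (bt b)" "m q (al,k) = Some b" using hb_mp[OF qP al(1),of y] y by blast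
 hence "k < M" using M by force
 thus ?thesis using k(1) num_mem by blast
 qed
 have sz:"szle dl q (num (card (dom (m q))))" using szle_num[OF qP] by blast
 have "Qc (pair (num (card (dom (m q)))) (num M)) xi" unfolding Qc_def using q(2) sz hM g(2) qP fq by blast
 thus ?thesis by (intro exI[of _ "pair (num (card (dom (m q)))) (num M)"]) simp
 qed
 \<comment> \<open>There are only countably many colours, while the index set has size
   \<open>aleph1\<close>; so it cannot be covered by finite colour classes.\<close>
 have "EX i. i <: cprod omega omega&infinite {xi. xi <: powset omega&Qc i xi}"
 proof (rule ccontr)
 assume "~ ?thesis"
 hence "lep (powset omega) (cprod (cprod omega omega) omega)" by (intro finite_cover[OF dQc exQ]) blast+
 thus False using lep3 lep_trans equinum_lep2[OF pow_w] w1(4) by blast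
 qed
 then obtain n M where inf:"infinite {xi. xi <: powset omega&Qc (pair (num n) (num M)) xi}" by (auto simp: mem_cprod mem_omega simp del: mem_powset)
 define A where "A = {xi. xi <: powset omega&Qc (pair (num n) (num M)) xi}"
 have "EX p ga1. leq p p0&card (dom (m p)) <= n&(ALL k b. m p (al,k) = Some b-->k < M)&ga1 <: aleph1&p : PP&fc memR p (envl [taj,ck (pair xi ga1)])"
 if x:"xi : A" for xi
 proof -
 obtain p ga1 where p:"leq p p0" "szle dl p (num n)" "ALL y. hb p al y-->(EX k b. y = pair k b&k <: num M)" "ga1 <: aleph1" "p : PP" "fc memR p (envl [taj,ck (pair xi ga1)])"
 using x unfolding A_def Qc_def by auto
 have "k < M" if "m p (al,k) = Some b" for k b
 proof -
 have "hb p al (pair (num k) (bt b))" using hb_mp'[OF p(5) al(1)] that by blast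
 hence "num k <: num M" using p(3) by (metis pair_inject)
 thus ?thesis using num_mem by blast
 qed
 thus ?thesis using p szle_num[OF p(5)] by blast
 qed
 then obtain pp ga1ga1 where P:"!!xi. xi : A==>leq (pp xi) p0&card (dom (m (pp xi))) <= n&(ALL k b. m (pp xi) (al,k) = Some b-->k < M) &
 ga1ga1 xi <: aleph1&pp xi : PP&fc memR (pp xi) (envl [taj,ck (pair xi (ga1ga1 xi))])" by metis
 \<comment> \<open>Indices with the same \<open>key\<close> agree below \<open>M\<close>. They can
   split only at places from \<open>M\<close> on, about which the conditions say nothing at
   coordinate \<open>al\<close>.\<close>
 define key where "key xi = {k. k < M&num k <: xi}" for xi
 have "finite (key ` A)" by (rule finite_subset[of _ "Pow {..<M}"]) (auto simp: key_def)
 then obtain xi0 where x0:"infinite {xi \<in> A. key xi = key xi0}" using pigeonhole_infinite[of A key] inf unfolding A_def[symmetric] by blast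
 obtain B where B:"B <= {xi \<in> A. key xi = key xi0}" "finite B" "card B = Suc (K - 1)" "\<forall>x\<in>B. \<forall>y\<in>B. agree (m (pp x)) (m (pp y))"
 proof -
 have "\<exists>B\<subseteq>{xi \<in> A. key xi = key xi0}. finite B&card B = Suc (K - 1)&(\<forall>x\<in>B. \<forall>y\<in>B. agree (m (pp x)) (m (pp y)))"
 by (rule infinite_compatible[OF x0,of "%x. m (pp x)" n "K - 1"]) (use P dom_mp(1) in auto)
 thus ?thesis using that by blast
 qed
 have cB:"card B = K" using B(3) K by simp
 have BA:"xi : A" "key xi = key xi0" if "xi : B" for xi using B(1) that by auto
 obtain r where r:"r : PP" "\<forall>p\<in>pp ` B. m p \<subseteq>\<^sub>m m r" "dom (m r) = (\<Union>p\<in>pp ` B. dom (m p))"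
 proof -
 have "\<exists>r\<in>PP. (\<forall>p\<in>pp ` B. m p \<subseteq>\<^sub>m m r)&dom (m r) = (\<Union>p\<in>pp ` B. dom (m p))"
 proof (rule ex_union)
 show "finite (pp ` B)" using B(2) by simp
 show "pp ` B <= PP" using P BA(1) by blast
 show "agree (m p) (m p')" if "p : pp ` B" "p' : pp ` B" for p p' using that B(4) by blast
 qed
 thus ?thesis using that by blast
 qed
 have rM:"m r (al,k) = None" if k:"M <= k" for k
 proof (rule ccontr)
 assume "m r (al,k) ~= None"
 hence "(al,k) : dom (m r)" by auto
 then obtain xi where "xi : B" "(al,k) : dom (m (pp xi))" using r(3) by auto
 hence "k < M" using P[OF BA(1)] by blast
 thus False using k by simp
 qed
 define De where "De = {k. \<exists>xi\<in>B. \<exists>et\<in>B. df xi et k}"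
 have "De <= (%(xi,et). THE k. df xi et k) ` (B \<times> B)"
 proof
 fix k assume "k : De"
 then obtain xi et where h:"xi : B" "et : B" "df xi et k" unfolding De_def by blast
 have "(THE k. df xi et k) = k" using h(3) df_unique by (intro the_equality) blast+
 thus "k : (%(xi,et). THE k. df xi et k) ` (B \<times> B)" using h by (intro image_eqI[of _ _ "(xi,et)"]) auto
 qed
 moreover have "finite ((%(xi,et). THE k. df xi et k) ` (B \<times> B))" using B(2) by (intro finite_imageI finite_cartesian_product)
 ultimately have finDe:"finite De" by (rule finite_subset)
 have DeM:"M <= k" if k:"k : De" for k
 proof (rule ccontr)
 assume lt:"~ M <= k"
 obtain xi et where h:"xi : B" "et : B" "df xi et k" using k unfolding De_def by blast
 have "key xi = key et" using BA(2) h by simp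
 hence "k : key xi<->k : key et" by simp
 hence "num k <: xi<->num k <: et" using lt unfolding key_def by simp
 thus False using h(3) unfolding df_def by blast
 qed
 \<comment> \<open>The common extension \<open>r\<close> with the bit \<open>b\<close> entered at
   coordinate \<open>al\<close> at all places of \<open>De\<close>, where two of the chosen indices
   split: the tuple is a clique for \<open>b\<close> true and an anticlique for \<open>b\<close>
   false.\<close>
 define gb where "gb b = (%x. if x : {al} \<times> De then Some b else m r x)" for b :: bool
 have "\<exists>q\<in>PP. m q = gb b" for b
 proof (rule ex_mp)
 have d:"dom (gb b) <= {al} \<times> De \<union> dom (m r)" unfolding gb_def by (auto simp: dom_def split: if_splits)
 show "finite (dom (gb b))" by (rule finite_subset[OF d]) (use finDe dom_mp(1)[OF r(1)] in auto)
 have "{al} \<times> De <= ext dl \<times> UNIV" using al(1) by auto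
 thus "dom (gb b) <= ext dl \<times> UNIV" using d dom_mp(2)[OF r(1)] by (meson Un_least subset_trans)
 qed
 then obtain q where q:"!!b. q b : PP" "!!b. m (q b) = gb b" by metis
 have qr:"m r \<subseteq>\<^sub>m m (q b)" for b unfolding q(2) gb_def map_le_def using rM DeM by auto
 obtain g where g:"bij_betw g {..<K} B" using ex_bij_betw_nat_finite[OF B(2)] unfolding cB by (auto simp: atLeast0LessThan)
 have gB:"g l : B" if "l < K" for l using g that unfolding bij_betw_def by auto
 have gi:"inj_on g {..<K}" using g unfolding bij_betw_def by blast
 have zK:"\<exists>l<K. z = num l" if "z <: num K" for z using that ext_num[of K] by (auto simp flip: mem_ext)
 have zW:"\<exists>l<K. z = W.num l" if "memW z (W.num K)" for z using that W.ext_num[of K] by (auto simp flip: W.mem_ext)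
 have gI:"g l <: powset omega" if "l < K" for l using BA(1)[OF gB[OF that]] unfolding A_def by blast
 define t f where "t = lam (num K) (%z. ga1ga1 (g (nv z)))" and "f = lam (num K) (%z. g (nv z))"
 have finK:"finite (ext (num K))" by (simp add: ext_num)
 have t1:"ga1ga1 (g (nv z)) <: aleph1" if "z <: num K" for z using zK[OF that] P[OF BA(1)[OF gB]] by auto
 have f1:"g (nv z) <: powset omega" if "z <: num K" for z using zK[OF that] gI by (auto simp del: mem_powset)
 have t:"fn t (num K) aleph1" "!!l. l < K==>ap t (num l) = ga1ga1 (g l)"
 unfolding t_def using fn_finite(1,3)[OF finK t1] by (simp_all add: num_mem)
 have f:"fn f (num K) (powset omega)" "!!l. l < K==>ap f (num l) = g l"
 unfolding f_def using fn_finite(1,3)[OF finK f1] by (simp_all add: num_mem)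
 have tW:"W.fn (ii t) (W.num K) (ii aleph1)" "!!l. l < K==>W.ap (ii t) (W.num l) = ii (ga1ga1 (g l))"
 and fW:"W.fn (ii f) (W.num K) (ii (powset omega))" "!!l. l < K==>W.ap (ii f) (W.num l) = ii (g l)"
 proof -
 have tf:"func_on t (num K)" and ff:"func_on f (num K)" using t(1) f(1) fn_def by blast+
 show "W.fn (ii t) (W.num K) (ii aleph1)" "W.fn (ii f) (W.num K) (ii (powset omega))" using ii_fn[OF t(1)] ii_fn[OF f(1)] by (simp_all only: ii_num)
 fix l assume l:"l < K"
 hence lK:"num l <: num K" using num_mem by blast
 have lW:"memW (W.num l) (W.num K)" using l W.num_mem by blast
 show "W.ap (ii t) (W.num l) = ii (ga1ga1 (g l))"
 using W.ap_eq[OF ii_func[OF tf,unfolded ii_num] lW] ii_app[OF tf lK] ap_eq[OF tf lK] t(2)[OF l] by (simp only: ii_num)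
 show "W.ap (ii f) (W.num l) = ii (g l)"
 using W.ap_eq[OF ii_func[OF ff,unfolded ii_num] lW] ii_app[OF ff lK] ap_eq[OF ff lK] f(2)[OF l] by (simp only: ii_num)
 qed
 \<comment> \<open>The images of the indices are decided by \<open>r\<close> and do not depend on
   \<open>b\<close>, so the same tuple \<open>t\<close> is put into \<open>S\<close> by
   \<open>q True\<close> and kept out of it by \<open>q False\<close>.\<close>
 have dec:"memW (ii t) (v taS)<->b" if H:"Gen H v" "q b : H" for H v b
 proof -
 have pH:"pp xi : H" "p0 : H" if "xi : B" for xi
 proof -
 have pr:"pp xi : PP" "leq (pp xi) p0" using P[OF BA(1)[OF that]] by blast+
 have "m (pp xi) \<subseteq>\<^sub>m m (q b)" using r(2) that qr[of b] map_le_trans by blast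
 hence "leq (q b) (pp xi)" unfolding Le_mp using pr q(1) by blast
 thus "pp xi : H" using Gen_facts(2)[OF H(1) H(2)] by blast
 thus "p0 : H" using Gen_facts(2)[OF H(1)] pr(2) by blast
 qed
 have p0H:"p0 : H" using pH(2) gB[OF K] by blast
 note rph = RPH[OF H(1) p0H]
 have fj:"W.func_on (v taj) (ii (powset omega))" using rph unfolding RP_def W.fn_def by blast
 have jx:"W.ap (v taj) (ii xi) = ii (ga1ga1 xi)" if x:"xi : B" for xi
 proof -
 have xI:"memW (ii xi) (ii (powset omega))" using BA(1)[OF x] unfolding A_def by (simp only: ii_mem mem_Collect_eq)
 have "memR (%n. v (envl [taj,ck (pair xi (ga1ga1 xi))] n))" using fcD[OF _ H(1) pH(1)[OF x]] P[OF BA(1)[OF x]] by blast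
 hence "memW (W.pair (ii xi) (ii (ga1ga1 xi))) (v taj)" by (simp only: memR_env[OF H(1)] ii_pair)
 thus ?thesis using W.func_app[OF fj xI] W.ap_eq[OF fj xI] by simp
 qed
 have QCb:"QC (v Cname) (ii al) (W.ap (ii f) l) (W.ap (ii f) l')<->b" if h:"memW l (W.num K)" "memW l' (W.num K)" "l ~= l'" for l l'
 proof -
 obtain i where i:"i < K" "l = W.num i" using zW[OF h(1)] by blast
 obtain i' where i': "i' < K" "l' = W.num i'" using zW[OF h(2)] by blast
 have "i ~= i'" using h(3) i i' by blast
 hence "g i ~= g i'" using inj_onD[OF gi] i i' by blast
 then obtain k where k:"df (g i) (g i') k" using df_ex gI i i' by blast
 hence "k : De" unfolding De_def using gB i i' by blast
 hence "m (q b) (al,k) = Some b" unfolding q(2) gb_def by simp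
 hence "memW (W.pair (ii al) (W.num k)) (v Cname)<->b" by (rule bit_decided[OF H])
 thus ?thesis using QC_df[OF k] fW(2) i i' by simp
 qed
 have inj:"ALL l l'. memW l (W.num K)&memW l' (W.num K)&W.ap (ii f) l = W.ap (ii f) l'-->l = l'"
 proof (intro allI impI)
 fix l l' assume h:"memW l (W.num K)&memW l' (W.num K)&W.ap (ii f) l = W.ap (ii f) l'"
 obtain i where i:"i < K" "l = W.num i" using zW h by blast
 obtain i' where i': "i' < K" "l' = W.num i'" using zW h by blast
 have "g i = g i'" using h fW(2)[OF i(1)] fW(2)[OF i'(1)] i i' by simp
 thus "l = l'" using inj_onD[OF gi] i i' by blast
 qed
 have tj:"ALL l. memW l (W.num K)-->W.ap (ii t) l = W.ap (v taj) (W.ap (ii f) l)"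
 proof (intro allI impI)
 fix l assume "memW l (W.num K)"
 then obtain i where i:"i < K" "l = W.num i" using zW by blast
 thus "W.ap (ii t) l = W.ap (v taj) (W.ap (ii f) l)" using tW(2)[OF i(1)] fW(2)[OF i(1)] jx[OF gB[OF i(1)]] by simp
 qed
 have "((ALL l l'. memW l (W.num K)&memW l' (W.num K)&l ~= l'-->QC (v Cname) (ii al) (W.ap (ii f) l) (W.ap (ii f) l'))-->memW (ii t) (v taS)) &
 ((ALL l l'. memW l (W.num K)&memW l' (W.num K)&l ~= l'-->~ QC (v Cname) (ii al) (W.ap (ii f) l) (W.ap (ii f) l'))-->~ memW (ii t) (v taS))"
 by (rule rph[unfolded RP_def,THEN conjunct2,THEN spec,THEN spec,THEN mp,OF conjI[OF fW(1) conjI[OF inj conjI[OF tW(1) tj]]]])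
 thus ?thesis using QCb by (cases b) simp_all
 qed
 have tB:"t <: BB" unfolding BB_def using t(1) by simp
 have "fc memR (q True) (envl [taS,ck t])" unfolding fc_def using dec memR_env by blast
 hence "D t (q True)" unfolding D_def using q(1) by blast
 \<comment> \<open>A condition from the chosen predense set that is compatible with
   \<open>q True\<close>. It decides the membership of \<open>t\<close> positively and does not
   mention the coordinate \<open>al\<close>.\<close>
 then obtain e r1 where e:"e <: ap E (pair t (num (card (dom (m (q True))))))" "leq r1 (q True)" "leq r1 e"
 using E[OF tB,of "card (dom (m (q True)))"] q(1) by blast
 have eP:"e : PP" "D t e" using E[OF tB,of "card (dom (m (q True)))"] e(1) by blast+
 obtain H v where H:"Gen H v" "r1 : H" using hom e(2) Le_mp by blast
 have HH:"q True : H" "e : H" using Gen_facts(2)[OF H] e(2,3) by blast+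
 have "memW (ii t) (v taS)" using dec[OF H(1) HH(1)] by simp
 hence "~ fc NR e (envl [taS,ck t])" using fcD[OF _ H(1) HH(2),of NR "envl [taS,ck t]"] memR_env[OF H(1)] unfolding NR_def by blast
 hence fe:"fc memR e (envl [taS,ck t])" using eP(2) unfolding D_def by blast
 have eal:"m e (al,k) = None" for k
 proof (rule ccontr)
 assume "m e (al,k) ~= None"
 then obtain b where "m e (al,k) = Some b" by blast
 hence "hb e al (pair (num k) (bt b))" using hb_mp'[OF eP(1) al(1)] by blast
 hence "cc (pair t (num (card (dom (m (q True)))))) al" unfolding cc_def using e(1) by blast
 moreover have "pair t (num (card (dom (m (q True))))) <: L" unfolding L_def using tB by simp
 ultimately show False using alC C al(1) by blast
 qed
 have r1:"m (q True) \<subseteq>\<^sub>m m r1" "m e \<subseteq>\<^sub>m m r1" using e(2,3) unfolding Le_mp by blast+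
 \<comment> \<open>Off the places just filled, \<open>q False\<close> coincides with
   \<open>q True\<close>, with which \<open>e\<close> is compatible; at those places
   \<open>e\<close> is undefined. A generic filter through both gives the contradiction.\<close>
 have "agree (m e) (m (q False))" unfolding agree_def
 proof (intro allI impI)
 fix x c d assume c:"m e x = Some c" and d:"m (q False) x = Some d"
 have "x \<notin> {al} \<times> De" using c eal by auto
 hence "m (q True) x = Some d" using d unfolding q(2) gb_def by simp
 hence "m r1 x = Some d" "m r1 x = Some c" using r1 c unfolding map_le_def by (metis domI)+
 thus "c = d" by simp
 qed
 then obtain r2 where r2:"leq r2 e" "leq r2 (q False)" using ex_common[OF eP(1) q(1)] by blast
 obtain H' v' where H': "Gen H' v'" "r2 : H'" using hom r2(1) Le_mp by blast
 have HH': "e : H'" "q False : H'" using Gen_facts(2)[OF H'] r2 by blast+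
 have "memW (ii t) (v' taS)" using fcD[OF fe H'(1) HH'(1)] memR_env[OF H'(1)] by blast
 thus False using dec[OF H'(1) HH'(2)] by simp
 qed
 thus ?thesis using be1(1) by blast
qed

end

section \<open>Finite sums in an arbitrary Banach space\<close>

context zf0
begin

definition ysm :: "'v => 'v => ('v => 'v) => 'v => 'v" where "ysm P z h n = rc z (%l v. ap P (pair v (h l))) n"
lemma dt_ysm [dpi]: assumes "dt UNIV P" "dt UNIV z" "dt UNIV (%e. h (%n. e (Suc n)) (e 0))" "dt UNIV n"
 shows "dt UNIV (%e. ysm (P e) (z e) (h e) (n e))"
proof -
 have 1:"dt UNIV (%e. h (%n. e (Suc (Suc n))) (e 0))"
 using dt_reindex[OF assms(3),of "%n. case n of 0 => 0 | Suc k => Suc (Suc k)"] by simp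
 have 2:"dt UNIV (%e. P (%n. e (Suc (Suc n))))" by (rule dt_reindex[OF assms(1)])
 show ?thesis unfolding ysm_def by (intro dpi assms(2,4) 1 2)
qed

end

locale ynorm = zf0 mem for mem :: "'v => 'v => bool" (infix \<open><:\<close> 50) +
 fixes Y :: 'v assumes Y:"banach Y"
begin

abbreviation "A \<equiv> points Y"
abbreviation "P \<equiv> plus_of Y"
abbreviation "S \<equiv> scale_of Y"
abbreviation "nY \<equiv> norm_of Y"
abbreviation "V \<equiv> vec Y"

lemma Y_pair:"Y = pair (pair A P) (pair S nY)" using Y unfolding banach_def by blast
lemma Y_norm:"is_norm Y nY" using Y unfolding banach_def by blast
lemma Y_module:"module scalars V" using Y unfolding banach_def vector_space_def by blast
lemma Y_fn:"fn P (cprod A A) A" "fn S (cprod reals A) A" using Y unfolding banach_def vector_space_def by blast+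

sublocale M: module scalars V by (rule Y_module)

lemma carr:"x : carrier V<->x <: A" by (simp add: vec_def)
lemma apP:"x <: A==>y <: A==>ap P (pair x y) = x \<oplus>\<^bsub>V\<^esub> y"
 using ap_eq[of P "cprod A A" "pair x y"] Y_fn(1) unfolding fn_def by (simp add: vec_def)
lemma add_A:"x <: A==>y <: A==>x \<oplus>\<^bsub>V\<^esub> y <: A" using M.a_closed[of x y] by (simp add: carr)
lemma zero_A:"\<zero>\<^bsub>V\<^esub> <: A" using M.zero_closed by (simp add: carr)
text \<open>Cancellation in the additive group. It allows a formula to identify the zero vector as
  the point with \<open>z + z = z\<close>, without mentioning the algebraic structure of
  HOL.\<close>

lemma zero_unique: assumes "z <: A" "ap P (pair z z) = z" shows "z = \<zero>\<^bsub>V\<^esub>"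
proof -
 have z:"z : carrier V" using assms carr by blast
 have e:"z \<oplus>\<^bsub>V\<^esub> z = z" using apP[OF assms(1,1)] assms(2) by simp
 have "z = z \<oplus>\<^bsub>V\<^esub> (z \<oplus>\<^bsub>V\<^esub> \<ominus>\<^bsub>V\<^esub> z)" using z by (simp add: M.r_neg)
 also have "... = (z \<oplus>\<^bsub>V\<^esub> z) \<oplus>\<^bsub>V\<^esub> \<ominus>\<^bsub>V\<^esub> z" using z by (simp add: M.a_assoc)
 also have "... = \<zero>\<^bsub>V\<^esub>" unfolding e using z by (simp add: M.r_neg)
 finally show ?thesis .
qed
lemma scal:"r : carrier scalars<->r : Reals_in" "r \<oplus>\<^bsub>scalars\<^esub> s = r + s" "\<one>\<^bsub>scalars\<^esub> = 1" "\<zero>\<^bsub>scalars\<^esub> = 0"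
 by (simp_all add: scalars_def)
lemma m1:"- 1 : Reals_in" using Reals_minus[OF Reals_const(2)] by simp
lemma sub_S: assumes "x <: A" "y <: A" shows "ap P (pair x (ap S (pair (rlc (- 1)) y))) = x \<ominus>\<^bsub>V\<^esub> y"
proof -
 have y:"y : carrier V" using assms carr by blast
 define n where "n = (- 1) \<odot>\<^bsub>V\<^esub> y"
 have nA:"n <: A" using M.smult_closed[of "- 1" y] y m1 by (simp add: n_def carr scal)
 have "ap S (pair (rlc (- 1)) y) = app S (pair (rlc (- 1)) y)"
 using ap_eq[of S "cprod reals A" "pair (rlc (- 1)) y"] Y_fn(2) assms(2) m1 unfolding fn_def by simp
 hence s:"ap S (pair (rlc (- 1)) y) = n" by (simp add: n_def vec_def)
 have "n \<oplus>\<^bsub>V\<^esub> y = (- 1) \<odot>\<^bsub>V\<^esub> y \<oplus>\<^bsub>V\<^esub> 1 \<odot>\<^bsub>V\<^esub> y" using M.smult_one[OF y] by (simp add: n_def scal)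
 also have "... = (- 1 + 1) \<odot>\<^bsub>V\<^esub> y" using M.smult_l_distr[of "- 1" 1 y] y m1 Reals_const(2) by (simp add: scal)
 also have "... = \<zero>\<^bsub>V\<^esub>" using M.smult_l_null[OF y] by (simp add: scal)
 finally have "\<ominus>\<^bsub>V\<^esub> y = n" using M.minus_equality[of n y] y nA carr by blast
 thus ?thesis unfolding s using apP[OF assms(1) nA] by (simp add: a_minus_def)
qed
lemma mem_norm: assumes "x <: A" shows "rtc q <: ap nY x<->of_rat q < nrm nY x"
proof -
 have f:"fn nY A reals" using Y_norm unfolding is_norm_def by blast
 hence "ap nY x = app nY x" using ap_eq[of nY A x] assms unfolding fn_def by blast
 moreover have "isr (app nY x)" using f assms unfolding fn_def mem_reals by blast
 ultimately show ?thesis using rat_mem_real isr_val unfolding nrm_def by metis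
qed
lemma tri:"x <: A==>y <: A==>nrm nY (x \<oplus>\<^bsub>V\<^esub> y) <= nrm nY x + nrm nY y"
 using Y_norm unfolding is_norm_def by (simp add: carr)

lemma ysm_Suc:"ysm P z h (num 0) = z" "ysm P z h (num (Suc n)) = ap P (pair (ysm P z h (num n)) (h (num n)))"
 unfolding ysm_def rc_num by simp_all
lemma ysm_A: assumes "!!l. l < n==>h (num l) <: A"
 shows "ysm P \<zero>\<^bsub>V\<^esub> h (num n) <: A"
 using assms
proof (induction n)
 case (Suc n)
 hence "ysm P \<zero>\<^bsub>V\<^esub> h (num n) <: A" "h (num n) <: A" by simp_all
 thus ?case unfolding ysm_Suc using apP add_A by simp
qed (use ysm_Suc(1) zero_A in simp)

lemma ysm_diff: assumes "!!l. l < n==>h (num l) <: A" "!!l. l < n==>h' (num l) <: A" "!!l. l < n==>nrm nY (h (num l) \<ominus>\<^bsub>V\<^esub> h' (num l)) <= d"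
 shows "nrm nY (ysm P \<zero>\<^bsub>V\<^esub> h (num n) \<ominus>\<^bsub>V\<^esub> ysm P \<zero>\<^bsub>V\<^esub> h' (num n)) <= real n * d"
 using assms
proof (induction n)
 case 0
 have "nrm nY \<zero>\<^bsub>V\<^esub> = 0"
 proof -
 have "0 \<odot>\<^bsub>V\<^esub> \<zero>\<^bsub>V\<^esub> = \<zero>\<^bsub>V\<^esub>" using M.smult_l_null[of "\<zero>\<^bsub>V\<^esub>"] by (simp add: scal)
 moreover have "nrm nY (0 \<odot>\<^bsub>V\<^esub> \<zero>\<^bsub>V\<^esub>) = \<bar>0\<bar> * nrm nY \<zero>\<^bsub>V\<^esub>" using Y_norm M.zero_closed Reals_const(1) unfolding is_norm_def by blast
 ultimately show ?thesis by simp
 qed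
 moreover have "\<zero>\<^bsub>V\<^esub> \<ominus>\<^bsub>V\<^esub> \<zero>\<^bsub>V\<^esub> = \<zero>\<^bsub>V\<^esub>" using M.r_neg[of "\<zero>\<^bsub>V\<^esub>"] by (simp add: a_minus_def)
 ultimately show ?case unfolding ysm_Suc by simp
next
 case (Suc n)
 define a a' b b' where "a = ysm P \<zero>\<^bsub>V\<^esub> h (num n)" and "a' = ysm P \<zero>\<^bsub>V\<^esub> h' (num n)" and "b = h (num n)" and "b' = h' (num n)"
 have ab:"a <: A" "a' <: A" "b <: A" "b' <: A" unfolding a_def a'_def b_def b'_def using ysm_A[of n h] ysm_A[of n h'] Suc.prems by simp_all
 hence c:"a : carrier V" "a' : carrier V" "b : carrier V" "b' : carrier V" by (simp_all add: carr)
 have "(a \<oplus>\<^bsub>V\<^esub> b) \<ominus>\<^bsub>V\<^esub> (a' \<oplus>\<^bsub>V\<^esub> b') = (a \<ominus>\<^bsub>V\<^esub> a') \<oplus>\<^bsub>V\<^esub> (b \<ominus>\<^bsub>V\<^esub> b')"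
 using c by (simp add: a_minus_def M.minus_add M.a_ac)
 moreover have "a \<ominus>\<^bsub>V\<^esub> a' <: A" "b \<ominus>\<^bsub>V\<^esub> b' <: A" using c by (simp_all add: M.minus_closed flip: carr)
 ultimately have "nrm nY ((a \<oplus>\<^bsub>V\<^esub> b) \<ominus>\<^bsub>V\<^esub> (a' \<oplus>\<^bsub>V\<^esub> b')) <= nrm nY (a \<ominus>\<^bsub>V\<^esub> a') + nrm nY (b \<ominus>\<^bsub>V\<^esub> b')" using tri by simp
 moreover have "nrm nY (a \<ominus>\<^bsub>V\<^esub> a') <= real n * d" unfolding a_def a'_def using Suc.IH Suc.prems by simp
 moreover have "nrm nY (b \<ominus>\<^bsub>V\<^esub> b') <= d" unfolding b_def b'_def using Suc.prems(3)[of n] by simp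
 ultimately have "nrm nY ((a \<oplus>\<^bsub>V\<^esub> b) \<ominus>\<^bsub>V\<^esub> (a' \<oplus>\<^bsub>V\<^esub> b')) <= real (Suc n) * d" by (simp add: algebra_simps)
 thus ?case unfolding ysm_Suc using apP[OF ab(1,3)] apP[OF ab(2,4)] by (simp add: a_def a'_def b_def b'_def)
qed

lemma norm_minus: assumes "x <: A" "y <: A" shows "nrm nY (x \<ominus>\<^bsub>V\<^esub> y) = nrm nY (y \<ominus>\<^bsub>V\<^esub> x)"
proof -
 have c:"x : carrier V" "y : carrier V" using assms carr by blast+
 have d:"x \<ominus>\<^bsub>V\<^esub> y : carrier V" using c by (rule M.minus_closed)
 have e:"y \<ominus>\<^bsub>V\<^esub> x = \<ominus>\<^bsub>V\<^esub> (x \<ominus>\<^bsub>V\<^esub> y)" using c by (simp add: a_minus_def M.minus_add M.a_ac)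
 have "\<ominus>\<^bsub>V\<^esub> (x \<ominus>\<^bsub>V\<^esub> y) = (- 1) \<odot>\<^bsub>V\<^esub> (x \<ominus>\<^bsub>V\<^esub> y)"
 proof -
 have sc:"(- 1) \<odot>\<^bsub>V\<^esub> (x \<ominus>\<^bsub>V\<^esub> y) : carrier V" using M.smult_closed[of "- 1"] d m1 by (simp add: scal)
 have "(- 1) \<odot>\<^bsub>V\<^esub> (x \<ominus>\<^bsub>V\<^esub> y) \<oplus>\<^bsub>V\<^esub> (x \<ominus>\<^bsub>V\<^esub> y) = (- 1) \<odot>\<^bsub>V\<^esub> (x \<ominus>\<^bsub>V\<^esub> y) \<oplus>\<^bsub>V\<^esub> 1 \<odot>\<^bsub>V\<^esub> (x \<ominus>\<^bsub>V\<^esub> y)" using M.smult_one[OF d] by (simp add: scal)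
 also have "... = (- 1 + 1) \<odot>\<^bsub>V\<^esub> (x \<ominus>\<^bsub>V\<^esub> y)" using M.smult_l_distr[of "- 1" 1 "x \<ominus>\<^bsub>V\<^esub> y"] d m1 Reals_const(2) by (simp add: scal)
 also have "... = \<zero>\<^bsub>V\<^esub>" using M.smult_l_null[OF d] by (simp add: scal)
 finally show ?thesis using M.minus_equality[OF _ d sc] by blast
 qed
 moreover have "nrm nY ((- 1) \<odot>\<^bsub>V\<^esub> (x \<ominus>\<^bsub>V\<^esub> y)) = \<bar>- 1\<bar> * nrm nY (x \<ominus>\<^bsub>V\<^esub> y)" using Y_norm d m1 unfolding is_norm_def by blast
 ultimately show ?thesis using e by simp
qed

lemma norm_diff: assumes "x <: A" "y <: A" shows "\<bar>nrm nY x - nrm nY y\<bar> <= nrm nY (x \<ominus>\<^bsub>V\<^esub> y)"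
proof -
 have *: "nrm nY u <= nrm nY (u \<ominus>\<^bsub>V\<^esub> w) + nrm nY w" if "u <: A" "w <: A" for u w
 proof -
 have c:"u : carrier V" "w : carrier V" using that carr by blast+
 have "(u \<ominus>\<^bsub>V\<^esub> w) \<oplus>\<^bsub>V\<^esub> w = u" using c by (simp add: a_minus_def M.a_assoc M.l_neg)
 thus ?thesis using tri[of "u \<ominus>\<^bsub>V\<^esub> w" w] that c M.minus_closed[of u w] by (simp add: carr)
 qed
 show ?thesis using *[OF assms] *[OF assms(2,1)] norm_minus[OF assms] by linarith
qed

end

section \<open>From an embedding to a numerical gap\<close>

context c2
begin

abbreviation "II \<equiv> ii (powset omega)"

text \<open>The part of an embedding that is used later. The colour \<open>p\<close> consists of the
  space, a number \<open>k\<close> and rationals \<open>q' < q\<close> between which the norms of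
  sums of \<open>k\<close> images jump; for a given space there are only countably many colours. The
  map \<open>j\<close> is quantified away because it varies with \<open>al\<close>.\<close>

definition emb :: "'w => 'w => bool" where
 "emb p al<->(EX A P S nY k q q' z j. p = W.pair (W.pair (W.pair A P) (W.pair S nY)) (W.pair k (W.pair q q')) &
 memW k W.omega&k ~= W.empty&W.QLT q' q&memW z A&W.ap P (W.pair z z) = z&W.fn j II A &
 (ALL f. W.fn f k II&(ALL l l'. memW l k&memW l' k&W.ap f l = W.ap f l'-->l = l') -->
 ((ALL l l'. memW l k&memW l' k&l ~= l'-->QC creal al (W.ap f l) (W.ap f l'))-->memW q (W.ap nY (W.ysm P z (%l. W.ap j (W.ap f l)) k))) &
 ((ALL l l'. memW l k&memW l' k&l ~= l'-->~ QC creal al (W.ap f l) (W.ap f l'))-->~ memW q' (W.ap nY (W.ysm P z (%l. W.ap j (W.ap f l)) k)))))"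
lemma dp_emb:"W.dp UNIV (%e. emb (e 0) (e 1))" unfolding emb_def by (intro dpi dp_QC)

lemma embeds_emb: assumes Y:"W.banach Y" and e:"W.embeds (B.X (ii al)) Y"
 shows "EX k q q'. memW k W.omega&memW q W.Rat&memW q' W.Rat&emb (W.pair Y (W.pair k (W.pair q q'))) (ii al)"
proof -
 interpret y: ynorm memW Y by unfold_locales (rule Y)
 let ?X = "W.vec (B.X (ii al))" and ?V = "W.vec Y"
 obtain T c where T:"W.fn T (B.pts (ii al)) (W.points Y)"
 "\<forall>x\<in>carrier ?X. \<forall>y\<in>carrier ?X. W.app T (x \<oplus>\<^bsub>?X\<^esub> y) = W.app T x \<oplus>\<^bsub>?V\<^esub> W.app T y"
 "\<forall>r\<in>W.Reals_in. \<forall>x\<in>carrier ?X. W.app T (r \<odot>\<^bsub>?X\<^esub> x) = r \<odot>\<^bsub>?V\<^esub> W.app T x"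
 and c:"0 < c" "\<forall>x\<in>carrier ?X. 1 / c * W.nrm (B.nm (ii al)) x <= W.nrm (W.norm_of Y) (W.app T x) &
 W.nrm (W.norm_of Y) (W.app T x) <= c * W.nrm (B.nm (ii al)) x"
 using e unfolding W.embeds_def B.X_parts by blast
 have apT:"W.ap T x = W.app T x" "memW (W.app T x) (W.points Y)" if "memW x (B.pts (ii al))" for x
 using T(1) that W.ap_eq unfolding W.fn_def by blast+
 obtain C :: nat where C:"c <= real C" "2 <= C"
 proof -
 obtain n :: nat where "c <= real n" using real_arch_simple by blast
 thus thesis using that[of "max n 2"] by simp
 qed
 \<comment> \<open>The power makes both roots exact: \<open>sqrt K\<close> is \<open>4 C^4\<close>
   and the fourth root is \<open>2 C^2\<close>, so that after division and multiplication by
   \<open>C\<close> a gap remains.\<close>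
 define K where "K = 16 * C ^ 8"
 \<comment> \<open>The two norm bounds after distortion. The lower one for cliques is reduced by 1
   because the cut requires a strict inequality.\<close>
 define rh rh' :: rat where "rh = 4 * of_nat C ^ 3 - 1" and "rh' = 2 * of_nat C ^ 3"
 have C3:"1 <= real C ^ 3" using C(2) by simp
 have rr:"rh' < rh"
 proof -
 have "(1::rat) <= of_nat C ^ 3" using C(2) by simp
 thus ?thesis unfolding rh_def rh'_def by linarith
 qed
 have sK:"sqrt (real K) = 4 * real C ^ 4" "sqrt (sqrt (real K)) = 2 * real C ^ 2"
 proof -
 show s:"sqrt (real K) = 4 * real C ^ 4" by (rule real_sqrt_unique) (simp_all add: K_def power_mult_distrib flip: power_mult)
 show "sqrt (sqrt (real K)) = 2 * real C ^ 2" unfolding s by (rule real_sqrt_unique) (simp_all add: power_mult_distrib flip: power_mult)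
 qed
 have Tz:"W.app T B.vz = \<zero>\<^bsub>?V\<^esub>"
 proof -
 have z:"B.vz : carrier ?X" by (simp add: B.X_vec B.vz)
 have "W.app T B.vz = W.app T (0 \<odot>\<^bsub>?X\<^esub> B.vz)" using module.smult_l_null[OF B.X_module z] by (simp add: y.scal B.X_vec)
 also have "... = 0 \<odot>\<^bsub>?V\<^esub> W.app T B.vz" using T(3) z W.Reals_const(1) by blast
 also have "... = \<zero>\<^bsub>?V\<^esub>" using y.M.smult_l_null[of "W.app T B.vz"] apT(2)[OF B.vz(1)] by (simp add: y.scal y.carr)
 finally show ?thesis .
 qed
 \<comment> \<open>A formula for being the unit vector of \<open>i\<close>, needed because
   \<open>fn_rel\<close> accepts definable relations only.\<close>
 define bb where "bb i b<->W.fn b II W.reals&(ALL l. memW l II-->W.ap b l = (if l = i then W.rlc 1 else W.rlc 0))" for i b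
 have bb:"bb i b<->b = B.bas i" if i:"memW i II" for i b
 proof
 assume h:"bb i b"
 show "b = B.bas i" by (rule W.fn_eqI[of b II W.reals _ W.reals]) (use h B.pts_fn(1)[OF B.bas(1)[OF i]] B.bas(3)[OF i] in \<open>auto simp: bb_def\<close>)
 next
 assume "b = B.bas i" thus "bb i b" unfolding bb_def using B.pts_fn(1)[OF B.bas(1)[OF i]] B.bas(3)[OF i] by simp
 qed
 obtain j where j:"W.fn j II (W.points Y)" "!!i. memW i II==>(EX b. bb i b&W.app j i = W.ap T b)"
 proof (rule W.fn_rel[of "%i y. EX b. bb i b&y = W.ap T b" II "W.points Y"])
 show "W.dp UNIV (%e. EX b. bb (e 0) b&e 1 = W.ap T b)" unfolding bb_def by (intro dpi)
 show "EX y. memW y (W.points Y)&(EX b. bb i b&y = W.ap T b)" if "memW i II" for i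
 using bb[OF that] apT[OF B.bas(1)[OF that]] by metis
 show "y = y'" if "memW i II" "EX b. bb i b&y = W.ap T b" "EX b. bb i b&y' = W.ap T b" for i y y' using that(2,3) unfolding bb[OF that(1)] by simp
 qed (use that in blast)
 have jT:"W.ap j i = W.app T (B.bas i)" if i:"memW i II" for i
 proof -
 have "W.ap j i = W.app j i" using j(1) i W.ap_eq unfolding W.fn_def by blast
 thus ?thesis using j(2)[OF i] bb[OF i] apT(1)[OF B.bas(1)[OF i]] by metis
 qed
 have sums:"W.ysm (W.plus_of Y) \<zero>\<^bsub>?V\<^esub> (%l. W.ap j (W.ap f l)) (W.num n) = W.app T (B.bsum g n)"
 if g:"!!l. l < n==>W.ap f (W.num l) = g l&memW (g l) II" "inj_on g {..<n}" for f g n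
 using g
 proof (induction n)
 case 0 thus ?case using y.ysm_Suc(1) Tz by simp
 next
 case (Suc n)
 have gn:"W.ap f (W.num n) = g n" "memW (g n) II" using Suc.prems(1) by auto
 have b:"memW (B.bsum g n) (B.pts (ii al))" using B.bsum[of n g] Suc.prems by (simp add: inj_on_def)
 have b2:"memW (B.bas (g n)) (B.pts (ii al))" by (rule B.bas(1)[OF gn(2)])
 have IH:"W.ysm (W.plus_of Y) \<zero>\<^bsub>?V\<^esub> (%l. W.ap j (W.ap f l)) (W.num n) = W.app T (B.bsum g n)" using Suc by (simp add: inj_on_def)
 have "W.app T (B.bsum g n \<oplus>\<^bsub>?X\<^esub> B.bas (g n)) = W.app T (B.bsum g n) \<oplus>\<^bsub>?V\<^esub> W.app T (B.bas (g n))" using T(2) b b2 by (simp add: B.X_vec)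
 thus ?case unfolding y.ysm_Suc IH gn(1) jT[OF gn(2)] using y.apP[OF apT(2)[OF b] apT(2)[OF b2]] B.X_vec(2)[OF b b2] by simp
 qed
 have main:"((ALL l l'. memW l (W.num K)&memW l' (W.num K)&l ~= l'-->QC creal (ii al) (W.ap f l) (W.ap f l')) -->
 memW (W.rtc rh) (W.ap (W.norm_of Y) (W.ysm (W.plus_of Y) \<zero>\<^bsub>?V\<^esub> (%l. W.ap j (W.ap f l)) (W.num K)))) &
 ((ALL l l'. memW l (W.num K)&memW l' (W.num K)&l ~= l'-->~ QC creal (ii al) (W.ap f l) (W.ap f l')) -->
 ~ memW (W.rtc rh') (W.ap (W.norm_of Y) (W.ysm (W.plus_of Y) \<zero>\<^bsub>?V\<^esub> (%l. W.ap j (W.ap f l)) (W.num K))))"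
 if f:"W.fn f (W.num K) II" "ALL l l'. memW l (W.num K)&memW l' (W.num K)&W.ap f l = W.ap f l'-->l = l'" for f
 proof -
 define g where "g l = W.ap f (W.num l)" for l
 have g:"!!l. l < K==>W.ap f (W.num l) = g l&memW (g l) II" using f(1) unfolding g_def W.fn_ap by (simp add: W.num_mem)
 have gi:"inj_on g {..<K}" unfolding inj_on_def g_def using f(2) by (metis W.num_inj W.num_mem lessThan_iff)
 have gI:"!!l. l < K==>memW (g l) II" using g by blast
 have b:"memW (B.bsum g K) (B.pts (ii al))" using B.bsum[OF gI gi] by blast
 define x where "x = W.app T (B.bsum g K)"
 have xA:"memW x (W.points Y)" unfolding x_def by (rule apT(2)[OF b])
 have s:"W.ysm (W.plus_of Y) \<zero>\<^bsub>?V\<^esub> (%l. W.ap j (W.ap f l)) (W.num K) = x" unfolding x_def by (rule sums[OF g gi])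
 define n where "n = nf (QC creal (ii al)) (g ` {..<K}) (%i. 1)"
 have NB:"B.N (ii al) (B.bsum g K) = nf (QW (ii al)) (g ` {..<K}) (%i. 1)" by (rule B.N_bsum[OF gI gi])
 have nn:"W.nrm (B.nm (ii al)) (B.bsum g K) = n" unfolding B.nm(2)[OF b] NB n_def by (simp only: QW_def)
 have cx:"1 / c * n <= W.nrm (W.norm_of Y) x" "W.nrm (W.norm_of Y) x <= c * n" using c(2) b unfolding x_def nn[symmetric] by (simp_all add: B.X_vec)
 have card:"card (g ` {..<K}) = K" using card_image[OF gi] by simp
 have fin:"finite (g ` {..<K})" by simp
 have conv:"P (g i) (g i')" if h:"ALL l l'. memW l (W.num K)&memW l' (W.num K)&l ~= l'-->P (W.ap f l) (W.ap f l')" "i < K" "i' < K" "g i ~= g i'" for P i i'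
 using h(1)[THEN spec,THEN spec,of "W.num i" "W.num i'"] h(2-4) unfolding g_def by (metis W.num_mem)
 show ?thesis unfolding s y.mem_norm[OF xA]
 proof (intro conjI impI)
 assume h:"ALL l l'. memW l (W.num K)&memW l' (W.num K)&l ~= l'-->QC creal (ii al) (W.ap f l) (W.ap f l')"
 have "sqrt (real (card (g ` {..<K}))) <= n" unfolding n_def by (rule nf_clique[OF fin]) (use conv[of "QC creal (ii al)",OF h] in auto)
 hence n4:"4 * real C ^ 4 <= n" unfolding card sK .
 have "4 * real C ^ 3 * c <= 4 * real C ^ 3 * real C" using C(1) by (intro mult_left_mono) auto
 also have "... = 4 * real C ^ 4" by (simp add: power_numeral_reduce)
 finally have "4 * real C ^ 3 * c <= n" using n4 by linarith
 hence "4 * real C ^ 3 <= 1 / c * n" using c(1) by (simp add: field_simps)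
 hence "4 * real C ^ 3 <= W.nrm (W.norm_of Y) x" using cx(1) by linarith
 moreover have "of_rat rh = 4 * real C ^ 3 - 1" unfolding rh_def by (simp add: of_rat_diff of_rat_mult of_rat_power)
 ultimately show "of_rat rh < W.nrm (W.norm_of Y) x" by linarith
 next
 assume h:"ALL l l'. memW l (W.num K)&memW l' (W.num K)&l ~= l'-->~ QC creal (ii al) (W.ap f l) (W.ap f l')"
 have "n <= sqrt (sqrt (real (card (g ` {..<K}))))" unfolding n_def by (rule nf_anticlique[OF fin]) (use conv[of "%x y. ~ QC creal (ii al) x y",OF h] in auto)
 hence n2:"n <= 2 * real C ^ 2" unfolding card sK(2) .
 have "c * n <= c * (2 * real C ^ 2)" using n2 c(1) by (intro mult_left_mono) auto
 also have "... <= real C * (2 * real C ^ 2)" using C(1) by (intro mult_right_mono) auto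
 also have "... = 2 * real C ^ 3" by (simp add: power_numeral_reduce)
 finally have "W.nrm (W.norm_of Y) x <= 2 * real C ^ 3" using cx(2) by linarith
 moreover have "of_rat rh' = 2 * real C ^ 3" unfolding rh'_def by (simp add: of_rat_mult of_rat_power)
 ultimately show "~ of_rat rh' < W.nrm (W.norm_of Y) x" by linarith
 qed
 qed
 have K0:"W.num K ~= W.empty" using W.num_inj[of K 0] C(2) unfolding K_def by simp
 have zz:"W.ap (W.plus_of Y) (W.pair \<zero>\<^bsub>?V\<^esub> \<zero>\<^bsub>?V\<^esub>) = \<zero>\<^bsub>?V\<^esub>" using y.apP[OF y.zero_A y.zero_A] y.M.l_zero[OF y.M.zero_closed] by simp
 have R:"memW (W.rtc rh) W.Rat" "memW (W.rtc rh') W.Rat" using W.mem_Rat by blast+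
 have "emb (W.pair Y (W.pair (W.num K) (W.pair (W.rtc rh) (W.rtc rh')))) (ii al)" unfolding emb_def
 by (rule exI[of _ "W.points Y"],rule exI[of _ "W.plus_of Y"],rule exI[of _ "W.scale_of Y"],rule exI[of _ "W.norm_of Y"],
 rule exI[of _ "W.num K"],rule exI[of _ "W.rtc rh"],rule exI[of _ "W.rtc rh'"],rule exI[of _ "\<zero>\<^bsub>?V\<^esub>"],rule exI[of _ j])
 (use y.Y_pair K0 rr y.zero_A zz j(1) main in \<open>simp add: W.QLT_iff del: W.num.simps\<close>)
 thus ?thesis using R W.num_omega by blast
qed

end

section \<open>Refuting a small universal family\<close>

context c2
begin

theorem no_universal: assumes H:"W.lep H (ii aleph1)" "!!Y. memW Y H==>W.banach Y&W.has_density Y W.aleph1"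
 and emb:"!!al. al <: dl==>EX Y. memW Y H&W.embeds (B.X (ii al)) Y"
 shows False
proof -
 let ?L = "W.cprod H (W.cprod W.omega (W.cprod W.Rat W.Rat))"
 have L:"W.lep ?L (ii aleph1)"
 proof -
 have "W.lep (W.cprod W.Rat W.Rat) W.omega" by (rule W.lep_trans[OF W.lep_prod[OF B.lep_Rat B.lep_Rat] W.lep_omega2])
 hence "W.lep (W.cprod W.omega (W.cprod W.Rat W.Rat)) W.omega" by (rule W.lep_trans[OF W.lep_prod[OF W.lep_refl] W.lep_omega2])
 hence "W.lep ?L (W.cprod (ii aleph1) W.omega)" by (rule W.lep_prod[OF H(1)])
 moreover have "W.lep (W.cprod (ii aleph1) W.omega) (ii aleph1)" unfolding ii_omega[symmetric] ii_cprod by (rule ii_lep[OF w1_omega])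
 ultimately show ?thesis by (rule W.lep_trans)
 qed
 have ex:"EX p. memW p ?L&emb p (ii al)" if a:"al <: dl" for al
 proof -
 obtain Y where Y:"memW Y H" "W.embeds (B.X (ii al)) Y" using emb[OF a] by blast
 then obtain k q q' where k:"memW k W.omega" "memW q W.Rat" "memW q' W.Rat" "emb (W.pair Y (W.pair k (W.pair q q'))) (ii al)"
 using embeds_emb[of Y al] H(2)[OF Y(1)] by blast
 thus ?thesis using Y(1) by (intro exI[of _ "W.pair Y (W.pair k (W.pair q q'))"]) simp
 qed
 obtain p where p:"memW p ?L" "ALL be1. be1 <: dl-->(EX al. al <: dl&~ al <: be1&emb p (ii al))"
 using unbounded_fiber[OF dp_emb L ex] by blast
 obtain Y k q0 q1 where pY:"p = W.pair Y (W.pair k (W.pair q0 q1))" "memW Y H" "memW k W.omega" "memW q0 W.Rat" "memW q1 W.Rat"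
 using p(1) by (auto simp: W.mem_cprod)
 obtain K where kK:"k = W.num K" using pY(3) W.mem_omega by blast
 obtain rh rh' where qq:"q0 = W.rtc rh" "q1 = W.rtc rh'" using pY(4,5) W.mem_Rat by blast
 have banach:"W.banach Y" "W.has_density Y (ii aleph1)" using H(2)[OF pY(2)] by (simp_all add: aleph1_W)
 interpret y: ynorm memW Y by unfold_locales (rule banach(1))
 let ?V = "W.vec Y" and ?A = "W.points Y" and ?P = "W.plus_of Y" and ?S = "W.scale_of Y" and ?n = "W.norm_of Y"
 \<comment> \<open>The components hidden in \<open>p\<close> are identified with those of the one
   space \<open>Y\<close>; \<open>p\<close> is the same for unboundedly many ordinals, and only
   \<open>j\<close> still depends on the ordinal.\<close>
 have E:"0 < K&rh' < rh&(EX j. W.fn j II ?A &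
 (ALL f. W.fn f (W.num K) II&(ALL l l'. memW l (W.num K)&memW l' (W.num K)&W.ap f l = W.ap f l'-->l = l') -->
 ((ALL l l'. memW l (W.num K)&memW l' (W.num K)&l ~= l'-->QC creal a (W.ap f l) (W.ap f l')) -->
 memW (W.rtc rh) (W.ap ?n (W.ysm ?P \<zero>\<^bsub>?V\<^esub> (%l. W.ap j (W.ap f l)) (W.num K)))) &
 ((ALL l l'. memW l (W.num K)&memW l' (W.num K)&l ~= l'-->~ QC creal a (W.ap f l) (W.ap f l')) -->
 ~ memW (W.rtc rh') (W.ap ?n (W.ysm ?P \<zero>\<^bsub>?V\<^esub> (%l. W.ap j (W.ap f l)) (W.num K))))))" if e:"emb p a" for a
 proof -
 obtain A' P' S' n' k' q0' q1' z j where h:"p = W.pair (W.pair (W.pair A' P') (W.pair S' n')) (W.pair k' (W.pair q0' q1'))"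
 and r:"k' ~= W.empty" "W.QLT q1' q0'" "memW z A'" "W.ap P' (W.pair z z) = z" "W.fn j II A'"
 "ALL f. W.fn f k' II&(ALL l l'. memW l k'&memW l' k'&W.ap f l = W.ap f l'-->l = l') -->
 ((ALL l l'. memW l k'&memW l' k'&l ~= l'-->QC creal a (W.ap f l) (W.ap f l'))-->memW q0' (W.ap n' (W.ysm P' z (%l. W.ap j (W.ap f l)) k'))) &
 ((ALL l l'. memW l k'&memW l' k'&l ~= l'-->~ QC creal a (W.ap f l) (W.ap f l'))-->~ memW q1' (W.ap n' (W.ysm P' z (%l. W.ap j (W.ap f l)) k')))"
 using e unfolding emb_def by blast
 have "Y = W.pair (W.pair A' P') (W.pair S' n')" and k': "k' = W.num K" "q0' = W.rtc rh" "q1' = W.rtc rh'"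
 using h pY(1) kK qq by simp_all
 hence e': "A' = ?A" "P' = ?P" "n' = ?n" by (simp_all add: W.points_def W.plus_of_def W.norm_of_def)
 have z:"z = \<zero>\<^bsub>?V\<^esub>" using y.zero_unique r(3,4) unfolding e' by blast
 have "0 < K" using r(1) unfolding k' by (cases K) simp_all
 moreover have "rh' < rh" using r(2) unfolding k' W.QLT_iff .
 ultimately show ?thesis using r(5,6) unfolding e' k' z by (intro conjI exI[of _ j])
 qed
 obtain al0 where "emb p (ii al0)" using p(2) num_w2[of 0] by blast
 hence K:"0 < K" and rr:"rh' < rh" using E by blast+
 obtain d F where d:"W.dense_in Y d" and F:"W.fn F d (ii aleph1)" "bij_betw (W.app F) (W.ext d) (W.ext (ii aleph1))"
 using banach(2) unfolding W.has_density_def W.equinum_def by blast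
 have apF:"W.ap F x = W.app F x" if "memW x d" for x using W.ap_eq that F(1) unfolding W.fn_def by blast
 have inj:"x = x'" if "memW x d" "memW x' d" "W.ap F x = W.ap F x'" for x x'
 using that apF bij_betw_imp_inj_on[OF F(2)] by (auto simp: inj_on_def)
 have surj:"EX x. memW x d&W.ap F x = ga1" if "memW ga1 (ii aleph1)" for ga1
 proof -
 have "ga1 : W.app F ` W.ext d" using bij_betw_imp_surj_on[OF F(2)] that by simp
 then obtain x where "memW x d" "ga1 = W.app F x" by auto
 thus ?thesis using apF by auto
 qed
 \<comment> \<open>The inverse enumeration of the dense set by \<open>aleph1\<close>. It replaces
   vectors of \<open>Y\<close> by ground model ordinals, about which conditions can decide.\<close>
 obtain u where u:"W.fn u (ii aleph1) d" "!!ga1. memW ga1 (ii aleph1)==>memW (W.app u ga1) d&W.ap F (W.app u ga1) = ga1"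
 proof (rule W.fn_rel[of "%ga1 x. memW x d&W.ap F x = ga1" "ii aleph1" d])
 show "W.dp UNIV (%e. memW (e 1) d&W.ap F (e 1) = e 0)" by (intro dpi)
 show "EX x. memW x d&memW x d&W.ap F x = ga1" if "memW ga1 (ii aleph1)" for ga1 using surj[OF that] by blast
 show "x = x'" if "memW x d" "memW x' d" "memW x d&W.ap F x = ga1" "memW x' d&W.ap F x' = ga1" for ga1 x x' using inj that by simp
 qed (use that in blast)
 have apu:"W.ap u ga1 = W.app u ga1" if "memW ga1 (ii aleph1)" for ga1 using W.ap_eq that u(1) unfolding W.fn_def by blast
 have dA:"memW x ?A" if "memW x d" for x using d that unfolding W.dense_in_def by (auto simp: y.carr)
 have uA:"memW (W.ap u ga1) ?A" if "memW ga1 (ii aleph1)" for ga1 using dA u(2)[OF that] apu[OF that] by simp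
 \<comment> \<open>Replacing \<open>K\<close> images by points within \<open>eps\<close> moves the
   norm of the sum by at most a quarter of the gap between \<open>rh'\<close> and \<open>rh\<close>.
   So comparison with the midpoint still separates the two cases.\<close>
 define mid eps where "mid = (rh + rh') / 2" and "eps = (rh - rh') / (4 * of_nat K)"
 have eps:"0 < eps" unfolding eps_def using rr K by simp
 have Ke:"real K * of_rat eps = (of_rat rh - of_rat rh') / 4"
 unfolding eps_def using K by (simp add: of_rat_divide of_rat_diff of_rat_mult)
 have rm:"of_rat mid = (of_rat rh + of_rat rh') / (2::real)" unfolding mid_def by (simp add: of_rat_divide of_rat_add)
 have rr': "of_rat rh' < (of_rat rh :: real)" using rr by (simp add: of_rat_less)
 \<comment> \<open>The tuples of numbers whose vectors have a sum of large norm. This set depends on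
   \<open>Y\<close>, \<open>K\<close> and the dense set, but not on any embedding.\<close>
 define SS where "SS = W.coll {t. memW t (W.fs (W.num K) (ii aleph1)) &
 memW (W.rtc mid) (W.ap ?n (W.ysm ?P \<zero>\<^bsub>?V\<^esub> (%l. W.ap u (W.ap t l)) (W.num K)))}"
 have "W.isset {t. memW t (W.fs (W.num K) (ii aleph1)) &
 memW (W.rtc mid) (W.ap ?n (W.ysm ?P \<zero>\<^bsub>?V\<^esub> (%l. W.ap u (W.ap t l)) (W.num K)))}" by (rule W.sep) (intro dpi)
 hence SS:"memW t SS<->W.fn t (W.num K) (ii aleph1) &
 memW (W.rtc mid) (W.ap ?n (W.ysm ?P \<zero>\<^bsub>?V\<^esub> (%l. W.ap u (W.ap t l)) (W.num K)))" for t
 unfolding SS_def by (simp add: W.mem_coll del: W.num.simps)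
 obtain be1 where be1:"be1 <: dl" "ALL al j. al <: dl&~ al <: be1-->~ RP j SS creal (ii al) II (W.num K) (ii aleph1)" using core[OF K] by blast
 obtain al where al:"al <: dl" "~ al <: be1" "emb p (ii al)" using p(2) be1(1) by blast
 obtain j where j:"W.fn j II ?A"
 "ALL f. W.fn f (W.num K) II&(ALL l l'. memW l (W.num K)&memW l' (W.num K)&W.ap f l = W.ap f l'-->l = l') -->
 ((ALL l l'. memW l (W.num K)&memW l' (W.num K)&l ~= l'-->QC creal (ii al) (W.ap f l) (W.ap f l')) -->
 memW (W.rtc rh) (W.ap ?n (W.ysm ?P \<zero>\<^bsub>?V\<^esub> (%l. W.ap j (W.ap f l)) (W.num K)))) &
 ((ALL l l'. memW l (W.num K)&memW l' (W.num K)&l ~= l'-->~ QC creal (ii al) (W.ap f l) (W.ap f l')) -->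
 ~ memW (W.rtc rh') (W.ap ?n (W.ysm ?P \<zero>\<^bsub>?V\<^esub> (%l. W.ap j (W.ap f l)) (W.num K))))" using E[OF al(3)] by blast
 have jA:"memW (W.ap j i) ?A" if "memW i II" for i using j(1) that unfolding W.fn_ap by blast
 \<comment> \<open>Closeness of the image of \<open>i\<close> to the \<open>ga1\<close>-th point,
   written with the operations and the cut of the norm so that it is definable.\<close>
 define J where "J i ga1<->memW ga1 (ii aleph1)&~ memW (W.rtc eps) (W.ap ?n (W.ap ?P (W.pair (W.ap j i) (W.ap ?S (W.pair (W.rlc (- 1)) (W.ap u ga1))))))" for i ga1
 have J:"J i ga1<->W.nrm ?n (W.ap j i \<ominus>\<^bsub>?V\<^esub> W.ap u ga1) <= of_rat eps" if i:"memW i II" and g:"memW ga1 (ii aleph1)" for i ga1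
 proof -
 have "W.ap j i \<ominus>\<^bsub>?V\<^esub> W.ap u ga1 : carrier ?V" using jA[OF i] uA[OF g] by (intro y.M.minus_closed) (simp_all add: y.carr)
 hence "memW (W.ap j i \<ominus>\<^bsub>?V\<^esub> W.ap u ga1) ?A" by (simp only: y.carr)
 thus ?thesis unfolding J_def y.sub_S[OF jA[OF i] uA[OF g]] using y.mem_norm g by (simp add: linorder_not_less)
 qed
 have Jex:"EX ga1. memW ga1 (ii aleph1)&J i ga1" if i:"memW i II" for i
 proof -
 have e0:"(0::real) < of_rat eps" using eps by simp
 have cj:"W.ap j i : carrier ?V" using jA[OF i] by (simp only: y.carr)
 have "\<exists>x\<in>W.ext d. W.nrm ?n (W.ap j i \<ominus>\<^bsub>?V\<^esub> x) < of_rat eps"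
 by (rule d[unfolded W.dense_in_def,THEN conjunct2,THEN bspec,THEN spec,THEN mp,OF cj e0])
 then obtain x where x:"memW x d" "W.nrm ?n (W.ap j i \<ominus>\<^bsub>?V\<^esub> x) < of_rat eps" by (elim bexE) (simp only: W.mem_ext)
 have g:"memW (W.ap F x) (ii aleph1)" using F(1) x(1) unfolding W.fn_ap by blast
 have "W.ap u (W.ap F x) = x" using inj[OF _ x(1)] u(2)[OF g] apu[OF g] by simp
 hence "J i (W.ap F x)" using J[OF i g] x(2) by simp
 thus ?thesis using g by blast
 qed
 have ow1:"W.ordinal (ii aleph1)" by (rule ii_ordinal[OF ord_w1])
 \<comment> \<open>The least number of a sufficiently close point is taken, again in place of
   choice.\<close>
 obtain j' where j': "W.fn j' II (ii aleph1)" "!!i. memW i II==>J i (W.app j' i)&(ALL c. memW c (W.app j' i)-->~ J i c)"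
 proof (rule W.fn_rel[of "%i ga1. J i ga1&(ALL c. memW c ga1-->~ J i c)" II "ii aleph1"])
 show "W.dp UNIV (%e. J (e 0) (e 1)&(ALL c. memW c (e 1)-->~ J (e 0) c))" unfolding J_def by (intro dpi)
 show "EX ga1. memW ga1 (ii aleph1)&J i ga1&(ALL c. memW c ga1-->~ J i c)" if i:"memW i II" for i
 proof -
 obtain ga1 where g:"memW ga1 (ii aleph1)" "J i ga1" using Jex[OF i] by blast
 obtain b where b:"J i b" "!!c. memW c b==>~ J i c" using W.least_ordinal[of ga1 "J i",OF W.ordinal_mem[OF ow1 g(1)] g(2)] by metis
 thus ?thesis unfolding J_def by blast
 qed
 show "ga1 = ga1'" if "memW ga1 (ii aleph1)" "memW ga1' (ii aleph1)" "J i ga1&(ALL c. memW c ga1-->~ J i c)" "J i ga1'&(ALL c. memW c ga1'-->~ J i c)" for i ga1 ga1'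
 using W.ordinal_linear[OF W.ordinal_mem[OF ow1 that(1)] W.ordinal_mem[OF ow1 that(2)]] that(3,4) by blast
 qed (use that in blast)
 have apj': "W.ap j' i = W.app j' i" if "memW i II" for i using W.ap_eq that j'(1) unfolding W.fn_def by blast
 have close:"\<bar>W.nrm ?n (W.ysm ?P \<zero>\<^bsub>?V\<^esub> (%l. W.ap j (W.ap f l)) (W.num K)) - W.nrm ?n (W.ysm ?P \<zero>\<^bsub>?V\<^esub> (%l. W.ap u (W.ap t l)) (W.num K))\<bar> <= (of_rat rh - of_rat rh') / 4
 & memW (W.ysm ?P \<zero>\<^bsub>?V\<^esub> (%l. W.ap j (W.ap f l)) (W.num K)) ?A&memW (W.ysm ?P \<zero>\<^bsub>?V\<^esub> (%l. W.ap u (W.ap t l)) (W.num K)) ?A"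
 if f:"W.fn f (W.num K) II" and t:"W.fn t (W.num K) (ii aleph1)" "ALL l. memW l (W.num K)-->W.ap t l = W.ap j' (W.ap f l)" for f t
 proof -
 have l:"memW (W.num l) (W.num K)" if "l < K" for l using that W.num_mem by blast
 have fI:"memW (W.ap f (W.num l)) II" if "l < K" for l using f l[OF that] unfolding W.fn_ap by blast
 have tI:"memW (W.ap t (W.num l)) (ii aleph1)" if "l < K" for l using t(1) l[OF that] unfolding W.fn_ap by blast
 have h:"memW (W.ap j (W.ap f (W.num l))) ?A" if "l < K" for l by (rule jA[OF fI[OF that]])
 have h': "memW (W.ap u (W.ap t (W.num l))) ?A" if "l < K" for l by (rule uA[OF tI[OF that]])
 have nd:"W.nrm ?n (W.ap j (W.ap f (W.num l)) \<ominus>\<^bsub>?V\<^esub> W.ap u (W.ap t (W.num l))) <= of_rat eps" if lK:"l < K" for l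
 proof -
 have e:"W.ap t (W.num l) = W.app j' (W.ap f (W.num l))" using t(2) l[OF lK] apj'[OF fI[OF lK]] by simp
 have "J (W.ap f (W.num l)) (W.ap t (W.num l))" using j'(2)[OF fI[OF lK]] e by simp
 thus ?thesis using J[OF fI[OF lK] tI[OF lK]] by blast
 qed
 have a:"memW (W.ysm ?P \<zero>\<^bsub>?V\<^esub> (%l. W.ap j (W.ap f l)) (W.num K)) ?A" "memW (W.ysm ?P \<zero>\<^bsub>?V\<^esub> (%l. W.ap u (W.ap t l)) (W.num K)) ?A"
 using y.ysm_A[of K "%l. W.ap j (W.ap f l)"] y.ysm_A[of K "%l. W.ap u (W.ap t l)"] h h' by blast+
 have "W.nrm ?n (W.ysm ?P \<zero>\<^bsub>?V\<^esub> (%l. W.ap j (W.ap f l)) (W.num K) \<ominus>\<^bsub>?V\<^esub> W.ysm ?P \<zero>\<^bsub>?V\<^esub> (%l. W.ap u (W.ap t l)) (W.num K)) <= real K * of_rat eps"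
 by (rule y.ysm_diff) (use h h' nd in auto)
 thus ?thesis using y.norm_diff[OF a] a unfolding Ke by linarith
 qed
 have "RP j' SS creal (ii al) II (W.num K) (ii aleph1)" unfolding RP_def
 proof (intro conjI allI impI j'(1))
 fix f t assume h:"W.fn f (W.num K) II&(ALL l l'. memW l (W.num K)&memW l' (W.num K)&W.ap f l = W.ap f l'-->l = l') &
 W.fn t (W.num K) (ii aleph1)&(ALL l. memW l (W.num K)-->W.ap t l = W.ap j' (W.ap f l))"
 note cl = close[of f t,THEN conjunct1] close[of f t,THEN conjunct2,THEN conjunct1] close[of f t,THEN conjunct2,THEN conjunct2]
 define a b where "a = W.ysm ?P \<zero>\<^bsub>?V\<^esub> (%l. W.ap j (W.ap f l)) (W.num K)" and "b = W.ysm ?P \<zero>\<^bsub>?V\<^esub> (%l. W.ap u (W.ap t l)) (W.num K)"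
 have ab:"\<bar>W.nrm ?n a - W.nrm ?n b\<bar> <= (of_rat rh - of_rat rh') / 4" "memW a ?A" "memW b ?A" unfolding a_def b_def using cl h by blast+
 have ab1:"W.nrm ?n a - W.nrm ?n b <= (of_rat rh - of_rat rh') / 4" "W.nrm ?n b - W.nrm ?n a <= (of_rat rh - of_rat rh') / 4"
 using abs_ge_self[of "W.nrm ?n a - W.nrm ?n b"] abs_ge_minus_self[of "W.nrm ?n a - W.nrm ?n b"] ab(1) by linarith+
 note jf = j(2)[THEN spec,of f,THEN mp,folded a_def]
 have tS:"memW t SS<->of_rat mid < W.nrm ?n b" unfolding SS b_def[symmetric] y.mem_norm[OF ab(3)] using h by blast
 show "memW t SS" if c:"ALL l l'. memW l (W.num K)&memW l' (W.num K)&l ~= l'-->QC creal (ii al) (W.ap f l) (W.ap f l')"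
 proof -
 have "memW (W.rtc rh) (W.ap ?n a)" using jf h c by blast
 hence "of_rat rh < W.nrm ?n a" by (simp only: y.mem_norm[OF ab(2)])
 thus ?thesis unfolding tS rm using ab1 rr' by argo
 qed
 show "~ memW t SS" if c:"ALL l l'. memW l (W.num K)&memW l' (W.num K)&l ~= l'-->~ QC creal (ii al) (W.ap f l) (W.ap f l')"
 proof -
 have "~ memW (W.rtc rh') (W.ap ?n a)" using jf h c by blast
 hence "~ of_rat rh' < W.nrm ?n a" using y.mem_norm[OF ab(2),of rh'] by simp
 thus ?thesis unfolding tS rm using ab1 rr' by argo
 qed
 qed
 thus False using be1(2) al(1,2) by blast
qed

end

theorem theorem3p1:
  fixes memV :: "'v \<Rightarrow> 'v \<Rightarrow> bool"
    and P :: "'v \<Rightarrow> 'v set"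
    and leP :: "'v \<Rightarrow> 'v \<Rightarrow> 'v \<Rightarrow> bool"
    and G :: "'v set"
    and memW :: "'w \<Rightarrow> 'w \<Rightarrow> bool"
    and val :: "'v \<Rightarrow> 'w"
    and \<omega>\<^sub>2 :: 'v
  assumes "wfp memV"
    and "set_struct.ZFC memV"
    and "set_struct.GCH memV"
    and "\<omega>\<^sub>2 = set_struct.aleph2 memV"
    and "set_struct.fs_cohen_iteration memV \<omega>\<^sub>2 P leP"
    and "set_struct.generic_filter memV (P \<omega>\<^sub>2) (leP \<omega>\<^sub>2) G"
    and "generic_extension memV G memW val"
  shows "set_struct.equinum memW (set_struct.powset memW (set_struct.omega memW)) (set_struct.aleph2 memW) \<and>
    (\<exists>F. set_struct.equinum memW F (set_struct.aleph2 memW) \<and>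
      (\<forall>X. memW X F \<longrightarrow> set_struct.banach memW X \<and> set_struct.UG memW X \<and>
         set_struct.has_density memW X (set_struct.aleph1 memW)) \<and>
      \<not> (\<exists>H k. memW k (set_struct.aleph2 memW) \<and> set_struct.equinum memW H k \<and>
           (\<forall>Y. memW Y H \<longrightarrow> set_struct.banach memW Y \<and>
              set_struct.has_density memW Y (set_struct.aleph1 memW)) \<and>
           (\<forall>X. memW X F \<longrightarrow> (\<exists>Y. memW Y H \<and> set_struct.embeds memW X Y))))"
proof -
 interpret Z: zfc memV by (rule zfcI[OF assms(1,2)])
 have o1: "Z.ordinal Z.aleph1" using Z.csucc_props(1)[OF Z.ordinal_omega] unfolding Z.aleph1_def Z.cardinal_def by blast
 have o2: "Z.ordinal \<omega>\<^sub>2" using Z.csucc_props(1)[OF o1] unfolding assms(4) Z.aleph2_def Z.cardinal_def by blast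
 have "P \<omega>\<^sub>2 = Z.Pi \<omega>\<^sub>2" "leP \<omega>\<^sub>2 = Z.Le \<omega>\<^sub>2" using Z.iteration_eq[OF assms(5) o2, of \<omega>\<^sub>2] by simp_all
 then have gf: "Z.generic_filter (Z.Pi \<omega>\<^sub>2) (Z.Le \<omega>\<^sub>2) G" using assms(6) by simp
 interpret c: c2 memV \<omega>\<^sub>2 G memW val
 by unfold_locales (rule gf assms(7) assms(3) assms(4))+
 show ?thesis
 proof (intro conjI exI[of _ c.Fam] allI impI notI)
 show "c.W.equinum (c.W.powset c.W.omega) c.W.aleph2" by (rule c.continuum)
 show "c.W.equinum c.Fam c.W.aleph2" by (rule c.equinum_Fam)
 fix X assume "memW X c.Fam"
 then obtain \<alpha> where X: "X = c.B.X (c.ii \<alpha>)" using c.mem_Fam by blast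
 show "c.W.banach X" "c.W.UG X" "c.W.has_density X c.W.aleph1" unfolding X by (rule c.B.X_banach c.B.X_UG c.B_density)+
 next
 assume "\<exists>H k. memW k c.W.aleph2 \<and> c.W.equinum H k \<and> (\<forall>Y. memW Y H \<longrightarrow> c.W.banach Y \<and> c.W.has_density Y c.W.aleph1) \<and>
 (\<forall>X. memW X c.Fam \<longrightarrow> (\<exists>Y. memW Y H \<and> c.W.embeds X Y))"
 then obtain H k where H: "memW k c.W.aleph2" "c.W.equinum H k" "\<forall>Y. memW Y H \<longrightarrow> c.W.banach Y \<and> c.W.has_density Y c.W.aleph1"
 "\<forall>X. memW X c.Fam \<longrightarrow> (\<exists>Y. memW Y H \<and> c.W.embeds X Y)" by blast
 obtain \<kappa> where k: "k = c.ii \<kappa>" "memV \<kappa> \<omega>\<^sub>2" using H(1) unfolding c.aleph2_W c.mem_ii by blast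
 \<comment> \<open>An element of the extension's \<open>aleph2\<close> is a ground model ordinal
   below \<open>\<omega>\<^sub>2\<close>, and it injects into \<open>aleph1\<close> already
   there.\<close>
 have "c.W.lep H (c.ii Z.aleph1)" using c.W.equinum_lep[OF H(2)] c.ii_lep[OF c.w2(3)[OF k(2)]] c.W.lep_trans unfolding k(1) by blast
 then show False by (rule c.no_universal) (use H(3,4) c.mem_Fam in blast)+
 qed
qed

end
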